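(* There is an algorithm that solves the min-max $r$-gather clustering problem on a spider exactly in $O(2^d r^4 d^5 + n)$ time, where $d$ is the degree of the center of the spider (the number of legs) and $n$ is the number of users. Similarly, there is an algorithm that solves the min-max $r$-gathering problem on a spider exactly in $O(2^d r^4 d^5 + n + m)$ time, where $m$ is the number of facilities.
   Context: A spider with center $o$ is a set $\{l_1,\dots,l_d\}$ of half-lines (legs) sharing the common endpoint $o$; the point on leg $l$ at distance $x\ge0$ from $o$ is $(l,x)$, and $\mathrm{dist}((l,x),(l',x'))=|x-x'|$ if $l=l'$ and $x+x'$ otherwise. Min-max $r$-gathering problem: given $n$ users $\mathcal U$ and $m$ facilities $\mathcal F$ (points of the metric space) and a positive integer $r$, find $\pi:\mathcal U\to\mathcal F$ with $|\pi^{-1}(f)|\in\{0\}\cup[r,\infty)$ for every $f$, minimizing $\max_{u}\mathrm{dist}(u,\pi(u))$. Min-max $r$-gather clustering problem: given $n$ users $\mathcal U$ and a positive integer $r$, partition $\mathcal U$ into clusters each of size at least $r$, minimizing the maximum cluster diameter (the largest distance between two users of the same cluster).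
   Formalization: The users and the facilities on each leg are assumed to be given in order of distance from the center; for unsorted input the bound fails on a real RAM, since already for d = 1, r = 2 pairing coinciding users needs Ω(n log n) comparisons. *)

theory Defs
  imports Complex_Main "HOL-Library.FuncSet" "HOL-Library.Disjoint_Sets"
begin

section \<open>Spiders\<close>

text \<open>The \<open>d\<close> legs are numbered \<open>0, \<dots>, d - 1\<close>, and \<open>(l, x)\<close> is the point on leg \<open>l\<close> at distance
  \<open>x\<close> from the center. The center has one name \<open>(l, 0)\<close> for each leg; these are at distance \<open>0\<close>
  from each other.\<close>

type_synonym point = "nat \<times> real"

definition spider_points :: "nat \<Rightarrow> point set" where
  "spider_points d = {(l, x). l < d \<and> 0 \<le> x}"

definition spider_dist :: "point \<Rightarrow> point \<Rightarrow> real" where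
  "spider_dist p q =
    (if fst p = fst q then \<bar>snd p - snd q\<bar> else snd p + snd q)"

section \<open>The two optimization problems\<close>

text \<open>Users and facilities are identified by their positions in the lists \<open>us\<close> and \<open>fs\<close>, so that
  several of them may be located at the same point. If there are no users, both cost functions are
  the unspecified value \<open>Max {}\<close>; all solutions then have the same cost.\<close>

definition r_gather_clustering :: "nat \<Rightarrow> point list \<Rightarrow> nat set set \<Rightarrow> bool" where
  "r_gather_clustering r us P \<longleftrightarrow>
    partition_on {..<length us} P \<and> (\<forall>c\<in>P. r \<le> card c)"

definition cluster_diameter :: "point list \<Rightarrow> nat set \<Rightarrow> real" where
  "cluster_diameter us c = Max {spider_dist (us ! i) (us ! j) |i j. i \<in> c \<and> j \<in> c}"

definition clustering_cost :: "point list \<Rightarrow> nat set set \<Rightarrow> real" where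
  "clustering_cost us P = Max (cluster_diameter us ` P)"

definition optimal_clustering :: "nat \<Rightarrow> point list \<Rightarrow> nat set set \<Rightarrow> bool" where
  "optimal_clustering r us = is_arg_min (clustering_cost us) (r_gather_clustering r us)"

definition r_gathering :: "nat \<Rightarrow> point list \<Rightarrow> point list \<Rightarrow> (nat \<Rightarrow> nat) \<Rightarrow> bool" where
  "r_gathering r us fs \<pi> \<longleftrightarrow>
    \<pi> \<in> {..<length us} \<rightarrow> {..<length fs} \<and>
    (\<forall>f<length fs. card {i \<in> {..<length us}. \<pi> i = f} \<in> {0} \<union> {r..})"

definition gathering_cost :: "point list \<Rightarrow> point list \<Rightarrow> (nat \<Rightarrow> nat) \<Rightarrow> real" where
  "gathering_cost us fs \<pi> = Max ((\<lambda>i. spider_dist (us ! i) (fs ! \<pi> i)) ` {..<length us})"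

definition optimal_gathering :: "nat \<Rightarrow> point list \<Rightarrow> point list \<Rightarrow> (nat \<Rightarrow> nat) \<Rightarrow> bool" where
  "optimal_gathering r us fs = is_arg_min (gathering_cost us fs) (r_gathering r us fs)"

section \<open>Algorithms: programs for a real RAM\<close>

text \<open>The memory consists of arrays of natural numbers and arrays of real numbers; a scalar is kept
  in entry \<open>0\<close> of an array. A program mentions finitely many arrays. Every arithmetic operation,
  memory access, comparison and control step costs one unit.

  Natural numbers have only addition and (truncated) subtraction: with unit-cost multiplication of
  unbounded numbers the machine would be unreasonably powerful. Real numbers have the field
  operations and comparison, but they cannot be rounded or otherwise converted to natural numbers,
  and the only real literals are natural numbers. Division by zero yields \<open>0\<close>.\<close>

type_synonym array = string

record state =
  nats :: "array \<Rightarrow> nat \<Rightarrow> nat"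
  reals :: "array \<Rightarrow> nat \<Rightarrow> real"

datatype nexp =
    NLit nat
  | NGet array nexp
  | NAdd nexp nexp
  | NSub nexp nexp

datatype rexp =
    RLit nat
  | RGet array nexp
  | RAdd rexp rexp
  | RSub rexp rexp
  | RMul rexp rexp
  | RDiv rexp rexp

datatype bexp =
    NLess nexp nexp
  | RLess rexp rexp
  | BNot bexp
  | BAnd bexp bexp

primrec nval :: "nexp \<Rightarrow> state \<Rightarrow> nat" where
  "nval (NLit k) s = k"
| "nval (NGet a e) s = nats s a (nval e s)"
| "nval (NAdd e f) s = nval e s + nval f s"
| "nval (NSub e f) s = nval e s - nval f s"

primrec rval :: "rexp \<Rightarrow> state \<Rightarrow> real" where
  "rval (RLit k) s = real k"
| "rval (RGet a e) s = reals s a (nval e s)"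
| "rval (RAdd e f) s = rval e s + rval f s"
| "rval (RSub e f) s = rval e s - rval f s"
| "rval (RMul e f) s = rval e s * rval f s"
| "rval (RDiv e f) s = rval e s / rval f s"

primrec bval :: "bexp \<Rightarrow> state \<Rightarrow> bool" where
  "bval (NLess e f) s \<longleftrightarrow> nval e s < nval f s"
| "bval (RLess e f) s \<longleftrightarrow> rval e s < rval f s"
| "bval (BNot b) s \<longleftrightarrow> \<not> bval b s"
| "bval (BAnd b c) s \<longleftrightarrow> bval b s \<and> bval c s"

primrec ncost :: "nexp \<Rightarrow> nat" where
  "ncost (NLit k) = 1"
| "ncost (NGet a e) = ncost e + 1"
| "ncost (NAdd e f) = ncost e + ncost f + 1"
| "ncost (NSub e f) = ncost e + ncost f + 1"

primrec rcost :: "rexp \<Rightarrow> nat" where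
  "rcost (RLit k) = 1"
| "rcost (RGet a e) = ncost e + 1"
| "rcost (RAdd e f) = rcost e + rcost f + 1"
| "rcost (RSub e f) = rcost e + rcost f + 1"
| "rcost (RMul e f) = rcost e + rcost f + 1"
| "rcost (RDiv e f) = rcost e + rcost f + 1"

primrec bcost :: "bexp \<Rightarrow> nat" where
  "bcost (NLess e f) = ncost e + ncost f + 1"
| "bcost (RLess e f) = rcost e + rcost f + 1"
| "bcost (BNot b) = bcost b + 1"
| "bcost (BAnd b c) = bcost b + bcost c + 1"

text \<open>\<open>NSet a e f\<close> is the assignment \<open>a[e] := f\<close> in an array of natural numbers, \<open>RSet a e f\<close> the one in
  an array of reals.\<close>

datatype prog =
    Skip
  | NSet array nexp nexp
  | RSet array nexp rexp
  | Seq prog prog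
  | Cond bexp prog prog
  | While bexp prog

text \<open>\<open>run p s t s'\<close>: started in state \<open>s\<close>, the program \<open>p\<close> halts after \<open>t\<close> steps in state \<open>s'\<close>.\<close>

inductive run :: "prog \<Rightarrow> state \<Rightarrow> nat \<Rightarrow> state \<Rightarrow> bool" where
  Skip: "run Skip s 1 s"
| NSet: "run (NSet a e f) s (ncost e + ncost f + 1)
    (s\<lparr>nats := (nats s)(a := (nats s a)(nval e s := nval f s))\<rparr>)"
| RSet: "run (RSet a e f) s (ncost e + rcost f + 1)
    (s\<lparr>reals := (reals s)(a := (reals s a)(nval e s := rval f s))\<rparr>)"
| Seq: "run p s t s' \<Longrightarrow> run q s' t' s'' \<Longrightarrow> run (Seq p q) s (t + t') s''"
| CondTrue: "bval b s \<Longrightarrow> run p s t s' \<Longrightarrow> run (Cond b p q) s (bcost b + t + 1) s'"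
| CondFalse: "\<not> bval b s \<Longrightarrow> run q s t s' \<Longrightarrow> run (Cond b p q) s (bcost b + t + 1) s'"
| WhileFalse: "\<not> bval b s \<Longrightarrow> run (While b p) s (bcost b + 1) s"
| WhileTrue: "bval b s \<Longrightarrow> run p s t s' \<Longrightarrow> run (While b p) s' t' s'' \<Longrightarrow>
    run (While b p) s (bcost b + t + t' + 1) s''"

inductive_cases run_SkipE: "run Skip s t s'"
inductive_cases run_NSetE: "run (NSet a e f) s t s'"
inductive_cases run_RSetE: "run (RSet a e f) s t s'"
inductive_cases run_SeqE: "run (Seq p q) s t s'"
inductive_cases run_CondE: "run (Cond b p q) s t s'"
inductive_cases run_WhileE: "run (While b p) s t s'"

lemma run_deterministic:
  "run p s t s' \<Longrightarrow> run p s u s'' \<Longrightarrow> t = u \<and> s' = s''"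
proof (induction arbitrary: u s'' rule: run.induct)
  case (Skip s)
  then show ?case by (rule run_SkipE) simp
next
  case (NSet a e f s)
  then show ?case by (rule run_NSetE) simp
next
  case (RSet a e f s)
  then show ?case by (rule run_RSetE) simp
next
  case (Seq p s t s1 q t' s2)
  from Seq.prems show ?case
    by (rule run_SeqE) (auto dest: Seq.IH)
next
  case (CondTrue b s p t s1 q)
  from CondTrue.prems show ?case
    by (rule run_CondE) (use CondTrue.hyps(1) in \<open>auto dest: CondTrue.IH\<close>)
next
  case (CondFalse b s q t s1 p)
  from CondFalse.prems show ?case
    by (rule run_CondE) (use CondFalse.hyps(1) in \<open>auto dest: CondFalse.IH\<close>)
next
  case (WhileFalse b s p)
  from WhileFalse.prems show ?case
    by (rule run_WhileE) (use WhileFalse.hyps in simp_all)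
next
  case (WhileTrue b s p t s1 t' s2)
  from WhileTrue.prems show ?case
    by (rule run_WhileE) (use WhileTrue.hyps(1) in \<open>auto dest: WhileTrue.IH\<close>)
qed

section \<open>Input and output\<close>

text \<open>The points on each leg are listed by increasing distance from the center; points of different
  legs may be interleaved arbitrarily. Without the order on the legs the linear dependency on the
  number of points is impossible: already for \<open>d = 1\<close> and \<open>r = 2\<close>, grouping users whose locations
  coincide in pairs takes \<open>\<Omega>(n log n)\<close> comparisons of reals.\<close>

definition spider_input :: "nat \<Rightarrow> point list \<Rightarrow> bool" where
  "spider_input d ps \<longleftrightarrow>
    set ps \<subseteq> spider_points d \<and>
    sorted_wrt (\<lambda>p q. fst p = fst q \<longrightarrow> snd p \<le> snd q) ps"

definition array_of :: "'a::zero list \<Rightarrow> nat \<Rightarrow> 'a" where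
  "array_of xs i = (if i < length xs then xs ! i else 0)"

definition clustering_input :: "nat \<Rightarrow> nat \<Rightarrow> point list \<Rightarrow> state" where
  "clustering_input d r us =
    \<lparr>nats = (\<lambda>_ _. 0)
       (''d'' := array_of [d],
        ''r'' := array_of [r],
        ''n'' := array_of [length us],
        ''user_leg'' := array_of (map fst us)),
     reals = (\<lambda>_ _. 0)
       (''user_pos'' := array_of (map snd us))\<rparr>"

definition gathering_input :: "nat \<Rightarrow> nat \<Rightarrow> point list \<Rightarrow> point list \<Rightarrow> state" where
  "gathering_input d r us fs =
    \<lparr>nats = (\<lambda>_ _. 0)
       (''d'' := array_of [d],
        ''r'' := array_of [r],
        ''n'' := array_of [length us],
        ''m'' := array_of [length fs],
        ''user_leg'' := array_of (map fst us),
        ''facility_leg'' := array_of (map fst fs)),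
     reals = (\<lambda>_ _. 0)
       (''user_pos'' := array_of (map snd us),
        ''facility_pos'' := array_of (map snd fs))\<rparr>"

text \<open>A clustering is returned as an array of labels: two users belong to the same cluster iff they
  have the same label.\<close>

definition clusters :: "nat \<Rightarrow> (nat \<Rightarrow> nat) \<Rightarrow> nat set set" where
  "clusters n label = (\<lambda>i. {j. j < n \<and> label j = label i}) ` {..<n}"

definition answers_clustering :: "nat \<Rightarrow> point list \<Rightarrow> state \<Rightarrow> bool" where
  "answers_clustering r us s \<longleftrightarrow>
    (if \<exists>P. r_gather_clustering r us P
     then nats s ''feasible'' 0 = 1 \<and>
       optimal_clustering r us (clusters (length us) (nats s ''cluster''))
     else nats s ''feasible'' 0 = 0)"

definition answers_gathering :: "nat \<Rightarrow> point list \<Rightarrow> point list \<Rightarrow> state \<Rightarrow> bool" where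
  "answers_gathering r us fs s \<longleftrightarrow>
    (if \<exists>\<pi>. r_gathering r us fs \<pi>
     then nats s ''feasible'' 0 = 1 \<and>
       optimal_gathering r us fs (nats s ''assignment'')
     else nats s ''feasible'' 0 = 0)"

end

theory Submission
  imports Defs
begin

text \<open>Both problems ask for a cover by balls of radius \<open>c\<close> with at least \<open>r\<close> users each: for the clustering problem the
  balls are arbitrary, because on a spider a set of diameter \<open>2c\<close> lies in a ball of radius \<open>c\<close>.

  Call a cluster mixed if it has users on several legs. In a solution with the fewest mixed clusters, which moreover
  use users as near to the center as possible, the mixed clusters have their centers on different legs, and on every leg
  their users form a prefix of length at most \<open>K = 2r(d + 1)\<close>. The rest of a leg is solved by a one-dimensional dynamic
  program, in linear time with a monotone deque. Merge the first \<open>K\<close> users of all legs into one list ordered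
  by distance. A mixed cluster with center \<open>(l, x)\<close> can take exactly the users of other legs at distance at most
  \<open>c - x\<close>, which is a threshold \<open>t\<close> in the list. So one can choose the centers by decreasing threshold, and the only
  information to carry along is the threshold, the set of legs already treated and the number of users still owed to
  the clusters opened so far. This gives \<open>O(2^d r^2 d^3)\<close> states with \<open>O(r d^2)\<close> choices each.\<close>

section \<open>Total correctness with running times\<close>

text \<open>A mixed cluster can be described by numbers because a ball opened at a threshold
  contains all points up to that threshold, on every leg. Users passed below it are interchangeable:
  any of them can fill any place owed, so the debts of all clusters merge into one number, and a
  Hall-type count shows that this loses nothing. Optimality is split into two inequalities: the
  table value is at most the radius of every solution, and the traceback constructs a solution of at
  most that radius. A function \<delta> stands for the distance to the nearest facility and is 0 for
  clustering; the first inequality uses that no center is closer than \<delta>, the second that some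
  center attains it. Filling the table takes time 2^d r^3 d^5. The fourth power of r stems from the
  facilities: about r^2 d^4 ideal centers need a nearest facility without continuing an earlier
  search, each search costs m/q + q, and q of order r^2 d^4 gives m + r^4 d^8 in total. Since d^3 =
  O(2^d), this fits the bound.\<close>

definition ok :: "prog => state => (nat => state => bool) => bool" where
  "ok p s Q \<longleftrightarrow> (\<exists>t s'. run p s t s' \<and> Q t s')"

abbreviation nscalar :: "state => array => nat" (infixl "$" 999) where "s$a \<equiv> nats s a 0"
abbreviation rscalar :: "state => array => real" (infixl "$$" 999) where "s$$a \<equiv> reals s a 0"

definition nupd :: "array => nat => nat => state => state" where
  "nupd a i x s = s\<lparr>nats := (nats s)(a := (nats s a)(i := x))\<rparr>"

definition rupd :: "array => nat => real => state => state" where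
  "rupd a i x s = s\<lparr>reals := (reals s)(a := (reals s a)(i := x))\<rparr>"

lemma nats_nupd [simp]: "nats (nupd a i x s) b = (if b = a then (nats s a)(i := x) else nats s b)"
  and reals_nupd [simp]: "reals (nupd a i x s) = reals s"
  and nats_rupd [simp]: "nats (rupd a i y s) = nats s"
  and reals_rupd [simp]: "reals (rupd a i y s) b = (if b = a then (reals s a)(i := y) else reals s b)"
  by (simp_all add: nupd_def rupd_def)

text \<open>Runs are deterministic, so one known run decides \<open>ok\<close>. Hence the rules for
  the program constructs are equivalences, and the simplifier can execute straight-line code
  symbolically.\<close>

lemma ok_run: "run p s t s' ==> ok p s Q \<longleftrightarrow> Q t s'"
  unfolding ok_def using run_deterministic by blast

lemma ok_Skip [simp]: "ok Skip s Q \<longleftrightarrow> Q 1 s"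
  by (rule ok_run) (rule run.Skip)

lemma ok_NSet [simp]:
  "ok (NSet a e f) s Q \<longleftrightarrow> Q (ncost e + ncost f + 1) (nupd a (nval e s) (nval f s) s)"
  unfolding nupd_def by (rule ok_run) (rule run.NSet)

lemma ok_RSet [simp]:
  "ok (RSet a e f) s Q \<longleftrightarrow> Q (ncost e + rcost f + 1) (rupd a (nval e s) (rval f s) s)"
  unfolding rupd_def by (rule ok_run) (rule run.RSet)

lemma ok_Seq [simp]: "ok (Seq p q) s Q \<longleftrightarrow> ok p s (\<lambda>t s'. ok q s' (\<lambda>t'. Q (t + t')))"
  unfolding ok_def by (blast intro: run.Seq elim: run_SeqE)

lemma ok_Cond_True: "bval b s ==> ok (Cond b p q) s Q \<longleftrightarrow> ok p s (\<lambda>t. Q (bcost b + t + 1))"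
proof
  assume b: "bval b s" and "ok (Cond b p q) s Q"
  then obtain t s' where "run (Cond b p q) s t s'" "Q t s'" by (auto simp: ok_def)
  with b show "ok p s (\<lambda>t. Q (bcost b + t + 1))"
    unfolding ok_def by (elim run_CondE) (auto simp: add.assoc)
next
  assume b: "bval b s" and "ok p s (\<lambda>t. Q (bcost b + t + 1))"
  then obtain t s' where "run p s t s'" "Q (bcost b + t + 1) s'" unfolding ok_def by blast
  with b show "ok (Cond b p q) s Q" unfolding ok_def by (blast intro: run.CondTrue)
qed

lemma ok_Cond_False: "\<not> bval b s ==> ok (Cond b p q) s Q \<longleftrightarrow> ok q s (\<lambda>t. Q (bcost b + t + 1))"
proof
  assume b: "\<not> bval b s" and "ok (Cond b p q) s Q"
  then obtain t s' where "run (Cond b p q) s t s'" "Q t s'" by (auto simp: ok_def)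
  with b show "ok q s (\<lambda>t. Q (bcost b + t + 1))"
    unfolding ok_def by (elim run_CondE) (auto simp: add.assoc)
next
  assume b: "\<not> bval b s" and "ok q s (\<lambda>t. Q (bcost b + t + 1))"
  then obtain t s' where "run q s t s'" "Q (bcost b + t + 1) s'" unfolding ok_def by blast
  with b show "ok (Cond b p q) s Q" unfolding ok_def by (blast intro: run.CondFalse)
qed

lemma ok_Cond [simp]: "ok (Cond b p q) s Q \<longleftrightarrow>
    (if bval b s then ok p s (\<lambda>t. Q (bcost b + t + 1)) else ok q s (\<lambda>t. Q (bcost b + t + 1)))"
  using ok_Cond_True[of b s p q Q] ok_Cond_False[of b s p q Q] by (cases "bval b s") auto

lemma ok_While_True:
  "bval b s ==> ok p s (\<lambda>t s'. ok (While b p) s' (\<lambda>t'. Q (bcost b + t + t' + 1))) ==>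
    ok (While b p) s Q"
  unfolding ok_def by (blast intro: run.WhileTrue)

lemma ok_While_False: "\<not> bval b s ==> Q (bcost b + 1) s ==> ok (While b p) s Q"
  unfolding ok_def by (blast intro: run.WhileFalse)

primrec nwrites :: "prog => array set" where
  "nwrites Skip = {}"
| "nwrites (NSet a e f) = {a}"
| "nwrites (RSet a e f) = {}"
| "nwrites (Seq p q) = nwrites p \<union> nwrites q"
| "nwrites (Cond b p q) = nwrites p \<union> nwrites q"
| "nwrites (While b p) = nwrites p"

primrec rwrites :: "prog => array set" where
  "rwrites Skip = {}"
| "rwrites (NSet a e f) = {}"
| "rwrites (RSet a e f) = {a}"
| "rwrites (Seq p q) = rwrites p \<union> rwrites q"
| "rwrites (Cond b p q) = rwrites p \<union> rwrites q"
| "rwrites (While b p) = rwrites p"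

text \<open>Purely syntactic: it compares the arrays outside the write sets. An invariant then
  survives a subprogram as soon as the write sets avoid the arrays it mentions.\<close>

definition frame :: "prog => state => state => bool" where
  "frame p s s' \<longleftrightarrow> (\<forall>a. a \<notin> nwrites p --> nats s' a = nats s a) \<and>
    (\<forall>a. a \<notin> rwrites p --> reals s' a = reals s a)"

lemma run_frame: "run p s t s' ==> frame p s s'"
  by (induction rule: run.induct) (auto simp: frame_def)

lemma frameD:
  "frame p s s' ==> a \<notin> nwrites p ==> nats s' a = nats s a"
  "frame p s s' ==> a \<notin> rwrites p ==> reals s' a = reals s a"
  by (auto simp: frame_def)

lemma ok_conseq:
  assumes "ok p s Q" and "\<And>t s'. Q t s' ==> frame p s s' ==> R t s'"
  shows "ok p s R"
  using assms run_frame unfolding ok_def by blast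

text \<open>Besides the postcondition of the first program, its frame is available for the second
  one; \<open>ok_Seq\<close> alone would lose it.\<close>

lemma ok_seq:
  assumes "ok p s P" and "\<And>t s'. P t s' ==> frame p s s' ==> ok q s' (\<lambda>t'. Q (t + t'))"
  shows "ok (Seq p q) s Q"
  using ok_conseq[OF assms] by simp

text \<open>Termination and the time bound come from the same potential \<open>\<Phi>\<close>.\<close>

lemma ok_While:
  fixes \<Phi> :: "state => nat"
  assumes "I s0"
    and step: "\<And>s. I s ==> frame p s0 s ==> bval b s ==>
      ok p s (\<lambda>t s'. I s' \<and> bcost b + t + 1 + \<Phi> s' <= \<Phi> s)"
    and exit: "\<And>t s. I s ==> frame p s0 s ==> \<not> bval b s ==> t + \<Phi> s <= \<Phi> s0 + bcost b + 1 ==> Q t s"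
  shows "ok (While b p) s0 Q"
proof -
  have "ok (While b p) s (\<lambda>t s'. I s' \<and> frame p s0 s' \<and> \<not> bval b s' \<and> t + \<Phi> s' <= \<Phi> s + bcost b + 1)"
    if "I s" "frame p s0 s" for s
    using that
  proof (induction "\<Phi> s" arbitrary: s rule: less_induct)
    case less
    show ?case
    proof (cases "bval b s")
      case True
      have "ok p s (\<lambda>t s'. ok (While b p) s' (\<lambda>t' s''. I s'' \<and> frame p s0 s'' \<and> \<not> bval b s'' \<and>
          bcost b + t + t' + 1 + \<Phi> s'' <= \<Phi> s + bcost b + 1))"
      proof (rule ok_conseq[OF step[OF less.prems True]])
        fix t s' assume *: "I s' \<and> bcost b + t + 1 + \<Phi> s' <= \<Phi> s" "frame p s s'"
        then have "frame p s0 s'" using less.prems(2) by (auto simp: frame_def)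
        with * have "ok (While b p) s' (\<lambda>t s''. I s'' \<and> frame p s0 s'' \<and> \<not> bval b s'' \<and>
            t + \<Phi> s'' <= \<Phi> s' + bcost b + 1)"
          by (intro less.hyps) auto
        then show "ok (While b p) s' (\<lambda>t' s''. I s'' \<and> frame p s0 s'' \<and> \<not> bval b s'' \<and>
          bcost b + t + t' + 1 + \<Phi> s'' <= \<Phi> s + bcost b + 1)"
          by (rule ok_conseq) (use * in auto)
      qed
      then show ?thesis by (rule ok_While_True[OF True])
    next
      case False
      then show ?thesis by (rule ok_While_False) (use less.prems False in auto)
    qed
  qed
  from this[OF assms(1)] show ?thesis
    by (rule ok_conseq) (auto simp: frame_def intro!: exit)
qed

abbreviation nv :: "array => nexp" where "nv a \<equiv> NGet a (NLit 0)"
abbreviation rv :: "array => rexp" where "rv a \<equiv> RGet a (NLit 0)"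
abbreviation nset :: "array => nexp => prog" where "nset a \<equiv> NSet a (NLit 0)"
abbreviation rset :: "array => rexp => prog" where "rset a \<equiv> RSet a (NLit 0)"
abbreviation NLe :: "nexp => nexp => bexp" where "NLe e f \<equiv> BNot (NLess f e)"
abbreviation RLe :: "rexp => rexp => bexp" where "RLe e f \<equiv> BNot (RLess f e)"
abbreviation seq (infixr ";;" 60) where "p ;; q \<equiv> Seq p q"
abbreviation incr :: "array => prog" where "incr a \<equiv> nset a (NAdd (nv a) (NLit 1))"

definition For :: "array => nexp => prog => prog" where
  "For x e p = nset x (NLit 0) ;; While (NLess (nv x) e) (p ;; incr x)"

lemma writes_For [simp]:
  "nwrites (For x e p) = insert x (nwrites p)" "rwrites (For x e p) = rwrites p"
  by (auto simp: For_def)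

lemma nupd_same [simp]: "nupd x 0 (nats s x 0) s = s"
  by (simp add: nupd_def)

text \<open>The cost may depend on the index because a pass over a leg costs the number of points on
  it, and only the sum over all legs is linear. The bound \<open>e\<close> is evaluated anew at
  every test, so \<open>bnd\<close> demands that its value stays \<open>N\<close>.\<close>

lemma ok_For_sum:
  assumes "I 0 (nupd x 0 0 s0)"
    and x: "x \<notin> nwrites p"
    and bnd: "\<And>k s. k <= N ==> I k s ==> frame (For x e p) s0 s ==> nats s x 0 = k ==> nval e s = N"
    and step: "\<And>k s. k < N ==> I k s ==> frame (For x e p) s0 s ==> nats s x 0 = k ==>
      ok p s (\<lambda>t s'. t <= c k \<and> I (Suc k) (nupd x 0 (Suc k) s'))"
    and exit: "\<And>t s. I N s ==> frame (For x e p) s0 s ==> nats s x 0 = N ==>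
      t <= (\<Sum>k<N. c k) + N * (ncost e + 10) + ncost e + 10 ==> Q t s"
  shows "ok (For x e p) s0 Q"
proof -
  let ?J = "\<lambda>s. nats s x 0 <= N \<and> I (nats s x 0) s"
  let ?b = "NLess (nv x) e"
  let ?P = "\<lambda>s. (\<Sum>k\<in>{nats s x 0..<N}. c k + (ncost e + 10))"
  have fr: "frame (For x e p) s0 s" if "frame (p ;; incr x) (nupd x 0 0 s0) s" for s
    using that by (auto simp: frame_def)
  have "ok (While ?b (p ;; incr x)) (nupd x 0 0 s0) (\<lambda>t s. Q (Suc (Suc (Suc t))) s)"
  proof (rule ok_While[where I = ?J and \<Phi> = ?P])
    show "?J (nupd x 0 0 s0)" using assms(1) by simp
  next
    fix s assume J: "?J s" and f: "frame (p ;; incr x) (nupd x 0 0 s0) s" and b: "bval ?b s"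
    let ?k = "nats s x 0"
    have k: "?k < N" using b J bnd[OF _ _ fr[OF f]] by auto
    have "ok p s (\<lambda>t s'. t <= c ?k \<and> I (Suc ?k) (nupd x 0 (Suc ?k) s'))"
      using step[OF k _ fr[OF f]] J by simp
    then have "ok p s (\<lambda>t s'. nats s' x 0 = ?k \<and> t <= c ?k \<and> I (Suc ?k) (nupd x 0 (Suc ?k) s'))"
      by (rule ok_conseq) (use x frameD in auto)
    then have "ok p s (\<lambda>t s'. ok (incr x) s' (\<lambda>t' s''. ?J s'' \<and> bcost ?b + (t + t') + 1 + ?P s'' <= ?P s))"
    proof (rule ok_conseq)
      fix t s' assume *: "nats s' x 0 = ?k \<and> t <= c ?k \<and> I (Suc ?k) (nupd x 0 (Suc ?k) s')"
      have "?P s = c ?k + (ncost e + 10) + (\<Sum>k\<in>{Suc ?k..<N}. c k + (ncost e + 10))"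
        using k by (rule sum.atLeast_Suc_lessThan)
      then show "ok (incr x) s' (\<lambda>t' s''. ?J s'' \<and> bcost ?b + (t + t') + 1 + ?P s'' <= ?P s)"
        using * k by simp
    qed
    then show "ok (p ;; incr x) s (\<lambda>t s'. ?J s' \<and> bcost ?b + t + 1 + ?P s' <= ?P s)"
      by (simp only: ok_Seq)
  next
    fix t s assume J: "?J s" and f: "frame (p ;; incr x) (nupd x 0 0 s0) s" and b: "\<not> bval ?b s"
      and t: "t + ?P s <= ?P (nupd x 0 0 s0) + bcost ?b + 1"
    have "nval e s = N" using J bnd[OF _ _ fr[OF f]] by auto
    with b J have k: "nats s x 0 = N" by simp
    have "?P (nupd x 0 0 s0) = (\<Sum>k<N. c k) + N * (ncost e + 10)" by (simp add: sum.distrib atLeast0LessThan)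
    with t k show "Q (Suc (Suc (Suc t))) s" by (intro exit) (use J k fr[OF f] in simp_all)
  qed
  then show ?thesis by (simp add: For_def)
qed

lemma ok_For:
  assumes "I 0 (nupd x 0 0 s0)"
    and x: "x \<notin> nwrites p"
    and bnd: "\<And>k s. k <= N ==> I k s ==> frame (For x e p) s0 s ==> nats s x 0 = k ==> nval e s = N"
    and step: "\<And>k s. k < N ==> I k s ==> frame (For x e p) s0 s ==> nats s x 0 = k ==>
      ok p s (\<lambda>t s'. t <= c \<and> I (Suc k) (nupd x 0 (Suc k) s'))"
    and exit: "\<And>t s. I N s ==> frame (For x e p) s0 s ==> nats s x 0 = N ==>
      t <= N * (c + ncost e + 10) + ncost e + 10 ==> Q t s"
  shows "ok (For x e p) s0 Q"
proof (rule ok_For_sum[where I = I and N = N and c = "\<lambda>_. c", OF assms(1-4)])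
  fix t s assume "I N s" "frame (For x e p) s0 s" "nats s x 0 = N" "t <= (\<Sum>k<N. c) + N * (ncost e + 10) + ncost e + 10"
  then show "Q t s" by (intro exit) (simp_all add: algebra_simps)
qed

section \<open>Normal form of solutions\<close>

lemma spider_dist_between:
  assumes "spider_dist z (l, x1) <= c" "spider_dist z (l, x2) <= c" "x1 <= x" "x <= x2"
  shows "spider_dist z (l, x) <= c"
  using assms by (auto simp: spider_dist_def split: if_splits)

text \<open>Balls in a tree are convex, and the path from \<open>p\<close> to \<open>q\<close> runs
  through the center; so the ball contains the leg of \<open>p\<close> from the center up to
  \<open>p\<close>.\<close>

lemma spider_dist_hull:
  assumes "spider_dist z p <= c" "spider_dist z q <= c" "fst p ~= fst q"
    "0 <= snd z" "0 <= snd q" "0 <= x" "x <= snd p"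
  shows "spider_dist z (fst p, x) <= c"
  using assms by (auto simp: spider_dist_def split: if_splits)

text \<open>Leg \<open>d\<close> is an additional leg without users. A ball of radius \<open>c\<close> around a point at distance \<open>x\<close> from
  the center may be moved to \<open>(d, x)\<close> if the part of it on its own leg beyond distance \<open>c - x\<close> is not needed.
  \<open>\<delta> p\<close> is a lower bound for the distance of \<open>p\<close> to an admissible center of a cluster.\<close>

locale spider_users =
  fixes d r :: nat and cnt :: "nat => nat" and X :: "nat => nat => real" and \<delta> :: "point => real"
  assumes d1: "1 <= d" and r1: "1 <= r"
    and X_nonneg: "i < cnt l ==> 0 <= X l i"
    and X_mono: "i <= j ==> j < cnt l ==> X l i <= X l j"
    and cnt_virtual: "d <= l ==> cnt l = 0"
begin

definition Us :: "(nat \<times> nat) set" where "Us = {(l, i). i < cnt l}"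

definition pt :: "nat \<times> nat => point" where "pt u = (fst u, X (fst u) (snd u))"

text \<open>Facilities enter only through the lower bound \<delta>, so a center moved to the virtual
  leg, where no facility lies, stays legal. On that leg only the point at distance 0 is tested,
  since a test farther out could exclude centers placed there.\<close>

definition cen :: "point => bool" where
  "cen z \<longleftrightarrow> 0 <= snd z \<and> fst z <= d \<and>
    (\<forall>l x. 0 <= x \<and> (l < d \<or> x = 0) --> \<delta> (l, x) <= spider_dist z (l, x))"

definition cls :: "(nat \<times> nat => nat) => nat => (nat \<times> nat) set" where
  "cls f g = {u \<in> Us. f u = g}"

definition solution :: "real => (nat \<times> nat => nat) => (nat => point) => bool" where
  "solution c f z \<longleftrightarrow> (\<forall>u\<in>Us. r <= card (cls f (f u)) \<and> cen (z (f u)) \<and>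
    spider_dist (z (f u)) (pt u) <= c)"

text \<open>The labels of the clusters with users on several legs, called mixed below; \<open>MU\<close> are their users.\<close>

definition GM :: "(nat \<times> nat => nat) => nat set" where
  "GM f = {g. \<exists>u\<in>cls f g. \<exists>v\<in>cls f g. fst u ~= fst v}"

definition MU :: "(nat \<times> nat => nat) => (nat \<times> nat) set" where
  "MU f = {u \<in> Us. f u \<in> GM f}"

text \<open>Small weight means that mixed clusters use users near the center. The summand 1 makes
  the removal of a user a strict decrease even at position 0.\<close>

definition weight :: "(nat \<times> nat => nat) => nat" where
  "weight f = (\<Sum>u\<in>MU f. snd u + 1)"

definition realc :: "(nat \<times> nat => nat) => (nat => point) => nat set" where
  "realc f z = {g \<in> GM f. fst (z g) < d}"

text \<open>The third component pushes centers of mixed clusters to the virtual leg whenever their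
  users permit. Without it, centers could not be forced onto distinct legs, nor clusters forced to
  have users far out on the leg of their center.\<close>

definition smaller where
  "smaller f' z' f z \<longleftrightarrow> card (GM f') < card (GM f) \<or> card (GM f') = card (GM f) \<and>
     (weight f' < weight f \<or> weight f' = weight f \<and> card (realc f' z') < card (realc f z))"

definition minimal where
  "minimal c f z \<longleftrightarrow> solution c f z \<and> (\<forall>f' z'. solution c f' z' --> \<not> smaller f' z' f z)"

lemma Us_leg: "u \<in> Us ==> fst u < d"
  using cnt_virtual by (auto simp: Us_def) (metis not_less less_zeroE)

lemma finite_Us [simp]: "finite Us"
proof -
  have "Us \<subseteq> (SIGMA l:{..<d}. {..<cnt l})" using Us_leg by (auto simp: Us_def)
  then show ?thesis by (rule finite_subset) simp
qed

lemma finite_cls [simp]: "finite (cls f g)" by (simp add: cls_def)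

lemma finite_GM [simp]: "finite (GM f)"
  by (rule finite_subset[of _ "f ` Us"]) (auto simp: GM_def cls_def)

lemma finite_MU [simp]: "finite (MU f)" by (simp add: MU_def)

lemma finite_realc [simp]: "finite (realc f z)" by (simp add: realc_def)

lemma pt_nonneg: "u \<in> Us ==> 0 <= snd (pt u)"
  using X_nonneg by (auto simp: Us_def pt_def)

section \<open>Exchange arguments for minimal solutions\<close>

lemma minimal_exists:
  assumes "solution c f z"
  obtains f z where "minimal c f z"
proof -
  let ?R = "inv_image (less_than <*lex*> less_than <*lex*> less_than)
     (\<lambda>(f, z). (card (GM f), weight f, card (realc f z)))"
  have "wf ?R" by auto
  moreover have "(f, z) \<in> {(f, z). solution c f z}" using assms by simp
  ultimately obtain p where p: "p \<in> {(f, z). solution c f z}"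
    and min: "\<And>q. (q, p) \<in> ?R ==> q \<notin> {(f, z). solution c f z}"
    by (rule wfE_min) blast
  obtain f z where fz: "p = (f, z)" by (cases p)
  have "minimal c f z" unfolding minimal_def
  proof (intro conjI allI impI)
    show "solution c f z" using p fz by simp
  next
    fix f' z' assume "solution c f' z'"
    with min[of "(f', z')"] fz show "\<not> smaller f' z' f z"
      by (auto simp: smaller_def)
  qed
  then show ?thesis by (rule that)
qed

text \<open>Most exchanges only remove mixed labels and mixed users, and then inclusions of sets
  replace comparisons of numbers. The exception is the swap in \<open>minimal_prefix\<close>, which
  replaces a mixed user by another one.\<close>

lemma not_minimalI:
  assumes "minimal c f z" "solution c f' z'" "GM f' \<subseteq> GM f" "MU f' \<subseteq> MU f"
    and "GM f' ~= GM f \<or> MU f' ~= MU f \<or> realc f' z' \<subset> realc f z"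
  shows False
proof -
  have le: "card (GM f') <= card (GM f)" "weight f' <= weight f"
    using assms(3,4) by (auto simp: weight_def intro: card_mono sum_mono2)
  have "smaller f' z' f z"
    using assms(5)
  proof (elim disjE)
    assume "GM f' ~= GM f"
    then have "card (GM f') < card (GM f)" using assms(3) by (intro psubset_card_mono) auto
    then show ?thesis by (simp add: smaller_def)
  next
    assume "MU f' ~= MU f"
    then have "MU f' \<subset> MU f" using assms(4) by auto
    then obtain b where "b \<in> MU f - MU f'" by blast
    then have "weight f' < weight f" unfolding weight_def
      using assms(4) by (intro sum_strict_mono2[where b = b]) auto
    then show ?thesis using le by (auto simp: smaller_def)
  next
    assume "realc f' z' \<subset> realc f z"
    then have "card (realc f' z') < card (realc f z)" by (intro psubset_card_mono) auto
    then show ?thesis using le by (auto simp: smaller_def)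
  qed
  with assms(1,2) show False by (auto simp: minimal_def)
qed

lemma GM_other_leg:
  assumes "g \<in> GM f"
  obtains v where "v \<in> cls f g" "fst v ~= l"
proof -
  from assms obtain u v where "u \<in> cls f g" "v \<in> cls f g" "fst u ~= fst v" by (auto simp: GM_def)
  then show ?thesis using that[of u] that[of v] by (cases "fst u = l") auto
qed

lemma solutionD:
  assumes "solution c f z" "u \<in> cls f g"
  shows "r <= card (cls f g)" "cen (z g)" "spider_dist (z g) (pt u) <= c" "0 <= snd (z g)" "fst (z g) <= d"
  using assms by (auto simp: solution_def cls_def cen_def)

lemma multi_hull:
  assumes "solution c f z" "g \<in> GM f" "v \<in> cls f g" "0 <= x" "x <= X (fst v) (snd v)"
  shows "spider_dist (z g) (fst v, x) <= c"
proof -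
  obtain w where w: "w \<in> cls f g" "fst w ~= fst v" using GM_other_leg[OF assms(2)] .
  show ?thesis
    using spider_dist_hull[of "z g" "pt v" c "pt w" x] w(2) assms(4,5) pt_nonneg[of w]
      solutionD(3,4)[OF assms(1) assms(3)] solutionD(3)[OF assms(1) w(1)] w(1)
    by (simp add: pt_def cls_def)
qed

lemma cls_same_leg: "g \<notin> GM f ==> u \<in> cls f g ==> v \<in> cls f g ==> fst u = fst v"
  unfolding GM_def by blast

text \<open>Otherwise swapping the labels of \<open>u\<close> and \<open>v\<close> lowers the
  weight. The mixed cluster \<open>C\<close> can take \<open>u\<close> because its ball covers the
  leg from the center up to \<open>v\<close>. If the other cluster \<open>D\<close> has a user
  beyond \<open>v\<close>, convexity puts \<open>v\<close> into its ball; if not, the ball of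
  \<open>C\<close> covers all users of the new \<open>D\<close>, which adopts that center.\<close>

lemma minimal_prefix:
  assumes m: "minimal c f z" and uv: "u \<in> Us" "v \<in> Us" "fst u = fst v" "snd u < snd v"
    and v: "f v \<in> GM f"
  shows "f u \<in> GM f"
proof (rule ccontr)
  assume u: "f u \<notin> GM f"
  define l where "l = fst u"
  define C where "C = f v"
  define D where "D = f u"
  have CD: "C ~= D" and uneqv: "u ~= v" using u v uv by (auto simp: C_def D_def)
  have sol: "solution c f z" using m by (simp add: minimal_def)
  have uD: "u \<in> cls f D" and vC: "v \<in> cls f C" using uv by (auto simp: cls_def C_def D_def)
  define f' where "f' = f(u := C, v := D)"
  define z' where "z' = (if \<exists>w\<in>cls f D. snd v < snd w then z else z(D := z C))"
  have clsD: "cls f' D = insert v (cls f D - {u})"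
    and clsC: "cls f' C = insert u (cls f C - {v})"
    and clso: "\<And>g. g ~= C ==> g ~= D ==> cls f' g = cls f g"
    using uv CD uneqv by (auto simp: cls_def f'_def C_def D_def)
  have Dleg: "fst w = l" if "w \<in> cls f D" for w
    using cls_same_leg[of D f w u] u uD that by (auto simp: D_def l_def)
  have sizes: "card (cls f' g) = card (cls f g)" for g
  proof -
    have v': "v \<notin> cls f D" and u': "u \<notin> cls f C" using CD by (auto simp: cls_def C_def D_def)
    have "card (cls f' D) = card (cls f D)"
      unfolding clsD using card.remove[OF _ uD] v' by (subst card_insert_disjoint) auto
    moreover have "card (cls f' C) = card (cls f C)"
      unfolding clsC using card.remove[OF _ vC] u' by (subst card_insert_disjoint) auto
    ultimately show ?thesis using clso by metis
  qed
  have Xuv: "0 <= X l (snd u)" "X l (snd u) <= X l (snd v)"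
    using uv X_mono[of "snd u" "snd v" l] X_nonneg[of "snd u" l] by (auto simp: Us_def l_def)
  have ptl: "pt w = (l, X l (snd w))" if "w \<in> insert v (cls f D)" for w
  proof -
    have "fst w = l" using that Dleg[of w] uv(3) l_def by (elim insertE) simp_all
    then show ?thesis by (simp add: pt_def)
  qed
  have hullC: "spider_dist (z C) (l, x) <= c" if "0 <= x" "x <= X l (snd v)" for x
    using multi_hull[OF sol _ vC, of x] that v uv(3) by (auto simp: C_def l_def)
  have distD: "spider_dist (z' D) (pt w) <= c" if "w \<in> cls f' D" for w
  proof (cases "\<exists>w\<in>cls f D. snd v < snd w")
    case True
    then obtain y where y: "y \<in> cls f D" "snd v < snd y" by blast
    have "X l (snd v) <= X l (snd y)"
      using y X_mono[of "snd v" "snd y" l] Dleg[OF y(1)] by (auto simp: cls_def Us_def)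
    then have "spider_dist (z D) (l, X l (snd v)) <= c"
      using spider_dist_between[of "z D" l "X l (snd u)" c "X l (snd y)" "X l (snd v)"] Xuv
        solutionD(3)[OF sol uD] solutionD(3)[OF sol y(1)] ptl[of u] ptl[of y] uD y by auto
    moreover have "z' D = z D" using True by (simp add: z'_def)
    ultimately show ?thesis
      using that solutionD(3)[OF sol, of w D] ptl[of v] by (auto simp: clsD)
  next
    case False
    then have zD: "z' D = z C" by (simp add: z'_def)
    have w: "w \<in> insert v (cls f D)" using that unfolding clsD by blast
    have wl: "snd w <= snd v" using w False by (metis insertE linorder_not_less order_refl)
    have "w \<in> Us" "fst w = l" using w uv(2) ptl[OF w] by (auto simp: cls_def pt_def)
    then have "snd w < cnt l" by (auto simp: Us_def)
    then have "0 <= X l (snd w)" "X l (snd w) <= X l (snd v)"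
      using X_nonneg X_mono[of "snd w" "snd v" l] uv wl by (auto simp: l_def Us_def)
    then show ?thesis using hullC ptl[OF w] zD by simp
  qed
  have z'other: "z' g = z g" if "g ~= D" for g using that by (auto simp: z'_def)
  have cenD: "cen (z' D)" using solutionD(2)[OF sol uD] solutionD(2)[OF sol vC] by (auto simp: z'_def)
  have "solution c f' z'" unfolding solution_def
  proof (intro ballI)
    fix w assume w: "w \<in> Us"
    let ?g = "f' w"
    have wg: "w \<in> cls f' ?g" using w by (simp add: cls_def)
    have ne: "\<exists>y. y \<in> cls f ?g" using sizes[of ?g] wg by (metis card_eq_0_iff empty_iff equals0I finite_cls)
    then obtain y where y: "y \<in> cls f ?g" by blast
    have s: "r <= card (cls f' ?g)" using solutionD(1)[OF sol y] sizes by simp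
    show "r <= card (cls f' ?g) \<and> cen (z' ?g) \<and> spider_dist (z' ?g) (pt w) <= c"
    proof (cases "?g = D")
      case True
      then show ?thesis using s cenD distD wg by auto
    next
      case False
      have "spider_dist (z ?g) (pt w) <= c"
      proof (cases "w \<in> cls f ?g")
        case True
        then show ?thesis using solutionD(3)[OF sol] by blast
      next
        case f: False
        then have "w = u" "?g = C" using wg False clsC clso by (metis Diff_iff insertE)+
        then show ?thesis using hullC[of "X l (snd u)"] Xuv by (auto simp: pt_def l_def)
      qed
      then show ?thesis using s z'other[OF False] solutionD(2)[OF sol y] by simp
    qed
  qed
  moreover have GM: "GM f' = GM f"
  proof -
    obtain w where w: "w \<in> cls f C" "fst w ~= l" using GM_other_leg[OF v] unfolding C_def .
    have "u \<in> cls f' C" "w \<in> cls f' C" using w uv by (auto simp: clsC l_def)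
    then have 1: "C \<in> GM f'" using w(2) unfolding GM_def l_def by blast
    have leg': "fst w = l" if "w \<in> cls f' D" for w
      using that Dleg[of w] uv(3) unfolding clsD l_def by auto
    have 2: "D \<notin> GM f'"
    proof
      assume "D \<in> GM f'"
      then obtain a b where "a \<in> cls f' D" "b \<in> cls f' D" "fst a ~= fst b" unfolding GM_def by blast
      with leg'[of a] leg'[of b] show False by simp
    qed
    have "g \<in> GM f' \<longleftrightarrow> g \<in> GM f" for g
    proof -
      consider "g = C" | "g = D" | "g ~= C" "g ~= D" by blast
      then show ?thesis
      proof cases
        case 1
        with \<open>C \<in> GM f'\<close> v show ?thesis by (simp add: C_def)
      next
        case 2
        with \<open>D \<notin> GM f'\<close> u show ?thesis by (simp add: D_def)
      next
        case 3
        show ?thesis using clso[OF 3] by (simp only: GM_def mem_Collect_eq)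
      qed
    qed
    then show ?thesis by blast
  qed
  moreover have "weight f' < weight f"
  proof -
    have fu: "f' u = C" "f' v = D" "\<And>w. w ~= u ==> w ~= v ==> f' w = f w"
      using uneqv by (auto simp: f'_def)
    have "MU f' = insert u (MU f - {v})"
    proof (rule set_eqI)
      fix w
      consider "w = u" | "w = v" | "w ~= u" "w ~= v" by blast
      then show "w \<in> MU f' \<longleftrightarrow> w \<in> insert u (MU f - {v})"
        by cases (use fu uneqv u v uv(1,2) in \<open>simp_all add: MU_def GM C_def D_def\<close>)
    qed
    moreover have "u \<notin> MU f" "v \<in> MU f" using u v uv by (auto simp: MU_def)
    ultimately have "weight f' = (snd u + 1) + (\<Sum>w\<in>MU f - {v}. snd w + 1)"
      by (simp add: weight_def)
    moreover have "weight f = (snd v + 1) + (\<Sum>w\<in>MU f - {v}. snd w + 1)"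
      using \<open>v \<in> MU f\<close> by (simp add: weight_def sum.remove)
    ultimately show ?thesis using uv by simp
  qed
  ultimately show False using m by (auto simp: minimal_def smaller_def)
qed

text \<open>Merging the two clusters would leave one mixed cluster less.\<close>

lemma minimal_no_absorb:
  assumes m: "minimal c f z" and C: "C1 \<in> GM f" "C2 \<in> GM f" "C1 ~= C2"
    and "\<And>u. u \<in> cls f C1 ==> spider_dist (z C2) (pt u) <= c"
  shows False
proof -
  have sol: "solution c f z" using m by (simp add: minimal_def)
  define f' where "f' = (\<lambda>u. if f u = C1 then C2 else f u)"
  obtain y where y: "y \<in> cls f C2" using GM_other_leg[OF C(2)] by blast
  have cl: "cls f' C2 = cls f C1 \<union> cls f C2" "cls f' C1 = {}"
    "\<And>g. g ~= C1 ==> g ~= C2 ==> cls f' g = cls f g"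
    using C(3) by (auto simp: cls_def f'_def)
  have "solution c f' z" unfolding solution_def
  proof (intro ballI)
    fix w assume w: "w \<in> Us"
    show "r <= card (cls f' (f' w)) \<and> cen (z (f' w)) \<and> spider_dist (z (f' w)) (pt w) <= c"
    proof (cases "f w = C1 \<or> f w = C2")
      case True
      then have f: "f' w = C2" by (auto simp: f'_def)
      have "card (cls f C2) <= card (cls f' C2)" by (rule card_mono) (auto simp: cl)
      then show ?thesis
        using True f solutionD[OF sol y] w assms(5)[of w] solutionD(3)[OF sol, of w C2]
        by (auto simp: cls_def)
    next
      case False
      then have "f' w = f w" by (simp add: f'_def)
      then show ?thesis using False w cl(3)[of "f w"] solutionD[OF sol, of w "f w"] by (auto simp: cls_def)
    qed
  qed
  moreover have GMs: "GM f' \<subseteq> GM f - {C1}"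
  proof
    fix g assume g: "g \<in> GM f'"
    then show "g \<in> GM f - {C1}" using cl C by (cases "g = C2"; cases "g = C1") (auto simp: GM_def)
  qed
  moreover have "MU f' \<subseteq> MU f" using C GMs by (auto simp: MU_def f'_def split: if_splits)
  ultimately show False using not_minimalI[OF m, of f' z] C by blast
qed

text \<open>The users of two mixed clusters are pooled and divided anew. Progress consists either in
  \<open>A\<close> lying on one leg, so that \<open>C1\<close> is no longer mixed, or in the center
  of \<open>C2\<close> leaving the real legs.\<close>

lemma minimal_redistribute:
  assumes m: "minimal c f z" and C: "C1 \<in> GM f" "C2 \<in> GM f" "C1 ~= C2"
    and AB: "A \<union> B = cls f C1 \<union> cls f C2" "A \<inter> B = {}" "r <= card A" "r <= card B"
    and A: "\<And>u. u \<in> A ==> spider_dist (z C1) (pt u) <= c"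
    and B: "\<And>u. u \<in> B ==> spider_dist z2 (pt u) <= c" and z2: "cen z2"
    and better: "(\<forall>u\<in>A. \<forall>v\<in>A. fst u = fst v) \<and> z2 = z C2 \<or> fst (z C2) < d \<and> \<not> fst z2 < d"
  shows False
proof -
  have sol: "solution c f z" using m by (simp add: minimal_def)
  define f' where "f' = (\<lambda>u. if u \<in> A then C1 else if u \<in> B then C2 else f u)"
  define z' where "z' = z(C2 := z2)"
  obtain y1 where y1: "y1 \<in> cls f C1" using GM_other_leg[OF C(1)] by blast
  have U: "A \<subseteq> Us" "B \<subseteq> Us" using AB(1) by (auto simp: cls_def)
  have fAB: "f u = C1 \<or> f u = C2 \<longleftrightarrow> u \<in> A \<or> u \<in> B" if "u \<in> Us" for u
    using AB(1) that by (auto simp: cls_def)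
  have cl: "cls f' C1 = A" "cls f' C2 = B"
    "\<And>g. g ~= C1 ==> g ~= C2 ==> cls f' g = cls f g"
  proof -
    have "(f' u = C1 \<longleftrightarrow> u \<in> A) \<and> (f' u = C2 \<longleftrightarrow> u \<in> B) \<and> (g ~= C1 --> g ~= C2 --> (f' u = g \<longleftrightarrow> f u = g))"
      if "u \<in> Us" for u g
      using C(3) AB(2) fAB[OF that] by (auto simp: f'_def)
    then show "cls f' C1 = A" "cls f' C2 = B" "\<And>g. g ~= C1 ==> g ~= C2 ==> cls f' g = cls f g"
      using U unfolding cls_def by blast+
  qed
  have "solution c f' z'" unfolding solution_def
  proof (intro ballI)
    fix w assume w: "w \<in> Us"
    show "r <= card (cls f' (f' w)) \<and> cen (z' (f' w)) \<and> spider_dist (z' (f' w)) (pt w) <= c"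
    proof (cases "w \<in> A \<or> w \<in> B")
      case True
      then show ?thesis using C(3) AB A B z2 cl solutionD(2)[OF sol y1] by (auto simp: f'_def z'_def)
    next
      case False
      then have "f' w = f w" "f w ~= C1" "f w ~= C2" using fAB[OF w] by (auto simp: f'_def)
      then show ?thesis using w cl(3)[of "f w"] solutionD[OF sol, of w "f w"]
        by (auto simp: cls_def z'_def)
    qed
  qed
  moreover have GMs: "GM f' \<subseteq> GM f"
  proof
    fix g assume "g \<in> GM f'"
    then show "g \<in> GM f" using cl C by (cases "g = C2"; cases "g = C1") (auto simp: GM_def)
  qed
  moreover have "MU f' \<subseteq> MU f"
    using C GMs fAB by (auto simp: MU_def f'_def split: if_splits)
  moreover have "GM f' ~= GM f \<or> MU f' ~= MU f \<or> realc f' z' \<subset> realc f z"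
    using better
  proof
    assume "(\<forall>u\<in>A. \<forall>v\<in>A. fst u = fst v) \<and> z2 = z C2"
    then have "C1 \<notin> GM f'" unfolding GM_def mem_Collect_eq cl by blast
    then have "GM f' ~= GM f" using C(1) by metis
    then show ?thesis by simp
  next
    assume *: "fst (z C2) < d \<and> \<not> fst z2 < d"
    then have "realc f' z' \<subseteq> realc f z" "C2 \<in> realc f z" "C2 \<notin> realc f' z'"
      using GMs C by (auto simp: realc_def z'_def split: if_splits)
    then have "realc f' z' \<subset> realc f z" by (metis psubsetI)
    then show ?thesis by simp
  qed
  ultimately show False by (rule not_minimalI[OF m])
qed

text \<open>Seen from the virtual leg, at the same distance from the center, every point tested by
  \<open>cen\<close> is at least as far away as before.\<close>

lemma cen_virtual: "cen z ==> cen (d, snd z)"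
proof -
  assume c: "cen z"
  have "\<delta> (l, x) <= spider_dist (d, snd z) (l, x)" if "0 <= x \<and> (l < d \<or> x = 0)" for l x
  proof -
    have "\<delta> (l, x) <= spider_dist z (l, x)" using c that unfolding cen_def by blast
    also have "\<dots> <= spider_dist (d, snd z) (l, x)"
      using that c by (auto simp: spider_dist_def cen_def)
    finally show ?thesis .
  qed
  then show ?thesis using c unfolding cen_def by simp
qed

text \<open>A ball of radius c around (l, x) with x \<le> c reaches to c + x on leg l and to c - x
  on all others; these two numbers govern the exchanges below. That x \<le> c follows from a user on
  a leg other than that of the center.\<close>

lemma real_centre_region:
  assumes "solution c f z" "g \<in> GM f" "u \<in> cls f g"
  shows "fst u = fst (z g) ==> snd (pt u) <= c + snd (z g)"
    and "fst u ~= fst (z g) ==> snd (pt u) <= c - snd (z g)"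
    and "0 <= snd (z g)" "snd (z g) <= c" "fst (z g) <= d"
proof -
  obtain w where w: "w \<in> cls f g" "fst w ~= fst (z g)" using GM_other_leg[OF assms(2)] .
  show "fst u = fst (z g) ==> snd (pt u) <= c + snd (z g)"
    "fst u ~= fst (z g) ==> snd (pt u) <= c - snd (z g)"
    "0 <= snd (z g)" "fst (z g) <= d"
    using solutionD[OF assms(1,3)] by (auto simp: spider_dist_def pt_def split: if_splits)
  have "w \<in> Us" using w by (simp add: cls_def)
  then show "snd (z g) <= c"
    using solutionD[OF assms(1) w(1)] w(2) pt_nonneg[of w] by (auto simp: spider_dist_def pt_def split: if_splits)
qed

lemma region_dist:
  assumes "u \<in> Us" "snd zz <= c"
    and "fst u = fst zz ==> snd (pt u) <= c + snd zz"
    and "fst u ~= fst zz ==> snd (pt u) <= c - snd zz"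
  shows "spider_dist zz (pt u) <= c"
  using assms pt_nonneg[OF assms(1)] by (auto simp: spider_dist_def pt_def)

text \<open>Of two balls centered on the same leg, the one centered farther out, \<open>C1\<close>,
  covers the users of both clusters on that leg, and the other covers the users of both off that
  leg. If at least r users are on the leg, r or more of them can form a cluster without other legs.
  Otherwise \<open>C1\<close> takes all of them and is topped up to r; the rest lies off the leg,
  and the center of \<open>C2\<close> can move to the virtual leg. On the virtual leg there are no
  users, and \<open>C2\<close> absorbs \<open>C1\<close>.\<close>

lemma minimal_distinct:
  assumes m: "minimal c f z" and C: "C1 \<in> GM f" "C2 \<in> GM f" "C1 ~= C2"
  shows "fst (z C1) ~= fst (z C2)"
proof -
  have sol: "solution c f z" using m by (simp add: minimal_def)
  have *: False if C: "C1 \<in> GM f" "C2 \<in> GM f" "C1 ~= C2" and same: "fst (z C1) = fst (z C2)"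
    and y: "snd (z C2) <= snd (z C1)" for C1 C2
  proof -
    define l where "l = fst (z C1)"
    have l: "fst (z C1) = l" "fst (z C2) = l" using same by (auto simp: l_def)
    obtain w1 w2 where w: "w1 \<in> cls f C1" "w2 \<in> cls f C2" using GM_other_leg[OF C(1)] GM_other_leg[OF C(2)] by metis
    note z1 = real_centre_region(3,4,5)[OF sol C(1) w(1)] and z2 = real_centre_region(3,4,5)[OF sol C(2) w(2)]
    note reg1 = real_centre_region(1,2)[OF sol C(1), unfolded l] and reg2 = real_centre_region(1,2)[OF sol C(2), unfolded l]
    have U: "u \<in> Us" if "u \<in> cls f C1 \<union> cls f C2" for u using that by (auto simp: cls_def)
    have d1: "spider_dist (z C1) (pt u) <= c" if "u \<in> cls f C1 \<union> cls f C2" "u \<in> cls f C1 \<or> fst u = l" for u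
    proof (rule region_dist[OF U[OF that(1)]])
      show "fst u = fst (z C1) ==> snd (pt u) <= c + snd (z C1)" using that reg1(1)[of u] reg2(1)[of u] y l by auto
      show "fst u ~= fst (z C1) ==> snd (pt u) <= c - snd (z C1)" using that reg1(2)[of u] l by auto
    qed (use z1 in auto)
    have off: "snd (pt u) <= c - snd (z C2)" if "u \<in> cls f C1 \<union> cls f C2" "fst u ~= l" for u
      using that reg1(2)[of u] reg2(2)[of u] y by auto
    have d2: "spider_dist (z C2) (pt u) <= c" if "u \<in> cls f C1 \<union> cls f C2" "u \<in> cls f C2 \<or> fst u ~= l" for u
    proof (rule region_dist[OF U[OF that(1)]])
      show "fst u = fst (z C2) ==> snd (pt u) <= c + snd (z C2)" using that reg2(1)[of u] l by auto
      show "fst u ~= fst (z C2) ==> snd (pt u) <= c - snd (z C2)" using that off[of u] l by auto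
    qed (use z2 in auto)
    define on1 where "on1 = {u \<in> cls f C1. fst u = l}"
    define on2 where "on2 = {u \<in> cls f C2. fst u = l}"
    define off1 where "off1 = {u \<in> cls f C1. fst u ~= l}"
    let ?all = "cls f C1 \<union> cls f C2"
    have fin: "finite on1" "finite on2" "finite off1" by (simp_all add: on1_def on2_def off1_def)
    have disj: "cls f C1 \<inter> cls f C2 = {}" using C(3) by (auto simp: cls_def)
    have rC: "r <= card (cls f C1)" "r <= card (cls f C2)" using solutionD(1)[OF sol] w by auto
    have card_all: "card ?all = card (cls f C1) + card (cls f C2)" using disj by (simp add: card_Un_disjoint)
    have c1: "card (cls f C1) = card on1 + card off1"
    proof -
      have "cls f C1 = on1 \<union> off1" "on1 \<inter> off1 = {}" by (auto simp: on1_def off1_def)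
      then show ?thesis using fin by (simp add: card_Un_disjoint)
    qed
    have don: "on1 \<inter> on2 = {}" using disj by (auto simp: on1_def on2_def)
    show False
    proof (cases "l < d")
      case False
      have "spider_dist (z C2) (pt u) <= c" if "u \<in> cls f C1" for u
        using d2[of u] Us_leg[of u] U[of u] that False by simp
      then show False by (rule minimal_no_absorb[OF m C])
    next
      case True
      show False
      proof (cases "r <= card on1 + card on2")
        case le: True
        \<comment> \<open>Either the on-leg users of \<open>C1\<close> suffice and \<open>C2\<close>
          remains whole, or \<open>A\<close> is filled up to exactly r, so that at least r of the at
          least 2r users remain.\<close>
        obtain A where A: "on1 \<subseteq> A" "A \<subseteq> on1 \<union> on2" "r <= card A" "card A = r \<or> A = on1"
        proof (cases "r <= card on1")
          case True then show ?thesis using that[of on1] by auto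
        next
          case False
          have "r - card on1 <= card on2" using le by simp
          then obtain P where P: "P \<subseteq> on2" "card P = r - card on1" "finite P"
            by (rule obtain_subset_with_card_n)
          moreover have "on1 \<inter> P = {}" using P(1) don by blast
          ultimately have c: "card (on1 \<union> P) = r" using fin(1) False by (simp add: card_Un_disjoint)
          show ?thesis using P(1) c by (intro that[of "on1 \<union> P"]) blast+
        qed
        have u2: "r <= card (?all - A)"
        proof (cases "A = on1")
          case True
          then have "cls f C2 \<subseteq> ?all - A" using disj by (auto simp: on1_def)
          then show ?thesis using rC card_mono[of "?all - A" "cls f C2"] by auto
        next
          case False
          then have "card A = r" using A by auto
          moreover have "A \<subseteq> ?all" using A by (auto simp: on1_def on2_def)
          then have "card (?all - A) = card ?all - card A"
            by (intro card_Diff_subset finite_subset[of A ?all]) simp_all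
          ultimately show ?thesis using rC card_all by linarith
        qed
        have mem: "u \<in> ?all \<and> fst u = l" if "u \<in> A" for u
          using subsetD[OF A(2) that] unfolding on1_def on2_def by blast
        then have u1: "A \<union> (?all - A) = ?all" by blast
        have u3: "spider_dist (z C1) (pt u) <= c" if "u \<in> A" for u
          using mem[OF that] d1[of u] by blast
        have u4: "spider_dist (z C2) (pt u) <= c" if "u \<in> ?all - A" for u
        proof -
          have "u \<in> ?all" "u \<in> cls f C2 \<or> fst u ~= l" using that subsetD[OF A(1), of u] unfolding on1_def by blast+
          then show ?thesis by (rule d2)
        qed
        have "\<forall>u\<in>A. \<forall>v\<in>A. fst u = fst v" using mem by metis
        then have u5: "(\<forall>u\<in>A. \<forall>v\<in>A. fst u = fst v) \<and> z C2 = z C2 \<or> fst (z C2) < d \<and> \<not> fst (z C2) < d"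
          by (intro disjI1 conjI refl)
        show False
          by (rule minimal_redistribute[OF m C u1 _ A(3) u2 u3 u4 solutionD(2)[OF sol w(2)] u5]) simp_all
      next
        case gt: False
        then have "r - (card on1 + card on2) <= card off1" using c1 rC by linarith
        then obtain P where P: "P \<subseteq> off1" "card P = r - (card on1 + card on2)"
          by (rule obtain_subset_with_card_n)
        define A where "A = on1 \<union> on2 \<union> P"
        have "card A = r" unfolding A_def
        proof -
          have "finite P" using P(1) fin(3) by (rule finite_subset)
          moreover have "(on1 \<union> on2) \<inter> P = {}" using P(1) unfolding on1_def on2_def off1_def by blast
          moreover have "card (on1 \<union> on2) + card P = r" using P(2) gt don fin by (simp add: card_Un_disjoint)
          ultimately show "card (on1 \<union> on2 \<union> P) = r" using fin by (simp add: card_Un_disjoint)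
        qed
        moreover have Asub: "A \<subseteq> ?all" using P(1) unfolding A_def on1_def on2_def off1_def by blast
        then have "card (?all - A) = card ?all - card A"
          by (intro card_Diff_subset finite_subset[of A ?all]) simp_all
        ultimately have rest: "r <= card (?all - A)" "r <= card A" using rC card_all by linarith+
        have offleg: "fst u ~= l" if "u \<in> ?all - A" for u using that unfolding A_def on1_def on2_def by blast
        have u1: "A \<union> (?all - A) = ?all" using Asub by blast
        have u3: "spider_dist (z C1) (pt u) <= c" if "u \<in> A" for u
        proof -
          have "u \<in> ?all" "u \<in> cls f C1 \<or> fst u = l"
            using that P(1) unfolding A_def on1_def on2_def off1_def by blast+
          then show ?thesis by (rule d1)
        qed
        have u4: "spider_dist (d, snd (z C2)) (pt u) <= c" if u: "u \<in> ?all - A" for u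
        proof (rule region_dist)
          have ua: "u \<in> ?all" using u by blast
          then show "u \<in> Us" by (rule U)
          show "snd (d, snd (z C2)) <= c" using z2 by simp
          show "fst u = fst (d, snd (z C2)) ==> snd (pt u) <= c + snd (d, snd (z C2))"
            using Us_leg[OF U[OF ua]] by simp
          show "snd (pt u) <= c - snd (d, snd (z C2))" using off[OF ua offleg[OF u]] by simp
        qed
        have u5: "(\<forall>u\<in>A. \<forall>v\<in>A. fst u = fst v) \<and> (d, snd (z C2)) = z C2 \<or>
            fst (z C2) < d \<and> \<not> fst (d, snd (z C2)) < d" using True l by simp
        show False
          by (rule minimal_redistribute[OF m C u1 _ rest(2,1) u3 u4
                cen_virtual[OF solutionD(2)[OF sol w(2)]] u5]) simp_all
      qed
    qed
  qed
  show ?thesis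
  proof
    assume eq: "fst (z C1) = fst (z C2)"
    consider "snd (z C2) <= snd (z C1)" | "snd (z C1) <= snd (z C2)" by linarith
    then show False
      by cases (use *[of C1 C2] *[of C2 C1] C eq in auto)
  qed
qed

text \<open>If all users on the leg of the center lay within the off-leg reach, the center could be
  moved to the virtual leg at the same distance, leaving fewer centers on real legs.\<close>

lemma minimal_far_user:
  assumes m: "minimal c f z" and C: "C \<in> GM f" "fst (z C) < d"
  obtains u where "u \<in> cls f C" "fst u = fst (z C)" "c - snd (z C) < X (fst u) (snd u)"
proof (rule ccontr)
  note witness = that
  assume nt: "\<not> thesis"
  have near: "X (fst u) (snd u) <= c - snd (z C)" if u: "u \<in> cls f C" "fst u = fst (z C)" for u
  proof (rule ccontr)
    assume "\<not> X (fst u) (snd u) <= c - snd (z C)"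
    then have "c - snd (z C) < X (fst u) (snd u)" by linarith
    then have thesis by (rule witness[OF u])
    with nt show False by simp
  qed
  have sol: "solution c f z" using m by (simp add: minimal_def)
  obtain w where w: "w \<in> cls f C" using GM_other_leg[OF C(1)] by metis
  define z' where "z' = z(C := (d, snd (z C)))"
  have "solution c f z'" unfolding solution_def
  proof (intro ballI conjI)
    fix u assume u: "u \<in> Us"
    then have uc: "u \<in> cls f (f u)" by (simp add: cls_def)
    note s = solutionD[OF sol uc]
    show "r <= card (cls f (f u))" by (rule s)
    show "cen (z' (f u))" using s(2) cen_virtual[OF s(2)] by (auto simp: z'_def)
    show "spider_dist (z' (f u)) (pt u) <= c"
    proof (cases "f u = C")
      case True
      then have uC: "u \<in> cls f C" using uc by simp
      have "snd (pt u) <= c - snd (z C)"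
        using near[OF uC] real_centre_region(2)[OF sol C(1) uC] by (cases "fst u = fst (z C)") (auto simp: pt_def)
      then show ?thesis using True real_centre_region(4)[OF sol C(1) uC] Us_leg[OF u] u
        by (intro region_dist) (auto simp: z'_def)
    qed (use s in \<open>auto simp: z'_def\<close>)
  qed
  moreover have "C \<in> realc f z" "realc f z' \<subseteq> realc f z" "C \<notin> realc f z'"
    using C by (auto simp: realc_def z'_def)
  then have "realc f z' \<subset> realc f z" by (metis psubsetI)
  ultimately show False using not_minimalI[OF m, of f z'] by simp
qed

text \<open>Of 2r users on one leg, r could be split off under a fresh label with the same center,
  which leaves at least r behind and makes fewer users mixed.\<close>

lemma minimal_leg_bound:
  assumes m: "minimal c f z" and C: "C \<in> GM f"
  shows "card {u \<in> cls f C. fst u = l} < 2 * r"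
proof (rule ccontr)
  let ?L = "{u \<in> cls f C. fst u = l}"
  assume "\<not> ?thesis"
  then have big: "2 * r <= card ?L" by simp
  then have "r <= card ?L" by simp
  then obtain A where A: "A \<subseteq> ?L" "card A = r" by (rule obtain_subset_with_card_n)
  have AC: "A \<subseteq> cls f C" "finite A" using A finite_subset[of A ?L] by auto
  have sol: "solution c f z" using m by (simp add: minimal_def)
  obtain g where g: "g \<notin> f ` Us" using finite_Us ex_new_if_finite[of "f ` Us"] by auto
  have gC: "g ~= C" using g GM_other_leg[OF C] by (auto simp: cls_def)
  define f' where "f' = (\<lambda>u. if u \<in> A then g else f u)"
  define z' where "z' = z(g := z C)"
  have cl: "cls f' g = A" "cls f' C = cls f C - A" "\<And>h. h ~= g ==> h ~= C ==> cls f' h = cls f h"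
    using g gC AC by (auto simp: cls_def f'_def)
  have "card (cls f C - A) = card (cls f C) - r" using AC A by (simp add: card_Diff_subset)
  moreover have "card ?L <= card (cls f C)" by (rule card_mono) auto
  ultimately have rest: "r <= card (cls f C - A)" using big by linarith
  have "solution c f' z'" unfolding solution_def
  proof (intro ballI)
    fix w assume w: "w \<in> Us"
    then have "w \<in> cls f (f w)" by (simp add: cls_def)
    note s = solutionD[OF sol this]
    have fg: "f w ~= g" using g w by auto
    show "r <= card (cls f' (f' w)) \<and> cen (z' (f' w)) \<and> spider_dist (z' (f' w)) (pt w) <= c"
    proof (cases "w \<in> A")
      case True
      then have "f w = C" using AC by (auto simp: cls_def)
      then show ?thesis using True s cl A by (auto simp: f'_def z'_def)
    next
      case False
      then show ?thesis using s cl(2) cl(3)[of "f w"] rest fg by (cases "f w = C") (auto simp: f'_def z'_def)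
    qed
  qed
  moreover have GMs: "GM f' \<subseteq> GM f"
  proof
    fix h assume h: "h \<in> GM f'"
    have "g \<notin> GM f'" using A(1) by (auto simp: GM_def cl)
    then have "h ~= g" using h by metis
    then show "h \<in> GM f" using h C cl(3)[of h] by (cases "h = C") (simp_all add: GM_def)
  qed
  moreover have "MU f' \<subseteq> MU f"
    using GMs C AC by (auto simp: MU_def f'_def cls_def split: if_splits)
  moreover have "MU f' ~= MU f"
  proof -
    have "A ~= {}" using A r1 by auto
    then obtain u where u: "u \<in> A" by blast
    have "g \<notin> GM f'" using A(1) by (auto simp: GM_def cl)
    then have "u \<notin> MU f'" using u by (auto simp: MU_def f'_def)
    moreover have "u \<in> MU f" using u AC C by (auto simp: MU_def cls_def)
    ultimately show ?thesis by metis
  qed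
  ultimately show False using not_minimalI[OF m, of f' z'] by simp
qed
text \<open>If even the on-leg reach of \<open>C1\<close> were within the off-leg reach of
  \<open>C2\<close>, the ball of \<open>C2\<close> would contain all users of \<open>C1\<close> and
  could absorb it.\<close>

lemma minimal_reach:
  assumes m: "minimal c f z" and C: "C1 \<in> GM f" "C2 \<in> GM f" "C1 ~= C2"
  shows "c - snd (z C2) < c + snd (z C1)"
proof (rule ccontr)
  assume "\<not> ?thesis"
  then have le: "c + snd (z C1) <= c - snd (z C2)" by simp
  have sol: "solution c f z" using m by (simp add: minimal_def)
  have "spider_dist (z C2) (pt u) <= c" if u: "u \<in> cls f C1" for u
  proof (rule region_dist)
    show "u \<in> Us" using u by (simp add: cls_def)
    obtain w where w: "w \<in> cls f C2" using GM_other_leg[OF C(2)] by metis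
    note z2 = real_centre_region(3,4)[OF sol C(2) w] and z1 = real_centre_region[OF sol C(1) u]
    then show "snd (z C2) <= c" by simp
    have "snd (pt u) <= c - snd (z C2)" using z1 le by (cases "fst u = fst (z C1)") auto
    then show "snd (pt u) <= c - snd (z C2)" "snd (pt u) <= c + snd (z C2)" using z2 by auto
  qed
  then show False by (rule minimal_no_absorb[OF m C])
qed

text \<open>A stray is a mixed user on the leg of the center of \<open>C\<close>, beyond the off-leg
  reach of that ball, which belongs to another cluster. The dynamic program assigns mixed users
  beyond the threshold of a leg to the cluster centered there, so strays have to be removed.\<close>

definition stray :: "real => (nat \<times> nat => nat) => (nat => point) => ((nat \<times> nat) \<times> nat) set" where
  "stray c f z = {(u, C). u \<in> MU f \<and> C \<in> GM f \<and> fst u = fst (z C) \<and>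
    c - snd (z C) < X (fst u) (snd u) \<and> f u ~= C}"

lemma finite_stray [simp]: "finite (stray c f z)"
  by (rule finite_subset[of _ "MU f \<times> GM f"]) (auto simp: stray_def)

text \<open>Swap \<open>u\<close> with a user \<open>v\<close> of \<open>C\<close> from another leg.
  By \<open>minimal_reach\<close> the ball of \<open>C\<close> contains \<open>u\<close>; and
  \<open>v\<close> is nearer to the center than \<open>u\<close>, hence in the other ball. By
  minimality the mixed labels and mixed users remain the same, so the new solution is minimal
  again.\<close>

lemma stray_reduce:
  assumes m: "minimal c f z" and ne: "(u, C) \<in> stray c f z"
  shows "\<exists>f'. minimal c f' z \<and> card (stray c f' z) < card (stray c f z)"
proof -
  have sol: "solution c f z" using m by (simp add: minimal_def)
  have u: "u \<in> MU f" "C \<in> GM f" "fst u = fst (z C)" "c - snd (z C) < X (fst u) (snd u)" "f u ~= C"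
    using ne by (auto simp: stray_def)
  define E where "E = f u"
  have uE: "u \<in> cls f E" "E \<in> GM f" "C ~= E" "u \<in> Us" using u by (auto simp: E_def MU_def cls_def)
  obtain v where v: "v \<in> cls f C" "fst v ~= fst (z C)" using GM_other_leg[OF u(2)] .
  have vU: "v \<in> Us" "f v = C" "v ~= u" using v u by (auto simp: cls_def)
  have legE: "fst (z E) ~= fst (z C)" using minimal_distinct[OF m uE(2) u(2)] uE(3) by metis
  note rE = real_centre_region[OF sol uE(2)] and rC = real_centre_region[OF sol u(2)]
  have Xu: "snd (pt u) <= c - snd (z E)" using rE(2)[OF uE(1)] legE u(3) by metis
  have reach: "c - snd (z E) < c + snd (z C)" by (rule minimal_reach[OF m u(2) uE(2,3)])
  have dC: "spider_dist (z C) (pt u) <= c"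
    using Xu reach u(3) rC(4)[OF v(1)] by (intro region_dist[OF uE(4)]) auto
  have Xv: "snd (pt v) <= c - snd (z E)"
    using rC(2)[OF v(1) v(2)] u(4) Xu by (simp add: pt_def)
  have dE: "spider_dist (z E) (pt v) <= c"
    using Xv rE(3,4)[OF uE(1)] by (intro region_dist[OF vU(1)]) auto
  define f' where "f' = f(u := C, v := E)"
  have f'u: "f' u = C" "f' v = E" "\<And>w. w ~= u ==> w ~= v ==> f' w = f w"
    using vU(3) by (auto simp: f'_def)
  have clC: "cls f' C = insert u (cls f C - {v})" and clE: "cls f' E = insert v (cls f E - {u})"
    and clo: "\<And>g. g ~= C ==> g ~= E ==> cls f' g = cls f g"
    using uE vU by (auto simp: cls_def f'_def E_def)
  have sizes: "card (cls f' g) = card (cls f g)" for g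
  proof -
    have "u \<notin> cls f C" "v \<notin> cls f E" using uE vU by (auto simp: cls_def E_def)
    then have "card (cls f' C) = card (cls f C)" "card (cls f' E) = card (cls f E)"
      unfolding clC clE using card.remove[OF _ v(1)] card.remove[OF _ uE(1)]
      by (simp_all add: card_insert_if)
    then show ?thesis using clo by metis
  qed
  have sol': "solution c f' z" unfolding solution_def
  proof (intro ballI)
    fix w assume w: "w \<in> Us"
    have "\<exists>y. y \<in> cls f (f' w)" using sizes[of "f' w"] w
      by (metis (mono_tags, lifting) card_gt_0_iff cls_def ex_in_conv finite_cls mem_Collect_eq)
    then obtain y where y: "y \<in> cls f (f' w)" by blast
    have "spider_dist (z (f' w)) (pt w) <= c"
    proof -
      consider "w = u" | "w = v" | "w ~= u" "w ~= v" by blast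
      then show ?thesis
        by cases (use dC dE f'u solutionD(3)[OF sol, of w "f w"] w in \<open>simp_all add: cls_def\<close>)
    qed
    then show "r <= card (cls f' (f' w)) \<and> cen (z (f' w)) \<and> spider_dist (z (f' w)) (pt w) <= c"
      using solutionD(1,2)[OF sol y] sizes by simp
  qed
  have GMs: "GM f' \<subseteq> GM f"
  proof
    fix g assume g: "g \<in> GM f'"
    consider "g = C" | "g = E" | "g ~= C" "g ~= E" by blast
    then show "g \<in> GM f"
    proof cases
      case 3
      show ?thesis using g clo[OF 3] by (simp only: GM_def mem_Collect_eq)
    qed (use u uE in simp_all)
  qed
  have MUs: "MU f' \<subseteq> MU f"
  proof
    fix w assume w: "w \<in> MU f'"
    consider "w = u" | "w = v" | "w ~= u" "w ~= v" by blast
    then show "w \<in> MU f"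
    proof cases
      case 3
      then show ?thesis using w f'u(3)[of w] GMs by (auto simp: MU_def)
    qed (use u vU in \<open>simp_all add: MU_def\<close>)
  qed
  have eq: "GM f' = GM f" "MU f' = MU f" using not_minimalI[OF m sol' GMs MUs] by blast+
  have re: "realc f' z = realc f z" by (simp add: realc_def eq)
  have min': "minimal c f' z"
    using m sol' unfolding minimal_def smaller_def weight_def eq re by blast
  have sub: "stray c f' z \<subseteq> stray c f z - {(u, C)}"
  proof (rule subrelI)
    fix w Q assume "(w, Q) \<in> stray c f' z"
    then have w: "w \<in> MU f" "Q \<in> GM f" "fst w = fst (z Q)" "c - snd (z Q) < X (fst w) (snd w)" "f' w ~= Q"
      unfolding stray_def eq mem_Collect_eq prod.case by blast+
    have wu: "w ~= u"
    proof
      assume [simp]: "w = u"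
      have "fst (z Q) = fst (z C)" using w u by simp
      then have "Q = C" using minimal_distinct[OF m w(2) u(2)] by blast
      then show False using w(5) f'u by simp
    qed
    have "f w ~= Q"
    proof (cases "w = v")
      case True
      then have "Q ~= C" using w(3) v(2) by metis
      then show ?thesis using True vU by simp
    qed (use wu w f'u in simp)
    then show "(w, Q) \<in> stray c f z - {(u, C)}" using w wu by (simp add: stray_def)
  qed
  then have "stray c f' z \<subset> stray c f z" using ne by blast
  then show ?thesis using min' psubset_card_mono[OF finite_stray] by blast
qed

lemma minimal_no_stray:
  assumes "solution c f z"
  obtains f z where "minimal c f z" "stray c f z = {}"
proof -
  obtain f0 z0 where "minimal c f0 z0" using minimal_exists[OF assms] .
  then obtain p where p: "minimal c (fst p) (snd p)"
    and least: "\<And>q. minimal c (fst q) (snd q) ==> card (stray c (fst p) (snd p)) <= card (stray c (fst q) (snd q))"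
    using ex_has_least_nat[of "\<lambda>p. minimal c (fst p) (snd p)" "(f0, z0)" "\<lambda>p. card (stray c (fst p) (snd p))"]
    by auto
  have "stray c (fst p) (snd p) = {}"
  proof (rule ccontr)
    assume "stray c (fst p) (snd p) ~= {}"
    then obtain u C where "(u, C) \<in> stray c (fst p) (snd p)" by (metis ex_in_conv surj_pair)
    from stray_reduce[OF p this] obtain f' where f': "minimal c f' (snd p)"
      "card (stray c f' (snd p)) < card (stray c (fst p) (snd p))" by blast
    with least[of "(f', snd p)"] show False by simp
  qed
  with p show ?thesis by (rule that)
qed

section \<open>Clusters within one leg\<close>

definition seg :: "nat => nat => nat => real" where
  "seg l j i = (X l (i - 1) - X l j) / 2 + \<delta> (l, (X l j + X l (i - 1)) / 2)"

text \<open>In a tree, the larger of the distances from \<open>z\<close> to the ends of a path is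
  half its length plus the distance from \<open>z\<close> to its midpoint, and \<open>cen\<close>
  bounds the latter from below by \<delta>. So \<open>seg l j i\<close> bounds the radius of every
  ball that covers users \<open>j\<close> to \<open>i - 1\<close>.\<close>

lemma seg_le:
  assumes "cen z" "spider_dist z (l, X l j) <= c" "spider_dist z (l, X l (i - 1)) <= c" "j < i" "i <= cnt l"
  shows "seg l j i <= c"
proof -
  have l: "l < d" using assms cnt_virtual[of l] by (cases "l < d") auto
  have x: "0 <= X l j" "X l j <= X l (i - 1)" using assms X_nonneg[of j l] X_mono[of j "i - 1" l] by auto
  then have "\<delta> (l, (X l j + X l (i - 1)) / 2) <= spider_dist z (l, (X l j + X l (i - 1)) / 2)"
    using assms(1) l unfolding cen_def by simp
  moreover have "(X l (i - 1) - X l j) / 2 + spider_dist z (l, (X l j + X l (i - 1)) / 2) <= c"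
    using assms(2,3) x by (auto simp: spider_dist_def field_simps split: if_splits)
  ultimately show ?thesis unfolding seg_def by linarith
qed

definition line_sol :: "real => nat => nat => (nat => nat) => (nat => point) => bool" where
  "line_sol c l j g z \<longleftrightarrow> (\<forall>u\<in>{j..<cnt l}. r <= card {v \<in> {j..<cnt l}. g v = g u} \<and> cen (z (g u)) \<and>
    spider_dist (z (g u)) (l, X l u) <= c)"

text \<open>Take the cluster whose last user \<open>M\<close> comes earliest and give it the first
  users instead, as many as it has. Every other cluster has a user beyond \<open>M\<close>, so by
  convexity its ball covers all that it receives between its own users. The ball that covers user
  \<open>j\<close> reaches at least to \<open>M\<close> and so covers the new segment, whence the
  bound on \<open>seg\<close>.\<close>

lemma line_split:
  assumes sol: "line_sol c l j g z" and j: "j < cnt l"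
  shows "\<exists>i g'. j + r <= i \<and> i <= cnt l \<and> seg l j i <= c \<and> line_sol c l i g' z"
proof -
  let ?S = "{j..<cnt l}"
  define K where "K q = {v \<in> ?S. g v = q}" for q
  have finK: "finite (K q)" for q by (simp add: K_def)
  have memK: "u \<in> K (g u)" if "u \<in> ?S" for u using that by (simp add: K_def)
  have MaxK: "Max (K (g u)) \<in> K (g u)" if "u \<in> ?S" for u using Max_in[OF finK] memK[OF that] by blast
  have "finite (g ` ?S)" "g ` ?S ~= {}" using j by auto
  then obtain D where D: "D \<in> g ` ?S" "\<And>q. q \<in> g ` ?S ==> Max (K D) <= Max (K q)"
    using ex_min_if_finite[of "(\<lambda>q. Max (K q)) ` (g ` ?S)"] by (metis (no_types, lifting) arg_min_least arg_min_if_finite(1))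
  obtain w where w: "w \<in> ?S" "g w = D" using D(1) by blast
  define M where "M = Max (K D)"
  have M: "M \<in> K D" using MaxK[OF w(1)] w(2) by (simp add: M_def)
  then have MS: "j <= M" "M < cnt l" by (auto simp: K_def)
  have leM: "u <= M" if "u \<in> K D" for u using Max_ge[OF finK that] by (simp add: M_def)
  define n where "n = card (K D)"
  define i where "i = j + n"
  have "K D \<subseteq> {j..M}" using leM by (auto simp: K_def)
  then have nM: "n <= Suc M - j" unfolding n_def using card_mono[of "{j..M}" "K D"] by simp
  have nr: "r <= n" using sol w unfolding line_sol_def n_def K_def by auto
  have i: "j + r <= i" "i <= Suc M" "i <= cnt l" using nM nr MS by (auto simp: i_def)
  have ji: "j < i" using i r1 by simp
  define A where "A = {j..<i}"
  have "card (K D - A) = card (A - K D)"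
  proof -
    have "card A = card (K D)" by (simp add: A_def i_def n_def)
    moreover have "card A = card (A \<inter> K D) + card (A - K D)"
      using card_Un_disjoint[of "A \<inter> K D" "A - K D"] by (simp add: A_def Int_Diff_Un Int_Diff_disjoint)
    moreover have "card (K D) = card (K D \<inter> A) + card (K D - A)"
      using card_Un_disjoint[of "K D \<inter> A" "K D - A"] finK by (simp add: Int_Diff_Un Int_Diff_disjoint)
    ultimately show ?thesis by (simp add: Int_commute)
  qed
  \<comment> \<open>Members of the chosen cluster outside the new segment trade places with foreign
    users inside it. The two sets have equal size because the segment has the size of the
    cluster.\<close>
  then obtain h where h: "bij_betw h (K D - A) (A - K D)"
    using finite_same_card_bij[of "K D - A" "A - K D"] finK by (auto simp: A_def)
  define g' where "g' u = (if u \<in> K D - A then g (h u) else g u)" for u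
  have hin: "h u \<in> A" "h u \<notin> K D" "h u \<in> ?S" if "u \<in> K D - A" for u
  proof -
    have "h u \<in> A - K D" using bij_betwE[OF h] that by blast
    then show "h u \<in> A" "h u \<notin> K D" "h u \<in> ?S" using i by (auto simp: A_def)
  qed
  have notA: "u \<notin> A" "u \<in> ?S" if "u \<in> {i..<cnt l}" for u using that i ji by (auto simp: A_def)
  have g'D: "g' u ~= D" if u: "u \<in> {i..<cnt l}" for u
  proof (cases "u \<in> K D - A")
    case True
    then show ?thesis using hin[OF True] by (auto simp: g'_def K_def)
  next
    case False
    then show ?thesis using notA[OF u] by (auto simp: g'_def K_def)
  qed
  have card': "card {v \<in> {i..<cnt l}. g' v = q} = card (K q)" if q: "q ~= D" for q
  proof -
    have e1: "{v \<in> {i..<cnt l}. g' v = q} = (K q - A) \<union> {v \<in> K D - A. g (h v) = q}"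
      using q i ji by (auto simp: g'_def K_def A_def)
    have e2: "h ` {v \<in> K D - A. g (h v) = q} = K q \<inter> A"
    proof
      show "h ` {v \<in> K D - A. g (h v) = q} \<subseteq> K q \<inter> A" using hin by (auto simp: K_def)
      show "K q \<inter> A \<subseteq> h ` {v \<in> K D - A. g (h v) = q}"
      proof
        fix x assume x: "x \<in> K q \<inter> A"
        then have "x \<in> A - K D" using q by (auto simp: K_def)
        then obtain v where "v \<in> K D - A" "h v = x" using h by (metis bij_betw_imp_surj_on imageE)
        then show "x \<in> h ` {v \<in> K D - A. g (h v) = q}" using x by (auto simp: K_def)
      qed
    qed
    have "inj_on h {v \<in> K D - A. g (h v) = q}"
      using bij_betw_imp_inj_on[OF h] by (rule inj_on_subset) auto
    then have "card {v \<in> K D - A. g (h v) = q} = card (K q \<inter> A)" using e2 card_image by fastforce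
    moreover have "(K q - A) \<inter> {v \<in> K D - A. g (h v) = q} = {}" using q by (auto simp: K_def)
    moreover have "card (K q) = card (K q \<inter> A) + card (K q - A)"
      using card_Un_disjoint[of "K q \<inter> A" "K q - A"] finK by (simp add: Int_Diff_Un Int_Diff_disjoint)
    ultimately show ?thesis unfolding e1 using finK by (subst card_Un_disjoint) auto
  qed
  have cenS: "cen (z (g u))" "r <= card (K (g u))" "spider_dist (z (g u)) (l, X l u) <= c" if "u \<in> ?S" for u
    using sol that unfolding line_sol_def K_def by auto
  have dist: "spider_dist (z (g u)) (l, X l x) <= c" if u: "u \<in> ?S" "u <= x" "x <= M" for u x
  proof -
    let ?m = "Max (K (g u))"
    have m: "?m \<in> K (g u)" by (rule MaxK[OF u(1)])
    have "M <= ?m" unfolding M_def by (rule D(2)) (use u in blast)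
    moreover have "?m \<in> ?S" "g ?m = g u" using m by (auto simp: K_def)
    ultimately show ?thesis
      using u cenS(3)[OF u(1)] cenS(3)[of ?m] spider_dist_between[of "z (g u)" l "X l u" c "X l ?m" "X l x"]
        X_mono[of u x l] X_mono[of x ?m l] by auto
  qed
  have "seg l j i <= c"
    using dist[of j j] dist[of j "i - 1"] j ji i MS cenS(1)[of j] by (intro seg_le[of "z (g j)"]) auto
  moreover have "line_sol c l i g' z" unfolding line_sol_def
  proof (intro ballI)
    fix u assume u: "u \<in> {i..<cnt l}"
    have c: "card {v \<in> {i..<cnt l}. g' v = g' u} = card (K (g' u))" by (rule card'[OF g'D[OF u]])
    show "r <= card {v \<in> {i..<cnt l}. g' v = g' u} \<and> cen (z (g' u)) \<and> spider_dist (z (g' u)) (l, X l u) <= c"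
    proof (cases "u \<in> K D - A")
      case True
      then have "h u <= u" "u <= M" using hin[OF True] u leM by (auto simp: A_def)
      then show ?thesis using True hin[OF True] cenS[of "h u"] dist[of "h u" u] c by (simp add: g'_def)
    next
      case False
      then have "g' u = g u" unfolding g'_def by (rule if_not_P)
      then show ?thesis using cenS[OF notA(2)[OF u]] c by simp
    qed
  qed
  ultimately show ?thesis using i by blast
qed

text \<open>By repeated use of \<open>line_split\<close>, any clustering of the rest of a leg can be
  taken apart into consecutive segments, and the inequalities for \<open>G\<close> are added one
  segment at a time.\<close>

lemma line_upper:
  assumes G: "G (cnt l) <= 0" "\<And>j i. j < cnt l ==> j + r <= i ==> i <= cnt l ==> G j <= max (G i) (seg l j i)"
    and c: "(0::real) <= c"
  shows "line_sol c l j g z ==> j <= cnt l ==> G j <= c"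
proof (induction "cnt l - j" arbitrary: j g rule: less_induct)
  case less
  show ?case
  proof (cases "j = cnt l")
    case True then show ?thesis using G(1) c by simp
  next
    case False
    then have j: "j < cnt l" using less.prems by simp
    obtain i g' where i: "j + r <= i" "i <= cnt l" "seg l j i <= c" "line_sol c l i g' z"
      using line_split[OF less.prems(1) j] by blast
    have "G i <= c" using less.hyps[of i g'] i j r1 by auto
    then show ?thesis using G(2)[OF j i(1,2)] i(3) by linarith
  qed
qed
end

section \<open>The dynamic program at the center\<close>

definition cn :: "(nat => nat) => nat => nat => nat" where
  "cn own t l = card {s. s < t \<and> own s = l}"

lemma cn_0 [simp]: "cn own 0 l = 0" by (simp add: cn_def)

lemma cn_Suc: "cn own (Suc t) l = cn own t l + (if own t = l then 1 else 0)"
proof -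
  have "{s. s < Suc t \<and> own s = l} = {s. s < t \<and> own s = l} \<union> (if own t = l then {t} else {})"
    by (auto simp: less_Suc_eq)
  then show ?thesis by (auto simp: cn_def card_insert_if)
qed

lemma cn_mono: "s <= t ==> cn own s l <= cn own t l"
  unfolding cn_def by (rule card_mono) auto

text \<open>The choice \<open>e = 0\<close> for a leg means that no mixed cluster is centered on it; \<open>e \<ge> 1\<close> means that there is one,
  which takes \<open>e - 1\<close> users of its own leg beyond the threshold and needs \<open>r + 1 - e\<close> users before the threshold.\<close>

definition need :: "nat => nat => nat" where
  "need r e = (if e = 0 then 0 else r + 1 - e)"

section \<open>Sets of legs as binary numbers\<close>

lemma bit_add_pow:
  fixes S :: nat
  assumes "\<not> bit S l"
  shows "bit (S + 2 ^ l) k \<longleftrightarrow> bit S k \<or> k = l"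
proof -
  have "S + 2 ^ l = set_bit l S" using assms by (simp add: set_bit_eq)
  then show ?thesis by (auto simp: bit_set_bit_iff)
qed

lemma add_pow_less:
  fixes S :: nat
  assumes "S < 2 ^ n" "\<not> bit S l" "l < n"
  shows "S + 2 ^ l < 2 ^ n"
proof -
  have high: "\<not> bit (S + 2 ^ l) k" if "n <= k" for k
  proof -
    have "S < 2 ^ k" using assms(1) that by (meson less_le_trans one_le_numeral power_increasing)
    then have "\<not> bit S k" by (simp add: bit_iff_odd)
    then show ?thesis using bit_add_pow[OF assms(2)] assms(3) that by auto
  qed
  have "take_bit n (S + 2 ^ l) = S + 2 ^ l"
  proof (rule bit_eqI)
    fix k
    show "bit (take_bit n (S + 2 ^ l)) k \<longleftrightarrow> bit (S + 2 ^ l) k"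
      using high[of k] by (cases "k < n") (simp_all add: bit_take_bit_iff)
  qed
  then show ?thesis by (metis take_bit_nat_less_exp)
qed

lemma all_bits:
  fixes S :: nat
  assumes "S < 2 ^ n" "\<And>l. l < n ==> bit S l"
  shows "S = 2 ^ n - 1"
proof -
  have "S = mask n"
  proof (rule bit_eqI)
    fix k
    show "bit S k \<longleftrightarrow> bit (mask n :: nat) k"
    proof (cases "k < n")
      case False
      then have "S < 2 ^ k" using assms(1) by (meson less_le_trans one_le_numeral power_increasing not_less)
      then have "\<not> bit S k" by (simp add: bit_iff_odd)
      then show ?thesis using False by (simp add: bit_mask_iff)
    qed (use assms in \<open>auto simp: bit_mask_iff\<close>)
  qed
  then show ?thesis by (simp add: mask_eq_exp_minus_1)
qed

text \<open>\<open>own\<close> lists the legs of the at most \<open>K\<close> innermost users of every leg in the order of their distances \<open>B\<close>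
  from the center, so that \<open>cn own t l\<close> users of leg \<open>l\<close> are among the first \<open>t\<close>.\<close>

locale spider_merge = spider_users +
  fixes K T :: nat and own :: "nat => nat" and B :: "nat => real"
  assumes K: "K = 2 * r * (d + 1)"
    and own: "t < T ==> own t < d"
    and B0: "B 0 = 0"
    and BS: "t < T ==> B (Suc t) = X (own t) (cn own t (own t))"
    and cnT: "cn own T l = min (cnt l) K"
    and Bnext: "t <= T ==> cn own t l < min (cnt l) K ==> B t <= X l (cn own t l)"
begin

abbreviation lim :: "nat => nat" where "lim l \<equiv> min (cnt l) K"
abbreviation cm :: "nat => nat => nat" where "cm \<equiv> cn own"

lemma cm_le: "t <= T ==> cm t l <= lim l"
  using cn_mono[of t T own l] cnT by simp

lemma cm_own: "t < T ==> cm t (own t) < lim (own t)"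
  using cn_mono[of "Suc t" T own "own t"] cnT[of "own t"] by (simp add: cn_Suc)

lemma B_mono: "t < T ==> B t <= B (Suc t)"
  using Bnext[of t "own t"] BS[of t] cm_own[of t] by simp

lemma B_mono': "s <= t ==> t <= T ==> B s <= B t"
proof (induction t rule: dec_induct)
  case (step n)
  then show ?case using B_mono[of n] by auto
qed simp

lemma B_nonneg: "t <= T ==> 0 <= B t" using B_mono'[of 0 t] B0 by simp

lemma B_pass: "t <= T ==> i < cm t l ==> X l i <= B t"
proof (induction t)
  case (Suc t)
  show ?case
  proof (cases "i < cm t l")
    case True
    then show ?thesis using Suc B_mono[of t] by auto
  next
    case False
    then have "own t = l" "i = cm t l" using Suc.prems by (auto simp: cn_Suc split: if_splits)
    then show ?thesis using BS[of t] Suc.prems by simp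
  qed
qed simp

text \<open>The largest \<open>t\<close> with \<open>B t <= b\<close>. By maximality, users tied at
  distance \<open>b\<close> are all before the threshold, on every leg at once.\<close>

lemma threshold:
  assumes "0 <= b"
  obtains t where "t <= T" "B t <= b" "\<And>l i. i < lim l ==> i < cm t l \<longleftrightarrow> X l i <= b"
proof -
  have fin: "finite {t. t <= T \<and> B t <= b}" by simp
  define t where "t = Max {t. t <= T \<and> B t <= b}"
  have "0 \<in> {t. t <= T \<and> B t <= b}" using assms B0 by simp
  then have t: "t <= T" "B t <= b" using Max_in[OF fin] unfolding t_def by blast+
  have max: "b < B (Suc t)" if "t < T"
  proof (rule ccontr)
    assume "\<not> b < B (Suc t)"
    then have "Suc t <= t" using that Max_ge[OF fin, of "Suc t"] unfolding t_def[symmetric] by auto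
    then show False by simp
  qed
  have "i < cm t l \<longleftrightarrow> X l i <= b" if i: "i < lim l" for l i
  proof
    assume "i < cm t l"
    then show "X l i <= b" using B_pass[OF t(1)] t(2) by force
  next
    assume le: "X l i <= b"
    show "i < cm t l"
    proof (rule ccontr)
      assume "\<not> i < cm t l"
      then have c: "cm t l <= i" "cm t l < lim l" using i by auto
      then have "t ~= T" using cnT[of l] by auto
      then have tT: "t < T" using t by simp
      have "B (Suc t) <= X l (cm t l)"
      proof (cases "own t = l")
        case True then show ?thesis using BS[OF tT] by simp
      next
        case False
        then show ?thesis using Bnext[of "Suc t" l] tT c by (simp add: cn_Suc)
      qed
      also have "\<dots> <= X l i" using c i by (intro X_mono) auto
      finally show False using max[OF tT] le by simp
    qed
  qed
  with t show ?thesis by (rule that)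
qed

text \<open>How far the ball must extend on the leg of its center: to the last of the
  \<open>e - 1\<close> own users beyond the threshold, at position \<open>cm t l + e - 2\<close>, or
  only to \<open>B t\<close> if there are none.\<close>

definition reach :: "nat => nat => nat => real" where
  "reach t l e = (if e <= 1 then B t else X l (cm t l + e - 2))"

text \<open>A ball reaching to a on leg l and to b on the other legs has its ideal center at (l, (a
  - b)/2) and radius (a + b)/2; \<delta> is the price of moving the center to an admissible point.
  The term with \<open>G\<close> is the cost of the users farther out on the leg.\<close>

definition wcost :: "(nat => nat => real) => nat => nat => nat => real" where
  "wcost G t l e = (if e = 0 then G l (cm t l) else
    max (G l (cm t l + e - 1)) ((reach t l e + B t) / 2 + \<delta> (l, (reach t l e - B t) / 2)))"

abbreviation Dmax :: nat where "Dmax \<equiv> r * (d + 1)"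

text \<open>By the last conjunct, a leg without a center is not the first to be treated unless
  \<open>t = 0\<close>. So whenever a user of a treated leg is passed, some open cluster can absorb
  it. \<open>Dmax\<close> suffices because each of the \<open>d + 1\<close> legs adds at most r to
  the debt.\<close>

definition can_open :: "nat => nat => nat => nat => nat => bool" where
  "can_open t S D l e \<longleftrightarrow> l <= d \<and> \<not> bit S l \<and> e <= lim l - cm t l + 1 \<and> D + need r e <= Dmax \<and>
    \<not> (e = 0 \<and> S = 0 \<and> 0 < t)"

text \<open>With no place owed the truncated difference stays 0: the user then joins a cluster that
  already has enough.\<close>

definition pay :: "nat => nat => nat => nat" where
  "pay t S D = (if bit S (own (t - 1)) then D - 1 else D)"

text \<open>\<open>V t S D\<close> is the cost of serving the first \<open>t\<close> users of the merged list and all legs outside the bit set \<open>S\<close>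
  when the clusters of the legs in \<open>S\<close> still need \<open>D\<close> users; a user of a leg outside \<open>S\<close> is accounted for
  when the threshold of its leg is chosen.\<close>

definition dp_upper :: "(nat => nat => real) => (nat => nat => nat => real) => bool" where
  "dp_upper G V \<longleftrightarrow> (\<forall>t S D. t <= T --> S < 2 ^ (d + 1) --> D <= Dmax -->
    (t = 0 \<and> S = 2 ^ (d + 1) - 1 \<and> D = 0 --> V t S D <= 0) \<and>
    (0 < t --> V t S D <= V (t - 1) S (pay t S D)) \<and>
    (\<forall>l e. can_open t S D l e --> V t S D <= max (wcost G t l e) (V t (S + 2 ^ l) (D + need r e))))"

text \<open>A minimal solution without strays is followed through the table: leg \<open>l\<close> is
  treated at its threshold \<open>\<tau> l\<close> with choice \<open>e l\<close>. Only numbers of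
  users matter on the way, and the debts can always be paid because the needs of all clusters with
  thresholds at most \<open>t\<close> are met by distinct users among the first
  \<open>t\<close>.\<close>

theorem dp_complete:
  assumes "solution c f0 z0" and c: "0 <= c"
    and G0: "\<And>l. l <= d ==> G l (cnt l) <= 0"
    and G1: "\<And>l j i. l <= d ==> j < cnt l ==> j + r <= i ==> i <= cnt l ==> G l j <= max (G l i) (seg l j i)"
    and V: "dp_upper G V"
  shows "V T 0 0 <= c"
proof -
  obtain f z where m: "minimal c f z" and ns: "stray c f z = {}" using minimal_no_stray[OF assms(1)] .
  have sol: "solution c f z" using m by (simp add: minimal_def)
  have noStray: "f u = C" if "u \<in> MU f" "C \<in> GM f" "fst u = fst (z C)" "c - snd (z C) < X (fst u) (snd u)" for u C
    using ns that unfolding stray_def by blast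
  \<comment> \<open>By \<open>minimal_prefix\<close> the mixed users of leg \<open>l\<close> are
    exactly its first \<open>k l\<close> users.\<close>
  define k where "k l = card {i. (l, i) \<in> MU f}" for l
  have kiff: "i < k l \<longleftrightarrow> (l, i) \<in> MU f" for l i
  proof -
    have fin: "finite {i. (l, i) \<in> MU f}"
      by (rule finite_subset[of _ "snd ` MU f"]) (auto intro: rev_image_eqI)
    have dc: "j \<in> {i. (l, i) \<in> MU f}" if "i \<in> {i. (l, i) \<in> MU f}" "j < i" for i j
      using minimal_prefix[OF m, of "(l, j)" "(l, i)"] that by (auto simp: MU_def Us_def)
    have "{i. (l, i) \<in> MU f} = {..<k l}"
      unfolding k_def
    proof (rule card_subset_eq[symmetric])
      show "{..<card {i. (l, i) \<in> MU f}} \<subseteq> {i. (l, i) \<in> MU f}"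
      proof (rule subsetI, rule ccontr)
        fix x assume x: "x \<in> {..<card {i. (l, i) \<in> MU f}}" "x \<notin> {i. (l, i) \<in> MU f}"
        have "{i. (l, i) \<in> MU f} \<subseteq> {..<x}"
        proof
          fix i assume i: "i \<in> {i. (l, i) \<in> MU f}"
          then show "i \<in> {..<x}" using dc[OF i, of x] x(2) by (cases "x < i"; cases "x = i") auto
        qed
        then have "card {i. (l, i) \<in> MU f} <= x" using card_mono[of "{..<x}"] by fastforce
        then show False using x(1) by simp
      qed
    qed (use fin in simp_all)
    then show ?thesis by blast
  qed
  have MU_D: "i < cnt l" "l < d" "f (l, i) \<in> GM f" "(l, i) \<in> cls f (f (l, i))" if "i < k l" for l i
    using that Us_leg[of "(l, i)"] unfolding kiff by (auto simp: MU_def Us_def cls_def)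
  have k_cnt: "k l <= cnt l" for l
    using MU_D(1)[of "k l - 1" l] by (cases "k l") auto
  have kd: "k d = 0" using k_cnt[of d] cnt_virtual[of d] by simp
  obtain h where h: "inj_on (\<lambda>C. fst (z C)) (GM f)" "h = the_inv_into (GM f) (\<lambda>C. fst (z C))"
    using minimal_distinct[OF m] by (auto simp: inj_on_def)
  have legC: "fst (z C) <= d" "0 <= c - snd (z C)" "0 <= snd (z C)" if C: "C \<in> GM f" for C
  proof -
    obtain w where w: "w \<in> cls f C" using GM_other_leg[OF C] by metis
    show "fst (z C) <= d" "0 <= c - snd (z C)" "0 <= snd (z C)" using real_centre_region(3-5)[OF sol C w] by auto
  qed
  have card_GM: "card (GM f) <= d + 1"
    using card_inj_on_le[OF h(1), of "{..d}"] legC(1) by auto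
  \<comment> \<open>There are at most \<open>d + 1\<close> mixed clusters, as their centers lie on
    distinct legs, and each has fewer than 2r users of leg \<open>l\<close>. This is the origin of
    \<open>K\<close>.\<close>
  have klim: "k l <= lim l" for l
  proof -
    have "{i. (l, i) \<in> MU f} = snd ` (\<Union>C\<in>GM f. {u \<in> cls f C. fst u = l})"
      by (force simp: MU_def cls_def)
    then have "k l <= card (\<Union>C\<in>GM f. {u \<in> cls f C. fst u = l})"
      unfolding k_def by (metis (no_types, lifting) card_image_le finite_GM finite_UN finite_cls finite_subset mem_Collect_eq subsetI)
    also have "\<dots> <= (\<Sum>C\<in>GM f. card {u \<in> cls f C. fst u = l})" by (rule card_UN_le) simp
    also have "\<dots> <= (\<Sum>C\<in>GM f. 2 * r)" by (rule sum_mono) (use minimal_leg_bound[OF m] in \<open>simp add: less_imp_le\<close>)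
    also have "\<dots> <= (d + 1) * (2 * r)" using card_GM by (simp only: sum_constant) (rule mult_le_mono1, simp)
    finally show ?thesis using k_cnt[of l] K by (simp add: mult.commute)
  qed
  define main where "main l \<longleftrightarrow> (\<exists>C\<in>GM f. fst (z C) = l)" for l
  define gc where "gc l = (THE C. C \<in> GM f \<and> fst (z C) = l)" for l
  have gc_eq: "gc (fst (z C)) = C" if "C \<in> GM f" for C
    unfolding gc_def using that h(1) by (intro the_equality) (auto dest: inj_onD)
  have gc: "gc l \<in> GM f" "fst (z (gc l)) = l" if "main l" for l
    using that gc_eq unfolding main_def by metis+
  define bb where "bb l = c - snd (z (gc l))" for l
  define th where "th l = (SOME t. t <= T \<and> B t <= bb l \<and> (\<forall>l' i. i < lim l' --> (i < cm t l' \<longleftrightarrow> X l' i <= bb l)))" for l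
  have th: "th l <= T" "B (th l) <= bb l" "\<And>l' i. i < lim l' ==> i < cm (th l) l' \<longleftrightarrow> X l' i <= bb l" if "main l" for l
  proof -
    have "0 <= bb l" unfolding bb_def by (rule legC(2)[OF gc(1)[OF that]])
    from threshold[OF this] have "\<exists>t. t <= T \<and> B t <= bb l \<and> (\<forall>l' i. i < lim l' --> (i < cm t l' \<longleftrightarrow> X l' i <= bb l))"
      by metis
    from someI_ex[OF this] show "th l <= T" "B (th l) <= bb l" "\<And>l' i. i < lim l' ==> i < cm (th l) l' \<longleftrightarrow> X l' i <= bb l"
      unfolding th_def by blast+
  qed
  \<comment> \<open>A leg that carries a center is treated at the off-leg reach of its ball, any
    other leg at the least \<open>t\<close> that has all its mixed users before it.\<close>
  define \<tau> where "\<tau> l = (if main l then th l else (LEAST t. k l <= cm t l))" for l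
  have \<tau>main: "main l ==> \<tau> l = th l" for l by (simp add: \<tau>_def)
  have exT: "k l <= cm T l" for l using klim cnT by simp
  have \<tau>non: "k l <= cm (\<tau> l) l" "\<And>s. s < \<tau> l ==> cm s l < k l" if "\<not> main l" for l
    using LeastI[of "\<lambda>t. k l <= cm t l", OF exT] not_less_Least[of _ "\<lambda>t. k l <= cm t l"] that
    by (auto simp: \<tau>_def not_le)
  have \<tau>T: "\<tau> l <= T" for l
    using th(1)[of l] Least_le[of "\<lambda>t. k l <= cm t l", OF exT] by (auto simp: \<tau>_def)
  \<comment> \<open>On a real leg with a center, \<open>minimal_far_user\<close> gives a mixed user
    beyond the threshold, so the mixed prefix extends at least that far.\<close>
  have \<tau>k: "cm (\<tau> l) l <= k l" if "l <= d" for l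
  proof (cases "main l")
    case True
    show ?thesis
    proof (cases "l < d")
      case ld: True
      obtain u where u: "u \<in> cls f (gc l)" "fst u = l" "bb l < X (fst u) (snd u)"
        using minimal_far_user[OF m gc(1)[OF True]] gc(2)[OF True] ld unfolding bb_def by metis
      then have "snd u < k l" using gc(1)[OF True] unfolding kiff by (auto simp: MU_def cls_def)
      moreover have "\<not> snd u < cm (th l) l"
        using th(3)[OF True, of "snd u" l] u klim[of l] \<open>snd u < k l\<close> by auto
      ultimately show ?thesis using \<tau>main[OF True] by simp
    next
      case False
      then have "l = d" using that by simp
      then show ?thesis using cm_le[OF \<tau>T[of l], of l] cnt_virtual[of d] by simp
    qed
  next
    case False
    show ?thesis
    proof (cases "\<tau> l")
      case (Suc s)
      then have "cm s l < k l" using \<tau>non(2)[OF False, of s] by simp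
      then show ?thesis using Suc by (simp add: cn_Suc)
    qed simp
  qed
  define e where "e l = (if main l then k l - cm (\<tau> l) l + 1 else 0)" for l
  have near: "i < cm (\<tau> l) l'" if "main l" "(l', i) \<in> cls f (gc l)" "l' ~= l" for l l' i
  proof -
    have "X l' i <= bb l" using real_centre_region(2)[OF sol gc(1)[OF that(1)] that(2)] gc(2)[OF that(1)] that(3)
      by (simp add: pt_def bb_def)
    moreover have "(l', i) \<in> MU f" using that(2) gc(1)[OF that(1)] by (simp add: MU_def cls_def)
    then have "i < lim l'" using klim[of l'] kiff[of i l'] by simp
    ultimately show ?thesis using th(3)[OF that(1)] \<tau>main[OF that(1)] by simp
  qed
  have Gk: "G l (k l) <= c" if l: "l <= d" for l
  proof (rule line_upper[where l = l and G = "G l" and z = z and g = "\<lambda>i. f (l, i)"])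
    show "line_sol c l (k l) (\<lambda>i. f (l, i)) z" unfolding line_sol_def
    proof (intro ballI)
      fix i assume i: "i \<in> {k l..<cnt l}"
      let ?C = "f (l, i)"
      have iU: "(l, i) \<in> cls f ?C" using i by (simp add: cls_def Us_def)
      have nM: "(l, i) \<notin> MU f" using i kiff[of i l] by simp
      then have nG: "?C \<notin> GM f" using i by (simp add: MU_def Us_def)
      have "cls f ?C \<subseteq> Pair l ` {v \<in> {k l..<cnt l}. f (l, v) = ?C}"
      proof
        fix u assume u: "u \<in> cls f ?C"
        have "fst u = l" using cls_same_leg[OF nG u iU] by simp
        then obtain v where v: "u = (l, v)" by (cases u) auto
        have "(l, v) \<notin> MU f" using u v nG by (simp add: MU_def cls_def)
        then show "u \<in> Pair l ` {v \<in> {k l..<cnt l}. f (l, v) = ?C}"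
          using u v kiff[of v l] by (auto simp: cls_def Us_def)
      qed
      then have "card (cls f ?C) <= card {v \<in> {k l..<cnt l}. f (l, v) = ?C}"
        by (rule surj_card_le[rotated]) simp
      then show "r <= card {v \<in> {k l..<cnt l}. f (l, v) = ?C} \<and> cen (z ?C) \<and> spider_dist (z ?C) (l, X l i) <= c"
        using solutionD(1-3)[OF sol iU] by (auto simp: pt_def)
    qed
  qed (use G0[OF l] G1[OF l] c k_cnt in auto)
  have wc: "wcost G (\<tau> l) l (e l) <= c" if l: "l <= d" for l
  proof (cases "main l")
    case False
    then have "cm (\<tau> l) l = k l" using \<tau>k[OF l] \<tau>non(1)[OF False] by simp
    then show ?thesis using False Gk[OF l] by (simp add: wcost_def e_def)
  next
    case True
    let ?t = "\<tau> l" and ?a = "reach (\<tau> l) l (e l)" and ?z = "z (gc l)"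
    have B: "B ?t <= c - snd ?z" using th(2)[OF True] \<tau>main[OF True] by (simp add: bb_def)
    have Bn: "0 <= B ?t" by (rule B_nonneg[OF \<tau>T])
    obtain w where w: "w \<in> cls f (gc l)" using GM_other_leg[OF gc(1)[OF True]] by metis
    have a: "B ?t <= ?a \<and> ?a <= c + snd ?z \<and> (l < d \<or> ?a = B ?t)"
    proof (cases "e l <= 1")
      case True
      then have "?a = B ?t" by (simp add: reach_def)
      then show ?thesis using B legC(3)[OF gc(1)[OF \<open>main l\<close>]] by auto
    next
      case False
      then have ek: "e l = k l - cm ?t l + 1" "cm ?t l < k l" using True by (auto simp: e_def)
      then have ra: "?a = X l (k l - 1)" by (simp add: reach_def)
      have kl: "k l - 1 < k l" using ek by simp
      define C where "C = f (l, k l - 1)"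
      have C: "C \<in> GM f" "(l, k l - 1) \<in> cls f C" "l < d" using MU_D[OF kl] by (auto simp: C_def)
      have "X l (k l - 1) <= c + snd ?z"
      \<comment> \<open>The last mixed user of the leg may belong to a cluster centered on another
        leg; then \<open>minimal_reach\<close> shows that the ball centered on \<open>l\<close>
        reaches it too.\<close>
      proof (cases "C = gc l")
        case eq: True
        show ?thesis using real_centre_region(1)[OF sol C(1,2)] eq gc(2)[OF True] by (simp add: pt_def)
      next
        case neq: False
        have "fst (z C) ~= l" using minimal_distinct[OF m C(1) gc(1)[OF True] neq] gc(2)[OF True] by simp
        then have "X l (k l - 1) <= c - snd (z C)" using real_centre_region(2)[OF sol C(1,2)] by (simp add: pt_def)
        then show ?thesis using minimal_reach[OF m gc(1)[OF True] C(1)] neq by fastforce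
      qed
      moreover have "B ?t <= X l (cm ?t l)" using ek klim[of l] by (intro Bnext[OF \<tau>T]) simp
      moreover have "X l (cm ?t l) <= X l (k l - 1)" using ek k_cnt[of l] by (intro X_mono) auto
      ultimately show ?thesis using ra C by simp
    qed
    have cz: "cen ?z" by (rule solutionD(2)[OF sol w])
    have "\<delta> (l, (?a - B ?t) / 2) <= spider_dist ?z (l, (?a - B ?t) / 2)"
      using cz a unfolding cen_def by auto
    also have "\<dots> = \<bar>snd ?z - (?a - B ?t) / 2\<bar>" using gc(2)[OF True] by (simp add: spider_dist_def)
    finally have dl: "\<delta> (l, (?a - B ?t) / 2) <= \<bar>snd ?z - (?a - B ?t) / 2\<bar>" .
    \<comment> \<open>The identity behind this: (x1 + x2)/2 + |w - (x1 - x2)/2| is the larger of x1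
      - w and x2 + w.\<close>
    have "(x1 + x2) / 2 + y <= c" if "y <= \<bar>w - (x1 - x2) / 2\<bar>" "x1 <= c + w" "x2 <= c - w" for x1 x2 y w :: real
      using that by (auto simp: abs_if field_simps split: if_splits)
    from this[OF dl _ B] have "(?a + B ?t) / 2 + \<delta> (l, (?a - B ?t) / 2) <= c" using a by blast
    moreover have "G l (cm ?t l + e l - 1) <= c" using Gk[OF l] \<tau>k[OF l] True by (simp add: e_def)
    moreover have "e l ~= 0" using True by (simp add: e_def)
    ultimately show ?thesis by (simp add: wcost_def)
  qed
  \<comment> \<open>The users that can pay debts by the time \<open>t\<close>: mixed, among the
    first \<open>t\<close>, and before the threshold of their own leg.\<close>
  define A where "A t = {u \<in> MU f. snd u < cm t (fst u) \<and> snd u < cm (\<tau> (fst u)) (fst u)}" for t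
  have finA: "finite (A t)" for t by (simp add: A_def)
  define nd where "nd l = need r (e l)" for l
  \<comment> \<open>\<open>P l\<close> is the cluster centered on \<open>l\<close> without its
    members beyond the threshold on that leg. These sets are disjoint and large enough for the
    needs; they lie in \<open>A t\<close> because a member beyond the threshold of another leg with
    a center would be a stray.\<close>
  have hall: "(\<Sum>l\<in>{l. l <= d \<and> main l \<and> \<tau> l <= t}. nd l) <= card (A t)" for t
  proof -
    let ?Q = "{l. l <= d \<and> main l \<and> \<tau> l <= t}"
    define P where "P l = {u \<in> cls f (gc l). \<not> (fst u = l \<and> cm (\<tau> l) l <= snd u)}" for l
    have ndP: "nd l <= card (P l)" if "l \<in> ?Q" for l
    proof -
      have ml: "main l" "l <= d" using that by auto
      obtain w where w: "w \<in> cls f (gc l)" using GM_other_leg[OF gc(1)[OF ml(1)]] by metis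
      have "cls f (gc l) \<subseteq> P l \<union> Pair l ` {cm (\<tau> l) l..<k l}"
      proof
        fix u assume u: "u \<in> cls f (gc l)"
        have "snd u < k (fst u)" using u gc(1)[OF ml(1)] unfolding kiff by (simp add: MU_def cls_def)
        then show "u \<in> P l \<union> Pair l ` {cm (\<tau> l) l..<k l}" using u by (cases u) (auto simp: P_def)
      qed
      then have "card (cls f (gc l)) <= card (P l \<union> Pair l ` {cm (\<tau> l) l..<k l})" by (rule card_mono[rotated]) (simp add: P_def)
      also have "\<dots> <= card (P l) + card (Pair l ` {cm (\<tau> l) l..<k l})" by (rule card_Un_le)
      also have "card (Pair l ` {cm (\<tau> l) l..<k l}) <= k l - cm (\<tau> l) l" using card_image_le[of "{cm (\<tau> l) l..<k l}" "Pair l"] by simp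
      finally have "r <= card (P l) + (k l - cm (\<tau> l) l)" using solutionD(1)[OF sol w] by linarith
      then show ?thesis using ml by (simp add: nd_def need_def e_def)
    qed
    have PA: "P l \<subseteq> A t" if "l \<in> ?Q" for l
    proof
      fix u assume u: "u \<in> P l"
      have ml: "main l" "l <= d" "\<tau> l <= t" using that by auto
      obtain l' i where li: "u = (l', i)" by (cases u)
      have uC: "(l', i) \<in> cls f (gc l)" using u li by (simp add: P_def)
      have uM: "(l', i) \<in> MU f" using uC gc(1)[OF ml(1)] by (simp add: MU_def cls_def)
      have i1: "i < cm (\<tau> l) l'"
      proof (cases "l' = l")
        case True then show ?thesis using u li by (auto simp: P_def)
      next
        case False then show ?thesis by (rule near[OF ml(1) uC])
      qed
      have "i < cm (\<tau> l') l'"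
      proof (cases "main l'")
        case False
        then show ?thesis using uM \<tau>non(1)[OF False] kiff[of i l'] by simp
      next
        case main': True
        show ?thesis
        proof (rule ccontr)
          assume n: "\<not> i < cm (\<tau> l') l'"
          then have ne: "l' ~= l" using i1 by auto
          have "i < lim l'" using uM klim[of l'] kiff[of i l'] by simp
          then have "bb l' < X l' i" using n th(3)[OF main', of i l'] \<tau>main[OF main'] by simp
          then have "f (l', i) = gc l'" using noStray[OF uM gc(1)[OF main']] gc(2)[OF main'] by (simp add: bb_def)
          then have "gc l = gc l'" using uC by (simp add: cls_def)
          then show False using gc(2)[OF ml(1)] gc(2)[OF main'] ne by simp
        qed
      qed
      moreover have "i < cm t l'" using i1 cn_mono[OF ml(3), of own l'] by simp
      ultimately show "u \<in> A t" using uM li by (simp add: A_def)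
    qed
    have disj: "P l \<inter> P l' = {}" if "l \<in> ?Q" "l' \<in> ?Q" "l ~= l'" for l l'
    proof -
      have "gc l ~= gc l'" using gc(2)[of l] gc(2)[of l'] that by auto
      then show ?thesis by (auto simp: P_def cls_def)
    qed
    have finQ: "finite ?Q" by simp
    have "(\<Sum>l\<in>?Q. nd l) <= (\<Sum>l\<in>?Q. card (P l))" by (rule sum_mono) (rule ndP)
    also have "\<dots> = card (\<Union>l\<in>?Q. P l)"
      using disj by (subst card_UN_disjoint[OF finQ]) (auto simp: P_def)
    also have "\<dots> <= card (A t)" using PA by (intro card_mono finA) blast
    finally show ?thesis .
  qed
  have ndr: "nd l <= r" for l by (auto simp: nd_def need_def)
  \<comment> \<open>Along the descent, legs with thresholds above \<open>t\<close> are treated and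
    legs with thresholds below \<open>t\<close> are not; debts and the needs of clusters still to be
    opened are together covered by \<open>A t\<close>; and the debt is at most r per treated
    leg.\<close>
  have claim: "V t S D <= c"
    if "t <= T" "S < 2 ^ (d + 1)" "\<And>l. l <= d ==> t < \<tau> l ==> bit S l"
      "\<And>l. l <= d ==> bit S l ==> t <= \<tau> l"
      "D + (\<Sum>l\<in>{l. l <= d \<and> main l \<and> \<not> bit S l}. nd l) <= card (A t)"
      "D <= r * card {l. l <= d \<and> bit S l}" for t S D
    using that
  \<comment> \<open>The measure orders states by \<open>t\<close> and, for equal \<open>t\<close>,
    by decreasing \<open>S\<close>, matching the two kinds of moves in the table.\<close>
  proof (induction "t * 2 ^ (d + 1) + (2 ^ (d + 1) - S)" arbitrary: t S D rule: less_induct)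
    case less
    note p = less.prems
    have Dm: "D <= Dmax"
    proof -
      have "card {l. l <= d \<and> bit S l} <= card {..d}" by (rule card_mono) auto
      then show ?thesis using p(6) mult_le_mono2[of "card {l. l <= d \<and> bit S l}" "d + 1" r] by simp
    qed
    note up = V[unfolded dp_upper_def, rule_format, OF p(1,2) Dm]
    show ?case
    proof (cases "\<exists>l\<le>d. \<not> bit S l \<and> \<tau> l = t")
      case True
      then obtain l1 where l1: "l1 <= d" "\<not> bit S l1" "\<tau> l1 = t" by blast
      obtain l where l: "l <= d" "\<not> bit S l" "\<tau> l = t" "main l \<or> S ~= 0 \<or> t = 0"
      proof (cases "main l1 \<or> S ~= 0 \<or> t = 0")
        case True then show ?thesis using that l1 by blast
      next
        case False
        \<comment> \<open>A leg without a center may not come first. Its last mixed user belongs to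
          a cluster centered on another leg, whose threshold is at least as large and, since nothing
          is treated yet, equal to \<open>t\<close>. That leg is treated instead.\<close>
        then have nm: "\<not> main l1" and S0: "S = 0" and t0: "0 < t" by auto
        have k0: "k l1 - 1 < k l1" using \<tau>non(2)[OF nm, of 0] l1 t0 by simp
        define C where "C = f (l1, k l1 - 1)"
        have C: "C \<in> GM f" "(l1, k l1 - 1) \<in> cls f C" using MU_D[OF k0] by (auto simp: C_def)
        let ?l = "fst (z C)"
        have ml: "main ?l" using C by (auto simp: main_def)
        have ne: "l1 ~= ?l" using nm ml by metis
        have "k l1 - 1 < cm (\<tau> ?l) l1" using near[OF ml _ ne] C(2) gc_eq[OF C(1)] by simp
        then have "\<not> \<tau> ?l < \<tau> l1" using \<tau>non(2)[OF nm, of "\<tau> ?l"] k0 by auto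
        moreover have "\<not> t < \<tau> ?l" using p(3)[OF legC(1)[OF C(1)]] S0 by auto
        ultimately have "\<tau> ?l = t" using l1 by simp
        then show ?thesis using that[of ?l] legC(1)[OF C(1)] S0 ml by simp
      qed
      let ?S = "S + 2 ^ l" and ?D = "D + nd l"
      have bS: "bit ?S l' \<longleftrightarrow> bit S l' \<or> l' = l" for l' by (rule bit_add_pow[OF l(2)])
      have S': "?S < 2 ^ (d + 1)" using add_pow_less[OF p(2) l(2)] l(1) by simp
      have cb: "card {l'. l' <= d \<and> bit ?S l'} = Suc (card {l'. l' <= d \<and> bit S l'})"
      proof -
        have "{l'. l' <= d \<and> bit ?S l'} = insert l {l'. l' <= d \<and> bit S l'}" using bS l by auto
        then show ?thesis using l by simp
      qed
      have D': "?D <= r * card {l'. l' <= d \<and> bit ?S l'}" using p(6) ndr[of l] by (simp add: cb)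
      have "card {l'. l' <= d \<and> bit ?S l'} <= card {..d}" by (rule card_mono) auto
      then have Dm': "?D <= Dmax" using D' mult_le_mono2[of "card {l'. l' <= d \<and> bit ?S l'}" "d + 1" r] by simp
      have "can_open t S D l (e l)" unfolding can_open_def
        using l Dm' \<tau>k[OF l(1)] klim[of l] by (auto simp: nd_def e_def)
      then have "V t S D <= max (wcost G t l (e l)) (V t ?S ?D)" using up unfolding nd_def by blast
      moreover have "V t ?S ?D <= c"
      proof (rule less.hyps)
        show "t * 2 ^ (d + 1) + (2 ^ (d + 1) - ?S) < t * 2 ^ (d + 1) + (2 ^ (d + 1) - S)"
          using S' by (simp add: diff_less_mono2)
        show "t <= T" "?S < 2 ^ (d + 1)" by fact+
        show "bit ?S l'" if "l' <= d" "t < \<tau> l'" for l' using p(3)[OF that] bS by simp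
        show "t <= \<tau> l'" if "l' <= d" "bit ?S l'" for l' using p(4)[OF that(1)] that(2) bS l by auto
        have "{l'. l' <= d \<and> main l' \<and> \<not> bit ?S l'} = {l'. l' <= d \<and> main l' \<and> \<not> bit S l'} - {l}" using bS by auto
        moreover have "nd l + (\<Sum>l\<in>{l'. l' <= d \<and> main l' \<and> \<not> bit S l'} - {l}. nd l) = (\<Sum>l\<in>{l'. l' <= d \<and> main l' \<and> \<not> bit S l'}. nd l)"
        proof (cases "main l")
          case True
          then show ?thesis using l by (subst (2) sum.remove[of _ l]) auto
        next
          case False
          then show ?thesis by (simp add: nd_def e_def need_def)
        qed
        ultimately show "?D + (\<Sum>l\<in>{l'. l' <= d \<and> main l' \<and> \<not> bit ?S l'}. nd l) <= card (A t)"
          using p(5) by simp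
        show "?D <= r * card {l. l <= d \<and> bit ?S l}" by (rule D')
      qed
      moreover have "wcost G t l (e l) <= c" using wc[OF l(1)] l(3) by simp
      ultimately show ?thesis by linarith
    next
      case False
      then have biff: "bit S l \<longleftrightarrow> t <= \<tau> l" if "l <= d" for l
        using p(3,4)[OF that] that by (metis le_less)
      show ?thesis
      proof (cases t)
        case 0
        have "S = 2 ^ (d + 1) - 1" by (rule all_bits[OF p(2)]) (use biff 0 in auto)
        moreover have "D = 0" using p(5) 0 by (simp add: A_def)
        ultimately show ?thesis using up 0 c by force
      next
        case (Suc s)
        define l0 where "l0 = own s"
        have l0: "l0 < d" using own[of s] Suc p(1) by (simp add: l0_def)
        have cmt: "cm t l = cm s l + (if l = l0 then 1 else 0)" for l using Suc by (auto simp: cn_Suc l0_def)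
        have cA: "card (A t) = card (A s) + (if bit S l0 then 1 else 0)"
        proof (cases "bit S l0")
          case True
          then have "t <= \<tau> l0" using biff l0 by simp
          then have le: "cm t l0 <= cm (\<tau> l0) l0" by (rule cn_mono)
          then have "cm s l0 < k l0" using \<tau>k[of l0] l0 cmt[of l0] by simp
          then have "A t = insert (l0, cm s l0) (A s)"
            using le cmt kiff[of "cm s l0" l0] by (auto simp: A_def split: if_splits)
          moreover have "(l0, cm s l0) \<notin> A s" by (simp add: A_def)
          ultimately show ?thesis using True finA by simp
        next
          case False
          then have "\<tau> l0 <= s" using biff[of l0] l0 Suc by simp
          then have le: "cm (\<tau> l0) l0 <= cm s l0" by (rule cn_mono)
          have "A t = A s" using le cmt by (auto simp: A_def split: if_splits)
          then show ?thesis using False by simp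
        qed
        have Qs: "{l. l <= d \<and> main l \<and> \<not> bit S l} = {l. l <= d \<and> main l \<and> \<tau> l <= s}"
          using biff Suc by auto
        have "V s S (pay t S D) <= c"
        proof (rule less.hyps)
          show "s * 2 ^ (d + 1) + (2 ^ (d + 1) - S) < t * 2 ^ (d + 1) + (2 ^ (d + 1) - S)" using Suc by simp
          show "s <= T" "S < 2 ^ (d + 1)" using p Suc by auto
          show "bit S l" if "l <= d" "s < \<tau> l" for l using that biff Suc by simp
          show "s <= \<tau> l" if "l <= d" "bit S l" for l using that biff[OF that(1)] Suc by simp
          \<comment> \<open>If the debt is positive, both sides drop together. If it is 0, the
            truncated subtraction keeps it at 0 and \<open>hall\<close> gives the inequality
            directly.\<close>
          show "pay t S D + (\<Sum>l\<in>{l. l <= d \<and> main l \<and> \<not> bit S l}. nd l) <= card (A s)"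
            using p(5) cA hall[of s] Suc unfolding Qs by (cases D) (auto simp: pay_def l0_def split: if_splits)
          show "pay t S D <= r * card {l. l <= d \<and> bit S l}" using p(6) by (auto simp: pay_def)
        qed
        then show ?thesis using up Suc by fastforce
      qed
    qed
  qed
  show ?thesis
  proof (rule claim)
    have "{l. l <= d \<and> main l \<and> \<not> bit (0::nat) l} = {l. l <= d \<and> main l \<and> \<tau> l <= T}" using \<tau>T by auto
    then show "0 + (\<Sum>l\<in>{l. l <= d \<and> main l \<and> \<not> bit (0::nat) l}. nd l) <= card (A T)" using hall[of T] by simp
  qed (use \<tau>T not_less in auto)
qed

end

section \<open>Reading off a solution\<close>

lemma spider_dist_triangle:
  "0 <= snd p ==> 0 <= snd q ==> 0 <= snd w ==> spider_dist p w <= spider_dist p q + spider_dist q w"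
  by (auto simp: spider_dist_def split: if_splits)

lemma spider_dist_sym: "spider_dist p q = spider_dist q p"
  by (auto simp: spider_dist_def)

context spider_users begin

text \<open>\<open>ctr k z\<close> says that the center with number \<open>k\<close> may stand at
  \<open>z\<close>. The condition is the counterpart of \<open>cen\<close>: the lower bound \<delta>
  is attained at \<open>p\<close> by this center.\<close>

definition near_ok :: "(nat => point => bool) => nat => point => bool" where
  "near_ok ctr k p \<longleftrightarrow> (\<exists>z. ctr k z \<and> 0 <= snd z \<and> spider_dist z p <= \<delta> p)"

text \<open>A certificate for the users in \<open>P\<close>, where \<open>FA\<close> gives the
  center number of each label. Sizes are counted within \<open>P\<close>, so a certificate can grow
  by whole clusters.\<close>

definition sat :: "(nat => point => bool) => real => (nat \<times> nat) set => (nat \<times> nat => nat) => (nat => nat) => bool" where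
  "sat ctr v P L FA \<longleftrightarrow> (\<exists>zz. \<forall>p\<in>P. r <= card {q \<in> P. L q = L p} \<and> ctr (FA (L p)) (zz (L p)) \<and>
    0 <= snd (zz (L p)) \<and> spider_dist (zz (L p)) (pt p) <= v)"

lemma sat_add:
  assumes s: "sat ctr v P L FA" and fin: "finite P" "finite A" and A: "r <= card A"
    and L: "\<And>p. p \<in> P ==> L p ~= g \<and> L' p = L p" "\<And>p. p \<in> A ==> L' p = g"
    and FA: "\<And>k. k ~= g ==> FA' k = FA k" "ctr (FA' g) z" "0 <= snd z"
    and dist: "\<And>p. p \<in> A ==> spider_dist z (pt p) <= v"
  shows "sat ctr v (P \<union> A) L' FA'"
proof -
  obtain zz where zz: "\<And>p. p \<in> P ==> r <= card {q \<in> P. L q = L p} \<and> ctr (FA (L p)) (zz (L p)) \<and>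
    0 <= snd (zz (L p)) \<and> spider_dist (zz (L p)) (pt p) <= v"
    using s unfolding sat_def by blast
  show ?thesis unfolding sat_def
  proof (intro exI[of _ "zz(g := z)"] ballI)
    fix p assume p: "p \<in> P \<union> A"
    show "r <= card {q \<in> P \<union> A. L' q = L' p} \<and> ctr (FA' (L' p)) ((zz(g := z)) (L' p)) \<and>
      0 <= snd ((zz(g := z)) (L' p)) \<and> spider_dist ((zz(g := z)) (L' p)) (pt p) <= v"
    proof (cases "p \<in> A")
      case True
      have "card A <= card {q \<in> P \<union> A. L' q = L' p}"
        using fin L(2) True by (intro card_mono) auto
      then show ?thesis using True A L(2)[OF True] FA dist by auto
    next
      case False
      then have pP: "p \<in> P" using p by blast
      have "card {q \<in> P. L q = L p} <= card {q \<in> P \<union> A. L' q = L' p}"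
        using fin L(1) pP by (intro card_mono) auto
      then show ?thesis using zz[OF pP] L(1)[OF pP] FA(1) by auto
    qed
  qed
qed

text \<open>The triangle inequality through the midpoint; together with \<open>seg_le\<close> this
  makes \<open>seg\<close> the exact cost of a segment.\<close>

lemma seg_cover:
  assumes "near_ok ctr k (l, (X l j + X l (i - 1)) / 2)" "seg l j i <= v" "j < i" "i <= cnt l"
  shows "\<exists>z. ctr k z \<and> 0 <= snd z \<and> (\<forall>u\<in>{j..<i}. spider_dist z (l, X l u) <= v)"
proof -
  let ?m = "(l, (X l j + X l (i - 1)) / 2)"
  obtain z where z: "ctr k z" "0 <= snd z" "spider_dist z ?m <= \<delta> ?m" using assms(1) by (auto simp: near_ok_def)
  have "spider_dist z (l, X l u) <= v" if u: "u \<in> {j..<i}" for u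
  proof -
    have x: "0 <= X l j" "X l j <= X l u" "X l u <= X l (i - 1)"
      using u assms X_nonneg[of j l] X_mono[of j u l] X_mono[of u "i - 1" l] by auto
    have "spider_dist ?m (l, X l u) <= (X l (i - 1) - X l j) / 2"
      using x by (auto simp: spider_dist_def abs_if field_simps)
    moreover have "spider_dist z (l, X l u) <= spider_dist z ?m + spider_dist ?m (l, X l u)"
      using x z by (intro spider_dist_triangle) auto
    ultimately show ?thesis using z(3) assms(2) unfolding seg_def by linarith
  qed
  then show ?thesis using z by blast
qed

end

section \<open>Balls of mixed clusters and the invariant of the traceback\<close>

context spider_merge begin

lemma reach_ge: "t <= T ==> e <= lim l - cm t l + 1 ==> B t <= reach t l e"
proof (cases "e <= 1")
  case False
  assume t: "t <= T" and e: "e <= lim l - cm t l + 1"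
  then have c: "cm t l < lim l" "cm t l + e - 2 < lim l" using False by auto
  have "B t <= X l (cm t l)" by (rule Bnext[OF t c(1)])
  also have "\<dots> <= X l (cm t l + e - 2)" using c False by (intro X_mono) auto
  finally show ?thesis using False by (simp add: reach_def)
qed (simp add: reach_def)

text \<open>The triangle inequality through the ideal center. The ball contains every point within
  \<open>B t\<close> of the center on whatever leg, so users passed later may be given to this
  cluster without looking at their position.\<close>

lemma centre_cover:
  assumes t: "t <= T" and e: "1 <= e" "e <= lim l - cm t l + 1"
    and k: "near_ok ctr k (l, (reach t l e - B t) / 2)" and w: "wcost G t l e <= v"
  shows "\<exists>z. ctr k z \<and> 0 <= snd z \<and> (\<forall>i<cm t l + (e - 1). spider_dist z (l, X l i) <= v) \<and>
    (\<forall>l' x. 0 <= x \<and> x <= B t --> spider_dist z (l', x) <= v)"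
proof -
  let ?a = "reach t l e" and ?b = "B t"
  let ?m = "(l, (?a - ?b) / 2)"
  obtain z where z: "ctr k z" "0 <= snd z" "spider_dist z ?m <= \<delta> ?m" using k by (auto simp: near_ok_def)
  have ab: "0 <= ?b" "?b <= ?a" using B_nonneg[OF t] reach_ge[OF t e(2)] by auto
  have h: "(?a + ?b) / 2 + \<delta> ?m <= v" using w e by (simp add: wcost_def)
  have cov: "spider_dist z (l', x) <= v" if "0 <= x" "x <= ?b \<or> l' = l \<and> x <= ?a" for l' x
  proof -
    have "spider_dist ?m (l', x) <= (?a + ?b) / 2"
      using that ab by (auto simp: spider_dist_def abs_if field_simps)
    moreover have "spider_dist z (l', x) <= spider_dist z ?m + spider_dist ?m (l', x)"
      using that ab z by (intro spider_dist_triangle) auto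
    ultimately show ?thesis using z(3) h by linarith
  qed
  have "spider_dist z (l, X l i) <= v" if i: "i < cm t l + (e - 1)" for i
  proof (rule cov)
    have il: "i < lim l" using i e cm_le[OF t, of l] by auto
    then show "0 <= X l i" by (intro X_nonneg) simp
    show "X l i <= ?b \<or> l = l \<and> X l i <= ?a"
    proof (cases "i < cm t l")
      case True then show ?thesis using B_pass[OF t] by simp
    next
      case False
      then have "2 <= e" using i by auto
      then have "?a = X l (cm t l + e - 2)" by (simp add: reach_def)
      then show ?thesis using X_mono[of i "cm t l + e - 2" l] i e cm_le[OF t, of l] False by auto
    qed
  qed
  then show ?thesis using z cov by blast
qed

definition labelled :: "nat => nat => (nat => nat) => (nat \<times> nat) set" where
  "labelled t S KF = {(l, i). l <= d \<and> bit S l \<and> cm t l <= i \<and> i < KF l}"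

text \<open>The last conjunct counts reserved places together with users already received; it turns
  into the size condition of a cluster when no reserved place is left.\<close>

definition cinv :: "(nat => point => bool) => real => nat => nat => nat => (nat => nat) =>
    (nat => nat) => (nat => nat) => (nat \<times> nat => nat) => point => nat => bool" where
  "cinv ctr v t S D KF FA Q L z l \<longleftrightarrow>
    bit S l \<and> ctr (FA l) z \<and> 0 <= snd z \<and> (\<forall>i<KF l. spider_dist z (l, X l i) <= v) \<and>
    (\<forall>l' x. 0 <= x \<and> x <= B t --> spider_dist z (l', x) <= v) \<and>
    r <= card {p \<in> labelled t S KF. L p = l} + card {i. i < D \<and> Q i = l}"

lemma cinvD:
  assumes "cinv ctr v t S D KF FA Q L z l"
  shows "bit S l" "ctr (FA l) z" "0 <= snd z" "\<And>i. i < KF l ==> spider_dist z (l, X l i) <= v"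
    "\<And>l' x. 0 <= x ==> x <= B t ==> spider_dist z (l', x) <= v"
    "r <= card {p \<in> labelled t S KF. L p = l} + card {i. i < D \<and> Q i = l}"
  using assms unfolding cinv_def by auto

text \<open>\<open>Q\<close> lists the \<open>D\<close> places that are still to be filled in open clusters, and \<open>ab\<close> is an open cluster that
  absorbs users when no place is left. The label of a mixed cluster is the leg of its center.\<close>

definition tinv :: "(nat => point => bool) => (nat => nat => real) => real => nat => nat => nat => (nat => nat) =>
    (nat => nat) => (nat => nat) => nat => (nat \<times> nat => nat) => bool" where
  "tinv ctr G v t S D KF FA Q ab L \<longleftrightarrow> t <= T \<and> S < 2 ^ (d + 1) \<and> D <= Dmax \<and>
    (\<forall>l\<le>d. bit S l --> cm t l <= KF l \<and> KF l <= lim l \<and> G l (KF l) <= v) \<and>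
    (\<exists>M zz. M \<subseteq> {..d} \<and>
      (\<forall>l\<in>M. cinv ctr v t S D KF FA Q L (zz l) l) \<and>
      (\<forall>p\<in>labelled t S KF. L p \<in> M \<and> spider_dist (zz (L p)) (pt p) <= v) \<and>
      (\<forall>i<D. Q i \<in> M) \<and> (S ~= 0 \<and> 0 < t --> ab \<in> M))"

lemma finite_labelled [simp]: "finite (labelled t S KF)"
  by (rule finite_subset[of _ "(SIGMA l:{..d}. {..<KF l})"]) (auto simp: labelled_def)

lemma tinvE:
  assumes "tinv ctr G v t S D KF FA Q ab L"
  obtains M zz where "M \<subseteq> {..d}" "\<And>l. l \<in> M ==> cinv ctr v t S D KF FA Q L (zz l) l"
    "\<And>p. p \<in> labelled t S KF ==> L p \<in> M \<and> spider_dist (zz (L p)) (pt p) <= v"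
    "\<And>i. i < D ==> Q i \<in> M" "S ~= 0 ==> 0 < t ==> ab \<in> M"
proof -
  from assms obtain M zz where *: "M \<subseteq> {..d}" "\<forall>l\<in>M. cinv ctr v t S D KF FA Q L (zz l) l"
    "\<forall>p\<in>labelled t S KF. L p \<in> M \<and> spider_dist (zz (L p)) (pt p) <= v"
    "\<forall>i<D. Q i \<in> M" "S ~= 0 \<and> 0 < t --> ab \<in> M"
    unfolding tinv_def by (elim conjE exE) (rule that)
  show ?thesis
    by (rule that[OF *(1) bspec[OF *(2)] bspec[OF *(3)]]) (simp_all add: *(4,5))
qed

lemma tinvI:
  assumes "t <= T" "S < 2 ^ (d + 1)" "D <= Dmax"
    "\<And>l. l <= d ==> bit S l ==> cm t l <= KF l \<and> KF l <= lim l \<and> G l (KF l) <= v"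
    "M \<subseteq> {..d}" "\<And>l. l \<in> M ==> cinv ctr v t S D KF FA Q L (zz l) l"
    "\<And>p. p \<in> labelled t S KF ==> L p \<in> M \<and> spider_dist (zz (L p)) (pt p) <= v"
    "\<And>i. i < D ==> Q i \<in> M" "S ~= 0 ==> 0 < t ==> ab \<in> M"
  shows "tinv ctr G v t S D KF FA Q ab L"
proof -
  have "\<forall>l\<in>M. cinv ctr v t S D KF FA Q L (zz l) l"
    "\<forall>p\<in>labelled t S KF. L p \<in> M \<and> spider_dist (zz (L p)) (pt p) <= v"
    "\<forall>i<D. Q i \<in> M" "S ~= 0 \<and> 0 < t --> ab \<in> M"
    using assms(6-9) by simp_all
  moreover have "\<forall>l\<le>d. bit S l --> cm t l <= KF l \<and> KF l <= lim l \<and> G l (KF l) <= v"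
    using assms(4) by simp
  ultimately show ?thesis unfolding tinv_def using assms(1-3,5) by (intro conjI exI[of _ M] exI[of _ zz])
qed

lemma tinvD:
  assumes "tinv ctr G v t S D KF FA Q ab L"
  shows "t <= T" "S < 2 ^ (d + 1)" "D <= Dmax"
    "\<And>l. l <= d ==> bit S l ==> cm t l <= KF l \<and> KF l <= lim l \<and> G l (KF l) <= v"
  using assms unfolding tinv_def by auto

lemma tinv_init: "tinv ctr G v T 0 0 KF FA Q ab L"
  by (rule tinvI[where M = "{}"]) (auto simp: labelled_def)

lemma tinv_final:
  assumes "tinv ctr G v 0 (2 ^ (d + 1) - 1) 0 KF FA Q ab L"
  shows "sat ctr v {p \<in> Us. snd p < KF (fst p)} L FA"
    and "\<And>l. l <= d ==> KF l <= cnt l \<and> G l (KF l) <= v"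
    and "\<And>p. p \<in> Us ==> snd p < KF (fst p) ==> L p <= d"
proof -
  have bits: "bit (2 ^ (d + 1) - 1 :: nat) l" if "l <= d" for l
    using bit_mask_iff[of "d + 1" l, where ?'a = nat] that by (simp add: mask_eq_exp_minus_1)
  show k: "\<And>l. l <= d ==> KF l <= cnt l \<and> G l (KF l) <= v"
    using tinvD(4)[OF assms] bits by auto
  have "labelled 0 (2 ^ (d + 1) - 1) KF = {p \<in> Us. snd p < KF (fst p)}"
  proof (rule set_eqI)
    fix p :: "nat \<times> nat"
    obtain l i where p: "p = (l, i)" by (cases p)
    have "l <= d" if "i < cnt l" using Us_leg[of "(l, i)"] that by (simp add: Us_def)
    moreover have "i < cnt l" if "l <= d" "i < KF l" using k[OF that(1)] that(2) by simp
    ultimately show "p \<in> labelled 0 (2 ^ (d + 1) - 1) KF \<longleftrightarrow> p \<in> {p \<in> Us. snd p < KF (fst p)}"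
      using bits[of l] by (auto simp: labelled_def Us_def p)
  qed
  note lab = this
  obtain M zz where M: "M \<subseteq> {..d}" "\<And>l. l \<in> M ==> cinv ctr v 0 (2 ^ (d + 1) - 1) 0 KF FA Q L (zz l) l"
    "\<And>p. p \<in> labelled 0 (2 ^ (d + 1) - 1) KF ==> L p \<in> M \<and> spider_dist (zz (L p)) (pt p) <= v"
    using tinvE[OF assms] by metis
  show "\<And>p. p \<in> Us ==> snd p < KF (fst p) ==> L p <= d" using M(1,3) unfolding lab by blast
  show "sat ctr v {p \<in> Us. snd p < KF (fst p)} L FA"
    unfolding sat_def lab[symmetric]
  proof (intro exI[of _ zz] ballI conjI)
    fix p assume "p \<in> labelled 0 (2 ^ (d + 1) - 1) KF"
    note p = M(3)[OF this]
    note c = cinvD[OF M(2)[OF conjunct1[OF p]]]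
    show "ctr (FA (L p)) (zz (L p))" "0 <= snd (zz (L p))" "spider_dist (zz (L p)) (pt p) <= v"
      using c(2,3) p by auto
    show "r <= card {q \<in> labelled 0 (2 ^ (d + 1) - 1) KF. L q = L p}" using c(6) by simp
  qed
qed

lemma labelled_pass:
  assumes "t < T"
  shows "labelled t S KF = (if bit S (own t) \<and> cm t (own t) < KF (own t)
    then insert (own t, cm t (own t)) (labelled (Suc t) S KF) else labelled (Suc t) S KF)"
  using own[OF assms] by (auto simp: labelled_def cn_Suc split: if_splits)

lemma tinv_pass_closed:
  assumes i: "tinv ctr G v (Suc t) S D KF FA Q ab L" and nb: "\<not> bit S (own t)"
  shows "tinv ctr G v t S D KF FA Q ab L"
proof -
  have t: "t < T" using i by (simp add: tinv_def)
  have D: "labelled t S KF = labelled (Suc t) S KF" using labelled_pass[OF t, of S KF] nb by simp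
  have cm: "cm t l <= cm (Suc t) l" for l by (rule cn_mono) simp
  obtain M zz where M: "M \<subseteq> {..d}" "\<And>l. l \<in> M ==> cinv ctr v (Suc t) S D KF FA Q L (zz l) l"
    "\<And>p. p \<in> labelled (Suc t) S KF ==> L p \<in> M \<and> spider_dist (zz (L p)) (pt p) <= v"
    "\<And>i. i < D ==> Q i \<in> M" "S ~= 0 ==> 0 < Suc t ==> ab \<in> M"
    using tinvE[OF i] by metis
  show ?thesis
  proof (rule tinvI[where M = M and zz = zz])
    show "t <= T" "S < 2 ^ (d + 1)" "D <= Dmax" using tinvD(1-3)[OF i] by auto
    show "cm t l <= KF l \<and> KF l <= lim l \<and> G l (KF l) <= v" if "l <= d" "bit S l" for l
      using tinvD(4)[OF i that] cm[of l] by auto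
    show "cinv ctr v t S D KF FA Q L (zz l) l" if l: "l \<in> M" for l
      using cinvD[OF M(2)[OF l]] B_mono[OF t] unfolding cinv_def D by auto
    show "\<And>p. p \<in> labelled t S KF ==> L p \<in> M \<and> spider_dist (zz (L p)) (pt p) <= v" unfolding D by (rule M(3))
    show "\<And>i. i < D ==> Q i \<in> M" "S ~= 0 ==> 0 < t ==> ab \<in> M" using M(4,5) by simp_all
  qed (rule M(1))
qed

text \<open>The passed user is at distance \<open>B (Suc t)\<close> and therefore lies in every open
  ball. So the last reserved place, or the absorbing cluster if there is none, may take it.\<close>

lemma tinv_pass_open:
  assumes i: "tinv ctr G v (Suc t) S D KF FA Q ab L" and b: "bit S (own t)"
    and lab: "lb = (if 0 < D then Q (D - 1) else ab)"
    and L': "L' (own t, cm t (own t)) = lb" "\<And>p. p \<in> Us ==> p ~= (own t, cm t (own t)) ==> L' p = L p"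
  shows "tinv ctr G v t S (D - 1) KF FA Q ab L'"
proof -
  let ?l = "own t" and ?D = "labelled (Suc t) S KF"
  let ?p = "(?l, cm t ?l)"
  have t: "t < T" using i by (simp add: tinv_def)
  have l: "?l < d" by (rule own[OF t])
  have KF: "cm (Suc t) l <= KF l \<and> KF l <= lim l \<and> G l (KF l) <= v" if "l <= d" "bit S l" for l
    using i that by (simp add: tinv_def)
  have cm: "cm t l <= cm (Suc t) l" for l by (rule cn_mono) simp
  have k: "cm t ?l < KF ?l" using KF[of ?l] l b by (simp add: cn_Suc)
  have Dn: "labelled t S KF = insert ?p ?D" using labelled_pass[OF t, of S KF] b k by simp
  have pn: "?p \<notin> ?D" by (simp add: labelled_def cn_Suc)
  have DU: "?D \<subseteq> Us"
  proof
    fix p assume "p \<in> ?D"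
    then show "p \<in> Us" using KF by (fastforce simp: labelled_def Us_def)
  qed
  have same: "L' p = L p" if "p \<in> ?D" for p using L'(2)[of p] DU pn that by blast
  obtain M zz where M: "M \<subseteq> {..d}"
    and z: "\<And>l. l \<in> M ==> cinv ctr v (Suc t) S D KF FA Q L (zz l) l"
    and dn: "\<And>p. p \<in> ?D ==> L p \<in> M \<and> spider_dist (zz (L p)) (pt p) <= v"
    and Q: "\<And>i. i < D ==> Q i \<in> M" and ab: "S ~= 0 ==> 0 < Suc t ==> ab \<in> M"
    using tinvE[OF i] by metis
  have "S ~= 0"
  proof
    assume "S = 0"
    then show False using b by simp
  qed
  then have lbM: "lb \<in> M" using lab Q[of "D - 1"] ab by (cases "D = 0") auto
  have XB: "X ?l (cm t ?l) = B (Suc t)" using BS[OF t] by simp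
  have B1: "0 <= B (Suc t)" using t by (intro B_nonneg) simp
  have dp: "spider_dist (zz lb) (pt ?p) <= v" using cinvD(5)[OF z[OF lbM]] XB B1 by (simp add: pt_def)
  have cnt: "r <= card {p \<in> insert ?p ?D. L' p = l} + card {i. i < D - 1 \<and> Q i = l}" if lM: "l \<in> M" for l
  proof -
    have e: "{p \<in> insert ?p ?D. L' p = l} = (if lb = l then {?p} else {}) \<union> {p \<in> ?D. L p = l}"
      using same L'(1) by auto
    have fin: "finite {p \<in> ?D. L p = l}" by simp
    have c1: "card {p \<in> insert ?p ?D. L' p = l} = card {p \<in> ?D. L p = l} + (if lb = l then 1 else 0)"
      unfolding e using pn fin by simp
    have c2: "card {i. i < D \<and> Q i = l} <= card {i. i < D - 1 \<and> Q i = l} + (if lb = l then 1 else 0)"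
    proof (cases D)
      case (Suc D')
      have "{i. i < D \<and> Q i = l} = {i. i < D - 1 \<and> Q i = l} \<union> (if lb = l then {D'} else {})"
        using Suc lab by (auto simp: less_Suc_eq)
      then show ?thesis using Suc by (auto simp: card_insert_if)
    qed simp
    show ?thesis using cinvD(6)[OF z[OF lM]] c1 c2 by linarith
  qed
  show ?thesis
  proof (rule tinvI[where M = M and zz = zz])
    show "t <= T" "S < 2 ^ (d + 1)" "D - 1 <= Dmax" using tinvD(1-3)[OF i] by auto
    show "cm t l <= KF l \<and> KF l <= lim l \<and> G l (KF l) <= v" if "l <= d" "bit S l" for l
      using KF[OF that] cm[of l] by auto
    show "cinv ctr v t S (D - 1) KF FA Q L' (zz l) l" if l: "l \<in> M" for l
      using cinvD[OF z[OF l]] cnt[OF l] B_mono[OF t] unfolding cinv_def Dn by auto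
    show "L' p \<in> M \<and> spider_dist (zz (L' p)) (pt p) <= v" if "p \<in> labelled t S KF" for p
      using that dn[of p] same[of p] L'(1) lbM dp unfolding Dn by (cases "p = ?p") auto
    show "\<And>i. i < D - 1 ==> Q i \<in> M" using Q by simp
    show "S ~= 0 ==> 0 < t ==> ab \<in> M" using ab by simp
  qed (rule M)
qed

lemma labelled_open:
  assumes "\<not> bit S l" "l <= d" "\<And>l'. l' ~= l ==> KF' l' = KF l'"
  shows "labelled t (S + 2 ^ l) KF' = labelled t S KF \<union> Pair l ` {cm t l..<KF' l}"
proof (rule set_eqI)
  fix p :: "nat \<times> nat"
  obtain l' i where p: "p = (l', i)" by (cases p)
  have "bit (S + 2 ^ l) l' \<longleftrightarrow> bit S l' \<or> l' = l" by (rule bit_add_pow[OF assms(1)])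
  then show "p \<in> labelled t (S + 2 ^ l) KF' \<longleftrightarrow> p \<in> labelled t S KF \<union> Pair l ` {cm t l..<KF' l}"
    using assms by (cases "l' = l") (auto simp: labelled_def p)
qed

text \<open>With a center, the \<open>e - 1\<close> own users beyond the threshold and the
  \<open>need r e\<close> reserved places make up at least r. With \<open>e = 0\<close> no cluster
  is added, and only the end of the mixed prefix of the leg gets fixed.\<close>

lemma tinv_open:
  assumes i: "tinv ctr G v t S D KF FA Q ab L" and op: "can_open t S D l e"
    and w: "wcost G t l e <= v" and near: "1 <= e ==> near_ok ctr (FA' l) (l, (reach t l e - B t) / 2)"
    and KF': "KF' l = cm t l + (e - 1)" "\<And>l'. l' ~= l ==> KF' l' = KF l'"
    and FA': "\<And>l'. l' ~= l ==> FA' l' = FA l'"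
    and ab': "ab' = (if S = 0 then l else ab)"
    and Q': "\<And>i. i < D ==> Q' i = Q i" "\<And>i. D <= i ==> i < D + need r e ==> Q' i = l"
    and L': "\<And>i. i < e - 1 ==> L' (l, cm t l + i) = l"
      "\<And>p. p \<in> Us ==> fst p ~= l ==> L' p = L p"
  shows "tinv ctr G v t (S + 2 ^ l) (D + need r e) KF' FA' Q' ab' L'"
proof -
  let ?D = "labelled t S KF" and ?N = "Pair l ` {cm t l..<KF' l}"
  have ld: "l <= d" and nb: "\<not> bit S l" and e: "e <= lim l - cm t l + 1" and Dm: "D + need r e <= Dmax"
    and e0: "\<not> (e = 0 \<and> S = 0 \<and> 0 < t)" using op by (auto simp: can_open_def)
  have t: "t <= T" and S: "S < 2 ^ (d + 1)" using i by (auto simp: tinv_def)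
  have KF: "cm t l' <= KF l' \<and> KF l' <= lim l' \<and> G l' (KF l') <= v" if "l' <= d" "bit S l'" for l'
    using i that by (simp add: tinv_def)
  have Dn: "labelled t (S + 2 ^ l) KF' = ?D \<union> ?N" by (rule labelled_open[OF nb ld KF'(2)])
  have bS: "bit (S + 2 ^ l) l' \<longleftrightarrow> bit S l' \<or> l' = l" for l' by (rule bit_add_pow[OF nb])
  have Dl: "fst p ~= l" if "p \<in> ?D" for p using that nb by (auto simp: labelled_def)
  have DU: "p \<in> Us" if "p \<in> ?D" for p using that KF by (fastforce simp: labelled_def Us_def)
  have same: "L' p = L p" if "p \<in> ?D" for p using L'(2) Dl DU that by blast
  have new: "L' p = l" if "p \<in> ?N" for p
  proof -
    from that obtain i where "p = (l, i)" "i \<in> {cm t l..<KF' l}" by (rule imageE)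
    then have i: "p = (l, i)" "cm t l <= i" "i < KF' l" by auto
    show ?thesis using L'(1)[of "i - cm t l"] i KF'(1) by auto
  qed
  have kl: "KF' l <= lim l" using KF'(1) e cm_le[OF t, of l] by auto
  obtain M zz where M: "M \<subseteq> {..d}"
    and z: "\<And>l. l \<in> M ==> cinv ctr v t S D KF FA Q L (zz l) l"
    and dn: "\<And>p. p \<in> ?D ==> L p \<in> M \<and> spider_dist (zz (L p)) (pt p) <= v"
    and Q: "\<And>i. i < D ==> Q i \<in> M" and ab: "S ~= 0 ==> 0 < t ==> ab \<in> M"
    using tinvE[OF i] by metis
  have lM: "l \<notin> M" using cinvD(1)[OF z] nb by blast
  have G: "G l (KF' l) <= v" using w KF'(1) by (cases "e = 0") (auto simp: wcost_def)
  have KFall: "cm t l' <= KF' l' \<and> KF' l' <= lim l' \<and> G l' (KF' l') <= v" if "l' <= d" "bit (S + 2 ^ l) l'" for l'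
    using KF[of l'] KF' kl G that by (cases "l' = l") (auto simp: bS)
  have S': "S + 2 ^ l < 2 ^ (d + 1)" using add_pow_less[OF S nb] ld by simp
  have old: "cinv ctr v t (S + 2 ^ l) (D + need r e) KF' FA' Q' L' (zz m) m" if m: "m \<in> M" for m
  proof -
    have ml: "m ~= l" using m lM by blast
    have "card {p \<in> ?D. L p = m} <= card {p \<in> ?D \<union> ?N. L' p = m}" using same by (intro card_mono) auto
    moreover have "card {i. i < D \<and> Q i = m} <= card {i. i < D + need r e \<and> Q' i = m}" using Q'(1) by (intro card_mono) auto
    ultimately show ?thesis using cinvD[OF z[OF m]] ml KF'(2)[OF ml] FA'[OF ml] unfolding cinv_def Dn bS by auto
  qed
  show ?thesis
  proof (cases "e = 0")
    case True
    have nil: "?N = {}" using True KF'(1) by simp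
    have abM: "ab' \<in> M" if "0 < t"
    proof -
      have "S ~= 0" using e0 True that by simp
      then show ?thesis using ab[OF _ that] ab' by simp
    qed
    show ?thesis
    proof (rule tinvI[where M = M and zz = zz])
      show "L' p \<in> M \<and> spider_dist (zz (L' p)) (pt p) <= v" if "p \<in> labelled t (S + 2 ^ l) KF'" for p
        using that dn[of p] same[of p] unfolding Dn nil by simp
      show "Q' i \<in> M" if "i < D + need r e" for i using that Q[of i] Q'(1)[of i] True by (simp add: need_def)
      show "cm t l' <= KF' l' \<and> KF' l' <= lim l' \<and> G l' (KF' l') <= v" if "l' <= d" "bit (S + 2 ^ l) l'" for l'
        by (rule KFall[OF that])
      show "cinv ctr v t (S + 2 ^ l) (D + need r e) KF' FA' Q' L' (zz m) m" if "m \<in> M" for m by (rule old[OF that])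
      show "0 < t ==> ab' \<in> M" by (rule abM)
    qed (rule t S' Dm M)+
  next
    case False
    then have e1: "1 <= e" by simp
    obtain zl where zl: "ctr (FA' l) zl" "0 <= snd zl" "\<And>i. i < KF' l ==> spider_dist zl (l, X l i) <= v"
      "\<And>l' x. 0 <= x ==> x <= B t ==> spider_dist zl (l', x) <= v"
      using centre_cover[OF t e1 e near[OF e1] w] KF'(1) by auto
    have cl: "r <= card {p \<in> ?D \<union> ?N. L' p = l} + card {i. i < D + need r e \<and> Q' i = l}"
    proof -
      have "card ?N = e - 1" using KF'(1) by (simp add: card_image inj_on_def)
      moreover have "card ?N <= card {p \<in> ?D \<union> ?N. L' p = l}" using new by (intro card_mono) auto
      moreover have "card {D..<D + need r e} <= card {i. i < D + need r e \<and> Q' i = l}"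
        using Q'(2) by (intro card_mono) auto
      ultimately show ?thesis using e1 by (simp add: need_def split: if_splits)
    qed
    show ?thesis
    proof (rule tinvI[where M = "insert l M" and zz = "zz(l := zl)"])
      show "insert l M \<subseteq> {..d}" using M ld by simp
      show "cinv ctr v t (S + 2 ^ l) (D + need r e) KF' FA' Q' L' ((zz(l := zl)) m) m" if "m \<in> insert l M" for m
      proof (cases "m = l")
        case True
        then show ?thesis using zl cl unfolding cinv_def Dn bS by auto
      next
        case False
        then show ?thesis using old[of m] that by simp
      qed
      show "L' p \<in> insert l M \<and> spider_dist ((zz(l := zl)) (L' p)) (pt p) <= v"
        if "p \<in> labelled t (S + 2 ^ l) KF'" for p
      proof (cases "p \<in> ?D")
        case True
        then have "L p ~= l" using dn lM by blast
        then show ?thesis using dn[OF True] same[OF True] by simp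
      next
        case False
        then have p: "p \<in> ?N" using that unfolding Dn by blast
        then have "spider_dist zl (pt p) <= v" using zl(3) by (auto simp: pt_def)
        then show ?thesis using new[OF p] by simp
      qed
      show "Q' i \<in> insert l M" if "i < D + need r e" for i
        using that Q[of i] Q'(1)[of i] Q'(2)[of i] by (cases "i < D") auto
      show "S + 2 ^ l ~= 0 ==> 0 < t ==> ab' \<in> insert l M" using ab ab' by simp
      show "cm t l' <= KF' l' \<and> KF' l' <= lim l' \<and> G l' (KF' l') <= v" if "l' <= d" "bit (S + 2 ^ l) l'" for l'
        by (rule KFall[OF that])
    qed (rule t S' Dm)+
  qed
qed

end

section \<open>From lists of points to positions on legs\<close>

definition legix :: "point list => nat => nat => nat list" where
  "legix ps k l = filter (\<lambda>i. fst (ps ! i) = l) [0..<k]"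

lemma legix_Suc: "legix ps (Suc k) l = legix ps k l @ (if fst (ps ! k) = l then [k] else [])"
  by (simp add: legix_def)

lemma legix_0 [simp]: "legix ps 0 l = []" by (simp add: legix_def)

lemma distinct_legix [simp]: "distinct (legix ps k l)" by (simp add: legix_def)

lemma set_legix: "set (legix ps k l) = {i. i < k \<and> fst (ps ! i) = l}" by (auto simp: legix_def)

lemma legix_nth: "i < length (legix ps k l) ==> legix ps k l ! i < k \<and> fst (ps ! (legix ps k l ! i)) = l"
  using nth_mem[of i "legix ps k l"] by (simp add: set_legix)

lemma legix_less: "i < j ==> j < length (legix ps k l) ==> legix ps k l ! i < legix ps k l ! j"
proof -
  have "sorted_wrt (<) (legix ps k l)" unfolding legix_def by (intro sorted_wrt_filter) simp
  then show "i < j ==> j < length (legix ps k l) ==> ?thesis" by (rule sorted_wrt_nth_less)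
qed

lemma length_legix: "length (legix ps k l) <= k"
  unfolding legix_def using length_filter_le[of _ "[0..<k]"] by simp

lemma legix_mono:
  assumes "spider_input d ps" "i <= j" "j < length (legix ps (length ps) l)"
  shows "snd (ps ! (legix ps (length ps) l ! i)) <= snd (ps ! (legix ps (length ps) l ! j))"
proof (cases "i = j")
  case False
  let ?L = "legix ps (length ps) l"
  have ij: "i < j" using False assms by simp
  have "?L ! i < ?L ! j" by (rule legix_less[OF ij assms(3)])
  moreover have "?L ! j < length ps" "fst (ps ! (?L ! j)) = l" "fst (ps ! (?L ! i)) = l"
    using legix_nth[OF assms(3)] legix_nth[of i ps "length ps" l] ij assms(3) by auto
  moreover have "sorted_wrt (\<lambda>p q. fst p = fst q --> snd p <= snd q) ps"
    using assms(1) by (simp add: spider_input_def)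
  ultimately show ?thesis
    using sorted_wrt_nth_less[of "\<lambda>p q. fst p = fst q --> snd p <= snd q" ps "?L ! i" "?L ! j"] by simp
qed simp

text \<open>The value 0 without facilities makes every point a free center, so the clustering
  problem is the case \<open>fs = []\<close>.\<close>

definition fdist :: "point list => point => real" where
  "fdist fs p = (if fs = [] then 0 else Min ((\<lambda>f. spider_dist f p) ` set fs))"

definition isfac :: "point list => nat => point => bool" where
  "isfac fs k z \<longleftrightarrow> fs = [] \<or> k < length fs \<and> z = fs ! k"

lemma fdist_le: "f \<in> set fs ==> fdist fs p <= spider_dist f p"
  by (auto simp: fdist_def)

lemma spider_dist_nonneg: "0 <= snd p ==> 0 <= snd q ==> 0 <= spider_dist p q"
  by (auto simp: spider_dist_def)

text \<open>The center is the midpoint between the farthest point \<open>p\<close> and a partner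
  \<open>b\<close>: the farthest point off the leg of \<open>p\<close> if there is one, and
  otherwise the innermost point on that leg.\<close>

lemma bounding_ball:
  assumes fin: "finite A" and ne: "A ~= {}" and nn: "\<And>p. p \<in> A ==> 0 <= snd p \<and> fst p < d"
    and dist: "\<And>p q. p \<in> A ==> q \<in> A ==> spider_dist p q <= 2 * c"
  shows "\<exists>z. 0 <= snd z \<and> fst z < d \<and> (\<forall>p\<in>A. spider_dist z p <= c)"
proof -
  have amax: "\<exists>p\<in>S. \<forall>q\<in>S. snd q <= snd p" if "finite S" "S ~= {}" for S :: "point set"
  proof -
    have "Max (snd ` S) \<in> snd ` S" using that by (intro Max_in) auto
    then obtain p where p: "p \<in> S" "Max (snd ` S) = snd p" by (rule imageE)
    have "snd q <= snd p" if "q \<in> S" for q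
      using Max_ge[of "snd ` S" "snd q"] that \<open>finite S\<close> p(2) by simp
    then show ?thesis using p(1) by blast
  qed
  have amin: "\<exists>p\<in>S. \<forall>q\<in>S. snd p <= snd q" if "finite S" "S ~= {}" for S :: "point set"
  proof -
    have "Min (snd ` S) \<in> snd ` S" using that by (intro Min_in) auto
    then obtain p where p: "p \<in> S" "Min (snd ` S) = snd p" by (rule imageE)
    have "snd p <= snd q" if "q \<in> S" for q
      using Min_le[of "snd ` S" "snd q"] that \<open>finite S\<close> p(2) by simp
    then show ?thesis using p(1) by blast
  qed
  obtain p where p: "p \<in> A" "\<And>q. q \<in> A ==> snd q <= snd p" using amax[OF fin ne] by blast
  define off where "off = {q \<in> A. fst q ~= fst p}"
  show ?thesis
  proof (cases "off = {}")
    case True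
    then have leg: "fst q = fst p" if "q \<in> A" for q using that unfolding off_def by blast
    obtain b where b: "b \<in> A" "\<And>q. q \<in> A ==> snd b <= snd q" using amin[OF fin ne] by blast
    have "snd p - snd b <= 2 * c" using dist[OF p(1) b(1)] leg[OF b(1)] p(2)[OF b(1)] by (simp add: spider_dist_def)
    then have "spider_dist (fst p, (snd p + snd b) / 2) q <= c" if "q \<in> A" for q
      using leg[OF that] p(2)[OF that] b(2)[OF that] by (auto simp: spider_dist_def abs_if field_simps)
    then show ?thesis using nn[OF p(1)] nn[OF b(1)] by (intro exI[of _ "(fst p, (snd p + snd b) / 2)"]) auto
  next
    case False
    have "finite off" using fin by (simp add: off_def)
    then obtain b where b: "b \<in> off" "\<And>q. q \<in> off ==> snd q <= snd b" using amax[OF _ False] by blast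
    have bA: "b \<in> A" "fst b ~= fst p" using b by (auto simp: off_def)
    have "snd p + snd b <= 2 * c" using dist[OF p(1) bA(1)] bA(2) by (simp add: spider_dist_def)
    then have "spider_dist (fst p, (snd p - snd b) / 2) q <= c" if "q \<in> A" for q
      using p(2)[OF that] p(2)[OF bA(1)] b(2)[of q] nn[OF that] nn[OF bA(1)] that
      by (cases "fst q = fst p") (auto simp: spider_dist_def abs_if field_simps off_def)
    then show ?thesis using nn[OF p(1)] p(2)[OF bA(1)] by (intro exI[of _ "(fst p, (snd p - snd b) / 2)"]) auto
  qed
qed

section \<open>The two problems as one covering problem\<close>

locale spider_problem =
  fixes d r :: nat and us fs :: "point list"
  assumes d1: "1 <= d" and r1: "1 <= r" and us: "spider_input d us" and fs: "spider_input d fs"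
begin

abbreviation "n \<equiv> length us"
abbreviation "m \<equiv> length fs"
definition cnt :: "nat => nat" where "cnt l = length (legix us n l)"
definition uid :: "nat => nat => nat" where "uid l i = legix us n l ! i"
definition X :: "nat => nat => real" where "X l i = snd (us ! uid l i)"

lemma us_point: "u < n ==> fst (us ! u) < d \<and> 0 <= snd (us ! u)"
proof -
  assume "u < n"
  then have "us ! u \<in> spider_points d" using us nth_mem[of u us] unfolding spider_input_def by blast
  then show ?thesis by (auto simp: spider_points_def)
qed

lemma fs_point: "f \<in> set fs ==> fst f < d \<and> 0 <= snd f"
proof -
  assume "f \<in> set fs"
  then have "f \<in> spider_points d" using fs unfolding spider_input_def by blast
  then show ?thesis by (auto simp: spider_points_def)
qed

lemma uid: "i < cnt l ==> uid l i < n \<and> fst (us ! uid l i) = l"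
  using legix_nth[of i us n l] by (simp add: cnt_def uid_def)

sublocale spider_users d r cnt X "fdist fs"
proof
  show "1 <= d" "1 <= r" by (fact d1 r1)+
  show "0 <= X l i" if "i < cnt l" for i l using uid[OF that] us_point by (simp add: X_def)
  show "X l i <= X l j" if "i <= j" "j < cnt l" for i j l
    using legix_mono[OF us that(1)] that(2) by (simp add: X_def uid_def cnt_def)
  show "cnt l = 0" if "d <= l" for l
  proof (rule ccontr)
    assume "cnt l ~= 0"
    then have "uid l 0 < n" "fst (us ! uid l 0) = l" using uid[of 0 l] by auto
    then show False using us_point that by fastforce
  qed
qed

definition uidp :: "nat \<times> nat => nat" where "uidp p = uid (fst p) (snd p)"

lemma uidp_bij: "bij_betw uidp Us {..<n}"
  unfolding bij_betw_def
proof
  show "inj_on uidp Us"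
  proof (rule inj_onI)
    fix p q assume pq: "p \<in> Us" "q \<in> Us" "uidp p = uidp q"
    obtain l i l' j where [simp]: "p = (l, i)" "q = (l', j)" by (cases p, cases q)
    have c: "i < cnt l" "j < cnt l'" using pq by (auto simp: Us_def)
    then have l: "l = l'" using uid[OF c(1)] uid[OF c(2)] pq(3) by (simp add: uidp_def)
    have "i = j" using nth_eq_iff_index_eq[OF distinct_legix, of i us n l j] pq(3) c l
      by (simp add: uidp_def uid_def cnt_def)
    then show "p = q" using l by simp
  qed
  show "uidp ` Us = {..<n}"
  proof
    show "uidp ` Us \<subseteq> {..<n}" using uid by (auto simp: uidp_def Us_def)
    show "{..<n} \<subseteq> uidp ` Us"
    proof
      fix u assume "u \<in> {..<n}"
      then have "u \<in> set (legix us n (fst (us ! u)))" by (simp add: set_legix)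
      then obtain i where "i < cnt (fst (us ! u))" "uid (fst (us ! u)) i = u"
        by (auto simp: in_set_conv_nth cnt_def uid_def)
      then show "u \<in> uidp ` Us" by (intro image_eqI[of _ _ "(fst (us ! u), i)"]) (auto simp: uidp_def Us_def)
    qed
  qed
qed

lemma uidp_less: "p \<in> Us ==> uidp p < n"
  using bij_betwE[OF uidp_bij] by blast

lemma uidp_surj: "u < n ==> \<exists>p\<in>Us. uidp p = u"
proof -
  assume "u < n"
  then have "u \<in> uidp ` Us" using bij_betw_imp_surj_on[OF uidp_bij] by simp
  then show ?thesis by blast
qed

lemma pt_uidp: "p \<in> Us ==> us ! uidp p = pt p"
proof -
  assume "p \<in> Us"
  then have "snd p < cnt (fst p)" by (auto simp: Us_def)
  from uid[OF this] show ?thesis unfolding pt_def X_def uidp_def by (metis prod.collapse)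
qed

lemma card_uidp: "card {p \<in> Us. P (uidp p)} = card {u. u < n \<and> P u}"
proof -
  have "uidp ` {p \<in> Us. P (uidp p)} = {u. u < n \<and> P u}"
    using uidp_less uidp_surj by blast
  moreover have "inj_on uidp {p \<in> Us. P (uidp p)}"
    using bij_betw_imp_inj_on[OF uidp_bij] by (rule inj_on_subset) auto
  ultimately show ?thesis by (metis card_image)
qed

definition total :: real where "total = (\<Sum>u<n. snd (us ! u))"

definition fpos0 :: real where "fpos0 = (if fs = [] then 0 else snd (fs ! 0))"

lemma cenI: "fs ~= [] ==> z \<in> set fs ==> cen z"
proof -
  assume "z \<in> set fs"
  then have "0 <= snd z" "fst z <= d" "fdist fs p <= spider_dist z p" for p
    using fs_point[of z] fdist_le[of z fs p] by simp_all
  then show ?thesis unfolding cen_def by blast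
qed

lemma cenI_nil: "fs = [] ==> 0 <= snd z ==> fst z <= d ==> cen z"
proof -
  assume fs: "fs = []" and z: "0 <= snd z" "fst z <= d"
  have "fdist fs (l, x) <= spider_dist z (l, x)" if "0 <= x" for l x
    using spider_dist_nonneg[of z "(l, x)"] z that unfolding fs by (simp add: fdist_def)
  then show ?thesis unfolding cen_def using z by blast
qed

lemma fpos0_nonneg: "0 <= fpos0"
  unfolding fpos0_def using fs_point[of "fs ! 0"] by simp

lemma total_nonneg: "0 <= total" unfolding total_def by (rule sum_nonneg) (simp add: us_point)

text \<open>One cluster of all users, served from the first facility or from the center. Its radius
  is below \<open>big\<close>, which can therefore mark impossible table entries.\<close>

lemma trivial_solution:
  assumes "r <= n"
  shows "\<exists>z. solution (fpos0 + total) (\<lambda>_. 0) z"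
proof -
  define z where "z = (if fs = [] then (0, 0) else fs ! 0)"
  have z: "cen z"
  proof (cases "fs = []")
    case True
    then have "z = (0, 0)" by (simp add: z_def)
    then show ?thesis using cenI_nil[OF True, of "(0, 0)"] by simp
  next
    case False
    then show ?thesis unfolding z_def by (simp only: if_False) (rule cenI, simp_all)
  qed
  have z2: "snd z = fpos0" by (simp add: z_def fpos0_def)
  have "card (cls (\<lambda>_. 0) 0) = n" using card_uidp[of "\<lambda>_. True"] by (simp add: cls_def)
  moreover have "spider_dist z (pt u) <= fpos0 + total" if u: "u \<in> Us" for u
  proof -
    have "snd (us ! uidp u) <= total" unfolding total_def
      by (rule member_le_sum) (use uidp_less[OF u] us_point in auto)
    then have "snd (pt u) <= total" using pt_uidp[OF u] by simp
    moreover have "spider_dist z (pt u) <= snd z + snd (pt u)"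
      using pt_nonneg[OF u] z2 fpos0_nonneg by (auto simp: spider_dist_def)
    ultimately show ?thesis using z2 by simp
  qed
  ultimately have "solution (fpos0 + total) (\<lambda>_. 0) (\<lambda>_. z)"
    using assms z by (simp add: solution_def)
  then show ?thesis by blast
qed

text \<open>\<open>bounding_ball\<close> turns the diameter of each cluster into half as large a
  radius.\<close>

lemma clustering_solution:
  assumes fs: "fs = []" and us: "us ~= []" and P: "r_gather_clustering r us P"
  shows "0 <= clustering_cost us P \<and> (\<exists>f z. solution (clustering_cost us P / 2) f z)"
proof -
  let ?c = "clustering_cost us P"
  have part: "partition_on {..<n} P" and card: "\<And>A. A \<in> P ==> r <= card A"
    using P by (auto simp: r_gather_clustering_def)
  have finP: "finite P" by (rule finite_elements[OF _ part]) simp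
  have PU: "A \<subseteq> {..<n}" if "A \<in> P" for A using partition_onD1[OF part] that by blast
  have finA: "finite A" if "A \<in> P" for A using PU[OF that] finite_subset by blast
  have diam: "spider_dist (us ! i) (us ! j) <= ?c" if "A \<in> P" "i \<in> A" "j \<in> A" for A i j
  proof -
    have "finite {spider_dist (us ! i) (us ! j) |i j. i \<in> A \<and> j \<in> A}"
    proof (rule finite_subset)
      show "{spider_dist (us ! i) (us ! j) |i j. i \<in> A \<and> j \<in> A} \<subseteq> (\<lambda>(i, j). spider_dist (us ! i) (us ! j)) ` (A \<times> A)"
        by auto
      show "finite ((\<lambda>(i, j). spider_dist (us ! i) (us ! j)) ` (A \<times> A))" using finA[OF that(1)] by simp
    qed
    then have "spider_dist (us ! i) (us ! j) <= cluster_diameter us A"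
      unfolding cluster_diameter_def using that by (intro Max_ge) auto
    also have "\<dots> <= ?c" unfolding clustering_cost_def using finP that by (intro Max_ge) auto
    finally show ?thesis .
  qed
  define cl where "cl u = (THE A. A \<in> P \<and> u \<in> A)" for u
  have cl_eq: "cl u = A" if "A \<in> P" "u \<in> A" for u A
    unfolding cl_def
  proof (rule the_equality)
    show "A \<in> P \<and> u \<in> A" using that by blast
    fix B assume "B \<in> P \<and> u \<in> B"
    then show "B = A" using disjointD[OF partition_onD2[OF part], of B A] that by blast
  qed
  have cl: "cl u \<in> P \<and> u \<in> cl u" if "u < n" for u
  proof -
    have "u \<in> \<Union>P" using partition_onD1[OF part] that by auto
    then obtain A where "A \<in> P" "u \<in> A" by blast
    then show ?thesis using cl_eq[of A u] by simp
  qed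
  have c0: "0 <= ?c"
  proof -
    have "spider_dist (us ! 0) (us ! 0) <= ?c" using diam[of "cl 0" 0 0] cl[of 0] us by auto
    then show ?thesis by (simp add: spider_dist_def)
  qed
  have "\<exists>z. 0 <= snd z \<and> fst z < d \<and> (\<forall>i\<in>A. spider_dist z (us ! i) <= ?c / 2)" if A: "A \<in> P" for A
  proof -
    have "\<exists>z. 0 <= snd z \<and> fst z < d \<and> (\<forall>p\<in>(!) us ` A. spider_dist z p <= ?c / 2)"
    proof (rule bounding_ball)
      show "finite ((!) us ` A)" using finA[OF A] by simp
      have "A ~= {}" using partition_onD3[OF part] A by blast
      then show "(!) us ` A ~= {}" by simp
      show "0 <= snd p \<and> fst p < d" if "p \<in> (!) us ` A" for p
        using that us_point PU[OF A] by blast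
      show "spider_dist p q <= 2 * (?c / 2)" if "p \<in> (!) us ` A" "q \<in> (!) us ` A" for p q
        using that diam[OF A] by force
    qed
    then show ?thesis by simp
  qed
  then obtain zz where zz: "\<And>A. A \<in> P ==> 0 <= snd (zz A) \<and> fst (zz A) < d \<and> (\<forall>i\<in>A. spider_dist (zz A) (us ! i) <= ?c / 2)"
    by metis
  \<comment> \<open>A cluster is labelled by the smallest index of its users.\<close>
  define f where "f p = Min (cl (uidp p))" for p
  have f: "f p < n \<and> cl (f p) = cl (uidp p)" if "p \<in> Us" for p
  proof -
    have c: "cl (uidp p) \<in> P" "uidp p \<in> cl (uidp p)" using cl[OF uidp_less[OF that]] by auto
    then have "f p \<in> cl (uidp p)" unfolding f_def using finA by (intro Min_in) auto
    then show ?thesis using cl_eq[OF c(1)] PU[OF c(1)] by blast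
  qed
  have "solution (?c / 2) f (\<lambda>g. zz (cl g))" unfolding solution_def
  proof (intro ballI)
    fix p assume p: "p \<in> Us"
    let ?A = "cl (uidp p)"
    have A: "?A \<in> P" "uidp p \<in> ?A" using cl[OF uidp_less[OF p]] by auto
    have "cls f (f p) = {q \<in> Us. uidp q \<in> ?A}"
    proof (rule set_eqI)
      fix q
      have "f q = f p \<longleftrightarrow> uidp q \<in> ?A" if q: "q \<in> Us"
        using f[OF p] f[OF q] cl[OF uidp_less[OF q]] cl_eq[OF A(1), of "uidp q"] unfolding f_def by metis
      then show "q \<in> cls f (f p) \<longleftrightarrow> q \<in> {q \<in> Us. uidp q \<in> ?A}" by (auto simp: cls_def)
    qed
    then have "card (cls f (f p)) = card {u. u < n \<and> u \<in> ?A}" using card_uidp[of "\<lambda>u. u \<in> ?A"] by simp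
    also have "{u. u < n \<and> u \<in> ?A} = ?A" using PU[OF A(1)] by auto
    finally have "r <= card (cls f (f p))" using card[OF A(1)] by simp
    moreover have "cen (zz (cl (f p)))" using zz[OF A(1)] f[OF p] by (intro cenI_nil[OF fs]) auto
    moreover have "spider_dist (zz (cl (f p))) (pt p) <= ?c / 2"
      using zz[OF A(1)] f[OF p] A(2) pt_uidp[OF p] by auto
    ultimately show "r <= card (cls f (f p)) \<and> cen (zz (cl (f p))) \<and> spider_dist (zz (cl (f p))) (pt p) <= ?c / 2"
      by blast
  qed
  then show ?thesis using c0 by blast
qed

lemma gathering_solution:
  assumes us: "us ~= []" and \<pi>: "r_gathering r us fs \<pi>"
  shows "0 <= gathering_cost us fs \<pi> \<and> solution (gathering_cost us fs \<pi>) (\<lambda>p. \<pi> (uidp p)) ((!) fs)"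
proof -
  let ?c = "gathering_cost us fs \<pi>"
  have dist: "spider_dist (us ! i) (fs ! \<pi> i) <= ?c" if "i < n" for i
    unfolding gathering_cost_def using that by (intro Max_ge) auto
  have m: "\<pi> i < m" if "i < n" for i using \<pi> that by (auto simp: r_gathering_def)
  have "0 <= spider_dist (us ! 0) (fs ! \<pi> 0)"
    using us us_point[of 0] fs_point[of "fs ! \<pi> 0"] m[of 0] by (intro spider_dist_nonneg) auto
  then have "0 <= ?c" using dist[of 0] us by auto
  moreover have "solution ?c (\<lambda>p. \<pi> (uidp p)) ((!) fs)" unfolding solution_def
  proof (intro ballI)
    fix p assume p: "p \<in> Us"
    let ?i = "uidp p"
    have i: "?i < n" by (rule uidp_less[OF p])
    have "card (cls (\<lambda>p. \<pi> (uidp p)) (\<pi> ?i)) = card {u. u < n \<and> \<pi> u = \<pi> ?i}"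
      unfolding cls_def using card_uidp[of "\<lambda>u. \<pi> u = \<pi> ?i"] by simp
    moreover have "card {u. u < n \<and> \<pi> u = \<pi> ?i} ~= 0" using i by auto
    moreover have "card {u \<in> {..<n}. \<pi> u = \<pi> ?i} \<in> {0} \<union> {r..}" using \<pi> m[OF i] unfolding r_gathering_def by blast
    moreover have "{u \<in> {..<n}. \<pi> u = \<pi> ?i} = {u. u < n \<and> \<pi> u = \<pi> ?i}" by auto
    ultimately have "r <= card (cls (\<lambda>p. \<pi> (uidp p)) (\<pi> ?i))"
      by (simp only: Un_iff singleton_iff atLeast_iff) blast
    moreover have "cen (fs ! \<pi> ?i)" using m[OF i] by (intro cenI) auto
    moreover have "spider_dist (fs ! \<pi> ?i) (pt p) <= ?c"
      using dist[OF i] pt_uidp[OF p] by (simp add: spider_dist_sym)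
    ultimately show "r <= card (cls (\<lambda>p. \<pi> (uidp p)) (\<pi> ?i)) \<and> cen (fs ! \<pi> ?i) \<and> spider_dist (fs ! \<pi> ?i) (pt p) <= ?c"
      by blast
  qed
  ultimately show ?thesis by blast
qed

text \<open>Both halves of optimality: the labelling has radius at most \<open>v\<close>, and
  \<open>v\<close> is below the radius of every solution.\<close>

definition result :: "(nat => nat) => (nat => nat) => real => bool" where
  "result lab fac v \<longleftrightarrow> sat (isfac fs) v Us (\<lambda>p. lab (uidp p)) fac \<and>
    (\<forall>c f z. 0 <= c --> solution c f z --> v <= c)"

abbreviation solved :: "state => bool" where
  "solved s \<equiv> (\<exists>v. result (nats s ''cluster'') (nats s ''fac'') v) \<and> (\<forall>u<n. nats s ''assignment'' u = nats s ''fac'' (nats s ''cluster'' u))"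

lemma result_balls:
  assumes "result lab fac v"
  shows "\<exists>zz. \<forall>u<n. r <= card {w. w < n \<and> lab w = lab u} \<and> isfac fs (fac (lab u)) (zz (lab u)) \<and>
    0 <= snd (zz (lab u)) \<and> spider_dist (zz (lab u)) (us ! u) <= v"
proof -
  from assms obtain zz where zz: "\<And>p. p \<in> Us ==> r <= card {q \<in> Us. lab (uidp q) = lab (uidp p)} \<and>
    isfac fs (fac (lab (uidp p))) (zz (lab (uidp p))) \<and> 0 <= snd (zz (lab (uidp p))) \<and>
    spider_dist (zz (lab (uidp p))) (pt p) <= v"
    unfolding result_def sat_def by blast
  show ?thesis
  proof (intro exI[of _ zz] allI impI)
    fix u assume "u < n"
    then obtain p where p: "p \<in> Us" "uidp p = u" using uidp_surj by blast
    show "r <= card {w. w < n \<and> lab w = lab u} \<and> isfac fs (fac (lab u)) (zz (lab u)) \<and>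
        0 <= snd (zz (lab u)) \<and> spider_dist (zz (lab u)) (us ! u) <= v"
      using zz[OF p(1)] card_uidp[of "\<lambda>w. lab w = lab u"] pt_uidp[OF p(1)] p(2) by simp
  qed
qed

text \<open>Going through the common center bounds all diameters by \<open>2 * v\<close>, and by
  \<open>clustering_solution\<close> no clustering costs less than that.\<close>

lemma result_clustering:
  assumes fs: "fs = []" and ne: "us ~= []" and res: "result lab fac v"
  shows "optimal_clustering r us (clusters n lab)"
proof -
  obtain zz where "\<forall>u<n. r <= card {w. w < n \<and> lab w = lab u} \<and> isfac fs (fac (lab u)) (zz (lab u)) \<and>
    0 <= snd (zz (lab u)) \<and> spider_dist (zz (lab u)) (us ! u) <= v"
    using result_balls[OF res] by blast
  then have zz: "r <= card {w. w < n \<and> lab w = lab u}"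
    "isfac fs (fac (lab u)) (zz (lab u)) \<and> 0 <= snd (zz (lab u)) \<and> spider_dist (zz (lab u)) (us ! u) <= v"
    if "u < n" for u using that by blast+
  let ?P = "clusters n lab"
  have P: "r_gather_clustering r us ?P" unfolding r_gather_clustering_def
  proof
    show "partition_on {..<n} ?P"
      by (rule partition_onI) (auto simp: clusters_def disjnt_def)
    show "\<forall>c\<in>?P. r <= card c" using zz(1) by (auto simp: clusters_def)
  qed
  have "clustering_cost us ?P <= 2 * v" unfolding clustering_cost_def
  proof (subst Max_le_iff)
    show "finite (cluster_diameter us ` ?P)" "cluster_diameter us ` ?P ~= {}" using ne by (auto simp: clusters_def)
    show "\<forall>a\<in>cluster_diameter us ` ?P. a <= 2 * v"
    proof
      fix a assume "a \<in> cluster_diameter us ` ?P"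
      then obtain u where u: "u < n" and a: "a = cluster_diameter us {j. j < n \<and> lab j = lab u}"
        by (auto simp: clusters_def)
      let ?A = "{j. j < n \<and> lab j = lab u}"
      have "spider_dist (us ! i) (us ! j) <= 2 * v" if "i \<in> ?A" "j \<in> ?A" for i j
        using zz(2)[of i] zz(2)[of j] that us_point[of i] us_point[of j]
          spider_dist_triangle[of "us ! i" "zz (lab u)" "us ! j"] spider_dist_sym[of "us ! i" "zz (lab u)"] by auto
      moreover have "finite {spider_dist (us ! i) (us ! j) |i j. i \<in> ?A \<and> j \<in> ?A}"
        by (rule finite_subset[of _ "(\<lambda>(i, j). spider_dist (us ! i) (us ! j)) ` (?A \<times> ?A)"]) auto
      ultimately show "a <= 2 * v" unfolding a cluster_diameter_def using u by (subst Max_le_iff) auto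
    qed
  qed
  moreover have "2 * v <= clustering_cost us P'" if P': "r_gather_clustering r us P'" for P'
  proof -
    obtain f z where "0 <= clustering_cost us P'" "solution (clustering_cost us P' / 2) f z"
      using clustering_solution[OF fs ne P'] by blast
    moreover have "\<And>c f z. 0 <= c ==> solution c f z ==> v <= c" using res unfolding result_def by blast
    ultimately have "v <= clustering_cost us P' / 2" by (metis divide_nonneg_pos zero_less_numeral)
    then show ?thesis by simp
  qed
  ultimately have le: "clustering_cost us ?P <= clustering_cost us P'" if "r_gather_clustering r us P'" for P'
    using that by (meson order_trans)
  show ?thesis unfolding optimal_clustering_def is_arg_min_def
    using P le by (meson not_less)
qed

lemma result_gathering:
  assumes fs: "fs ~= []" and ne: "us ~= []" and res: "result lab fac v" and \<pi>: "\<And>u. u < n ==> \<pi> u = fac (lab u)"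
  shows "optimal_gathering r us fs \<pi>"
proof -
  obtain zz where "\<forall>u<n. r <= card {w. w < n \<and> lab w = lab u} \<and> isfac fs (fac (lab u)) (zz (lab u)) \<and>
    0 <= snd (zz (lab u)) \<and> spider_dist (zz (lab u)) (us ! u) <= v"
    using result_balls[OF res] by blast
  then have zz: "r <= card {w. w < n \<and> lab w = lab u}"
    "isfac fs (fac (lab u)) (zz (lab u)) \<and> 0 <= snd (zz (lab u)) \<and> spider_dist (zz (lab u)) (us ! u) <= v"
    if "u < n" for u using that by blast+
  have f: "\<pi> u < m" "spider_dist (us ! u) (fs ! \<pi> u) <= v" if "u < n" for u
    using zz(2)[OF that] fs \<pi>[OF that] spider_dist_sym by (auto simp: isfac_def)
  have P: "r_gathering r us fs \<pi>" unfolding r_gathering_def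
  proof (intro conjI allI impI)
    show "\<pi> \<in> {..<n} \<rightarrow> {..<m}" using f by auto
    fix k assume "k < m"
    show "card {i \<in> {..<n}. \<pi> i = k} \<in> {0} \<union> {r..}"
    proof (cases "{i \<in> {..<n}. \<pi> i = k} = {}")
      case True then show ?thesis by (metis UnI1 card.empty singletonI)
    next
      case False
      then obtain u where u: "u < n" "\<pi> u = k" by auto
      \<comment> \<open>Several labels may share a facility; its users then form a union of label
        classes, each of size at least r.\<close>
      have "card {w. w < n \<and> lab w = lab u} <= card {i \<in> {..<n}. \<pi> i = k}"
        using \<pi> u by (intro card_mono) auto
      then show ?thesis using zz(1)[OF u(1)] by simp
    qed
  qed
  have "gathering_cost us fs \<pi> <= v" unfolding gathering_cost_def
    using ne f by (subst Max_le_iff) auto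
  moreover have "v <= gathering_cost us fs \<pi>'" if "r_gathering r us fs \<pi>'" for \<pi>'
    using gathering_solution[OF ne that] res unfolding result_def by blast
  ultimately have le: "gathering_cost us fs \<pi> <= gathering_cost us fs \<pi>'" if "r_gathering r us fs \<pi>'" for \<pi>'
    using that by (meson order_trans)
  show ?thesis unfolding optimal_gathering_def is_arg_min_def
    using P le by (meson not_less)
qed

lemma clustering_feasible:
  assumes "us ~= []"
  shows "(\<exists>P. r_gather_clustering r us P) \<longleftrightarrow> r <= n"
proof
  assume "\<exists>P. r_gather_clustering r us P"
  then obtain P where P: "partition_on {..<n} P" "\<And>c. c \<in> P ==> r <= card c" by (auto simp: r_gather_clustering_def)
  have "0 \<in> \<Union>P" using partition_onD1[OF P(1)] assms by auto
  then obtain c where c: "c \<in> P" by blast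
  then have "c \<subseteq> {..<n}" using partition_onD1[OF P(1)] by blast
  then have "card c <= n" using card_mono[of "{..<n}" c] by simp
  then show "r <= n" using P(2)[OF c] by simp
next
  assume "r <= n"
  then have "r_gather_clustering r us {{..<n}}"
    using assms by (auto simp: r_gather_clustering_def partition_on_def)
  then show "\<exists>P. r_gather_clustering r us P" by blast
qed

lemma gathering_feasible:
  assumes "us ~= []"
  shows "(\<exists>\<pi>. r_gathering r us fs \<pi>) \<longleftrightarrow> r <= n \<and> fs ~= []"
proof
  assume "\<exists>\<pi>. r_gathering r us fs \<pi>"
  then obtain \<pi> where \<pi>: "\<pi> \<in> {..<n} \<rightarrow> {..<m}" "\<forall>f<m. card {i \<in> {..<n}. \<pi> i = f} \<in> {0} \<union> {r..}"
    by (auto simp: r_gathering_def)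
  have 0: "0 < n" "\<pi> 0 < m" using assms \<pi>(1) by auto
  have "card {i \<in> {..<n}. \<pi> i = \<pi> 0} ~= 0" using 0 by auto
  then have "r <= card {i \<in> {..<n}. \<pi> i = \<pi> 0}" using \<pi>(2) 0(2) by auto
  also have "\<dots> <= n" using card_mono[of "{..<n}" "{i \<in> {..<n}. \<pi> i = \<pi> 0}"] by auto
  finally show "r <= n \<and> fs ~= []" using 0 by auto
next
  assume "r <= n \<and> fs ~= []"
  moreover have "card {i \<in> {..<n}. (0::nat) = f} \<in> {0} \<union> {r..}" if "r <= n" for f
    by (cases "f = 0") (use that in simp_all)
  ultimately have "r_gathering r us fs (\<lambda>_. 0)" by (simp add: r_gathering_def)
  then show "\<exists>\<pi>. r_gathering r us fs \<pi>" by blast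
qed

end

section \<open>Nearest facilities\<close>

abbreviation nadd (infixl "+n" 65) where "nadd \<equiv> NAdd"
abbreviation nsub (infixl "-n" 65) where "nsub \<equiv> NSub"
abbreviation radd (infixl "+r" 65) where "radd \<equiv> RAdd"
abbreviation rsub (infixl "-r" 65) where "rsub \<equiv> RSub"
abbreviation "N0 \<equiv> NLit 0"
abbreviation "N1 \<equiv> NLit 1"

definition fidx :: "nexp => nexp" where
  "fidx e = NGet ''fb'' (nv ''ql'') +n e"

text \<open>A query searches downwards from \<open>qp\<close>, first with stride \<open>q\<close> and then one by one. A sequence of queries that
  continue each other costs \<open>O(m)\<close> in total, and an isolated query costs \<open>O(m / q + q)\<close>, so that \<open>O(q)\<close> isolated
  queries are affordable.\<close>

definition near_jump :: prog where
  "near_jump = While (BAnd (NLe (nv ''q'') (nv ''qp'')) (RLe (rv ''qy'') (RGet ''F'' (fidx (nv ''qp'' -n nv ''q'')))))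
     (nset ''qp'' (nv ''qp'' -n nv ''q''))"

definition near_walk :: prog where
  "near_walk = While (BAnd (NLess N0 (nv ''qp'')) (RLe (rv ''qy'') (RGet ''F'' (fidx (nv ''qp'' -n N1)))))
     (nset ''qp'' (nv ''qp'' -n N1))"

text \<open>\<open>f0\<close> is a facility nearest to the center, and the value is the length of
  the way to it through the center. This overestimates the distance only if \<open>f0\<close> lies
  on the leg of the query, and then a neighbor of the query point is at least as close.\<close>

definition near_start :: prog where
  "near_start = (rset ''qd'' (rv ''qy'' +r RGet ''facility_pos'' (nv ''f0'')) ;; nset ''qf'' (nv ''f0''))"

definition near_right :: prog where
  "near_right = Cond (BAnd (NLess (nv ''qp'') (NGet ''fc'' (nv ''ql''))) (RLess (RGet ''F'' (fidx (nv ''qp'')) -r rv ''qy'') (rv ''qd'')))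
      (rset ''qd'' (RGet ''F'' (fidx (nv ''qp'')) -r rv ''qy'') ;; nset ''qf'' (NGet ''Fid'' (fidx (nv ''qp'')))) Skip"

definition near_left :: prog where
  "near_left = Cond (BAnd (NLess N0 (nv ''qp'')) (RLess (rv ''qy'' -r RGet ''F'' (fidx (nv ''qp'' -n N1))) (rv ''qd'')))
      (rset ''qd'' (rv ''qy'' -r RGet ''F'' (fidx (nv ''qp'' -n N1))) ;; nset ''qf'' (NGet ''Fid'' (fidx (nv ''qp'' -n N1)))) Skip"

definition near_pick :: prog where
  "near_pick = near_start ;; near_right ;; near_left"

definition near :: prog where
  "near = Cond (NLess N0 (nv ''m'')) (near_jump ;; near_walk ;; near_pick)
     (rset ''qd'' (RLit 0) ;; nset ''qf'' N0)"

lemma writes_near [simp]: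
  "nwrites near = {''qp'', ''qf''}" "rwrites near = {''qd''}"
  by (auto simp: near_def near_jump_def near_walk_def near_pick_def near_start_def near_right_def near_left_def)

context spider_problem begin

definition fcnt :: "nat => nat" where "fcnt l = length (legix fs m l)"
definition fid :: "nat => nat => nat" where "fid l i = legix fs m l ! i"
definition FX :: "nat => nat => real" where "FX l i = snd (fs ! fid l i)"

text \<open>Each leg owns \<open>n + 2\<close> entries: tables indexed by positions need entries up
  to \<open>n\<close>, and the table of choices \<open>e\<close> goes up to
  \<open>n + 1\<close>.\<close>

definition ubase :: "nat => nat" where "ubase l = l * (n + 2)"
definition fbase :: "nat => nat" where "fbase l = l * (m + 2)"
definition Kc :: nat where "Kc = 2 * r * (d + 1)"
text \<open>Of the order of the number of isolated queries: at most \<open>(d + 1) * Kc\<close>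
  users in the merged list, \<open>d + 1\<close> legs, and about \<open>Kc\<close> choices for
  each.\<close>

definition qc :: nat where "qc = (d + 1) * ((d + 1) * (Kc * Kc))"
text \<open>Plays the part of infinity: it exceeds the radius of the trivial solution and the
  distance of every user from the center.\<close>

definition big :: real where "big = 1 + fpos0 + total"

definition inp :: "state => bool" where
  "inp s \<longleftrightarrow> s$''d'' = d \<and> s$''r'' = r \<and> s$''n'' = n \<and> s$''m'' = m \<and>
    (\<forall>i<n. nats s ''user_leg'' i = fst (us ! i) \<and> reals s ''user_pos'' i = snd (us ! i)) \<and>
    (\<forall>i<m. nats s ''facility_leg'' i = fst (fs ! i) \<and> reals s ''facility_pos'' i = snd (fs ! i)) \<and>
    s$$''facility_pos'' = fpos0"

definition ctx :: "state => bool" where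
  "ctx s \<longleftrightarrow> inp s \<and> s$$''inf'' = big \<and> s$''K'' = Kc \<and> s$''q'' = qc \<and>
    s$''Dm'' = r * (d + 1) \<and>
    (\<forall>l\<le>d. nats s ''ub'' l = ubase l) \<and> (\<forall>l\<le>d. nats s ''fb'' l = fbase l) \<and>
    (\<forall>l\<le>d. nats s ''uc'' l = cnt l) \<and> (\<forall>l\<le>d. nats s ''fc'' l = fcnt l) \<and>
    (\<forall>l i. l <= d --> i < cnt l --> reals s ''X'' (ubase l + i) = X l i \<and> nats s ''U'' (ubase l + i) = uid l i) \<and>
    (\<forall>l i. l <= d --> i < fcnt l --> reals s ''F'' (fbase l + i) = FX l i \<and> nats s ''Fid'' (fbase l + i) = fid l i) \<and>
    (fs ~= [] --> s$''f0'' < m \<and> (\<forall>i<m. snd (fs ! s$''f0'') <= snd (fs ! i)))"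

abbreviation "ctxN \<equiv> {''d'', ''r'', ''n'', ''m'', ''user_leg'', ''facility_leg'', ''K'', ''q'', ''Dm'', ''ub'', ''fb'', ''uc'', ''fc'', ''U'', ''Fid'', ''f0''}"
abbreviation "ctxR \<equiv> {''user_pos'', ''facility_pos'', ''inf'', ''X'', ''F''}"

lemma ctx_cong: "(\<And>a. a \<in> ctxN ==> nats s' a = nats s a) ==> (\<And>a. a \<in> ctxR ==> reals s' a = reals s a) ==> ctx s' = ctx s"
  unfolding ctx_def inp_def by simp

lemma ctx_nupd [simp]: "a \<notin> ctxN ==> ctx (nupd a i x s) = ctx s"
  by (rule ctx_cong) auto

lemma ctx_rupd [simp]: "a \<notin> ctxR ==> ctx (rupd a i x s) = ctx s"
  by (rule ctx_cong) auto

lemma ctx_frame: "frame p s s' ==> nwrites p \<inter> ctxN = {} ==> rwrites p \<inter> ctxR = {} ==> ctx s' = ctx s"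
  by (rule ctx_cong) (auto simp: frame_def)

lemma ctxD:
  assumes "ctx s"
  shows "s$''d'' = d" "s$''r'' = r" "s$''n'' = n" "s$''m'' = m"
    "s$$''inf'' = big" "s$''K'' = Kc" "s$''q'' = qc" "s$''Dm'' = r * (d + 1)"
    "l <= d ==> nats s ''ub'' l = ubase l" "l <= d ==> nats s ''fb'' l = fbase l"
    "l <= d ==> nats s ''uc'' l = cnt l" "l <= d ==> nats s ''fc'' l = fcnt l"
    "l <= d ==> i < cnt l ==> reals s ''X'' (ubase l + i) = X l i"
    "l <= d ==> i < cnt l ==> nats s ''U'' (ubase l + i) = uid l i"
    "l <= d ==> i < fcnt l ==> reals s ''F'' (fbase l + i) = FX l i"
    "l <= d ==> i < fcnt l ==> nats s ''Fid'' (fbase l + i) = fid l i"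
  using assms unfolding ctx_def inp_def by simp_all

lemma ctx_f0: "ctx s ==> fs ~= [] ==> s$''f0'' < m \<and> reals s ''facility_pos'' (s$''f0'') = snd (fs ! s$''f0'') \<and>
    (\<forall>i<m. snd (fs ! s$''f0'') <= snd (fs ! i))"
  unfolding ctx_def inp_def by simp

lemma fid: "i < fcnt l ==> fid l i < m \<and> fst (fs ! fid l i) = l"
  using legix_nth[of i fs m l] by (simp add: fcnt_def fid_def)

lemma FX_mono: "i <= j ==> j < fcnt l ==> FX l i <= FX l j"
  using legix_mono[OF fs, of i j l] by (simp add: FX_def fid_def fcnt_def)

lemma fid_surj: "k < m ==> \<exists>i<fcnt (fst (fs ! k)). fid (fst (fs ! k)) i = k"
proof -
  assume "k < m"
  then have "k \<in> set (legix fs m (fst (fs ! k)))" by (simp add: set_legix)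
  then show ?thesis by (auto simp: in_set_conv_nth fcnt_def fid_def)
qed

lemma fcnt_le: "fcnt l <= m" unfolding fcnt_def by (rule length_legix)

lemma cnt_le: "cnt l <= n" unfolding cnt_def by (rule length_legix)

lemma Kc_pos: "1 <= Kc" using r1 by (simp add: Kc_def)

lemma qc_pos: "1 <= qc"
proof -
  have "0 < qc" using Kc_pos by (simp add: qc_def)
  then show ?thesis by simp
qed

lemma fdistI:
  assumes "fs ~= []" "k < m" "spider_dist (fs ! k) p <= x" "\<And>j. j < m ==> x <= spider_dist (fs ! j) p"
  shows "fdist fs p = x" "near_ok (isfac fs) k p"
proof -
  have "x = spider_dist (fs ! k) p" using assms(3) assms(4)[OF assms(2)] by simp
  moreover have "Min ((\<lambda>f. spider_dist f p) ` set fs) = spider_dist (fs ! k) p"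
  proof (rule Min_eqI)
    fix y assume "y \<in> (\<lambda>f. spider_dist f p) ` set fs"
    then obtain j where "j < m" "y = spider_dist (fs ! j) p" by (auto simp: in_set_conv_nth)
    then show "spider_dist (fs ! k) p <= y" using assms(4)[of j] assms(3) by simp
  qed (use assms(2) in auto)
  ultimately show d: "fdist fs p = x" using assms(1) by (simp add: fdist_def)
  show "near_ok (isfac fs) k p" unfolding near_ok_def
    using assms(2,3) d fs_point[of "fs ! k"] by (intro exI[of _ "fs ! k"]) (simp add: isfac_def)
qed

text \<open>A search position remains valid when \<open>y\<close> decreases, so the next query can
  resume where the last one stopped.\<close>

definition fac_above :: "nat => real => nat => bool" where
  "fac_above l y p \<longleftrightarrow> p <= fcnt l \<and> (\<forall>i. p <= i \<and> i < fcnt l --> y <= FX l i)"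

lemma fac_aboveI: "fac_above l y p ==> q < p ==> y <= FX l q ==> fac_above l y q"
  unfolding fac_above_def
proof (intro conjI allI impI)
  assume a: "p <= fcnt l \<and> (\<forall>i. p <= i \<and> i < fcnt l --> y <= FX l i)" "q < p" "y <= FX l q"
  show "q <= fcnt l" using a by simp
  show "y <= FX l i" if "q <= i \<and> i < fcnt l" for i
    using FX_mono[of q i l] that a(3) by linarith
qed

lemma ok_near_jump:
  assumes "ctx s" "s$''ql'' = l" "l <= d" "s$$''qy'' = y" "s$''qp'' = p" "fac_above l y p"
  shows "ok near_jump s (\<lambda>t s'. \<exists>k p'. s'$''qp'' = p' \<and> p = p' + k * qc \<and> fac_above l y p' \<and>
    (qc <= p' --> FX l (p' - qc) < y) \<and> t <= 60 * k + 60)"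
proof -
  let ?I = "\<lambda>s'. \<exists>k. p = s'$''qp'' + k * qc \<and> fac_above l y (s'$''qp'')"
  show ?thesis unfolding near_jump_def
  proof (rule ok_While[where I = ?I and \<Phi> = "\<lambda>s'. 60 * (s'$''qp'' div qc)"], goal_cases)
    case 1
    show ?case using assms by (auto intro: exI[of _ 0])
  next
    case (2 s')
    have c: "ctx s'" using ctx_frame[OF 2(2)] assms(1) by simp
    note fr = frameD[OF 2(2)]
    have q: "s'$''ql'' = l" "s'$$''qy'' = y" using fr assms by simp_all
    let ?p = "s'$''qp''"
    obtain k where k: "p = ?p + k * qc" "fac_above l y ?p" using 2(1) by blast
    have b1: "qc <= ?p" using 2(3) by (simp add: ctxD[OF c])
    have "?p - qc < fcnt l" using k(2) qc_pos b1 unfolding fac_above_def by linarith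
    note F = ctxD(15)[OF c assms(3) this]
    have b: "qc <= ?p" "y <= FX l (?p - qc)"
      using 2(3) F b1 assms(3) by (simp_all add: fidx_def ctxD[OF c] q)
    have "fac_above l y (?p - qc)" by (rule fac_aboveI[OF k(2)]) (use b qc_pos in auto)
    moreover have "p = (?p - qc) + Suc k * qc" using k(1) b by simp
    then have "\<exists>k. p = ?p - qc + k * qc" by blast
    moreover have "?p div qc = Suc ((?p - qc) div qc)" using b qc_pos by (simp add: le_div_geq)
    ultimately show ?case by (simp add: fidx_def ctxD(7)[OF c])
  next
    case (3 t s')
    have c: "ctx s'" using ctx_frame[OF 3(2)] assms(1) by simp
    note fr = frameD[OF 3(2)]
    have q: "s'$''ql'' = l" "s'$$''qy'' = y" using fr assms by simp_all
    let ?p = "s'$''qp''"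
    obtain k where k: "p = ?p + k * qc" "fac_above l y ?p" using 3(1) by blast
    have b: "FX l (?p - qc) < y" if "qc <= ?p"
    proof -
      have "?p - qc < fcnt l" using k(2) qc_pos that unfolding fac_above_def by linarith
      note F = ctxD(15)[OF c assms(3) this]
      show ?thesis using 3(3) F that assms(3) by (simp add: fidx_def ctxD[OF c] q)
    qed
    have "p div qc = ?p div qc + k" using k(1) qc_pos by simp
    then have "t <= 60 * k + 60" using 3(4) assms(5) by (simp add: fidx_def)
    then show ?case using k b by blast
  qed
qed

lemma ok_near_walk:
  assumes "ctx s" "s$''ql'' = l" "l <= d" "s$$''qy'' = y" "s$''qp'' = p" "fac_above l y p"
  shows "ok near_walk s (\<lambda>t s'. \<exists>p'. s'$''qp'' = p' \<and> p' <= p \<and> fac_above l y p' \<and>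
    (0 < p' --> FX l (p' - 1) < y) \<and> t <= 60 * (p - p') + 60)"
proof -
  let ?I = "\<lambda>s'. s'$''qp'' <= p \<and> fac_above l y (s'$''qp'')"
  show ?thesis unfolding near_walk_def
  proof (rule ok_While[where I = ?I and \<Phi> = "\<lambda>s'. 60 * s'$''qp''"], goal_cases)
    case 1
    show ?case using assms by simp
  next
    case (2 s')
    have c: "ctx s'" using ctx_frame[OF 2(2)] assms(1) by simp
    note fr = frameD[OF 2(2)]
    have q: "s'$''ql'' = l" "s'$$''qy'' = y" using fr assms by simp_all
    let ?p = "s'$''qp''"
    have b1: "1 <= ?p" using 2(3) by simp
    have "?p - 1 < fcnt l" using 2(1) b1 unfolding fac_above_def by linarith
    note F = ctxD(15)[OF c assms(3) this]
    have "y <= FX l (?p - 1)" using 2(3) F b1 assms(3) by (simp add: fidx_def ctxD[OF c] q)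
    then have "fac_above l y (?p - 1)" by (rule fac_aboveI[of l y ?p, rotated 2]) (use 2(1) b1 in simp_all)
    moreover have "60 * (?p - 1) + 60 = 60 * ?p" using b1 by linarith
    ultimately show ?case using 2(1) b1 by (simp add: fidx_def)
  next
    case (3 t s')
    have c: "ctx s'" using ctx_frame[OF 3(2)] assms(1) by simp
    note fr = frameD[OF 3(2)]
    have q: "s'$''ql'' = l" "s'$$''qy'' = y" using fr assms by simp_all
    let ?p = "s'$''qp''"
    have b: "FX l (?p - 1) < y" if "0 < ?p"
    proof -
      have "?p - 1 < fcnt l" using 3(1) that unfolding fac_above_def by linarith
      note F = ctxD(15)[OF c assms(3) this]
      show ?thesis using 3(3) F that assms(3) by (simp add: fidx_def ctxD[OF c] q)
    qed
    show ?case using 3(1,4) b assms(5) by (simp add: fidx_def)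
  qed
qed

text \<open>The shortest way to a facility either passes through the center or stays on the leg,
  where only the two neighbors of \<open>y\<close> matter.\<close>

lemma ok_near_pick:
  assumes c: "ctx s" and "s$''ql'' = l" "l <= d" "s$$''qy'' = y" "s$''qp'' = p" "fac_above l y p"
    and below: "0 < p --> FX l (p - 1) < y" and y: "0 <= y" and ne: "fs ~= []"
  shows "ok near_pick s (\<lambda>t s'. s'$$''qd'' = fdist fs (l, y) \<and> near_ok (isfac fs) (s'$''qf'') (l, y) \<and> t <= 200)"
proof -
  let ?f0 = "s$''f0''"
  note f0 = ctx_f0[OF c ne]
  have f0l: "fst (fs ! ?f0) < d" "0 <= snd (fs ! ?f0)" using fs_point[of "fs ! ?f0"] f0 by auto
  have F1: "reals s ''F'' (fbase l + p) = FX l p \<and> nats s ''Fid'' (fbase l + p) = fid l p" if "p < fcnt l"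
    using ctxD(15,16)[OF c assms(3) that] by simp
  have F2: "reals s ''F'' (fbase l + (p - 1)) = FX l (p - 1) \<and> nats s ''Fid'' (fbase l + (p - 1)) = fid l (p - 1)" if "0 < p"
  proof -
    have "p - 1 < fcnt l" using that assms(6) unfolding fac_above_def by linarith
    then show ?thesis using ctxD(15,16)[OF c assms(3)] by blast
  qed
  define x0 where "x0 = y + snd (fs ! ?f0)"
  define c1 where "c1 \<longleftrightarrow> p < fcnt l \<and> FX l p - y < x0"
  define x1 where "x1 = (if c1 then FX l p - y else x0)"
  define k1 where "k1 = (if c1 then fid l p else ?f0)"
  define c2 where "c2 \<longleftrightarrow> 0 < p \<and> y - FX l (p - 1) < x1"
  define x2 where "x2 = (if c2 then y - FX l (p - 1) else x1)"
  define k2 where "k2 = (if c2 then fid l (p - 1) else k1)"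
  have above: "y <= FX l i" if "p <= i" "i < fcnt l" for i using assms(6) that by (simp add: fac_above_def)
  have lt: "FX l i < y" if "i < p" for i
  proof -
    have "FX l i <= FX l (p - 1)" using that assms(6) by (intro FX_mono) (auto simp: fac_above_def)
    then show ?thesis using below that by auto
  qed
  have d0: "spider_dist (fs ! ?f0) (l, y) <= x0" using f0l y by (auto simp: spider_dist_def x0_def)
  have dF: "spider_dist (fs ! fid l i) (l, y) = \<bar>FX l i - y\<bar>" if "i < fcnt l" for i
    using fid[OF that] by (simp add: spider_dist_def FX_def)
  have k1: "k1 < m \<and> spider_dist (fs ! k1) (l, y) <= x1"
    using f0 d0 fid[of p l] dF[of p] above[of p] by (auto simp: k1_def x1_def c1_def)
  have pf: "p - 1 < fcnt l" if "0 < p" using assms(6) that unfolding fac_above_def by linarith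
  have k2: "k2 < m \<and> spider_dist (fs ! k2) (l, y) <= x2"
    using k1 fid[of "p - 1" l] dF[of "p - 1"] lt[of "p - 1"] pf by (auto simp: k2_def x2_def c2_def)
  have le: "x2 <= x1" "x1 <= x0" by (auto simp: x2_def x1_def c1_def c2_def)
  have low: "x2 <= spider_dist (fs ! j) (l, y)" if j: "j < m" for j
  proof (cases "fst (fs ! j) = l")
    case False
    then have "spider_dist (fs ! j) (l, y) = snd (fs ! j) + y" by (simp add: spider_dist_def)
    then show ?thesis using f0 j le by (auto simp: x0_def)
  next
    case True
    then obtain i where i: "i < fcnt l" "fid l i = j" using fid_surj[OF j] by blast
    have dj: "spider_dist (fs ! j) (l, y) = \<bar>FX l i - y\<bar>" using dF[OF i(1)] i(2) by simp
    show ?thesis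
    proof (cases "p <= i")
      case True
      have "FX l p <= FX l i" using FX_mono[OF True i(1)] .
      moreover have "x1 <= FX l p - y" using True i(1) by (auto simp: x1_def c1_def)
      ultimately show ?thesis using dj le by linarith
    next
      case False
      then have "FX l i <= FX l (p - 1)" using pf by (intro FX_mono) auto
      moreover have "x2 <= y - FX l (p - 1)" using False by (auto simp: x2_def c2_def)
      ultimately show ?thesis using dj by linarith
    qed
  qed
  have res: "fdist fs (l, y) = x2" "near_ok (isfac fs) k2 (l, y)"
    using fdistI[OF ne conjunct1[OF k2] conjunct2[OF k2] low] by auto
  have start: "ok near_start s (\<lambda>t s'. s'$$''qd'' = x0 \<and> s'$''qf'' = ?f0 \<and> t <= 20)"
    using f0 assms(4) by (simp add: near_start_def x0_def)
  have right: "ok near_right s' (\<lambda>t s'. s'$$''qd'' = x1 \<and> s'$''qf'' = k1 \<and> t <= 80)"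
    if s': "s'$$''qd'' = x0" "s'$''qf'' = ?f0" "frame near_start s s'" for s'
  proof -
    have c': "ctx s'" using ctx_frame[OF s'(3)] c by (simp add: near_start_def)
    have v: "s'$''ql'' = l" "s'$$''qy'' = y" "s'$''qp'' = p"
      using frameD[OF s'(3)] assms by (simp_all add: near_start_def)
    show ?thesis
    proof (cases "p < fcnt l")
      case True
      note F = ctxD(15,16)[OF c' assms(3) True]
      show ?thesis using True
        by (simp add: near_right_def fidx_def ctxD[OF c'] v F s' assms(3) x1_def k1_def c1_def)
    next
      case False
      then show ?thesis by (simp add: near_right_def fidx_def ctxD[OF c'] v s' assms(3) x1_def k1_def c1_def)
    qed
  qed
  have left: "ok near_left s' (\<lambda>t s'. s'$$''qd'' = x2 \<and> s'$''qf'' = k2 \<and> t <= 80)"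
    if s': "s'$$''qd'' = x1" "s'$''qf'' = k1" "ctx s'" "s'$''ql'' = l" "s'$$''qy'' = y" "s'$''qp'' = p" for s'
  proof (cases p)
    case 0
    then show ?thesis by (simp add: near_left_def fidx_def s' x2_def k2_def c2_def)
  next
    case (Suc p')
    then have "p' < fcnt l" using pf by simp
    note F = ctxD(15,16)[OF s'(3) assms(3) this]
    show ?thesis using Suc
      by (simp add: near_left_def fidx_def ctxD[OF s'(3)] F s' assms(3) x2_def k2_def c2_def)
  qed
  show ?thesis unfolding near_pick_def
  proof (rule ok_seq[OF start], rule ok_seq[OF right], goal_cases)
    case (4 t1 s1 t2 s2)
    have c1': "ctx s1" using ctx_frame[OF 4(2)] c by (simp add: near_start_def)
    have c2': "ctx s2" using ctx_frame[OF 4(4)] c1' by (simp add: near_right_def)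
    have v: "s2$''ql'' = l" "s2$$''qy'' = y" "s2$''qp'' = p"
      using frameD[OF 4(2)] frameD[OF 4(4)] assms by (simp_all add: near_start_def near_right_def)
    show ?case using 4(1,3) by (intro ok_conseq[OF left[OF _ _ c2' v]]) (simp_all add: res)
  qed blast+
qed

text \<open>Every query obeys both bounds. The first one telescopes over a descending sequence of
  queries, the second one serves the isolated queries.\<close>

definition near_time :: "nat => nat => nat" where
  "near_time p p' = min (120 * (p - p') + 400) (60 * (m div qc) + 60 * qc + 400)"

lemma ok_near:
  assumes c: "ctx s" and "s$''ql'' = l" "l <= d" "s$$''qy'' = y" "s$''qp'' = p" "fac_above l y p" "0 <= y"
  shows "ok near s (\<lambda>t s'. s'$$''qd'' = fdist fs (l, y) \<and> near_ok (isfac fs) (s'$''qf'') (l, y) \<and>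
    (\<exists>p'. s'$''qp'' = p' \<and> p' <= p \<and> fac_above l y p' \<and> t <= near_time p p'))"
proof (cases "fs = []")
  case True
  have "near_ok (isfac fs) 0 (l, y)" unfolding near_ok_def isfac_def
    using True assms(7) by (intro exI[of _ "(l, y)"]) (simp add: spider_dist_def fdist_def)
  moreover have "fdist fs (l, y) = 0" using True by (simp add: fdist_def)
  moreover have b: "\<not> bval (NLess N0 (nv ''m'')) s" using True by (simp add: ctxD[OF c])
  ultimately show ?thesis using assms(5,6) unfolding near_def ok_Cond_False[OF b]
    by (simp add: near_time_def)
next
  case False
  have "ok (near_jump ;; near_walk ;; near_pick) s (\<lambda>t s'. s'$$''qd'' = fdist fs (l, y) \<and> near_ok (isfac fs) (s'$''qf'') (l, y) \<and>
    (\<exists>p'. s'$''qp'' = p' \<and> p' <= p \<and> fac_above l y p' \<and> t + 5 <= near_time p p'))"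
  proof (rule ok_seq[OF ok_near_jump[OF assms(1-6)]])
    fix t1 s1
    assume "\<exists>k p'. s1$''qp'' = p' \<and> p = p' + k * qc \<and> fac_above l y p' \<and> (qc <= p' --> FX l (p' - qc) < y) \<and> t1 <= 60 * k + 60"
      and fr1: "frame near_jump s s1"
    then obtain k p1 where k: "s1$''qp'' = p1" "p = p1 + k * qc" "fac_above l y p1" "qc <= p1 --> FX l (p1 - qc) < y" "t1 <= 60 * k + 60"
      by blast
    have c1: "ctx s1" using ctx_frame[OF fr1] c by (simp add: near_jump_def)
    have q1: "s1$''ql'' = l" "s1$$''qy'' = y" using frameD[OF fr1] assms by (simp_all add: near_jump_def)
    show "ok (near_walk ;; near_pick) s1 (\<lambda>t' s'. s'$$''qd'' = fdist fs (l, y) \<and> near_ok (isfac fs) (s'$''qf'') (l, y) \<and>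
      (\<exists>p'. s'$''qp'' = p' \<and> p' <= p \<and> fac_above l y p' \<and> t1 + t' + 5 <= near_time p p'))"
    proof (rule ok_seq[OF ok_near_walk[OF c1 q1(1) assms(3) q1(2) k(1,3)]])
      fix t2 s2
      assume "\<exists>p'. s2$''qp'' = p' \<and> p' <= p1 \<and> fac_above l y p' \<and> (0 < p' --> FX l (p' - 1) < y) \<and> t2 <= 60 * (p1 - p') + 60"
        and fr2: "frame near_walk s1 s2"
      then obtain p2 where p2: "s2$''qp'' = p2" "p2 <= p1" "fac_above l y p2" "0 < p2 --> FX l (p2 - 1) < y" "t2 <= 60 * (p1 - p2) + 60"
        by (elim exE conjE) (rule that)
      have c2: "ctx s2" using ctx_frame[OF fr2] c1 by (simp add: near_walk_def)
      have q2: "s2$''ql'' = l" "s2$$''qy'' = y" using frameD[OF fr2] q1 by (simp_all add: near_walk_def)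
      \<comment> \<open>The jumps stopped because the facility one stride below is closer to the
        center than \<open>y\<close>; the walk cannot pass it.\<close>
      have "p1 - p2 <= qc"
      proof (rule ccontr)
        assume "\<not> p1 - p2 <= qc"
        then have "qc <= p1" "p2 <= p1 - qc" "p1 - qc < p1" using qc_pos by auto
        then show False using k(3,4) p2(3) unfolding fac_above_def by fastforce
      qed
      moreover have "k <= k * qc" using qc_pos by simp
      moreover have "k <= m div qc"
      proof -
        have "k * qc <= m" using k(2) assms(6) fcnt_le[of l] unfolding fac_above_def by linarith
        then show ?thesis using qc_pos by (simp add: less_eq_div_iff_mult_less_eq)
      qed
      ultimately have "t1 + t2 + 280 <= 60 * (m div qc) + 60 * qc + 400" "t1 + t2 + 280 <= 120 * (p - p2) + 400"
        using k(2,5) p2(2,5) by linarith+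
      then have bnd: "t1 + t2 + 280 <= near_time p p2" unfolding near_time_def by (intro min.boundedI)
      show "ok near_pick s2 (\<lambda>t' s'. s'$$''qd'' = fdist fs (l, y) \<and> near_ok (isfac fs) (s'$''qf'') (l, y) \<and>
        (\<exists>p'. s'$''qp'' = p' \<and> p' <= p \<and> fac_above l y p' \<and> t1 + (t2 + t') + 5 <= near_time p p'))"
      proof (rule ok_conseq[OF ok_near_pick[OF c2 q2(1) assms(3) q2(2) p2(1,3,4) assms(7) False]])
        fix t :: nat and s' assume a: "s'$$''qd'' = fdist fs (l, y) \<and> near_ok (isfac fs) (s'$''qf'') (l, y) \<and> t <= 200"
          and fr: "frame near_pick s2 s'"
        have "s'$''qp'' = p2" using frameD(1)[OF fr, of "''qp''"] p2(1)
          by (simp add: near_pick_def near_start_def near_right_def near_left_def)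
        then show "s'$$''qd'' = fdist fs (l, y) \<and> near_ok (isfac fs) (s'$''qf'') (l, y) \<and>
          (\<exists>p'. s'$''qp'' = p' \<and> p' <= p \<and> fac_above l y p' \<and> t1 + (t2 + t) + 5 <= near_time p p')"
          using a bnd p2 k(2) by auto
      qed
    qed
  qed
  note search = this
  have b: "bval (NLess N0 (nv ''m'')) s" using False by (simp add: ctxD[OF c])
  show ?thesis unfolding near_def ok_Cond_True[OF b]
    by (rule ok_conseq[OF search]) auto
qed

end

section \<open>Distributing the input over the legs\<close>

lemma index_inj:
  fixes W :: nat
  assumes "i < W" "i' < W"
  shows "l * W + i = l' * W + i' \<longleftrightarrow> l = l' \<and> i = i'"
proof
  assume eq: "l * W + i = l' * W + i'"
  have "(l * W + i) div W = l" "(l' * W + i') div W = l'" using assms by (simp_all add: div_mult_self3)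
  then show "l = l' \<and> i = i'" using eq by simp
qed simp

text \<open>A product of natural numbers is read off from a table of multiples built by repeated
  addition.\<close>

definition table :: "array => nexp => nexp => prog" where
  "table a len st = (NSet a N0 N0 ;; For ''ti'' len (NSet a (nv ''ti'' +n N1) (NGet a (nv ''ti'') +n st)))"

lemma writes_table [simp]: "nwrites (table a len st) = {a, ''ti''}" "rwrites (table a len st) = {}"
  by (auto simp: table_def)

lemma ok_table:
  assumes a: "a ~= ''ti''"
    and inv: "\<And>s'. (\<And>b. b ~= a ==> b ~= ''ti'' ==> nats s' b = nats s b) ==> nval len s' = L \<and> nval st s' = W"
  shows "ok (table a len st) s (\<lambda>t s'. (\<forall>i\<le>L. nats s' a i = i * W) \<and> t <= L * (ncost len + ncost st + 30) + ncost len + 30)"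
proof -
  have "ok (For ''ti'' len (NSet a (nv ''ti'' +n N1) (NGet a (nv ''ti'') +n st))) (nupd a 0 0 s)
    (\<lambda>t s'. (\<forall>i\<le>L. nats s' a i = i * W) \<and> t <= L * (ncost len + ncost st + 30) + ncost len + 20)"
  proof (rule ok_For[where I = "\<lambda>k s'. \<forall>i\<le>k. nats s' a i = i * W" and N = L and c = "ncost st + 20"], goal_cases)
    case 1
    show ?case using a by simp
  next
    case 2
    show ?case using a by simp
  next
    case (3 k s')
    have "\<And>b. b ~= a ==> b ~= ''ti'' ==> nats s' b = nats s b" using frameD(1)[OF 3(3)] by simp
    then show ?case using inv by blast
  next
    case (4 k s')
    have "\<And>b. b ~= a ==> b ~= ''ti'' ==> nats s' b = nats s b" using frameD(1)[OF 4(3)] by simp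
    then have st: "nval st s' = W" using inv by blast
    show ?case using 4(2,4) a by (auto simp: st le_Suc_eq)
  next
    case (5 t s')
    then show ?case by (simp add: algebra_simps)
  qed
  then show ?thesis unfolding table_def ok_Seq ok_NSet
    by (simp only: nval.simps) (rule ok_conseq, assumption, simp)
qed

text \<open>The distribution is stable: points of one leg keep their order in the input and thus
  remain sorted by distance.\<close>

definition bucket :: "array => array => array => array => array => array => array => prog" where
  "bucket num leg pos base ct xs ix = For ''bi'' (nv num) (
     nset ''bx'' (NGet base (NGet leg (nv ''bi'')) +n NGet ct (NGet leg (nv ''bi''))) ;;
     RSet xs (nv ''bx'') (RGet pos (nv ''bi'')) ;;
     NSet ix (nv ''bx'') (nv ''bi'') ;;
     NSet ct (NGet leg (nv ''bi'')) (NGet ct (NGet leg (nv ''bi'')) +n N1))"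

lemma writes_bucket [simp]:
  "nwrites (bucket num leg pos base ct xs ix) = {''bi'', ''bx'', ix, ct}" "rwrites (bucket num leg pos base ct xs ix) = {xs}"
  by (auto simp: bucket_def)

lemma ok_bucket:
  assumes names: "distinct [''bi'', ''bx'', num, leg, base, ct, ix]" "xs ~= pos"
    and len: "nats s num 0 = length ps"
    and pts: "\<And>i. i < length ps ==> nats s leg i = fst (ps ! i) \<and> reals s pos i = snd (ps ! i) \<and> fst (ps ! i) <= d"
    and base: "\<And>l. l <= d ==> nats s base l = l * (length ps + 2)"
    and ct: "\<And>l. nats s ct l = 0"
  shows "ok (bucket num leg pos base ct xs ix) s (\<lambda>t s'. (\<forall>l. nats s' ct l = length (legix ps (length ps) l)) \<and>
    (\<forall>l i. l <= d --> i < length (legix ps (length ps) l) -->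
      reals s' xs (l * (length ps + 2) + i) = snd (ps ! (legix ps (length ps) l ! i)) \<and>
      nats s' ix (l * (length ps + 2) + i) = legix ps (length ps) l ! i) \<and> t <= 60 * length ps + 60)"
proof -
  let ?n = "length ps"
  have ne: "ct ~= ''bi'' \<and> ct ~= ''bx'' \<and> ct ~= ix \<and> ix ~= ct \<and> ix ~= ''bi'' \<and> ix ~= ''bx'' \<and> leg ~= ''bi'' \<and> leg ~= ''bx'' \<and>
    leg ~= ix \<and> leg ~= ct \<and> base ~= ''bi'' \<and> base ~= ''bx'' \<and> base ~= ix \<and> base ~= ct \<and> num ~= ''bi'' \<and> num ~= ''bx'' \<and>
    num ~= ix \<and> num ~= ct \<and> pos ~= xs \<and> ''bi'' ~= ct \<and> ''bi'' ~= ix \<and> ''bx'' ~= ct \<and> ''bx'' ~= ix" using names by auto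
  define A where "A l i = l * (?n + 2) + i" for l i
  define I where "I k s' \<longleftrightarrow> (\<forall>l. nats s' ct l = length (legix ps k l)) \<and>
    (\<forall>l i. l <= d --> i < length (legix ps k l) -->
      reals s' xs (A l i) = snd (ps ! (legix ps k l ! i)) \<and> nats s' ix (A l i) = legix ps k l ! i)" for k and s' :: state
  show ?thesis unfolding bucket_def
  proof (rule ok_For[where I = I and N = ?n and c = 35], goal_cases)
    case 1
    show ?case using ct ne by (auto simp: I_def)
  next
    case 2
    show ?case using ne by auto
  next
    case (3 k s')
    show ?case using frameD(1)[OF 3(3), of num] ne len by auto
  next
    case (4 k s')
    have fr: "nats s' leg = nats s leg" "nats s' base = nats s base" "reals s' pos = reals s pos"
      using frameD[OF 4(3)] ne by auto
    let ?l = "fst (ps ! k)"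
    have l: "?l <= d" "nats s' leg k = ?l" "reals s' pos k = snd (ps ! k)" using pts[OF 4(1)] fr by auto
    have b: "nats s' base ?l + length (legix ps k ?l) = A ?l (length (legix ps k ?l))"
      using base[OF l(1)] fr unfolding A_def by simp
    have c: "nats s' ct l = length (legix ps k l)" for l using 4(2) by (simp add: I_def)
    let ?j = "length (legix ps k ?l)"
    have jn: "?j < ?n + 2" using length_legix[of ps k ?l] 4(1) by simp
    let ?s = "nupd ''bi'' 0 (Suc k) (nupd ct ?l (?j + 1) (nupd ix (A ?l ?j) k (rupd xs (A ?l ?j) (snd (ps ! k)) (nupd ''bx'' 0 (A ?l ?j) s'))))"
    have "I (Suc k) ?s" unfolding I_def
    proof (intro conjI allI impI)
      show "nats ?s ct l = length (legix ps (Suc k) l)" for l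
        using c[of l] ne by (auto simp: legix_Suc)
      fix l i assume li: "l <= d" "i < length (legix ps (Suc k) l)"
      have iN: "i < ?n + 2" using li(2) length_legix[of ps "Suc k" l] 4(1) by simp
      have eq: "A l i = A ?l ?j \<longleftrightarrow> l = ?l \<and> i = ?j" unfolding A_def by (rule index_inj[OF iN jn])
      have r: "reals ?s xs (A l i) = (if l = ?l \<and> i = ?j then snd (ps ! k) else reals s' xs (A l i))"
        using eq by simp
      have n: "nats ?s ix (A l i) = (if l = ?l \<and> i = ?j then k else nats s' ix (A l i))"
        using eq ne by simp
      have E: "(if l = ?l \<and> i = ?j then snd (ps ! k) else reals s' xs (A l i)) = snd (ps ! (legix ps (Suc k) l ! i)) \<and>
        (if l = ?l \<and> i = ?j then k else nats s' ix (A l i)) = legix ps (Suc k) l ! i"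
      proof (cases "l = ?l \<and> i = ?j")
        case True
        have "(legix ps k l @ [k]) ! length (legix ps k l) = k" by (rule nth_append_length)
        then have "legix ps (Suc k) l ! i = k" using True unfolding legix_Suc by simp
        then show ?thesis using True by simp
      next
        case False
        have "i < length (legix ps k l) + (if ?l = l then 1 else 0)" using li(2) unfolding legix_Suc by (cases "?l = l") simp_all
        then have i: "i < length (legix ps k l)" using False by (cases "?l = l") auto
        then have "legix ps (Suc k) l ! i = legix ps k l ! i" unfolding legix_Suc by (rule nth_append_left)
        moreover have "reals s' xs (A l i) = snd (ps ! (legix ps k l ! i)) \<and> nats s' ix (A l i) = legix ps k l ! i"
          using 4(2) li(1) i unfolding I_def by blast
        ultimately show ?thesis using False by (simp only: if_False simp_thms)
      qed
      show "reals ?s xs (A l i) = snd (ps ! (legix ps (Suc k) l ! i))"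
        by (rule trans[OF r conjunct1[OF E]])
      show "nats ?s ix (A l i) = legix ps (Suc k) l ! i"
        by (rule trans[OF n conjunct2[OF E]])
    qed
    then show ?case using 4(4) l b c ne by simp
  next
    case (5 t s')
    then show ?case by (simp add: I_def A_def)
  qed
qed

text \<open>Without facilities, the entry read at the start is the initial 0, in agreement with
  \<open>fpos0\<close>.\<close>

definition sum_pos :: prog where
  "sum_pos = rset ''inf'' (RLit 1 +r RGet ''facility_pos'' N0) ;;
     For ''bi'' (nv ''n'') (rset ''inf'' (rv ''inf'' +r RGet ''user_pos'' (nv ''bi'')))"

definition nearest0 :: prog where
  "nearest0 = nset ''f0'' N0 ;; For ''bi'' (nv ''m'')
     (Cond (RLess (RGet ''facility_pos'' (nv ''bi'')) (RGet ''facility_pos'' (nv ''f0''))) (nset ''f0'' (nv ''bi'')) Skip)"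

text \<open>Each table used for a product has \<open>K\<close> or \<open>d + 1\<close> steps, and
  its increment is a previously computed factor. So even the fourth-order product \<open>q\<close>
  costs only O(K + d).\<close>

definition prelude :: prog where
  "prelude = sum_pos ;; nearest0 ;;
    table ''ub'' (nv ''d'') (nv ''n'' +n NLit 2) ;;
    table ''fb'' (nv ''d'') (nv ''m'' +n NLit 2) ;;
    table ''kt'' (nv ''d'' +n N1) (nv ''r'' +n nv ''r'') ;; nset ''K'' (NGet ''kt'' (nv ''d'' +n N1)) ;;
    table ''dt'' (nv ''d'' +n N1) (nv ''r'') ;; nset ''Dm'' (NGet ''dt'' (nv ''d'' +n N1)) ;;
    table ''t1'' (nv ''K'') (nv ''K'') ;; nset ''k2'' (NGet ''t1'' (nv ''K'')) ;;
    table ''t2'' (nv ''d'' +n N1) (nv ''k2'') ;; nset ''k3'' (NGet ''t2'' (nv ''d'' +n N1)) ;;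
    table ''t3'' (nv ''d'' +n N1) (nv ''k3'') ;; nset ''q'' (NGet ''t3'' (nv ''d'' +n N1)) ;;
    bucket ''n'' ''user_leg'' ''user_pos'' ''ub'' ''uc'' ''X'' ''U'' ;;
    bucket ''m'' ''facility_leg'' ''facility_pos'' ''fb'' ''fc'' ''F'' ''Fid''"

context spider_problem begin

lemma ok_sum_pos:
  assumes "inp s"
  shows "ok sum_pos s (\<lambda>t s'. s'$$''inf'' = big \<and> t <= 30 * n + 30)"
proof -
  show ?thesis unfolding sum_pos_def ok_Seq ok_RSet
  proof (rule ok_For[where I = "\<lambda>k s'. s'$$''inf'' = 1 + fpos0 + (\<Sum>u<k. snd (us ! u))" and N = n and c = 10], goal_cases)
    case 1
    show ?case using assms by (simp add: inp_def)
  next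
    case 2
    show ?case by simp
  next
    case (3 k s')
    show ?case using frameD(1)[OF 3(3), of "''n''"] assms by (simp add: inp_def)
  next
    case (4 k s')
    have "reals s' ''user_pos'' k = snd (us ! k)"
      using frameD(2)[OF 4(3), of "''user_pos''"] assms 4(1) by (simp add: inp_def)
    then show ?case using 4(2,4) by simp
  next
    case (5 t s')
    then show ?case by (simp add: big_def total_def)
  qed
qed

lemma ok_nearest0:
  assumes "inp s"
  shows "ok nearest0 s (\<lambda>t s'. (fs ~= [] --> s'$''f0'' < m \<and> (\<forall>i<m. snd (fs ! s'$''f0'') <= snd (fs ! i))) \<and> t <= 40 * m + 30)"
proof -
  define I where "I k s' \<longleftrightarrow> (s'$''f0'' = 0 \<or> s'$''f0'' < k) \<and> (\<forall>i<k. snd (fs ! s'$''f0'') <= snd (fs ! i))" for k and s' :: state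
  show ?thesis unfolding nearest0_def ok_Seq ok_NSet
  proof (rule ok_For[where I = I and N = m and c = 20], goal_cases)
    case 1
    show ?case by (simp add: I_def)
  next
    case 2
    show ?case by simp
  next
    case (3 k s')
    show ?case using frameD(1)[OF 3(3), of "''m''"] assms by (simp add: inp_def)
  next
    case (4 k s')
    have fp: "reals s' ''facility_pos'' i = snd (fs ! i)" if "i < m" for i
      using frameD(2)[OF 4(3), of "''facility_pos''"] assms that by (simp add: inp_def)
    let ?f = "s'$''f0''"
    have "?f < m" using 4(1,2) by (auto simp: I_def)
    note f = fp[OF this] fp[OF 4(1)]
    show ?case
    proof (cases "snd (fs ! k) < snd (fs ! ?f)")
      case True
      have "snd (fs ! k) <= snd (fs ! i)" if "i < Suc k" for i
      proof (cases "i = k")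
        case False
        then have "snd (fs ! ?f) <= snd (fs ! i)" using that 4(2) unfolding I_def by simp
        then show ?thesis using True by simp
      qed simp
      then show ?thesis using True 4(4) f by (simp add: I_def)
    next
      case False
      have "snd (fs ! ?f) <= snd (fs ! i)" if "i < Suc k" for i
        using that 4(2) False unfolding I_def by (cases "i = k") auto
      moreover have "?f = 0 \<or> ?f < Suc k" using 4(2) unfolding I_def by auto
      ultimately show ?thesis using False 4(4) f by (simp add: I_def)
    qed
  next
    case (5 t s')
    then show ?case by (auto simp: I_def)
  qed
qed

lemma writes_sum_pos [simp]: "nwrites sum_pos = {''bi''}" "rwrites sum_pos = {''inf''}"
  by (auto simp: sum_pos_def)

lemma writes_nearest0 [simp]: "nwrites nearest0 = {''f0'', ''bi''}" "rwrites nearest0 = {}"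
  by (auto simp: nearest0_def)

definition prelude_time :: nat where
  "prelude_time = 100 * n + 100 * m + 100 * Kc + 400 * d + 2000"

lemma inpD: "inp s ==> s$''d'' = d" "inp s ==> s$''r'' = r" "inp s ==> s$''n'' = n" "inp s ==> s$''m'' = m"
  by (simp_all add: inp_def)

text \<open>The conjuncts on \<open>''uc''\<close> and \<open>''fc''\<close> say that the counters
  of a bucket pass are still zero before it starts, as \<open>ok_bucket\<close> requires.\<close>

definition stage :: "nat => state => bool" where
  "stage k s \<longleftrightarrow> inp s \<and> (1 <= k --> s$$''inf'' = big) \<and>
    (2 <= k --> fs ~= [] --> s$''f0'' < m \<and> (\<forall>i<m. snd (fs ! s$''f0'') <= snd (fs ! i))) \<and>
    (3 <= k --> (\<forall>l\<le>d. nats s ''ub'' l = l * (n + 2))) \<and>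
    (4 <= k --> (\<forall>l\<le>d. nats s ''fb'' l = l * (m + 2))) \<and>
    (5 <= k --> s$''K'' = Kc) \<and> (6 <= k --> s$''Dm'' = r * (d + 1)) \<and>
    (7 <= k --> s$''k2'' = Kc * Kc) \<and> (8 <= k --> s$''k3'' = (d + 1) * (Kc * Kc)) \<and>
    (9 <= k --> s$''q'' = qc) \<and>
    (10 <= k --> (\<forall>l. nats s ''uc'' l = cnt l) \<and> (\<forall>l i. l <= d --> i < cnt l -->
      reals s ''X'' (l * (n + 2) + i) = X l i \<and> nats s ''U'' (l * (n + 2) + i) = uid l i)) \<and>
    (11 <= k --> (\<forall>l. nats s ''fc'' l = fcnt l) \<and> (\<forall>l i. l <= d --> i < fcnt l -->
      reals s ''F'' (l * (m + 2) + i) = FX l i \<and> nats s ''Fid'' (l * (m + 2) + i) = fid l i)) \<and>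
    (k < 10 --> nats s ''uc'' = (\<lambda>_. 0)) \<and> (k < 11 --> nats s ''fc'' = (\<lambda>_. 0))"

lemma stage_inp: "stage k s ==> inp s" by (simp add: stage_def)

lemma stage_step1:
  assumes "stage 0 s"
  shows "ok sum_pos s (\<lambda>t s'. stage 1 s' \<and> t <= 30 * n + 30)"
proof (rule ok_conseq[OF ok_sum_pos[OF stage_inp[OF assms]]])
  fix t :: nat and s' assume "s'$$''inf'' = big \<and> t <= 30 * n + 30" and f: "frame sum_pos s s'"
  then show "stage 1 s' \<and> t <= 30 * n + 30" using assms unfolding stage_def inp_def
    by (simp add: frameD[OF f])
qed

lemma stage_step2:
  assumes "stage 1 s"
  shows "ok nearest0 s (\<lambda>t s'. stage 2 s' \<and> t <= 40 * m + 30)"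
proof (rule ok_conseq[OF ok_nearest0[OF stage_inp[OF assms]]])
  fix t :: nat and s'
  assume *: "(fs ~= [] --> s'$''f0'' < m \<and> (\<forall>i<m. snd (fs ! s'$''f0'') <= snd (fs ! i))) \<and> t <= 40 * m + 30"
    and f: "frame nearest0 s s'"
  have "stage 2 s'" using assms conjunct1[OF *] unfolding stage_def inp_def
    by (simp add: frameD[OF f])
  then show "stage 2 s' \<and> t <= 40 * m + 30" using * by simp
qed

lemma stage_step3:
  assumes "stage 2 s"
  shows "ok (table ''ub'' (nv ''d'') (nv ''n'' +n NLit 2)) s (\<lambda>t s'. stage 3 s' \<and> t <= 40 * d + 40)"
proof (rule ok_conseq[OF ok_table[where L = d and W = "n + 2"]])
  fix s' :: state assume "\<And>b. b ~= ''ub'' ==> b ~= ''ti'' ==> nats s' b = nats s b"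
  then show "nval (nv ''d'') s' = d \<and> nval (nv ''n'' +n NLit 2) s' = n + 2" using inpD[OF stage_inp[OF assms]] by simp
next
  fix t :: nat and s'
  assume *: "(\<forall>i\<le>d. nats s' ''ub'' i = i * (n + 2)) \<and> t <= d * (ncost (nv ''d'') + ncost (nv ''n'' +n NLit 2) + 30) + ncost (nv ''d'') + 30"
    and f: "frame (table ''ub'' (nv ''d'') (nv ''n'' +n NLit 2)) s s'"
  have "stage 3 s'" using assms conjunct1[OF *] unfolding stage_def inp_def
    by (simp add: frameD[OF f])
  then show "stage 3 s' \<and> t <= 40 * d + 40" using * by simp
qed simp

lemma stage_step4:
  assumes "stage 3 s"
  shows "ok (table ''fb'' (nv ''d'') (nv ''m'' +n NLit 2)) s (\<lambda>t s'. stage 4 s' \<and> t <= 40 * d + 40)"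
proof (rule ok_conseq[OF ok_table[where L = d and W = "m + 2"]])
  fix s' :: state assume "\<And>b. b ~= ''fb'' ==> b ~= ''ti'' ==> nats s' b = nats s b"
  then show "nval (nv ''d'') s' = d \<and> nval (nv ''m'' +n NLit 2) s' = m + 2" using inpD[OF stage_inp[OF assms]] by simp
next
  fix t :: nat and s'
  assume *: "(\<forall>i\<le>d. nats s' ''fb'' i = i * (m + 2)) \<and> t <= d * (ncost (nv ''d'') + ncost (nv ''m'' +n NLit 2) + 30) + ncost (nv ''d'') + 30"
    and f: "frame (table ''fb'' (nv ''d'') (nv ''m'' +n NLit 2)) s s'"
  have "stage 4 s'" using assms conjunct1[OF *] unfolding stage_def inp_def
    by (simp add: frameD[OF f])
  then show "stage 4 s' \<and> t <= 40 * d + 40" using * by simp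
qed simp

lemma ok_table_set:
  assumes names: "a ~= ''ti''" "x ~= ''ti''" "x ~= a"
    and inv: "\<And>s'. (\<And>b. b ~= a ==> b ~= ''ti'' ==> nats s' b = nats s b) ==> nval e s' = L \<and> nval st s' = W"
    and c: "ncost e <= 4" "ncost st <= 5"
  shows "ok (table a e st ;; nset x (NGet a e)) s (\<lambda>t s'. nats s' x 0 = L * W \<and>
    (\<forall>b. b ~= a --> b ~= x --> b ~= ''ti'' --> nats s' b = nats s b) \<and> reals s' = reals s \<and> t <= L * 40 + 60)"
proof (rule ok_seq[OF ok_table[OF names(1) inv]])
  fix t :: nat and s' assume *: "(\<forall>i\<le>L. nats s' a i = i * W) \<and> t <= L * (ncost e + ncost st + 30) + ncost e + 30"
    and f: "frame (table a e st) s s'"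
  have e: "nval e s' = L" using inv[of s'] frameD(1)[OF f] by simp
  have "t <= L * 40 + 40" using * c mult_le_mono2[of "ncost e + ncost st + 30" 40 L] by linarith
  moreover have "reals s' = reals s" by (rule ext) (simp add: frameD(2)[OF f])
  ultimately show "ok (nset x (NGet a e)) s' (\<lambda>t' s'. nats s' x 0 = L * W \<and>
    (\<forall>b. b ~= a --> b ~= x --> b ~= ''ti'' --> nats s' b = nats s b) \<and> reals s' = reals s \<and> t + t' <= L * 40 + 60)"
    using * c e names frameD(1)[OF f] by simp
qed

lemma stage_step5:
  assumes "stage 4 s"
  shows "ok (table ''kt'' (nv ''d'' +n N1) (nv ''r'' +n nv ''r'') ;; nset ''K'' (NGet ''kt'' (nv ''d'' +n N1))) s
    (\<lambda>t s'. stage 5 s' \<and> t <= 40 * d + 100)"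
proof (rule ok_conseq[OF ok_table_set[where L = "d + 1" and W = "r + r"]], goal_cases)
  case (4 s')
  then show ?case using inpD[OF stage_inp[OF assms]] by simp
next
  case (7 t s')
  have "(d + 1) * (r + r) = Kc" by (simp add: Kc_def)
  then show ?case using assms 7(1) unfolding stage_def inp_def by simp
qed simp_all

lemma stage_step6:
  assumes "stage 5 s"
  shows "ok (table ''dt'' (nv ''d'' +n N1) (nv ''r'') ;; nset ''Dm'' (NGet ''dt'' (nv ''d'' +n N1))) s
    (\<lambda>t s'. stage 6 s' \<and> t <= 40 * d + 100)"
proof (rule ok_conseq[OF ok_table_set[where L = "d + 1" and W = "r"]], goal_cases)
  case (4 s')
  then show ?case using inpD[OF stage_inp[OF assms]] by simp
next
  case (7 t s')
  then show ?case using assms unfolding stage_def inp_def by simp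
qed simp_all

lemma stage_step7:
  assumes "stage 6 s"
  shows "ok (table ''t1'' (nv ''K'') (nv ''K'') ;; nset ''k2'' (NGet ''t1'' (nv ''K''))) s
    (\<lambda>t s'. stage 7 s' \<and> t <= 40 * Kc + 100)"
proof (rule ok_conseq[OF ok_table_set[where L = Kc and W = Kc]], goal_cases)
  case (4 s')
  then show ?case using assms by (simp add: stage_def)
next
  case (7 t s')
  then show ?case using assms unfolding stage_def inp_def by simp
qed simp_all

lemma stage_step8:
  assumes "stage 7 s"
  shows "ok (table ''t2'' (nv ''d'' +n N1) (nv ''k2'') ;; nset ''k3'' (NGet ''t2'' (nv ''d'' +n N1))) s
    (\<lambda>t s'. stage 8 s' \<and> t <= 40 * d + 100)"
proof (rule ok_conseq[OF ok_table_set[where L = "d + 1" and W = "Kc * Kc"]], goal_cases)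
  case (4 s')
  then show ?case using inpD[OF stage_inp[OF assms]] assms by (simp add: stage_def)
next
  case (7 t s')
  then show ?case using assms unfolding stage_def inp_def by simp
qed simp_all

lemma stage_step9:
  assumes "stage 8 s"
  shows "ok (table ''t3'' (nv ''d'' +n N1) (nv ''k3'') ;; nset ''q'' (NGet ''t3'' (nv ''d'' +n N1))) s
    (\<lambda>t s'. stage 9 s' \<and> t <= 40 * d + 100)"
proof (rule ok_conseq[OF ok_table_set[where L = "d + 1" and W = "(d + 1) * (Kc * Kc)"]], goal_cases)
  case (4 s')
  then show ?case using inpD[OF stage_inp[OF assms]] assms by (simp add: stage_def)
next
  case (7 t s')
  have "(d + 1) * ((d + 1) * (Kc * Kc)) = qc" by (simp add: qc_def)
  then show ?case using assms 7(1) unfolding stage_def inp_def by simp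
qed simp_all

lemma stage_step10:
  assumes s: "stage 9 s"
  shows "ok (bucket ''n'' ''user_leg'' ''user_pos'' ''ub'' ''uc'' ''X'' ''U'') s (\<lambda>t s'. stage 10 s' \<and> t <= 60 * n + 60)"
proof (rule ok_conseq[OF ok_bucket[where ps = us and d = d]], goal_cases)
  case (3)
  show ?case using inpD[OF stage_inp[OF s]] by simp
next
  case (4 i)
  then show ?case using stage_inp[OF s] us_point[OF 4] by (simp add: inp_def)
next
  case (5 l)
  then show ?case using s by (simp add: stage_def)
next
  case (6 l)
  then show ?case using s by (simp add: stage_def)
next
  case (7 t s')
  have "stage 10 s'" using s 7(1) unfolding stage_def inp_def
    by (simp add: frameD[OF 7(2)] cnt_def X_def uid_def)
  then show ?case using 7(1) by simp
qed simp_all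

lemma stage_step11:
  assumes s: "stage 10 s"
  shows "ok (bucket ''m'' ''facility_leg'' ''facility_pos'' ''fb'' ''fc'' ''F'' ''Fid'') s (\<lambda>t s'. stage 11 s' \<and> t <= 60 * m + 60)"
proof (rule ok_conseq[OF ok_bucket[where ps = fs and d = d]], goal_cases)
  case (3)
  show ?case using inpD[OF stage_inp[OF s]] by simp
next
  case (4 i)
  then show ?case using stage_inp[OF s] fs_point[of "fs ! i"] by (simp add: inp_def less_imp_le)
next
  case (5 l)
  then show ?case using s by (simp add: stage_def)
next
  case (6 l)
  then show ?case using s by (simp add: stage_def)
next
  case (7 t s')
  have "stage 11 s'" using s 7(1) unfolding stage_def inp_def
    by (simp add: frameD[OF 7(2)] fcnt_def FX_def fid_def)
  then show ?case using 7(1) by simp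
qed simp_all

lemma stage_ctx: "stage 11 s ==> ctx s"
  unfolding stage_def ctx_def by (simp add: ubase_def fbase_def)

lemma ok_seq_stage:
  assumes "ok p s (\<lambda>t s'. P s' \<and> t <= a)" and "\<And>s'. P s' ==> ok q s' (\<lambda>t s''. R s'' \<and> t <= b)"
  shows "ok (p ;; q) s (\<lambda>t s'. R s' \<and> t <= a + b)"
proof (rule ok_seq[OF assms(1)])
  fix t s' assume "P s' \<and> t <= a"
  then show "ok q s' (\<lambda>t' s'. R s' \<and> t + t' <= a + b)"
    by (intro ok_conseq[OF assms(2)]) auto
qed

lemma seq_assoc: "ok (p ;; q ;; w) s Q \<longleftrightarrow> ok ((p ;; q) ;; w) s Q"
  by (simp add: add.assoc)

lemma ok_prelude:
  assumes "inp s" "nats s ''uc'' = (\<lambda>_. 0)" "nats s ''fc'' = (\<lambda>_. 0)"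
  shows "ok prelude s (\<lambda>t s'. ctx s' \<and> t <= prelude_time)"
proof -
  have s0: "stage 0 s" using assms by (simp add: stage_def)
  have "ok prelude s (\<lambda>t s'. ctx s' \<and> t <= (30 * n + 30) + ((40 * m + 30) + ((40 * d + 40) + ((40 * d + 40) +
     ((40 * d + 100) + ((40 * d + 100) + ((40 * Kc + 100) + ((40 * d + 100) + ((40 * d + 100) + ((60 * n + 60) + (60 * m + 60)))))))))))"
    unfolding prelude_def
    apply (rule ok_seq_stage[OF stage_step1[OF s0]])
    apply (rule ok_seq_stage[OF stage_step2], assumption)
    apply (rule ok_seq_stage[OF stage_step3], assumption)
    apply (rule ok_seq_stage[OF stage_step4], assumption)
    apply (subst seq_assoc, rule ok_seq_stage[OF stage_step5], assumption)
    apply (subst seq_assoc, rule ok_seq_stage[OF stage_step6], assumption)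
    apply (subst seq_assoc, rule ok_seq_stage[OF stage_step7], assumption)
    apply (subst seq_assoc, rule ok_seq_stage[OF stage_step8], assumption)
    apply (subst seq_assoc, rule ok_seq_stage[OF stage_step9], assumption)
    apply (rule ok_seq_stage[OF stage_step10], assumption)
    apply (rule ok_conseq[OF stage_step11], assumption)
    apply (simp add: stage_ctx)
    done
  then show ?thesis by (rule ok_conseq) (simp add: prelude_time_def)
qed

end

section \<open>The program for one leg\<close>

definition uidx :: "nexp => nexp" where
  "uidx e = NGet ''ub'' (nv ''ql'') +n e"

definition line_eval :: prog where
  "line_eval =
    rset ''qy'' (RDiv (RGet ''X'' (uidx (nv ''j'')) +r RGet ''X'' (uidx (NGet ''Qu'' (nv ''hd'') -n N1))) (RLit 2)) ;;
    near ;;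
    rset ''cc'' (RDiv (RGet ''X'' (uidx (NGet ''Qu'' (nv ''hd'') -n N1)) -r RGet ''X'' (uidx (nv ''j''))) (RLit 2) +r rv ''qd'')"

definition line_pop :: prog where
  "line_pop = While (BAnd (NLess (nv ''hd'') (nv ''tl''))
      (RLe (RGet ''G'' (uidx (nv ''i''))) (RGet ''G'' (uidx (NGet ''Qu'' (nv ''tl'' -n N1))))))
    (nset ''tl'' (nv ''tl'' -n N1))"

definition line_front :: prog where
  "line_front = While (BAnd (NLess (nv ''hd'' +n N1) (nv ''tl''))
      (RLe (RGet ''G'' (uidx (NGet ''Qu'' (nv ''hd'' +n N1)))) (rv ''cc'')))
    (incr ''hd'' ;; line_eval)"

definition line_store :: prog where
  "line_store =
    Cond (RLess (rv ''cc'') (RGet ''G'' (uidx (NGet ''Qu'' (nv ''hd'')))))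
      (RSet ''G'' (uidx (nv ''j'')) (RGet ''G'' (uidx (NGet ''Qu'' (nv ''hd'')))))
      (RSet ''G'' (uidx (nv ''j'')) (rv ''cc'')) ;;
    NSet ''nx'' (uidx (nv ''j'')) (NGet ''Qu'' (nv ''hd'')) ;;
    NSet ''NF'' (uidx (nv ''j'')) (nv ''qf'')"

definition line_push :: prog where
  "line_push = NSet ''Qu'' (nv ''tl'') (nv ''i'') ;; incr ''tl''"

definition line_body :: prog where
  "line_body = line_pop ;; line_push ;; line_eval ;; line_front ;; line_store"

text \<open>The segment end \<open>j + r\<close> becomes admissible exactly when \<open>j\<close> is
  reached, so each step offers one new candidate to the deque. With fewer than r users left on the
  leg the entry is infinite.\<close>

definition line_step :: prog where
  "line_step = nset ''j'' (nv ''j'' -n N1) ;;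
    Cond (NLess (NGet ''uc'' (nv ''ql'')) (nv ''j'' +n nv ''r''))
      (RSet ''G'' (uidx (nv ''j'')) (rv ''inf''))
      (nset ''i'' (nv ''j'' +n nv ''r'') ;; line_body)"

definition line_leg :: prog where
  "line_leg = nset ''ql'' (nv ''ll'') ;; nset ''qp'' (NGet ''fc'' (nv ''ql'')) ;; nset ''hd'' N0 ;; nset ''tl'' N0 ;;
    nset ''j'' (NGet ''uc'' (nv ''ql'')) ;; RSet ''G'' (uidx (nv ''j'')) (RLit 0) ;;
    While (NLess N0 (nv ''j'')) line_step"

definition line_dp :: prog where
  "line_dp = For ''ll'' (nv ''d'' +n N1) line_leg"

lemma writes_line [simp]:
  "nwrites line_eval = {''qp'', ''qf''}" "rwrites line_eval = {''qy'', ''qd'', ''cc''}"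
  "nwrites line_pop = {''tl''}" "rwrites line_pop = {}"
  "nwrites line_front = {''hd'', ''qp'', ''qf''}" "rwrites line_front = {''qy'', ''qd'', ''cc''}"
  "nwrites line_store = {''nx'', ''NF''}" "rwrites line_store = {''G''}"
  "nwrites line_push = {''Qu'', ''tl''}" "rwrites line_push = {}"
  by (auto simp: line_eval_def line_pop_def line_front_def line_store_def line_push_def)

lemma writes_line_step [simp]:
  "nwrites line_step = {''j'', ''i'', ''tl'', ''Qu'', ''hd'', ''qp'', ''qf'', ''nx'', ''NF''}"
  "rwrites line_step = {''G'', ''qy'', ''qd'', ''cc''}"
  by (auto simp: line_step_def line_body_def)

lemma writes_line_leg [simp]:
  "nwrites line_leg = {''ql'', ''j'', ''i'', ''tl'', ''Qu'', ''hd'', ''qp'', ''qf'', ''nx'', ''NF''}"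
  "rwrites line_leg = {''G'', ''qy'', ''qd'', ''cc''}"
  by (auto simp: line_leg_def)

lemma sum_legix: "(\<Sum>l<D. length (legix ps k l)) <= k"
proof (induction k)
  case (Suc k)
  have "(\<Sum>l<D. length (legix ps (Suc k) l)) = (\<Sum>l<D. length (legix ps k l) + (if l = fst (ps ! k) then 1 else 0))"
    by (intro sum.cong) (auto simp: legix_Suc)
  also have "\<dots> = (\<Sum>l<D. length (legix ps k l)) + (\<Sum>l<D. if l = fst (ps ! k) then 1 else 0)" by (rule sum.distrib)
  also have "\<dots> <= k + 1" using Suc by (intro add_mono) (simp_all add: sum.delta')
  finally show ?case by simp
qed simp

context spider_problem begin

lemma fdist_lip:
  assumes "0 <= y" "0 <= y'"
  shows "fdist fs (l, y) <= fdist fs (l, y') + \<bar>y - y'\<bar>"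
proof (cases "fs = []")
  case False
  have "Min ((\<lambda>f. spider_dist f (l, y')) ` set fs) \<in> (\<lambda>f. spider_dist f (l, y')) ` set fs"
    using False by (intro Min_in) auto
  then obtain f where f0: "Min ((\<lambda>f. spider_dist f (l, y')) ` set fs) = spider_dist f (l, y')" "f \<in> set fs"
    by (rule imageE)
  then have f: "f \<in> set fs" "fdist fs (l, y') = spider_dist f (l, y')" using False by (simp_all add: fdist_def)
  have "fdist fs (l, y) <= spider_dist f (l, y)" by (rule fdist_le[OF f(1)])
  also have "\<dots> <= spider_dist f (l, y') + \<bar>y - y'\<bar>" by (auto simp: spider_dist_def)
  finally show ?thesis using f by simp
qed (simp add: fdist_def)

text \<open>Lengthening the segment by h moves its midpoint by h/2. The distance to the nearest
  facility is 1-Lipschitz and falls by at most h/2, which the growth of half the length makes up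
  for.\<close>

lemma seg_mono:
  assumes "i < x'" "x' <= x" "x <= cnt l"
  shows "seg l i x' <= seg l i x"
proof -
  have X: "0 <= X l i" "X l i <= X l (x' - 1)" "X l (x' - 1) <= X l (x - 1)"
    using assms X_nonneg[of i l] X_mono[of i "x' - 1" l] X_mono[of "x' - 1" "x - 1" l] by simp_all
  then have "fdist fs (l, (X l i + X l (x' - 1)) / 2) <= fdist fs (l, (X l i + X l (x - 1)) / 2) +
    \<bar>(X l i + X l (x' - 1)) / 2 - (X l i + X l (x - 1)) / 2\<bar>" by (intro fdist_lip) auto
  moreover have "\<bar>(X l i + X l (x' - 1)) / 2 - (X l i + X l (x - 1)) / 2\<bar> = X l (x - 1) / 2 - X l (x' - 1) / 2"
    using X by (simp add: field_simps)
  ultimately show ?thesis unfolding seg_def by (simp add: diff_divide_distrib)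
qed

lemma seg_antimono:
  assumes "i' <= i" "i < x" "x <= cnt l"
  shows "seg l i x <= seg l i' x"
proof -
  have X: "0 <= X l i'" "X l i' <= X l i" "X l i <= X l (x - 1)"
    using assms X_nonneg[of i' l] X_mono[of i' i l] X_mono[of i "x - 1" l] by simp_all
  then have "fdist fs (l, (X l i + X l (x - 1)) / 2) <= fdist fs (l, (X l i' + X l (x - 1)) / 2) +
    \<bar>(X l i + X l (x - 1)) / 2 - (X l i' + X l (x - 1)) / 2\<bar>" by (intro fdist_lip) auto
  moreover have "\<bar>(X l i + X l (x - 1)) / 2 - (X l i' + X l (x - 1)) / 2\<bar> = X l i / 2 - X l i' / 2"
    using X by (simp add: field_simps)
  ultimately show ?thesis unfolding seg_def by (simp add: diff_divide_distrib)
qed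

section \<open>The recurrence on one leg and its monotone deque\<close>

definition line_ok :: "nat => nat => (nat => real) => (nat => nat) => (nat => nat) => bool" where
  "line_ok l j G nx NF \<longleftrightarrow> G (cnt l) = 0 \<and> (\<forall>i. j <= i \<and> i < cnt l -->
    (if cnt l < i + r then G i = big
     else i + r <= nx i \<and> nx i <= cnt l \<and> G i = max (G (nx i)) (seg l i (nx i)) \<and>
       near_ok (isfac fs) (NF i) (l, (X l i + X l (nx i - 1)) / 2) \<and>
       (\<forall>x. i + r <= x \<and> x <= cnt l --> G i <= max (G x) (seg l i x))))"

text \<open>The deque holds candidates \<open>x\<close> for the end of the segment that starts at \<open>j\<close>. Since \<open>seg\<close> is monotone in both
  arguments, a candidate that is dominated once stays dominated as \<open>j\<close> decreases.\<close>

definition dom :: "nat => nat => (nat => real) => nat => nat => bool" where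
  "dom l J G x' x \<longleftrightarrow> (\<forall>i<J. max (G x') (seg l i x') <= max (G x) (seg l i x))"

text \<open>Positions fall and values of \<open>G\<close> rise from head to tail. The predicate
  \<open>cov\<close> stands for a candidate about to be pushed: while the tail is being popped, it
  covers the discarded entries.\<close>

definition dq :: "nat => nat => nat => (nat => bool) => (nat => real) => (nat => nat) => nat => nat => bool" where
  "dq l J C cov G Q hh tt \<longleftrightarrow> hh <= tt \<and> (\<forall>k. hh <= k \<and> k < tt --> C <= Q k \<and> Q k <= cnt l) \<and>
    (\<forall>k k'. hh <= k \<and> k < k' \<and> k' < tt --> Q k' < Q k \<and> G (Q k) < G (Q k')) \<and>
    (\<forall>x. C <= x \<and> x <= cnt l --> cov x \<or> (\<exists>k. hh <= k \<and> k < tt \<and> dom l J G (Q k) x))"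

lemma dom_trans: "dom l J G x y ==> dom l J G y z ==> dom l J G x z"
  unfolding dom_def by (meson order_trans)

lemma dom_refl: "dom l J G x x" by (simp add: dom_def)

text \<open>The new end \<open>i\<close> is nearer to the center than the entry at the tail, so its
  segments cost no more; as its \<open>G\<close> is no larger either, it dominates that entry for
  all later starts.\<close>

lemma dq_pop:
  assumes q: "dq l J (Suc i) (dom l J G i) G Q hh tt" and ne: "hh < tt" and le: "G i <= G (Q (tt - 1))" and Ji: "J <= i"
  shows "dq l J (Suc i) (dom l J G i) G Q hh (tt - 1)"
proof -
  let ?y = "Q (tt - 1)"
  have y: "Suc i <= ?y" "?y <= cnt l" using q ne unfolding dq_def by auto
  have dy: "dom l J G i ?y" unfolding dom_def
  proof (intro allI impI)
    fix k assume "k < J"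
    then have "seg l k i <= seg l k ?y" using y Ji by (intro seg_mono) auto
    then show "max (G i) (seg l k i) <= max (G ?y) (seg l k ?y)" using le by linarith
  qed
  have "dom l J G i x \<or> (\<exists>k. hh <= k \<and> k < tt - 1 \<and> dom l J G (Q k) x)" if x: "Suc i <= x" "x <= cnt l" for x
  proof -
    have "dom l J G i x \<or> (\<exists>k. hh <= k \<and> k < tt \<and> dom l J G (Q k) x)" using q x unfolding dq_def by blast
    then show ?thesis
    proof
      assume "\<exists>k. hh <= k \<and> k < tt \<and> dom l J G (Q k) x"
      then obtain k where k: "hh <= k" "k < tt" "dom l J G (Q k) x" by blast
      show ?thesis
      proof (cases "k = tt - 1")
        case True
        then show ?thesis using dom_trans[OF dy] k(3) by blast
      next
        case False
        then have "k < tt - 1" using k(2) by simp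
        then show ?thesis using k by blast
      qed
    qed blast
  qed
  then show ?thesis using q ne unfolding dq_def by auto
qed

lemma dq_push:
  assumes q: "dq l J (Suc i) (dom l J G i) G Q hh tt" and stop: "hh = tt \<or> G (Q (tt - 1)) < G i" and i: "i <= cnt l"
  shows "dq l J i (\<lambda>_. False) G (Q(tt := i)) hh (Suc tt)"
proof -
  have hh: "hh <= tt" and b: "\<And>k. hh <= k ==> k < tt ==> Suc i <= Q k \<and> Q k <= cnt l"
    and mono: "\<And>k k'. hh <= k ==> k < k' ==> k' < tt ==> Q k' < Q k \<and> G (Q k) < G (Q k')"
    and cov: "\<And>x. Suc i <= x ==> x <= cnt l ==> dom l J G i x \<or> (\<exists>k. hh <= k \<and> k < tt \<and> dom l J G (Q k) x)"
    using q unfolding dq_def by blast+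
  let ?Q = "Q(tt := i)"
  show ?thesis unfolding dq_def
  proof (intro conjI allI impI)
    show "hh <= Suc tt" using hh by simp
    show "i <= ?Q k" "?Q k <= cnt l" if "hh <= k \<and> k < Suc tt" for k
      using that b[of k] i by (cases "k = tt"; force)+
    fix k k' assume k: "hh <= k \<and> k < k' \<and> k' < Suc tt"
    have kk: "k < tt" using k by simp
    show "?Q k' < ?Q k" using k b[of k] mono[of k k'] by (cases "k' = tt") auto
    have last: "G (Q k) < G i"
    proof -
      have ne: "hh < tt" using k by simp
      then have g: "G (Q (tt - 1)) < G i" using stop by simp
      show ?thesis
      proof (cases "k = tt - 1")
        case False
        then have "G (Q k) < G (Q (tt - 1))" using mono[of k "tt - 1"] k kk by auto
        then show ?thesis using g by simp
      qed (use g in simp)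
    qed
    show "G (?Q k) < G (?Q k')" using last k mono[of k k'] by (cases "k' = tt") auto
  next
    fix x assume x: "i <= x \<and> x <= cnt l"
    have "\<exists>k. hh <= k \<and> k < Suc tt \<and> dom l J G (?Q k) x"
    proof (cases "dom l J G i x")
      case True
      then show ?thesis using hh by (intro exI[of _ tt]) simp
    next
      case False
      then have "x ~= i" using dom_refl by metis
      then obtain k where k: "hh <= k" "k < tt" "dom l J G (Q k) x" using cov[of x] False x by auto
      then show ?thesis by (intro exI[of _ k]) simp
    qed
    then show "False \<or> (\<exists>k. hh <= k \<and> k < Suc tt \<and> dom l J G (?Q k) x)" by blast
  qed
qed

lemma dq_front:
  assumes q: "dq l (Suc j) C (\<lambda>_. False) G Q hh tt" and two: "Suc hh < tt" and le: "G (Q (Suc hh)) <= seg l j (Q hh)" and jC: "j < C"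
  shows "dq l (Suc j) C (\<lambda>_. False) G Q (Suc hh) tt"
proof -
  let ?x = "Q hh" and ?y = "Q (Suc hh)"
  have x: "C <= ?y" "?y < ?x" "?x <= cnt l" using q two unfolding dq_def by auto
  have d: "dom l (Suc j) G ?y ?x" unfolding dom_def
  proof (intro allI impI)
    fix i assume i: "i < Suc j"
    have "seg l i ?y <= seg l i ?x" using x i jC by (intro seg_mono) auto
    moreover have "seg l j ?x <= seg l i ?x" using x i jC by (intro seg_antimono) auto
    ultimately show "max (G ?y) (seg l i ?y) <= max (G ?x) (seg l i ?x)" using le by linarith
  qed
  have "\<exists>k. Suc hh <= k \<and> k < tt \<and> dom l (Suc j) G (Q k) w" if w: "C <= w" "w <= cnt l" for w
  proof -
    obtain k where k: "hh <= k" "k < tt" "dom l (Suc j) G (Q k) w" using q w unfolding dq_def by blast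
    show ?thesis
    proof (cases "k = hh")
      case True
      then show ?thesis using dom_trans[OF d] k(3) two by (intro exI[of _ "Suc hh"]) simp
    next
      case False
      then show ?thesis using k by (intro exI[of _ k]) simp
    qed
  qed
  then show ?thesis using q two unfolding dq_def by auto
qed

text \<open>When the front loop stops, both terms of the head are below the \<open>G\<close> of the
  next entry, and \<open>G\<close> rises along the deque. So the head beats every other entry, and
  the entries dominate all candidates.\<close>

lemma dq_best:
  assumes q: "dq l (Suc j) C (\<lambda>_. False) G Q hh tt" and ne: "hh < tt"
    and stop: "\<not> Suc hh < tt \<or> seg l j (Q hh) < G (Q (Suc hh))" and x: "C <= x" "x <= cnt l"
  shows "max (G (Q hh)) (seg l j (Q hh)) <= max (G x) (seg l j x)"
proof -
  obtain k where k: "hh <= k" "k < tt" "dom l (Suc j) G (Q k) x" using q x unfolding dq_def by blast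
  have d: "max (G (Q k)) (seg l j (Q k)) <= max (G x) (seg l j x)" using k(3) unfolding dom_def by simp
  have "max (G (Q hh)) (seg l j (Q hh)) <= max (G (Q k)) (seg l j (Q k))"
  proof (cases "k = hh")
    case False
    then have 2: "Suc hh < tt" "Suc hh <= k" using k by auto
    then have s: "seg l j (Q hh) < G (Q (Suc hh))" using stop by simp
    have m: "G (Q a) < G (Q b)" if "hh <= a" "a < b" "b < tt" for a b using q that unfolding dq_def by blast
    have "G (Q hh) < G (Q (Suc hh))" using m[of hh "Suc hh"] 2 by simp
    moreover have "G (Q (Suc hh)) <= G (Q k)" using m[of "Suc hh" k] 2 k by (cases "k = Suc hh") auto
    ultimately show ?thesis using s by linarith
  qed simp
  then show ?thesis using d by linarith
qed

lemma dq_weaken: "dq l J C cov G Q hh tt ==> J' <= J ==> dq l J' C cov G Q hh tt"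
  unfolding dq_def dom_def by (meson less_le_trans)

lemma dq_cong:
  assumes q: "dq l J C (\<lambda>_. False) G Q hh tt" and G: "\<And>x. C <= x ==> G' x = G x"
  shows "dq l J C (\<lambda>_. False) G' Q hh tt"
proof -
  have b: "\<And>k. hh <= k ==> k < tt ==> C <= Q k \<and> Q k <= cnt l" using q unfolding dq_def by blast
  have d: "dom l J G' (Q k) x \<longleftrightarrow> dom l J G (Q k) x" if "hh <= k" "k < tt" "C <= x" for k x
    using b[OF that(1,2)] that(3) G by (simp add: dom_def)
  have m: "Q k' < Q k \<and> G' (Q k) < G' (Q k')" if k: "hh <= k \<and> k < k' \<and> k' < tt" for k k'
  proof -
    have "Q k' < Q k \<and> G (Q k) < G (Q k')" using q k unfolding dq_def by blast
    then show ?thesis using b[of k] b[of k'] k G by simp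
  qed
  have "\<exists>k. hh <= k \<and> k < tt \<and> dom l J G' (Q k) x" if x: "C <= x \<and> x <= cnt l" for x
  proof -
    obtain k where "hh <= k" "k < tt" "dom l J G (Q k) x" using q x unfolding dq_def by blast
    then show ?thesis using d[of k x] x by blast
  qed
  moreover have "hh <= tt" using q unfolding dq_def by blast
  ultimately show ?thesis unfolding dq_def using b m by blast
qed

lemma fac_above_mono: "fac_above l y p ==> y' <= y ==> fac_above l y' p"
  unfolding fac_above_def by (meson order_trans)

abbreviation mid :: "nat => nat => nat => real" where "mid l j x \<equiv> (X l j + X l (x - 1)) / 2"

lemma mid_mono:
  assumes "x' <= x" "j' <= j" "j < cnt l" "1 <= x" "x <= cnt l"
  shows "mid l j' x' <= mid l j x"
proof -
  have "X l (x' - 1) <= X l (x - 1)" by (rule X_mono) (use assms in auto)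
  then show ?thesis using X_mono[OF assms(2,3)] by simp
qed

section \<open>Correctness and amortized cost of the program on one leg\<close>

definition lctx :: "nat => nat => state => bool" where
  "lctx l j s \<longleftrightarrow> ctx s \<and> s$''ql'' = l \<and> l <= d \<and> s$''j'' = j \<and> j < cnt l"

lemma lctx_frame: "frame p s s' ==> lctx l j s ==> nwrites p \<inter> insert ''ql'' (insert ''j'' ctxN) = {} ==> rwrites p \<inter> ctxR = {} ==> lctx l j s'"
  unfolding lctx_def using ctx_frame[of p s s'] frameD(1)[of p s s'] by simp

abbreviation Gf :: "nat => state => nat => real" where "Gf l s \<equiv> \<lambda>i. reals s ''G'' (ubase l + i)"
abbreviation hd' :: "state => nat" where "hd' s \<equiv> s$''hd''"
abbreviation tl' :: "state => nat" where "tl' s \<equiv> s$''tl''"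
abbreviation qp' :: "state => nat" where "qp' s \<equiv> s$''qp''"
abbreviation Qf :: "state => nat => nat" where "Qf s \<equiv> nats s ''Qu''"

definition evald :: "nat => nat => state => bool" where
  "evald l j s \<longleftrightarrow> s$$''cc'' = seg l j (Qf s (hd' s)) \<and>
    near_ok (isfac fs) (s$''qf'') (l, mid l j (Qf s (hd' s))) \<and> fac_above l (mid l j (Qf s (hd' s))) (qp' s)"

lemma ok_line_eval:
  assumes lc: "lctx l j s" and x: "j < Qf s (hd' s)" "Qf s (hd' s) <= cnt l"
    and fa: "fac_above l (mid l j (Qf s (hd' s))) (qp' s)"
  shows "ok line_eval s (\<lambda>t s'. evald l j s' \<and> qp' s' <= qp' s \<and> t + 120 * qp' s' <= 120 * qp' s + 500)"
proof -
  let ?x = "Qf s (hd' s)"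
  have c: "ctx s" and l: "l <= d" and j: "j < cnt l" and v: "s$''ql'' = l" "s$''j'' = j"
    using lc by (simp_all add: lctx_def)
  have Xj: "reals s ''X'' (ubase l + j) = X l j" by (rule ctxD(13)[OF c l j])
  have x1: "?x - 1 < cnt l" using x j by linarith
  have Xx: "reals s ''X'' (ubase l + (?x - 1)) = X l (?x - 1)" by (rule ctxD(13)[OF c l x1])
  let ?s = "rupd ''qy'' 0 (mid l j ?x) s"
  have y0: "0 <= mid l j ?x" using X_nonneg[OF j] X_nonneg[OF x1] by simp
  have st: "rupd ''qy'' (nval N0 s) (rval (RDiv (RGet ''X'' (uidx (nv ''j'')) +r RGet ''X'' (uidx (NGet ''Qu'' (nv ''hd'') -n N1))) (RLit 2)) s) s = ?s"
    using Xj Xx by (simp add: uidx_def v ctxD(9)[OF c l] del: Nat.add_diff_assoc Nat.diff_add_assoc)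
  have c': "ctx ?s" using c by simp
  have nr: "ok near ?s (\<lambda>t s'. s'$$''qd'' = fdist fs (l, mid l j ?x) \<and> near_ok (isfac fs) (s'$''qf'') (l, mid l j ?x) \<and>
    (\<exists>p'. s'$''qp'' = p' \<and> p' <= qp' s \<and> fac_above l (mid l j ?x) p' \<and> t <= near_time (qp' s) p'))"
    by (rule ok_near[OF c' _ l _ _ fa y0]) (simp_all add: v)
  show ?thesis unfolding line_eval_def ok_Seq ok_RSet st
  proof (rule ok_conseq[OF nr])
    fix t :: nat and s'
    assume a: "s'$$''qd'' = fdist fs (l, mid l j ?x) \<and> near_ok (isfac fs) (s'$''qf'') (l, mid l j ?x) \<and>
      (\<exists>p'. s'$''qp'' = p' \<and> p' <= qp' s \<and> fac_above l (mid l j ?x) p' \<and> t <= near_time (qp' s) p')"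
      and f: "frame near ?s s'"
    note fr = frameD[OF f]
    have t: "t + 120 * qp' s' <= 120 * qp' s + 400" "qp' s' <= qp' s" using a by (auto simp: near_time_def)
    have cc: "rval (RDiv (RGet ''X'' (uidx (NGet ''Qu'' (nv ''hd'') -n N1)) -r RGet ''X'' (uidx (nv ''j''))) (RLit 2) +r rv ''qd'') s' = seg l j ?x"
      using Xj Xx conjunct1[OF a] by (simp add: uidx_def fr v ctxD(9)[OF c l] seg_def del: Nat.add_diff_assoc Nat.diff_add_assoc)
    have fin: "evald l j (rupd ''cc'' (nval N0 s') (seg l j ?x) s')"
      using a by (simp add: evald_def fr)
    show "evald l j (rupd ''cc'' (nval N0 s') (rval (RDiv (RGet ''X'' (uidx (NGet ''Qu'' (nv ''hd'') -n N1)) -r RGet ''X'' (uidx (nv ''j''))) (RLit 2) +r rv ''qd'') s') s') \<and>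
      qp' (rupd ''cc'' (nval N0 s') (rval (RDiv (RGet ''X'' (uidx (NGet ''Qu'' (nv ''hd'') -n N1)) -r RGet ''X'' (uidx (nv ''j''))) (RLit 2) +r rv ''qd'') s') s') <= qp' s \<and>
      ncost N0 + rcost (RDiv (RGet ''X'' (uidx (nv ''j'')) +r RGet ''X'' (uidx (NGet ''Qu'' (nv ''hd'') -n N1))) (RLit 2)) + 1 +
       (t + (ncost N0 + rcost (RDiv (RGet ''X'' (uidx (NGet ''Qu'' (nv ''hd'') -n N1)) -r RGet ''X'' (uidx (nv ''j''))) (RLit 2) +r rv ''qd'') + 1)) +
       120 * qp' (rupd ''cc'' (nval N0 s') (rval (RDiv (RGet ''X'' (uidx (NGet ''Qu'' (nv ''hd'') -n N1)) -r RGet ''X'' (uidx (nv ''j''))) (RLit 2) +r rv ''qd'') s') s')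
       <= 120 * qp' s + 500"
      unfolding cc using fin t by (simp add: uidx_def)
  qed
qed

lemma ok_line_pop:
  assumes lc: "lctx l j s" and i: "s$''i'' = i" "j < i"
    and q: "dq l (Suc j) (Suc i) (dom l (Suc j) (Gf l s) i) (Gf l s) (Qf s) (hd' s) (tl' s)"
  shows "ok line_pop s (\<lambda>t s'. dq l (Suc j) (Suc i) (dom l (Suc j) (Gf l s) i) (Gf l s) (Qf s) (hd' s) (tl' s') \<and>
    (hd' s = tl' s' \<or> Gf l s (Qf s (tl' s' - 1)) < Gf l s i) \<and> tl' s' <= tl' s \<and> t + 60 * tl' s' <= 60 * tl' s + 60)"
  unfolding line_pop_def
proof (rule ok_While[where I = "\<lambda>s'. dq l (Suc j) (Suc i) (dom l (Suc j) (Gf l s) i) (Gf l s) (Qf s) (hd' s) (tl' s') \<and> tl' s' <= tl' s"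
      and \<Phi> = "\<lambda>s'. 60 * tl' s'"], goal_cases)
  case 1
  show ?case using q by blast
next
  case (2 s')
  note fr = frameD[OF 2(2)]
  have c: "ctx s" and l: "l <= d" and v: "s$''ql'' = l" using lc by (simp_all add: lctx_def)
  have b: "hd' s < tl' s'" "Gf l s i <= Gf l s (Qf s (tl' s' - 1))"
    using 2(3) by (simp_all add: uidx_def fr v i ctxD(9)[OF c l])
  have "dq l (Suc j) (Suc i) (dom l (Suc j) (Gf l s) i) (Gf l s) (Qf s) (hd' s) (tl' s' - 1)"
    by (rule dq_pop[OF conjunct1[OF 2(1)] b]) (use i in simp)
  moreover have "60 * (tl' s' - 1) + 60 = 60 * tl' s'" using b(1) by linarith
  ultimately show ?case using 2(1) by (simp add: uidx_def)
next
  case (3 t s')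
  note fr = frameD[OF 3(2)]
  have c: "ctx s" and l: "l <= d" and v: "s$''ql'' = l" using lc by (simp_all add: lctx_def)
  have hh: "hd' s <= tl' s'" using 3(1) unfolding dq_def by blast
  have "hd' s = tl' s' \<or> Gf l s (Qf s (tl' s' - 1)) < Gf l s i"
    using 3(3) hh by (auto simp: uidx_def fr v i ctxD(9)[OF c l])
  then show ?case using 3(1,4) by (simp add: uidx_def)
qed

lemma ok_line_front:
  assumes lc: "lctx l j s" and jC: "j < C" and ne: "hd' s < tl' s" and ev: "evald l j s"
    and q: "dq l (Suc j) C (\<lambda>_. False) (Gf l s) (Qf s) (hd' s) (tl' s)"
  shows "ok line_front s (\<lambda>t s'. dq l (Suc j) C (\<lambda>_. False) (Gf l s) (Qf s) (hd' s') (tl' s) \<and> hd' s' < tl' s \<and> evald l j s' \<and>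
    (\<not> Suc (hd' s') < tl' s \<or> seg l j (Qf s (hd' s')) < Gf l s (Qf s (Suc (hd' s')))) \<and> qp' s' <= qp' s \<and> hd' s <= hd' s' \<and>
    t + 700 * (tl' s - hd' s') + 120 * qp' s' <= 700 * (tl' s - hd' s) + 120 * qp' s + 60)"
  unfolding line_front_def
proof (rule ok_While[where I = "\<lambda>s'. dq l (Suc j) C (\<lambda>_. False) (Gf l s) (Qf s) (hd' s') (tl' s) \<and> hd' s' < tl' s \<and> evald l j s' \<and> qp' s' <= qp' s \<and> hd' s <= hd' s'"
      and \<Phi> = "\<lambda>s'. 700 * (tl' s - hd' s') + 120 * qp' s'"], goal_cases)
  case 1
  show ?case using q ne ev by simp
next
  case (2 s1)
  note fr = frameD[OF 2(2)]
  have lc1: "lctx l j s1" by (rule lctx_frame[OF 2(2) lc]) simp_all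
  have c: "ctx s" and l: "l <= d" and v: "s$''ql'' = l" using lc by (simp_all add: lctx_def)
  have j: "j < cnt l" using lc by (simp add: lctx_def)
  let ?h = "hd' s1"
  have q1: "dq l (Suc j) C (\<lambda>_. False) (Gf l s) (Qf s) ?h (tl' s)" using 2(1) by blast
  have e1: "evald l j s1" using 2(1) by blast
  have cc: "s1$$''cc'' = seg l j (Qf s ?h)" using e1 by (simp add: evald_def fr)
  have b: "Suc ?h < tl' s" "Gf l s (Qf s (Suc ?h)) <= seg l j (Qf s ?h)"
    using 2(3) by (simp_all add: uidx_def fr v cc ctxD(9)[OF c l])
  have q2: "dq l (Suc j) C (\<lambda>_. False) (Gf l s) (Qf s) (Suc ?h) (tl' s)" by (rule dq_front[OF q1 b jC])
  have bd: "C <= Qf s (Suc ?h)" "Qf s (Suc ?h) <= Qf s ?h" "Qf s ?h <= cnt l"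
    using q1 b(1) unfolding dq_def by (auto intro: less_imp_le)
  let ?s2 = "nupd ''hd'' 0 (Suc ?h) s1"
  have lc2: "lctx l j ?s2" using lc1 by (simp add: lctx_def)
  have "fac_above l (mid l j (Qf s ?h)) (qp' s1)" using e1 by (simp add: evald_def fr)
  then have fa: "fac_above l (mid l j (Qf s (Suc ?h))) (qp' s1)"
    by (rule fac_above_mono) (use bd jC j in \<open>intro mid_mono, auto\<close>)
  have ev2: "ok line_eval ?s2 (\<lambda>t s'. evald l j s' \<and> qp' s' <= qp' ?s2 \<and> t + 120 * qp' s' <= 120 * qp' ?s2 + 500)"
    by (rule ok_line_eval[OF lc2]) (use bd jC fa in \<open>simp_all add: fr\<close>)
  have dec: "700 * (tl' s - Suc ?h) + 700 = 700 * (tl' s - ?h)" using b(1) by linarith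
  have st: "nupd ''hd'' (nval N0 s1) (nval (NAdd (nv ''hd'') N1) s1) s1 = ?s2" by simp
  show ?case unfolding ok_Seq ok_NSet st
  proof (rule ok_conseq[OF ev2])
    fix t :: nat and s'
    assume a: "evald l j s' \<and> qp' s' <= qp' ?s2 \<and> t + 120 * qp' s' <= 120 * qp' ?s2 + 500" and f: "frame line_eval ?s2 s'"
    have h: "hd' s' = Suc ?h" using frameD(1)[OF f] by simp
    show "(dq l (Suc j) C (\<lambda>_. False) (Gf l s) (Qf s) (hd' s') (tl' s) \<and> hd' s' < tl' s \<and> evald l j s' \<and> qp' s' <= qp' s \<and> hd' s <= hd' s') \<and>
      bcost (BAnd (NLess (nv ''hd'' +n N1) (nv ''tl'')) (RLe (RGet ''G'' (uidx (NGet ''Qu'' (nv ''hd'' +n N1)))) (rv ''cc''))) +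
      (ncost N0 + ncost (NAdd (nv ''hd'') N1) + 1 + t) + 1 + (700 * (tl' s - hd' s') + 120 * qp' s')
      <= 700 * (tl' s - ?h) + 120 * qp' s1"
      using a q2 b(1) dec 2(1) unfolding h by (simp add: uidx_def)
  qed
next
  case (3 t s1)
  note fr = frameD[OF 3(2)]
  have c: "ctx s" and l: "l <= d" and v: "s$''ql'' = l" using lc by (simp_all add: lctx_def)
  have cc: "s1$$''cc'' = seg l j (Qf s (hd' s1))" using 3(1) by (simp add: evald_def fr)
  have "\<not> Suc (hd' s1) < tl' s \<or> seg l j (Qf s (hd' s1)) < Gf l s (Qf s (Suc (hd' s1)))"
    using 3(3) by (auto simp: uidx_def fr v cc ctxD(9)[OF c l] not_le)
  then show ?case using 3(1,4) by (simp add: uidx_def)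
qed

lemma line_ok_upd:
  assumes "line_ok l (Suc j) G nx NF" "j < cnt l"
    and "cnt l < j + r ==> g = big"
    and "j + r <= cnt l ==> j + r <= x \<and> x <= cnt l \<and> g = max (G x) (seg l j x) \<and>
       near_ok (isfac fs) k (l, mid l j x) \<and> (\<forall>x. j + r <= x \<and> x <= cnt l --> g <= max (G x) (seg l j x))"
  shows "line_ok l j (G(j := g)) (nx(j := x)) (NF(j := k))"
  unfolding line_ok_def
proof (intro conjI allI impI)
  show "(G(j := g)) (cnt l) = 0" using assms(1,2) by (simp add: line_ok_def)
  fix i assume i: "j <= i \<and> i < cnt l"
  have r: "0 < r" using r1 by simp
  show "if cnt l < i + r then (G(j := g)) i = big
     else i + r <= (nx(j := x)) i \<and> (nx(j := x)) i <= cnt l \<and> (G(j := g)) i = max ((G(j := g)) ((nx(j := x)) i)) (seg l i ((nx(j := x)) i)) \<and>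
       near_ok (isfac fs) ((NF(j := k)) i) (l, (X l i + X l ((nx(j := x)) i - 1)) / 2) \<and>
       (\<forall>xa. i + r <= xa \<and> xa <= cnt l --> (G(j := g)) i <= max ((G(j := g)) xa) (seg l i xa))"
  proof (cases "i = j")
    case True
    then show ?thesis using assms(3,4) r by (cases "cnt l < j + r") auto
  next
    case False
    then have "Suc j <= i" using i by simp
    then have e: "if cnt l < i + r then G i = big
     else i + r <= nx i \<and> nx i <= cnt l \<and> G i = max (G (nx i)) (seg l i (nx i)) \<and>
       near_ok (isfac fs) (NF i) (l, (X l i + X l (nx i - 1)) / 2) \<and>
       (\<forall>x. i + r <= x \<and> x <= cnt l --> G i <= max (G x) (seg l i x))"
      using assms(1) i unfolding line_ok_def by blast
    then show ?thesis using False i by (cases "cnt l < i + r") auto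
  qed
qed

text \<open>The last conjunct says that no midpoint still to be queried lies beyond the current
  search position. So the facility searches on a leg form one descending sequence.\<close>

definition linv :: "nat => state => bool" where
  "linv l s \<longleftrightarrow> ctx s \<and> s$''ql'' = l \<and> l <= d \<and> s$''j'' <= cnt l \<and>
    line_ok l (s$''j'') (Gf l s) (\<lambda>i. nats s ''nx'' (ubase l + i)) (\<lambda>i. nats s ''NF'' (ubase l + i)) \<and>
    dq l (s$''j'') (s$''j'' + r) (\<lambda>_. False) (Gf l s) (Qf s) (hd' s) (tl' s) \<and>
    (\<forall>i x. i < s$''j'' \<and> i < x \<and> x <= (if hd' s < tl' s then Qf s (hd' s) else cnt l) --> fac_above l (mid l i x) (qp' s))"

definition same_off :: "nat => state => state => bool" where
  "same_off l s s' \<longleftrightarrow> (\<forall>a. (\<forall>i\<le>cnt l. a ~= ubase l + i) --> reals s' ''G'' a = reals s ''G'' a \<and>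
     nats s' ''nx'' a = nats s ''nx'' a \<and> nats s' ''NF'' a = nats s ''NF'' a)"

lemma same_off_trans: "same_off l s s' ==> same_off l s' s'' ==> same_off l s s''"
  unfolding same_off_def by simp

text \<open>The decrease of \<open>j\<close> pays for the fixed work of a step and for one push, the
  length of the deque pays for removals, and \<open>qp\<close>, which never rises during the steps
  on a leg, pays for the facility search.\<close>

abbreviation lpot :: "state => nat" where
  "lpot s \<equiv> 3000 * s$''j'' + 800 * (tl' s - hd' s) + 130 * qp' s"

abbreviation nxf :: "nat => state => nat => nat" where "nxf l s \<equiv> \<lambda>i. nats s ''nx'' (ubase l + i)"
abbreviation NFf :: "nat => state => nat => nat" where "NFf l s \<equiv> \<lambda>i. nats s ''NF'' (ubase l + i)"

abbreviation leg_ok :: "nat => state => bool" where "leg_ok l s \<equiv> line_ok l 0 (Gf l s) (nxf l s) (NFf l s)"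

lemma ok_line_store:
  assumes lc: "lctx l j s" and ev: "evald l j s" and x: "Qf s (hd' s) = x" "x <= cnt l"
  shows "ok line_store s (\<lambda>t s'. Gf l s' = (Gf l s)(j := max (Gf l s x) (seg l j x)) \<and> nxf l s' = (nxf l s)(j := x) \<and>
    NFf l s' = (NFf l s)(j := s$''qf'') \<and> same_off l s s' \<and> t <= 100)"
proof -
  have c: "ctx s" and l: "l <= d" and j: "j < cnt l" and v: "s$''ql'' = l" "s$''j'' = j"
    using lc by (simp_all add: lctx_def)
  have cc: "s$$''cc'' = seg l j x" using ev x by (simp add: evald_def)
  have off: "same_off l s (nupd ''NF'' (ubase l + j) w (nupd ''nx'' (ubase l + j) y (rupd ''G'' (ubase l + j) g s)))" for w y g
    using j by (auto simp: same_off_def)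
  show ?thesis
  proof (cases "seg l j x < Gf l s x")
    case True
    then show ?thesis
      by (simp add: line_store_def uidx_def v x cc ctxD(9)[OF c l] off fun_eq_iff)
  next
    case False
    then show ?thesis
      by (simp add: line_store_def uidx_def v x cc ctxD(9)[OF c l] off fun_eq_iff)
  qed
qed

lemma ok_line_skip:
  assumes lv: "linv l s" and j: "s$''j'' = Suc j" and sm: "cnt l < j + r"
  shows "ok line_step s (\<lambda>t s'. linv l s' \<and> s'$''j'' = j \<and> same_off l s s' \<and> t + lpot s' + 20 <= lpot s)"
proof -
  have c: "ctx s" and v: "s$''ql'' = l" and l: "l <= d" and jc: "Suc j <= cnt l"
    and lo: "line_ok l (Suc j) (Gf l s) (nxf l s) (NFf l s)"
    and dqs: "dq l (Suc j) (Suc j + r) (\<lambda>_. False) (Gf l s) (Qf s) (hd' s) (tl' s)"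
    and fa: "\<And>i x. i < Suc j ==> i < x ==> x <= (if hd' s < tl' s then Qf s (hd' s) else cnt l) ==> fac_above l (mid l i x) (qp' s)"
    using lv j unfolding linv_def by auto
  let ?s = "rupd ''G'' (ubase l + j) big (nupd ''j'' 0 j s)"
  have h: "hd' s = tl' s"
  proof (rule ccontr)
    assume "hd' s ~= tl' s"
    then have "hd' s < tl' s" using dqs unfolding dq_def by linarith
    then have "Suc j + r <= Qf s (hd' s) \<and> Qf s (hd' s) <= cnt l" using dqs unfolding dq_def by blast
    then show False using sm by simp
  qed
  have G: "Gf l ?s = (Gf l s)(j := big)" by (auto simp: fun_eq_iff)
  have n: "nxf l s = (nxf l s)(j := nxf l s j)" "NFf l s = (NFf l s)(j := NFf l s j)" by (simp_all add: fun_eq_iff)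
  have "line_ok l j ((Gf l s)(j := big)) ((nxf l s)(j := nxf l s j)) ((NFf l s)(j := NFf l s j))"
    by (rule line_ok_upd[OF lo]) (use jc sm in simp_all)
  then have lo': "line_ok l j (Gf l ?s) (nxf l s) (NFf l s)" unfolding G n[symmetric] .
  have d': "dq l j (j + r) (\<lambda>_. False) (Gf l ?s) (Qf s) (hd' s) (tl' s)"
    using h sm unfolding dq_def by auto
  have "linv l ?s" unfolding linv_def
    using c l v jc lo' d' fa h by (auto simp: less_Suc_eq)
  moreover have "same_off l s ?s" using jc by (auto simp: same_off_def)
  ultimately show ?thesis using sm
    by (simp add: line_step_def j v uidx_def ctxD(2)[OF c] ctxD(9)[OF c l] ctxD(11)[OF c l] ctxD(5)[OF c])
qed

lemma ok_line_next:
  assumes lv: "linv l s" and j: "s$''j'' = Suc j" and sm: "j + r <= cnt l"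
  shows "ok line_step s (\<lambda>t s'. linv l s' \<and> s'$''j'' = j \<and> same_off l s s' \<and> t + lpot s' + 20 <= lpot s)"
proof -
  have c: "ctx s" and v: "s$''ql'' = l" and l: "l <= d" and jc: "Suc j <= cnt l"
    and lo: "line_ok l (Suc j) (Gf l s) (nxf l s) (NFf l s)"
    and dqs: "dq l (Suc j) (Suc j + r) (\<lambda>_. False) (Gf l s) (Qf s) (hd' s) (tl' s)"
    and fa: "\<And>i x. i < Suc j ==> i < x ==> x <= (if hd' s < tl' s then Qf s (hd' s) else cnt l) ==> fac_above l (mid l i x) (qp' s)"
    using lv j unfolding linv_def by auto
  let ?i = "j + r"
  let ?s = "nupd ''i'' 0 ?i (nupd ''j'' 0 j s)"
  have ji: "j < ?i" using r1 by simp
  have lc: "lctx l j ?s" using c v l jc by (simp add: lctx_def)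
  have q0: "dq l (Suc j) (Suc ?i) (dom l (Suc j) (Gf l s) ?i) (Gf l s) (Qf s) (hd' s) (tl' s)"
    using dqs unfolding dq_def by simp
  have pop: "ok line_pop ?s (\<lambda>t s'. dq l (Suc j) (Suc ?i) (dom l (Suc j) (Gf l s) ?i) (Gf l s) (Qf s) (hd' s) (tl' s') \<and>
    (hd' s = tl' s' \<or> Gf l s (Qf s (tl' s' - 1)) < Gf l s ?i) \<and> tl' s' <= tl' s \<and> t + 60 * tl' s' <= 60 * tl' s + 60)"
    using ok_line_pop[OF lc _ ji] q0 by simp
  have main: "ok line_body ?s
    (\<lambda>t s'. linv l s' \<and> s'$''j'' = j \<and> same_off l s s' \<and> t + lpot s' + 200 <= lpot s)"
    unfolding line_body_def
  proof (rule ok_seq[OF pop], rule ok_seq)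
    fix t1 :: nat and s1
    assume p: "dq l (Suc j) (Suc ?i) (dom l (Suc j) (Gf l s) ?i) (Gf l s) (Qf s) (hd' s) (tl' s1) \<and>
      (hd' s = tl' s1 \<or> Gf l s (Qf s (tl' s1 - 1)) < Gf l s ?i) \<and> tl' s1 <= tl' s \<and> t1 + 60 * tl' s1 <= 60 * tl' s + 60"
      and f1: "frame line_pop ?s s1"
    show "ok line_push s1 (\<lambda>t s'. t = 11 \<and> s' = nupd ''tl'' 0 (Suc (tl' s1)) (nupd ''Qu'' (tl' s1) ?i s1))"
      using frameD(1)[OF f1, of "''i''"] by (simp add: line_push_def)
    fix t2 :: nat and s2
    assume s2: "t2 = 11 \<and> s2 = nupd ''tl'' 0 (Suc (tl' s1)) (nupd ''Qu'' (tl' s1) ?i s1)"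
    note fr1 = frameD[OF f1]
    let ?Q = "(Qf s)(tl' s1 := ?i)"
    have hle: "hd' s <= tl' s1" using p unfolding dq_def by blast
    have tl1: "tl' s1 <= tl' s" using p by blast
    have v2: "reals s2 ''G'' = reals s ''G''" "Qf s2 = ?Q" "hd' s2 = hd' s" "tl' s2 = Suc (tl' s1)" "qp' s2 = qp' s"
      using s2 by (simp_all add: fr1)
    have lc2: "lctx l j s2" using lctx_frame[OF f1 lc] s2 by (simp add: lctx_def)
    have q2: "dq l (Suc j) ?i (\<lambda>_. False) (Gf l s) ?Q (hd' s) (Suc (tl' s1))"
      by (rule dq_push) (use p sm in auto)
    have x2: "?i <= ?Q (hd' s)" "?Q (hd' s) <= cnt l" using q2 hle unfolding dq_def by auto
    \<comment> \<open>The head never moves outwards: if popping has emptied the deque, the new head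
      \<open>j + r\<close> is below all former entries.\<close>
    have "?Q (hd' s) <= (if hd' s < tl' s then Qf s (hd' s) else cnt l)"
    proof (cases "hd' s = tl' s1")
      case True
      have "Suc j + r <= Qf s (hd' s)" if "hd' s < tl' s" using dqs that unfolding dq_def by blast
      then show ?thesis using True sm by auto
    next
      case False
      then show ?thesis using hle tl1 by auto
    qed
    then have fa2: "fac_above l (mid l j (?Q (hd' s))) (qp' s)" using x2 ji by (intro fa) auto
    have ev: "ok line_eval s2 (\<lambda>t s'. evald l j s' \<and> qp' s' <= qp' s2 \<and> t + 120 * qp' s' <= 120 * qp' s2 + 500)"
      by (rule ok_line_eval[OF lc2]) (use x2 ji fa2 v2 in auto)
    show "ok (line_eval ;; line_front ;; line_store) s2 (\<lambda>t s'. linv l s' \<and> s'$''j'' = j \<and> same_off l s s' \<and>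
      t1 + (t2 + t) + lpot s' + 200 <= lpot s)"
    proof (rule ok_seq[OF ev], rule ok_seq)
      fix t3 :: nat and s3
      assume e3: "evald l j s3 \<and> qp' s3 <= qp' s2 \<and> t3 + 120 * qp' s3 <= 120 * qp' s2 + 500" and f3: "frame line_eval s2 s3"
      have v3: "reals s3 ''G'' = reals s ''G''" "Qf s3 = ?Q" "hd' s3 = hd' s" "tl' s3 = Suc (tl' s1)"
        using frameD[OF f3] v2 by simp_all
      have lc3: "lctx l j s3" by (rule lctx_frame[OF f3 lc2]) simp_all
      show "ok line_front s3 (\<lambda>t s'. dq l (Suc j) ?i (\<lambda>_. False) (Gf l s) ?Q (hd' s') (Suc (tl' s1)) \<and> hd' s' < Suc (tl' s1) \<and> evald l j s' \<and>
        (\<not> Suc (hd' s') < Suc (tl' s1) \<or> seg l j (?Q (hd' s')) < Gf l s (?Q (Suc (hd' s')))) \<and> qp' s' <= qp' s3 \<and> hd' s <= hd' s' \<and>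
        t + 700 * (Suc (tl' s1) - hd' s') + 120 * qp' s' <= 700 * (Suc (tl' s1) - hd' s) + 120 * qp' s3 + 60)"
        by (rule ok_line_front[OF lc3 ji, unfolded v3]) (use q2 e3 hle in simp_all)
      fix t4 :: nat and s4
      assume e4: "dq l (Suc j) ?i (\<lambda>_. False) (Gf l s) ?Q (hd' s4) (Suc (tl' s1)) \<and> hd' s4 < Suc (tl' s1) \<and> evald l j s4 \<and>
        (\<not> Suc (hd' s4) < Suc (tl' s1) \<or> seg l j (?Q (hd' s4)) < Gf l s (?Q (Suc (hd' s4)))) \<and> qp' s4 <= qp' s3 \<and> hd' s <= hd' s4 \<and>
        t4 + 700 * (Suc (tl' s1) - hd' s4) + 120 * qp' s4 <= 700 * (Suc (tl' s1) - hd' s) + 120 * qp' s3 + 60"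
        and f4: "frame line_front s3 s4"
      note fr4 = frameD[OF f4]
      have v4: "reals s4 ''G'' = reals s ''G''" "Qf s4 = ?Q" "tl' s4 = Suc (tl' s1)" using v3 fr4 by simp_all
      have n4: "nxf l s4 = nxf l s" "NFf l s4 = NFf l s"
        using frameD(1)[OF f3] fr4 s2 by (simp_all add: fr1)
      have o4: "same_off l s s4" using frameD[OF f3] fr4 s2 by (simp add: same_off_def fr1)
      have lc4: "lctx l j s4" by (rule lctx_frame[OF f4 lc3]) simp_all
      define x where "x = ?Q (hd' s4)"
      have q4: "dq l (Suc j) ?i (\<lambda>_. False) (Gf l s) ?Q (hd' s4) (Suc (tl' s1))" using e4 by blast
      have x4: "?i <= x" "x <= cnt l" using q4 e4 unfolding dq_def x_def by auto
      have best: "max (Gf l s x) (seg l j x) <= max (Gf l s w) (seg l j w)" if "?i <= w" "w <= cnt l" for w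
        unfolding x_def by (rule dq_best[OF q4]) (use e4 that in auto)
      have Qx: "Qf s4 (hd' s4) = x" by (simp add: v4 x_def)
      have st: "ok line_store s4 (\<lambda>t s'. Gf l s' = (Gf l s)(j := max (Gf l s x) (seg l j x)) \<and> nxf l s' = (nxf l s)(j := x) \<and>
        NFf l s' = (NFf l s)(j := s4$''qf'') \<and> same_off l s4 s' \<and> t <= 100)"
        using ok_line_store[OF lc4 conjunct1[OF conjunct2[OF conjunct2[OF e4]]] Qx x4(2)] unfolding v4 n4 .
      have ev4: "near_ok (isfac fs) (s4$''qf'') (l, mid l j x)" "fac_above l (mid l j x) (qp' s4)"
        using e4 Qx by (simp_all add: evald_def)
      show "ok line_store s4 (\<lambda>t s'. linv l s' \<and> s'$''j'' = j \<and> same_off l s s' \<and>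
        t1 + (t2 + (t3 + (t4 + t))) + lpot s' + 200 <= lpot s)"
      proof (rule ok_conseq[OF st])
        fix t5 :: nat and s5
        assume e5: "Gf l s5 = (Gf l s)(j := max (Gf l s x) (seg l j x)) \<and> nxf l s5 = (nxf l s)(j := x) \<and>
          NFf l s5 = (NFf l s)(j := s4$''qf'') \<and> same_off l s4 s5 \<and> t5 <= 100" and f5: "frame line_store s4 s5"
        note fr5 = frameD[OF f5]
        have lc5: "lctx l j s5" by (rule lctx_frame[OF f5 lc4]) simp_all
        have Gd: "Gf l s5 = (Gf l s)(j := max (Gf l s x) (seg l j x))" "nxf l s5 = (nxf l s)(j := x)" "NFf l s5 = (NFf l s)(j := s4$''qf'')"
          using e5 by blast+
        have lo5: "line_ok l j (Gf l s5) (nxf l s5) (NFf l s5)" unfolding Gd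
          by (rule line_ok_upd[OF lo]) (use jc sm x4 ev4 best in auto)
        have q5: "dq l j (j + r) (\<lambda>_. False) (Gf l s5) (Qf s5) (hd' s5) (tl' s5)"
        proof -
          have "dq l j (j + r) (\<lambda>_. False) (Gf l s) ?Q (hd' s4) (Suc (tl' s1))" by (rule dq_weaken[OF q4]) simp
          then have "dq l j (j + r) (\<lambda>_. False) (Gf l s5) ?Q (hd' s4) (Suc (tl' s1))"
            by (rule dq_cong) (use ji fun_cong[OF Gd(1)] in auto)
          then show ?thesis using v4 by (simp add: fr5)
        qed
        have fa5: "fac_above l (mid l i w) (qp' s5)" if w: "i < j" "i < w" "w <= x" for i w
        proof -
          have "mid l i w <= mid l j x" using w x4 ji jc by (intro mid_mono) auto
          then show ?thesis using fac_above_mono[OF ev4(2)] by (simp add: fr5)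
        qed
        have lt: "hd' s5 < tl' s5" "Qf s5 (hd' s5) = x" using e4 v4 Qx by (simp_all add: fr5)
        have jj: "s5$''j'' = j" using lc5 by (simp add: lctx_def)
        have "linv l s5" unfolding linv_def jj using lc5 lo5 q5 fa5 lt jc by (simp add: lctx_def)
        moreover have "same_off l s s5" using same_off_trans[OF o4] e5 by blast
        moreover have "t1 + (t2 + (t3 + (t4 + t5))) + lpot s5 + 200 <= lpot s"
        proof -
          have z: "tl' s5 = Suc (tl' s1)" "hd' s5 = hd' s4" "qp' s5 = qp' s4" using v4 by (simp_all add: fr5)
          have b4: "t4 + 700 * (Suc (tl' s1) - hd' s4) + 120 * qp' s4 <= 700 * (Suc (tl' s1) - hd' s) + 120 * qp' s3 + 60"
            "qp' s4 <= qp' s3" "hd' s4 < Suc (tl' s1)" using e4 by blast+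
          have b3: "t3 + 120 * qp' s3 <= 120 * qp' s + 500" "qp' s3 <= qp' s" using e3 v2 by simp_all
          have b1: "t1 + 60 * tl' s1 <= 60 * tl' s + 60" using p by blast
          have h4: "hd' s <= hd' s4" using e4 by blast
          have b5: "t5 <= 100" "t2 = 11" using e5 s2 by blast+
          \<comment> \<open>The deque lengths are written as sums to avoid truncated subtraction:
            \<open>x1\<close> is the final length, \<open>x2\<close> the number popped at the tail,
            and \<open>x3\<close> the length left after that.\<close>
          have "\<exists>x. Suc (tl' s1) = hd' s4 + x" "\<exists>x. tl' s = tl' s1 + x" "\<exists>x. tl' s1 = hd' s + x"
            using b4(3) tl1 hle by presburger+
          then obtain x1 x2 x3 where x: "Suc (tl' s1) = hd' s4 + x1" "tl' s = tl' s1 + x2" "tl' s1 = hd' s + x3" by blast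
          have y: "Suc (tl' s1) - hd' s4 = x1" "tl' s - hd' s = x2 + x3" "Suc (tl' s1) - hd' s = Suc x3" using x by simp_all
          have "x1 <= Suc x3" using x h4 by linarith
          then have "100 * x1 <= 100 * x3 + 100" by simp
          moreover have "t1 <= 60 * x2 + 60" using b1 x(2) by simp
          moreover have "t3 + t4 + 700 * x1 + 120 * qp' s4 <= 120 * qp' s + 700 * x3 + 1260" using b3 b4 unfolding y by simp
          moreover have "10 * qp' s4 <= 10 * qp' s" using b3 b4 by simp
          ultimately show ?thesis using b5 unfolding j jj z y by simp
        qed
        ultimately show "linv l s5 \<and> s5$''j'' = j \<and> same_off l s s5 \<and>
          t1 + (t2 + (t3 + (t4 + t5))) + lpot s5 + 200 <= lpot s" using jj by blast
      qed
    qed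
  qed
  show ?thesis using sm
    by (simp add: line_step_def j v uidx_def ctxD(2)[OF c] ctxD(11)[OF c l] not_less)
      (rule ok_conseq[OF main], simp add: j)
qed

lemma ok_line_leg:
  assumes c: "ctx s" and ll: "s$''ll'' = l" and l: "l <= d"
  shows "ok line_leg s (\<lambda>t s'. leg_ok l s' \<and> same_off l s s' \<and>
    t <= 3000 * cnt l + 130 * fcnt l + 100)"
proof -
  let ?s = "rupd ''G'' (ubase l + cnt l) 0 (nupd ''j'' 0 (cnt l) (nupd ''tl'' 0 0 (nupd ''hd'' 0 0 (nupd ''qp'' 0 (fcnt l) (nupd ''ql'' 0 l s)))))"
  have i0: "linv l ?s" unfolding linv_def
    using c l r1 by (simp add: line_ok_def dq_def fac_above_def)
  have o0: "same_off l s ?s" by (simp add: same_off_def)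
  have w: "ok (While (NLess N0 (nv ''j'')) line_step) ?s (\<lambda>t s'. leg_ok l s' \<and> same_off l s s' \<and>
    t <= 3000 * cnt l + 130 * fcnt l + 5)"
  proof (rule ok_While[where I = "\<lambda>s'. linv l s' \<and> same_off l s s'" and \<Phi> = "\<lambda>s'. lpot s'"], goal_cases)
    case 1
    show ?case using i0 o0 by blast
  next
    case (2 s1)
    obtain j where j: "s1$''j'' = Suc j" using 2(3) by (cases "s1$''j''") auto
    have "ok line_step s1 (\<lambda>t s'. linv l s' \<and> s'$''j'' = j \<and> same_off l s1 s' \<and> t + lpot s' + 20 <= lpot s1)"
    proof (cases "cnt l < j + r")
      case True
      then show ?thesis using ok_line_skip[OF conjunct1[OF 2(1)] j] by blast
    next
      case False
      then show ?thesis using ok_line_next[OF conjunct1[OF 2(1)] j] by (simp add: not_less)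
    qed
    then show ?case
    proof (rule ok_conseq)
      fix t :: nat and s' assume a: "linv l s' \<and> s'$''j'' = j \<and> same_off l s1 s' \<and> t + lpot s' + 20 <= lpot s1"
      have "same_off l s s'" using 2(1) a same_off_trans by blast
      moreover have "bcost (NLess N0 (nv ''j'')) = 4" by simp
      ultimately show "(linv l s' \<and> same_off l s s') \<and> bcost (NLess N0 (nv ''j'')) + t + 1 + lpot s' <= lpot s1" using a by linarith
    qed
  next
    case (3 t s1)
    have j: "s1$''j'' = 0" using 3(3) by simp
    have p: "lpot ?s = 3000 * cnt l + 130 * fcnt l" by simp
    have "leg_ok l s1" using 3(1) j unfolding linv_def by simp
    then show ?case using 3(1,4) unfolding p by simp
  qed
  show ?thesis unfolding line_leg_def
    by (simp add: ll uidx_def ctxD(9,11,12)[OF c l]) (rule ok_conseq[OF w], simp)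
qed

lemma line_ok_cong:
  assumes "line_ok l 0 G nx NF" "\<And>i. i <= cnt l ==> G' i = G i \<and> nx' i = nx i \<and> NF' i = NF i"
  shows "line_ok l 0 G' nx' NF'"
  unfolding line_ok_def
proof (intro conjI allI impI)
  show "G' (cnt l) = 0" using assms by (simp add: line_ok_def)
  fix i assume i: "0 <= i \<and> i < cnt l"
  note e = assms(2)[of i]
  have o: "if cnt l < i + r then G i = big
     else i + r <= nx i \<and> nx i <= cnt l \<and> G i = max (G (nx i)) (seg l i (nx i)) \<and>
       near_ok (isfac fs) (NF i) (l, (X l i + X l (nx i - 1)) / 2) \<and>
       (\<forall>x. i + r <= x \<and> x <= cnt l --> G i <= max (G x) (seg l i x))"
    using assms(1) i unfolding line_ok_def by blast
  show "if cnt l < i + r then G' i = big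
     else i + r <= nx' i \<and> nx' i <= cnt l \<and> G' i = max (G' (nx' i)) (seg l i (nx' i)) \<and>
       near_ok (isfac fs) (NF' i) (l, (X l i + X l (nx' i - 1)) / 2) \<and>
       (\<forall>x. i + r <= x \<and> x <= cnt l --> G' i <= max (G' x) (seg l i x))"
    using o i e assms(2)[of "nx i"] assms(2) by (cases "cnt l < i + r") auto
qed

lemma ubase_inj: "i < n + 2 ==> i' < n + 2 ==> ubase l + i = ubase l' + i' \<longleftrightarrow> l = l' \<and> i = i'"
  unfolding ubase_def by (rule index_inj)

lemma same_off_line:
  assumes "same_off l s s'" "l' ~= l" "leg_ok l' s"
  shows "leg_ok l' s'"
proof (rule line_ok_cong[OF assms(3)])
  fix i assume i: "i <= cnt l'"
  have "\<forall>i'\<le>cnt l. ubase l' + i ~= ubase l + i'"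
  proof (intro allI impI)
    fix i' assume "i' <= cnt l"
    then show "ubase l' + i ~= ubase l + i'" using i cnt_le[of l] cnt_le[of l'] assms(2) by (subst ubase_inj) auto
  qed
  then show "Gf l' s' i = Gf l' s i \<and> nxf l' s' i = nxf l' s i \<and> NFf l' s' i = NFf l' s i"
    using assms(1) unfolding same_off_def by blast
qed

definition lines :: "state => bool" where
  "lines s \<longleftrightarrow> (\<forall>l\<le>d. leg_ok l s)"

lemma ok_line_dp:
  assumes c: "ctx s"
  shows "ok line_dp s (\<lambda>t s'. ctx s' \<and> lines s' \<and> t <= 3000 * n + 130 * m + 200 * d + 300)"
  unfolding line_dp_def
proof (rule ok_For_sum[where I = "\<lambda>k s'. \<forall>l<k. leg_ok l s'" and N = "Suc d"
      and c = "\<lambda>l. 3000 * cnt l + 130 * fcnt l + 100"], goal_cases)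
  case 1
  show ?case by simp
next
  case 2
  show ?case by simp
next
  case (3 k s1)
  have "ctx s1" using ctx_frame[OF 3(3)] c by simp
  then show ?case by (simp add: ctxD)
next
  case (4 k s1)
  have c1: "ctx s1" using ctx_frame[OF 4(3)] c by simp
  show ?case
  proof (rule ok_conseq[OF ok_line_leg[OF c1 4(4)]])
    show "k <= d" using 4(1) by simp
    fix t :: nat and s' assume a: "leg_ok k s' \<and> same_off k s1 s' \<and> t <= 3000 * cnt k + 130 * fcnt k + 100"
    have "leg_ok l s'" if "l < Suc k" for l
    proof (cases "l = k")
      case False
      then have "leg_ok l s1" using 4(2) that by simp
      then show ?thesis by (rule same_off_line[OF conjunct1[OF conjunct2[OF a]] False])
    qed (use a in simp)
    then show "t <= 3000 * cnt k + 130 * fcnt k + 100 \<and>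
      (\<forall>l<Suc k. line_ok l 0 (Gf l (nupd ''ll'' 0 (Suc k) s')) (nxf l (nupd ''ll'' 0 (Suc k) s')) (NFf l (nupd ''ll'' 0 (Suc k) s')))"
      using a by simp
  qed
next
  case (5 t s')
  have "ctx s'" using ctx_frame[OF 5(2)] c by simp
  moreover have "lines s'" using 5(1) by (simp add: lines_def less_Suc_eq_le)
  moreover have "(\<Sum>l<Suc d. 3000 * cnt l + 130 * fcnt l + 100) = 3000 * (\<Sum>l<Suc d. cnt l) + 130 * (\<Sum>l<Suc d. fcnt l) + 100 * Suc d"
    by (simp only: sum.distrib sum_distrib_left[symmetric]) simp
  moreover have "(\<Sum>l<Suc d. cnt l) <= n" unfolding cnt_def by (rule sum_legix)
  moreover have "(\<Sum>l<Suc d. fcnt l) <= m" unfolding fcnt_def by (rule sum_legix)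
  ultimately have "t <= (3000 * n + 130 * m + 100 * Suc d) + (14 * d + 14) + 4 + 10" using 5(4) by simp
  then show ?case using \<open>ctx s'\<close> \<open>lines s'\<close> by simp
qed

lemma writes_line_dp [simp]:
  "nwrites line_dp = {''ll'', ''ql'', ''j'', ''i'', ''tl'', ''Qu'', ''hd'', ''qp'', ''qf'', ''nx'', ''NF''}"
  "rwrites line_dp = {''G'', ''qy'', ''qd'', ''cc''}"
  by (auto simp: line_dp_def)

end

section \<open>Merging the inner users of all legs\<close>

definition merge_init :: prog where
  "merge_init = nset ''T'' N0 ;; For ''ml'' (nv ''d'' +n N1)
    (Cond (NLess (NGet ''uc'' (nv ''ml'')) (nv ''K'')) (NSet ''lm'' (nv ''ml'') (NGet ''uc'' (nv ''ml''))) (NSet ''lm'' (nv ''ml'') (nv ''K'')) ;;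
     NSet ''hp'' (nv ''ml'') N0 ;; nset ''T'' (nv ''T'' +n NGet ''lm'' (nv ''ml'')))"

definition merge_head :: rexp where
  "merge_head = RGet ''X'' (NGet ''ub'' (nv ''ml'') +n NGet ''hp'' (nv ''ml''))"

text \<open>A scan over all legs costs O(d) per user, which is affordable because only O(dK) users
  are merged.\<close>

definition merge_pick :: prog where
  "merge_pick = rset ''mb'' (rv ''inf'') ;; For ''ml'' (nv ''d'' +n N1)
    (Cond (BAnd (NLess (NGet ''hp'' (nv ''ml'')) (NGet ''lm'' (nv ''ml''))) (RLess merge_head (rv ''mb'')))
      (nset ''bl'' (nv ''ml'') ;; rset ''mb'' merge_head) Skip)"

definition merge_commit :: prog where
  "merge_commit = NSet ''own'' (nv ''mt'') (nv ''bl'') ;; RSet ''B'' (nv ''mt'' +n N1) (rv ''mb'') ;;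
     NSet ''hp'' (nv ''bl'') (NGet ''hp'' (nv ''bl'') +n N1)"

definition merge :: prog where
  "merge = merge_init ;; RSet ''B'' N0 (RLit 0) ;; For ''mt'' (nv ''T'') (merge_pick ;; merge_commit)"

lemma writes_merge_parts [simp]:
  "nwrites merge_init = {''T'', ''ml'', ''lm'', ''hp''}" "rwrites merge_init = {}"
  "nwrites merge_pick = {''ml'', ''bl''}" "rwrites merge_pick = {''mb''}"
  "nwrites merge_commit = {''own'', ''hp''}" "rwrites merge_commit = {''B''}"
  by (auto simp: merge_init_def merge_pick_def merge_commit_def)

lemma writes_merge [simp]:
  "nwrites merge = {''T'', ''ml'', ''lm'', ''hp'', ''bl'', ''own'', ''mt''}" "rwrites merge = {''mb'', ''B''}"
  by (auto simp: merge_def)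

lemma cn_upd: "t <= k ==> cn (own(k := b)) t l = cn own t l"
  unfolding cn_def by (rule arg_cong[where f = card]) auto

context spider_problem begin

lemma X_less_big:
  assumes "i < cnt l"
  shows "X l i < big"
proof -
  have "(l, i) \<in> Us" using assms by (simp add: Us_def)
  note u = uidp_less[OF this] pt_uidp[OF this]
  have "snd (us ! uidp (l, i)) <= total" unfolding total_def
    by (rule member_le_sum) (use u(1) us_point in auto)
  then show ?thesis using u(2) fpos0_nonneg by (simp add: pt_def big_def)
qed

abbreviation lmt :: "nat => nat" where "lmt l \<equiv> min (cnt l) Kc"

text \<open>The sum in the last conjunct shows that some leg still has a user to offer as long as
  \<open>k\<close> is below the total length.\<close>

definition mg :: "nat => (nat => nat) => (nat => real) => (nat => nat) => bool" where
  "mg k own B hp \<longleftrightarrow> (\<forall>l\<le>d. hp l = cn own k l) \<and> (\<forall>l\<le>d. hp l <= lmt l) \<and> (\<forall>t<k. own t < d) \<and> B 0 = 0 \<and>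
    (\<forall>t<k. B (Suc t) = X (own t) (cn own t (own t))) \<and>
    (\<forall>t\<le>k. \<forall>l. cn own t l < lmt l --> B t <= X l (cn own t l)) \<and> (\<Sum>l<Suc d. hp l) = k"

lemma mg_step:
  assumes g: "mg k own B hp" and b: "b < d" "hp b < lmt b"
    and best: "\<And>l. l <= d ==> hp l < lmt l ==> X b (hp b) <= X l (hp l)"
  shows "mg (Suc k) (own(k := b)) (B(Suc k := X b (hp b))) (hp(b := Suc (hp b)))"
proof -
  have hp: "\<And>l. l <= d ==> hp l = cn own k l" and le: "\<And>l. l <= d ==> hp l <= lmt l" and ow: "\<And>t. t < k ==> own t < d"
    and B0: "B 0 = 0" and BS: "\<And>t. t < k ==> B (Suc t) = X (own t) (cn own t (own t))"
    and nxt: "\<And>t l. t <= k ==> cn own t l < lmt l ==> B t <= X l (cn own t l)" and sm: "(\<Sum>l<Suc d. hp l) = k"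
    using g unfolding mg_def by blast+
  let ?own = "own(k := b)" and ?B = "B(Suc k := X b (hp b))" and ?hp = "hp(b := Suc (hp b))"
  have c: "cn ?own (Suc k) l = cn own k l + (if b = l then 1 else 0)" for l by (simp add: cn_Suc cn_upd)
  show ?thesis unfolding mg_def
  proof (intro conjI allI impI)
    show "?hp l = cn ?own (Suc k) l" if "l <= d" for l using hp[OF that] hp[of b] c[of l] b(1) by (cases "l = b") auto
    show "?hp l <= lmt l" if "l <= d" for l using le[OF that] b by auto
    show "?own t < d" if "t < Suc k" for t using ow[of t] that b by (cases "t = k") auto
    show "?B 0 = 0" using B0 by simp
    show "?B (Suc t) = X (?own t) (cn ?own t (?own t))" if "t < Suc k" for t
      using BS[of t] that b hp[of b] by (cases "t = k") (simp_all add: cn_upd)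
    show "?B t <= X l (cn ?own t l)" if t: "t <= Suc k" and l: "cn ?own t l < lmt l" for t l
    proof (cases "t = Suc k")
      case False
      then show ?thesis using nxt[of t l] t l by (simp add: cn_upd)
    next
      case True
      have ld: "l <= d" using l cnt_virtual[of l] by (cases "l <= d") auto
      have h: "hp l < lmt l" using l hp[OF ld] c[of l] unfolding True by (simp split: if_splits)
      have "X l (hp l) <= X l (cn ?own t l)"
        using l hp[OF ld] c[of l] unfolding True by (intro X_mono) auto
      then show ?thesis using best[OF ld h] True by simp
    qed
    have "(\<Sum>l<Suc d. ?hp l) = (\<Sum>l<Suc d. hp l + (if l = b then 1 else 0))" by (intro sum.cong) auto
    also have "\<dots> = Suc k" using sm b by (simp only: sum.distrib) (simp add: sum.delta')
    finally show "(\<Sum>l<Suc d. ?hp l) = Suc k" .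
  qed
qed

text \<open>The list is as long as all prefixes together and no prefix exceeds its limit, so every
  prefix has been merged completely.\<close>

lemma mg_final:
  assumes g: "mg T own B hp" and T: "T = (\<Sum>l<Suc d. lmt l)"
  shows "spider_merge d r cnt X Kc T own B"
proof -
  have hp: "\<And>l. l <= d ==> hp l = cn own T l" and le: "\<And>l. l <= d ==> hp l <= lmt l" and ow: "\<And>t. t < T ==> own t < d"
    and B0: "B 0 = 0" and BS: "\<And>t. t < T ==> B (Suc t) = X (own t) (cn own t (own t))"
    and nxt: "\<And>t l. t <= T ==> cn own t l < lmt l ==> B t <= X l (cn own t l)" and sm: "(\<Sum>l<Suc d. hp l) = T"
    using g unfolding mg_def by blast+
  have all: "hp l = lmt l" if l: "l <= d" for l
  proof (rule ccontr)
    assume "hp l ~= lmt l"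
    then have "hp l < lmt l" using le[OF l] le_neq_implies_less by blast
    then have "(\<Sum>l<Suc d. hp l) < (\<Sum>l<Suc d. lmt l)"
      using le l by (intro sum_strict_mono_ex1) (auto simp: less_Suc_eq_le)
    then show False using sm T by simp
  qed
  have "cn own T l = lmt l" for l
  proof (cases "l <= d")
    case True
    then show ?thesis using hp all by simp
  next
    case False
    have "{s. s < T \<and> own s = l} = {}" using ow False by fastforce
    then have "cn own T l = 0" by (simp add: cn_def)
    then show ?thesis using cnt_virtual[of l] False by simp
  qed
  then show ?thesis using ow B0 BS nxt by unfold_locales (simp_all add: Kc_def)
qed

lemma ok_merge_init:
  assumes c: "ctx s"
  shows "ok merge_init s (\<lambda>t s'. (\<forall>l\<le>d. nats s' ''lm'' l = lmt l) \<and> (\<forall>l\<le>d. nats s' ''hp'' l = 0) \<and>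
    s'$''T'' = (\<Sum>l<Suc d. lmt l) \<and> t <= 100 * d + 150)"
  unfolding merge_init_def ok_Seq ok_NSet
proof (rule ok_For[where I = "\<lambda>k s'. (\<forall>l<k. nats s' ''lm'' l = lmt l) \<and> (\<forall>l<k. nats s' ''hp'' l = 0) \<and> s'$''T'' = (\<Sum>l<k. lmt l)"
      and N = "Suc d" and c = 50], goal_cases)
  case 1
  show ?case by simp
next
  case 2
  show ?case by simp
next
  case (3 k s1)
  have "ctx s1" using ctx_frame[OF 3(3)] c by simp
  then show ?case by (simp add: ctxD)
next
  case (4 k s1)
  have c1: "ctx s1" using ctx_frame[OF 4(3)] c by simp
  have k: "k <= d" using 4(1) by simp
  show ?case
  proof (cases "cnt k < Kc")
    case True
    then show ?thesis using 4(2,4) by (simp add: ctxD[OF c1] ctxD(11)[OF c1 k] less_Suc_eq)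
  next
    case False
    then show ?thesis using 4(2,4) by (simp add: ctxD[OF c1] ctxD(11)[OF c1 k] less_Suc_eq min_def)
  qed
next
  case (5 t s1)
  then show ?case by (simp add: less_Suc_eq_le)
qed

lemma ok_merge_pick:
  assumes c: "ctx s" and lm: "\<And>l. l <= d ==> nats s ''lm'' l = lmt l" and b: "b <= d" "nats s ''hp'' b < lmt b"
  shows "ok merge_pick s (\<lambda>t s'. s'$''bl'' <= d \<and> nats s ''hp'' (s'$''bl'') < lmt (s'$''bl'') \<and>
    s'$$''mb'' = X (s'$''bl'') (nats s ''hp'' (s'$''bl'')) \<and>
    (\<forall>l\<le>d. nats s ''hp'' l < lmt l --> s'$$''mb'' <= X l (nats s ''hp'' l)) \<and> t <= 60 * d + 100)"
  unfolding merge_pick_def ok_Seq ok_RSet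
proof (rule ok_For[where I = "\<lambda>k s'. (s'$$''mb'' = big \<or> (s'$''bl'' < k \<and> nats s ''hp'' (s'$''bl'') < lmt (s'$''bl'') \<and>
      s'$$''mb'' = X (s'$''bl'') (nats s ''hp'' (s'$''bl'')))) \<and>
      (\<forall>l<k. nats s ''hp'' l < lmt l --> s'$$''mb'' <= X l (nats s ''hp'' l))"
      and N = "Suc d" and c = 40], goal_cases)
  case 1
  show ?case by (simp add: ctxD[OF c])
next
  case 2
  show ?case by simp
next
  case (3 k s1)
  have "ctx s1" using ctx_frame[OF 3(3)] c by simp
  then show ?case by (simp add: ctxD)
next
  case (4 k s1)
  have c1: "ctx s1" using ctx_frame[OF 4(3)] c by simp
  have k: "k <= d" using 4(1) by simp
  have fr: "nats s1 ''hp'' = nats s ''hp''" "nats s1 ''lm'' = nats s ''lm''" using frameD(1)[OF 4(3)] by simp_all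
  have Xh: "reals s1 ''X'' (ubase k + nats s ''hp'' k) = X k (nats s ''hp'' k)" if "nats s ''hp'' k < lmt k"
    using ctxD(13)[OF c1 k] that by simp
  let ?c = "nats s ''hp'' k < lmt k \<and> X k (nats s ''hp'' k) < s1$$''mb''"
  have ub: "nats s1 ''ub'' k = ubase k" by (rule ctxD(9)[OF c1 k])
  show ?case
  proof (cases ?c)
    case True
    have "\<forall>l<Suc k. nats s ''hp'' l < lmt l --> X k (nats s ''hp'' k) <= X l (nats s ''hp'' l)"
      using 4(2) True by (auto simp: less_Suc_eq)
    then show ?thesis using True 4(4) Xh by (simp add: merge_head_def fr lm[OF k] ub)
  next
    case False
    have I: "(s1$$''mb'' = big \<or> (s1$''bl'' < Suc k \<and> nats s ''hp'' (s1$''bl'') < lmt (s1$''bl'') \<and>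
      s1$$''mb'' = X (s1$''bl'') (nats s ''hp'' (s1$''bl'')))) \<and>
      (\<forall>l<Suc k. nats s ''hp'' l < lmt l --> s1$$''mb'' <= X l (nats s ''hp'' l))"
      using 4(2) False by (auto simp: less_Suc_eq)
    have nb: "\<not> bval (BAnd (NLess (NGet ''hp'' (nv ''ml'')) (NGet ''lm'' (nv ''ml''))) (RLess merge_head (rv ''mb''))) s1"
      using False 4(4) Xh by (auto simp: merge_head_def fr lm[OF k] ub)
    show ?thesis unfolding ok_Cond_False[OF nb] using I by (simp add: merge_head_def)
  qed
next
  case (5 t s1)
  have "s1$$''mb'' <= X b (nats s ''hp'' b)" using 5(1) b by (simp add: less_Suc_eq_le)
  also have "\<dots> < big" by (rule X_less_big) (use b in simp)
  finally have nb: "s1$$''mb'' ~= big" by simp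
  have "\<forall>l\<le>d. nats s ''hp'' l < lmt l --> s1$$''mb'' <= X l (nats s ''hp'' l)"
    using conjunct2[OF 5(1)] unfolding less_Suc_eq_le .
  moreover have "ncost N0 + rcost (rv ''inf'') + 1 + t <= 60 * d + 100" using 5(4) by (simp add: merge_head_def)
  moreover have "s1$''bl'' <= d \<and> nats s ''hp'' (s1$''bl'') < lmt (s1$''bl'') \<and>
    s1$$''mb'' = X (s1$''bl'') (nats s ''hp'' (s1$''bl''))"
    by (rule disjE[OF conjunct1[OF 5(1)]]) (erule notE[OF nb], simp only: less_Suc_eq_le simp_thms)
  ultimately show ?case by (simp only: simp_thms)
qed

definition merged :: "state => bool" where
  "merged s \<longleftrightarrow> (\<forall>l\<le>d. nats s ''lm'' l = lmt l) \<and> s$''T'' <= (d + 1) * Kc \<and>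
    spider_merge d r cnt X Kc (s$''T'') (nats s ''own'') (reals s ''B'')"

lemma ok_merge:
  assumes c: "ctx s"
  shows "ok merge s (\<lambda>t s'. merged s' \<and> t <= ((d + 1) * Kc) * (60 * d + 200) + 100 * d + 300)"
  unfolding merge_def
proof (rule ok_seq[OF ok_merge_init[OF c]], goal_cases)
  case (1 t0 s0)
  let ?T = "\<Sum>l<Suc d. lmt l"
  have c0: "ctx s0" using ctx_frame[OF 1(2)] c by simp
  have T: "?T <= (d + 1) * Kc"
    using sum_bounded_above[of "{..<Suc d}" lmt Kc] by simp
  define s1 where "s1 = rupd ''B'' 0 0 s0"
  have c1: "ctx s1" using c0 by (simp add: s1_def)
  have z1: "\<And>l. l <= d ==> nats s1 ''lm'' l = lmt l" "\<And>l. l <= d ==> nats s1 ''hp'' l = 0" "s1$''T'' = ?T" "s1$$''B'' = 0"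
    using 1(1) by (simp_all add: s1_def)
  have "ok (For ''mt'' (nv ''T'') (merge_pick ;; merge_commit)) s1 (\<lambda>t s'. merged s' \<and> t <= ?T * (60 * d + 200) + 20)"
  proof (rule ok_For[where I = "\<lambda>k s'. mg k (nats s' ''own'') (reals s' ''B'') (nats s' ''hp'')" and N = ?T and c = "60 * d + 150"], goal_cases)
    case 1
    show ?case using z1 X_nonneg by (simp add: mg_def)
  next
    case 2
    show ?case by simp
  next
    case (3 k s2)
    show ?case using frameD(1)[OF 3(3)] z1 by simp
  next
    case (4 k s2)
    have c2: "ctx s2" using ctx_frame[OF 4(3)] c1 by simp
    have lm: "nats s2 ''lm'' l = lmt l" if "l <= d" for l using frameD(1)[OF 4(3)] z1 that by simp
    have h: "\<forall>l\<le>d. nats s2 ''hp'' l <= lmt l" "(\<Sum>l<Suc d. nats s2 ''hp'' l) = k" using 4(2) unfolding mg_def by blast+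
    have "\<exists>b\<le>d. nats s2 ''hp'' b < lmt b"
    proof (rule ccontr)
      assume "\<not> (\<exists>b\<le>d. nats s2 ''hp'' b < lmt b)"
      then have "(\<Sum>l<Suc d. lmt l) <= (\<Sum>l<Suc d. nats s2 ''hp'' l)" by (intro sum_mono) (auto simp: less_Suc_eq_le not_less)
      then show False using h(2) 4(1) by simp
    qed
    then obtain b where b: "b <= d" "nats s2 ''hp'' b < lmt b" by blast
    show ?case
    proof (rule ok_seq[OF ok_merge_pick[OF c2 lm b]])
      fix t :: nat and s3
      assume a: "s3$''bl'' <= d \<and> nats s2 ''hp'' (s3$''bl'') < lmt (s3$''bl'') \<and>
        s3$$''mb'' = X (s3$''bl'') (nats s2 ''hp'' (s3$''bl'')) \<and>
        (\<forall>l\<le>d. nats s2 ''hp'' l < lmt l --> s3$$''mb'' <= X l (nats s2 ''hp'' l)) \<and> t <= 60 * d + 100"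
        and f: "frame merge_pick s2 s3"
      note fr = frameD[OF f]
      have bl: "s3$''bl'' < d" using a cnt_virtual[of d] by (cases "s3$''bl'' = d") auto
      have "mg (Suc k) ((nats s2 ''own'')(k := s3$''bl'')) ((reals s2 ''B'')(Suc k := X (s3$''bl'') (nats s2 ''hp'' (s3$''bl''))))
        ((nats s2 ''hp'')(s3$''bl'' := Suc (nats s2 ''hp'' (s3$''bl''))))"
      proof (rule mg_step[OF 4(2) bl])
        show "nats s2 ''hp'' (s3$''bl'') < lmt (s3$''bl'')" using a by blast
        have "s3$$''mb'' = X (s3$''bl'') (nats s2 ''hp'' (s3$''bl''))" using a by blast
        moreover have "\<And>l. l <= d ==> nats s2 ''hp'' l < lmt l ==> s3$$''mb'' <= X l (nats s2 ''hp'' l)" using a by blast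
        ultimately show "\<And>l. l <= d ==> nats s2 ''hp'' l < lmt l ==>
          X (s3$''bl'') (nats s2 ''hp'' (s3$''bl'')) <= X l (nats s2 ''hp'' l)" by metis
      qed
      then show "ok merge_commit s3 (\<lambda>t' s'. t + t' <= 60 * d + 150 \<and>
        mg (Suc k) (nats (nupd ''mt'' 0 (Suc k) s') ''own'') (reals (nupd ''mt'' 0 (Suc k) s') ''B'') (nats (nupd ''mt'' 0 (Suc k) s') ''hp''))"
        using a 4(4) by (simp add: merge_commit_def fr)
    qed auto
  next
    case (5 t s2)
    have z2: "nats s2 ''lm'' = nats s1 ''lm''" "nats s2 ''T'' = nats s1 ''T''" using frameD(1)[OF 5(2)] by simp_all
    have "merged s2" unfolding merged_def z2 using z1 T mg_final[OF 5(1) refl] by simp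
    moreover have "60 * d + 150 + ncost (nv ''T'') + 10 <= 60 * d + 200" by simp
    then have "?T * (60 * d + 150 + ncost (nv ''T'') + 10) <= ?T * (60 * d + 200)" by (rule mult_le_mono2)
    moreover have "ncost (nv ''T'') = 2" by simp
    ultimately show ?case using 5(4) by linarith
  qed
  then have "ok (For ''mt'' (nv ''T'') (merge_pick ;; merge_commit)) s1 (\<lambda>t s'. merged s' \<and> t0 + (3 + t) <= ((d + 1) * Kc) * (60 * d + 200) + 100 * d + 300)"
  proof (rule ok_conseq)
    fix t :: nat and s' assume a: "merged s' \<and> t <= ?T * (60 * d + 200) + 20"
    have "?T * (60 * d + 200) <= ((d + 1) * Kc) * (60 * d + 200)" using T by (rule mult_le_mono1)
    then show "merged s' \<and> t0 + (3 + t) <= ((d + 1) * Kc) * (60 * d + 200) + 100 * d + 300" using a 1(1) by linarith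
  qed
  then show ?case by (simp add: s1_def add.assoc)
qed

end

section \<open>The program for the center\<close>

definition dp_setup :: prog where
  "dp_setup = NSet ''pw'' N0 N1 ;;
    For ''cl'' (nv ''d'' +n N1) (NSet ''pw'' (nv ''cl'' +n N1) (NGet ''pw'' (nv ''cl'') +n NGet ''pw'' (nv ''cl'')) ;; NSet ''kk'' (nv ''cl'') N0) ;;
    table ''os'' (NGet ''pw'' (nv ''d'' +n N1)) (nv ''Dm'' +n N1) ;;
    table ''ot'' (nv ''T'') (NGet ''os'' (NGet ''pw'' (nv ''d'' +n N1)))"

definition cpos :: "nexp => nexp" where
  "cpos e = NGet ''ub'' (nv ''cl'') +n e"

definition kcl :: nexp where "kcl = NGet ''kk'' (nv ''cl'')"

text \<open>The choice 0 involves no center and no query. Any other choice starts its facility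
  search at the outer end of the leg, so these are the isolated queries.\<close>

definition wcell :: prog where
  "wcell = Cond (NLess N0 (nv ''ce''))
    (Cond (NLess N1 (nv ''ce'')) (rset ''ca'' (RGet ''X'' (cpos (kcl +n nv ''ce'' -n NLit 2)))) (rset ''ca'' (RGet ''B'' (nv ''ct''))) ;;
     nset ''ql'' (nv ''cl'') ;; nset ''qp'' (NGet ''fc'' (nv ''cl'')) ;;
     rset ''qy'' (RDiv (rv ''ca'' -r RGet ''B'' (nv ''ct'')) (RLit 2)) ;; near ;;
     rset ''cw'' (RDiv (rv ''ca'' +r RGet ''B'' (nv ''ct'')) (RLit 2) +r rv ''qd'') ;;
     Cond (RLess (rv ''cw'') (RGet ''G'' (cpos (kcl +n nv ''ce'' -n N1))))
       (RSet ''W'' (cpos (nv ''ce'')) (RGet ''G'' (cpos (kcl +n nv ''ce'' -n N1))))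
       (RSet ''W'' (cpos (nv ''ce'')) (rv ''cw'')) ;;
     NSet ''WF'' (cpos (nv ''ce'')) (nv ''qf''))
    (RSet ''W'' (cpos (nv ''ce'')) (RGet ''G'' (cpos kcl)))"

definition elen :: nexp where
  "elen = NGet ''lm'' (nv ''cl'') -n kcl +n NLit 2"

text \<open>The cost of a choice depends on the threshold but neither on the set of legs nor on the
  debt. Tabulating it once per threshold keeps the number of facility queries free of the factor
  \<open>2 ^ d\<close>.\<close>

definition wtab :: prog where
  "wtab = For ''cl'' (nv ''d'' +n N1) (For ''ce'' elen wcell)"

text \<open>Bits are obtained by subtracting powers of two from the highest downwards. This is done
  once for each set, not once for each debt.\<close>

definition decode :: prog where
  "decode = nset ''rem'' (nv ''cs'') ;; nset ''cl'' (nv ''d'' +n N1) ;;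
    While (NLess N0 (nv ''cl'')) (nset ''cl'' (nv ''cl'' -n N1) ;;
      Cond (NLess (nv ''rem'') (NGet ''pw'' (nv ''cl''))) (NSet ''ins'' (nv ''cl'') N0)
        (NSet ''ins'' (nv ''cl'') N1 ;; nset ''rem'' (nv ''rem'' -n NGet ''pw'' (nv ''cl''))))"

lemma writes_wtab [simp]:
  "nwrites dp_setup = {''pw'', ''cl'', ''kk'', ''os'', ''ot'', ''ti''}" "rwrites dp_setup = {}"
  "nwrites wcell = {''ql'', ''qp'', ''qf'', ''WF''}" "rwrites wcell = {''ca'', ''qy'', ''qd'', ''cw'', ''W''}"
  "nwrites wtab = {''cl'', ''ce'', ''ql'', ''qp'', ''qf'', ''WF''}" "rwrites wtab = {''ca'', ''qy'', ''qd'', ''cw'', ''W''}"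
  "nwrites decode = {''rem'', ''cl'', ''ins''}" "rwrites decode = {}"
proof -
  show *: "nwrites wcell = {''ql'', ''qp'', ''qf'', ''WF''}" "rwrites wcell = {''ca'', ''qy'', ''qd'', ''cw'', ''W''}"
    by (auto simp: wcell_def)
  show "nwrites wtab = {''cl'', ''ce'', ''ql'', ''qp'', ''qf'', ''WF''}" "rwrites wtab = {''ca'', ''qy'', ''qd'', ''cw'', ''W''}"
    by (auto simp: wtab_def *)
qed (auto simp: dp_setup_def decode_def)

lemma frame_eqs:
  "frame p s s' ==> nwrites p \<inter> N = {} ==> a \<in> N ==> nats s' a = nats s a"
  "frame p s s' ==> rwrites p \<inter> N = {} ==> a \<in> N ==> reals s' a = reals s a"
  by (auto simp: frame_def)

lemma disj_sub: "A \<inter> N = {} ==> M \<subseteq> N ==> A \<inter> M = {}"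
  by blast

text \<open>The results of the one-dimensional program and of the merge become fixed mathematical
  objects, with which later states are compared.\<close>

locale spider_core = spider_problem d r us fs +
    spider_merge where d = d and r = r and cnt = "spider_problem.cnt us" and X = "spider_problem.X us"
      and \<delta> = "fdist fs" and K = "spider_problem.Kc d r" and T = T and own = own and B = B
  for d r us fs T own B +
  fixes G :: "nat => nat => real" and nx NF :: "nat => nat => nat"
  assumes T_le: "T <= (d + 1) * spider_problem.Kc d r"
    and lines_ok: "l <= d ==> line_ok l 0 (G l) (nx l) (NF l)"
begin

definition cst :: "state => bool" where
  "cst s \<longleftrightarrow> ctx s \<and> (\<forall>l\<le>d. nats s ''lm'' l = lim l) \<and> s$''T'' = T \<and> nats s ''own'' = own \<and> reals s ''B'' = B \<and>
    (\<forall>l i. reals s ''G'' (ubase l + i) = G l i \<and> nats s ''nx'' (ubase l + i) = nx l i \<and> nats s ''NF'' (ubase l + i) = NF l i)"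

abbreviation "full \<equiv> 2 ^ (d + 1) - (1::nat)"
abbreviation "NS \<equiv> (2::nat) ^ (d + 1)"

definition tst :: "state => bool" where
  "tst s \<longleftrightarrow> cst s \<and> (\<forall>l\<le>d + 1. nats s ''pw'' l = 2 ^ l) \<and> (\<forall>S\<le>NS. nats s ''os'' S = S * (Dmax + 1)) \<and>
    (\<forall>t\<le>T. nats s ''ot'' t = t * (NS * (Dmax + 1)))"

abbreviation "cstN \<equiv> ctxN \<union> {''lm'', ''T'', ''own'', ''nx'', ''NF''}"
abbreviation "cstR \<equiv> ctxR \<union> {''B'', ''G''}"
abbreviation "tstN \<equiv> cstN \<union> {''pw'', ''os'', ''ot''}"

lemma cst_cong: "(\<And>a. a \<in> cstN ==> nats s' a = nats s a) ==> (\<And>a. a \<in> cstR ==> reals s' a = reals s a) ==> cst s' = cst s"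
proof -
  assume n: "\<And>a. a \<in> cstN ==> nats s' a = nats s a" and r: "\<And>a. a \<in> cstR ==> reals s' a = reals s a"
  have "ctx s' = ctx s" by (rule ctx_cong) (use n r in blast)+
  moreover have "nats s' ''lm'' = nats s ''lm''" "nats s' ''T'' = nats s ''T''" "nats s' ''own'' = nats s ''own''"
    "nats s' ''nx'' = nats s ''nx''" "nats s' ''NF'' = nats s ''NF''" by (rule n, simp)+
  moreover have "reals s' ''B'' = reals s ''B''" "reals s' ''G'' = reals s ''G''" by (rule r, simp)+
  ultimately show ?thesis unfolding cst_def by (simp only:)
qed

lemma tst_cong: "(\<And>a. a \<in> tstN ==> nats s' a = nats s a) ==> (\<And>a. a \<in> cstR ==> reals s' a = reals s a) ==> tst s' = tst s"
proof -
  assume n: "\<And>a. a \<in> tstN ==> nats s' a = nats s a" and r: "\<And>a. a \<in> cstR ==> reals s' a = reals s a"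
  have "cst s' = cst s" by (rule cst_cong) (rule n, erule UnI1, erule r)
  moreover have "nats s' ''pw'' = nats s ''pw''" "nats s' ''os'' = nats s ''os''" "nats s' ''ot'' = nats s ''ot''" by (rule n, simp)+
  ultimately show ?thesis unfolding tst_def by (simp only:)
qed

lemma cst_frame: "frame p s s' ==> nwrites p \<inter> cstN = {} ==> rwrites p \<inter> cstR = {} ==> cst s' = cst s"
  by (rule cst_cong) (erule (2) frame_eqs(1), erule (2) frame_eqs(2))

lemma tst_frame: "frame p s s' ==> nwrites p \<inter> tstN = {} ==> rwrites p \<inter> cstR = {} ==> tst s' = tst s"
  by (rule tst_cong) (erule (2) frame_eqs(1), erule (2) frame_eqs(2))

lemma tst_nupd [simp]: "a \<notin> tstN ==> tst (nupd a i x s) = tst s"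
  by (rule tst_cong) auto

lemma tst_rupd [simp]: "a \<notin> cstR ==> tst (rupd a i x s) = tst s"
  by (rule tst_cong) auto

lemma tstD:
  assumes "tst s"
  shows "cst s" "ctx s" "l <= d + 1 ==> nats s ''pw'' l = 2 ^ l" "S <= NS ==> nats s ''os'' S = S * (Dmax + 1)"
    "t <= T ==> nats s ''ot'' t = t * (NS * (Dmax + 1))"
    "l <= d ==> nats s ''lm'' l = lim l" "s$''T'' = T" "nats s ''own'' = own" "reals s ''B'' = B"
    "reals s ''G'' (ubase l + i) = G l i" "nats s ''nx'' (ubase l + i) = nx l i" "nats s ''NF'' (ubase l + i) = NF l i"
proof -
  have c: "cst s" "\<forall>l\<le>d + 1. nats s ''pw'' l = 2 ^ l" "\<forall>S\<le>NS. nats s ''os'' S = S * (Dmax + 1)" "\<forall>t\<le>T. nats s ''ot'' t = t * (NS * (Dmax + 1))"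
    using assms unfolding tst_def by - (elim conjE, assumption)+
  have e: "ctx s" "\<forall>l\<le>d. nats s ''lm'' l = lim l" "s$''T'' = T" "nats s ''own'' = own" "reals s ''B'' = B"
    "\<forall>l i. reals s ''G'' (ubase l + i) = G l i \<and> nats s ''nx'' (ubase l + i) = nx l i \<and> nats s ''NF'' (ubase l + i) = NF l i"
    using c(1) unfolding cst_def by - (elim conjE, assumption)+
  show "cst s" "ctx s" "s$''T'' = T" "nats s ''own'' = own" "reals s ''B'' = B" by (fact c e)+
  show "l <= d + 1 ==> nats s ''pw'' l = 2 ^ l" using c(2) by blast
  show "S <= NS ==> nats s ''os'' S = S * (Dmax + 1)" using c(3) by blast
  show "t <= T ==> nats s ''ot'' t = t * (NS * (Dmax + 1))" using c(4) by blast
  show "l <= d ==> nats s ''lm'' l = lim l" using e(2) by blast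
  show "reals s ''G'' (ubase l + i) = G l i" "nats s ''nx'' (ubase l + i) = nx l i" "nats s ''NF'' (ubase l + i) = NF l i"
    using e(6) by blast+
qed

lemma ok_dp_setup:
  assumes c: "cst s"
  shows "ok dp_setup s (\<lambda>t s'. tst s' \<and> (\<forall>l\<le>d. nats s' ''kk'' l = 0) \<and> t <= 100 * d + 60 * NS + 60 * T + 400)"
proof -
  have cx: "ctx s" and T: "s$''T'' = T" using c by (simp_all add: cst_def)
  let ?f = "For ''cl'' (nv ''d'' +n N1) (NSet ''pw'' (nv ''cl'' +n N1) (NGet ''pw'' (nv ''cl'') +n NGet ''pw'' (nv ''cl'')) ;; NSet ''kk'' (nv ''cl'') N0)"
  have 1: "ok (NSet ''pw'' N0 N1 ;; ?f) s (\<lambda>t s'. (\<forall>l\<le>d + 1. nats s' ''pw'' l = 2 ^ l) \<and> (\<forall>l\<le>d. nats s' ''kk'' l = 0) \<and> t <= 100 * d + 100)"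
    unfolding ok_Seq ok_NSet
  proof (rule ok_For[where I = "\<lambda>k s'. (\<forall>l\<le>k. nats s' ''pw'' l = 2 ^ l) \<and> (\<forall>l<k. nats s' ''kk'' l = 0)" and N = "Suc d" and c = 30], goal_cases)
    case (3 k s1)
    have "nats s1 ''d'' = nats s ''d''" using frameD(1)[OF 3(3), of "''d''"] by simp
    then show ?case by (simp add: ctxD[OF cx])
  next
    case (4 k s1)
    then show ?case by (simp add: le_Suc_eq less_Suc_eq)
  next
    case (5 t s1)
    then show ?case by (simp add: less_Suc_eq_le)
  qed simp_all
  show ?thesis unfolding dp_setup_def
  proof (subst seq_assoc, rule ok_seq[OF 1], goal_cases)
    case (1 t1 s1)
    note fr1 = frameD[OF 1(2)]
    have c1: "cst s1" using cst_frame[OF 1(2)] c by simp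
    have x1: "ctx s1" using c1 by (simp add: cst_def)
    have 2: "ok (table ''os'' (NGet ''pw'' (nv ''d'' +n N1)) (nv ''Dm'' +n N1)) s1 (\<lambda>t s'. (\<forall>S\<le>NS. nats s' ''os'' S = S * (Dmax + 1)) \<and>
      t <= NS * (ncost (NGet ''pw'' (nv ''d'' +n N1)) + ncost (nv ''Dm'' +n N1) + 30) + ncost (NGet ''pw'' (nv ''d'' +n N1)) + 30)"
    proof (rule ok_table)
      fix s' :: state assume u: "\<And>b. b ~= ''os'' ==> b ~= ''ti'' ==> nats s' b = nats s1 b"
      show "nval (NGet ''pw'' (nv ''d'' +n N1)) s' = NS \<and> nval (nv ''Dm'' +n N1) s' = Dmax + 1"
        using u 1(1) by (simp add: ctxD[OF x1])
    qed simp
    show ?case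
    proof (rule ok_seq[OF 2], goal_cases)
      case (1 t2 s2)
      note fr2 = frameD[OF 1(2)]
      have c2: "cst s2" using cst_frame[OF 1(2)] c1 by simp
      have x2: "ctx s2" and T2: "s2$''T'' = T" using c2 by (simp_all add: cst_def)
      have p2: "\<forall>l\<le>d + 1. nats s2 ''pw'' l = 2 ^ l" using \<open>_ \<and> (\<forall>l\<le>d. nats s1 ''kk'' l = 0) \<and> _\<close> by (simp add: fr2)
      have 3: "ok (table ''ot'' (nv ''T'') (NGet ''os'' (NGet ''pw'' (nv ''d'' +n N1)))) s2 (\<lambda>t s'. (\<forall>i\<le>T. nats s' ''ot'' i = i * (NS * (Dmax + 1))) \<and>
        t <= T * (ncost (nv ''T'') + ncost (NGet ''os'' (NGet ''pw'' (nv ''d'' +n N1))) + 30) + ncost (nv ''T'') + 30)"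
      proof (rule ok_table)
        fix s' :: state assume u: "\<And>b. b ~= ''ot'' ==> b ~= ''ti'' ==> nats s' b = nats s2 b"
        show "nval (nv ''T'') s' = T \<and> nval (NGet ''os'' (NGet ''pw'' (nv ''d'' +n N1))) s' = NS * (Dmax + 1)"
          using u 1(1) p2 T2 by (simp add: ctxD[OF x2])
      qed simp
      show ?case
      proof (rule ok_conseq[OF 3], goal_cases)
        case (1 t3 s3)
        note fr3 = frameD[OF 1(2)]
        have "cst s3" using cst_frame[OF 1(2)] c2 by simp
        then have "tst s3" unfolding tst_def using 1(1) p2 \<open>(\<forall>S\<le>NS. nats s2 ''os'' S = _ S) \<and> _\<close> by (simp add: fr3)
        moreover have "\<forall>l\<le>d. nats s3 ''kk'' l = 0" using \<open>_ \<and> (\<forall>l\<le>d. nats s1 ''kk'' l = 0) \<and> _\<close> by (simp add: fr2 fr3)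
        ultimately show ?case using 1(1) \<open>_ \<and> (\<forall>l\<le>d. nats s1 ''kk'' l = 0) \<and> _\<close> \<open>(\<forall>S\<le>NS. nats s2 ''os'' S = _ S) \<and> _\<close> by simp
      qed
    qed
  qed
qed

definition pst :: "nat => state => bool" where
  "pst t s \<longleftrightarrow> tst s \<and> s$''ct'' = t \<and> t <= T \<and> (\<forall>l\<le>d. nats s ''kk'' l = cn own t l)"

lemma pst_frame: "frame p s s' ==> nwrites p \<inter> (tstN \<union> {''ct'', ''kk''}) = {} ==> rwrites p \<inter> cstR = {} ==> pst t s' = pst t s"
proof -
  assume f: "frame p s s'" and n: "nwrites p \<inter> (tstN \<union> {''ct'', ''kk''}) = {}" and r: "rwrites p \<inter> cstR = {}"
  have "tst s' = tst s" by (rule tst_frame[OF f disj_sub[OF n Un_upper1] r])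
  moreover have "nats s' ''ct'' = nats s ''ct''" "nats s' ''kk'' = nats s ''kk''" by (rule frame_eqs(1)[OF f n], simp)+
  ultimately show ?thesis unfolding pst_def by (simp only:)
qed

lemma pstD:
  assumes "pst t s"
  shows "tst s" "s$''ct'' = t" "t <= T" "l <= d ==> nats s ''kk'' l = cn own t l"
proof -
  have e: "tst s" "s$''ct'' = t" "t <= T" "\<forall>l\<le>d. nats s ''kk'' l = cn own t l"
    using assms unfolding pst_def by - (elim conjE, assumption)+
  show "tst s" "s$''ct'' = t" "t <= T" by (fact e)+
  show "l <= d ==> nats s ''kk'' l = cn own t l" using e(4) by blast
qed

definition wcelld :: "nat => state => nat => nat => bool" where
  "wcelld t s l e \<longleftrightarrow> reals s ''W'' (ubase l + e) = wcost G t l e \<and>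
    (1 <= e --> near_ok (isfac fs) (nats s ''WF'' (ubase l + e)) (l, (reach t l e - B t) / 2))"

abbreviation wtabd :: "nat => state => bool" where
  "wtabd t s \<equiv> \<forall>l\<le>d. \<forall>e\<le>lim l - cm t l + 1. wcelld t s l e"

abbreviation W_but :: "nat => state => state => bool" where
  "W_but b s s' \<equiv> \<forall>a. a ~= b --> reals s' ''W'' a = reals s ''W'' a \<and> nats s' ''WF'' a = nats s ''WF'' a"

definition near_max :: nat where "near_max = 60 * (m div qc) + 60 * qc + 400"

lemma ok_wcell:
  assumes p: "pst t s" and v: "s$''cl'' = l" "s$''ce'' = e" and l: "l <= d" and e: "e <= lim l - cm t l + 1"
  shows "ok wcell s (\<lambda>t' s'. wcelld t s' l e \<and> W_but (ubase l + e) s s' \<and>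
    t' <= near_max + 200)"
proof -
  note c = pstD(1)[OF p] and ct = pstD(2)[OF p] and tT = pstD(3)[OF p] and kk = pstD(4)[OF p l]
  note x = tstD(2)[OF c]
  show ?thesis
  proof (cases e)
    case 0
    then show ?thesis
      by (simp add: wcell_def cpos_def kcl_def v kk ctxD(9)[OF x l] tstD(10)[OF c] wcelld_def wcost_def)
  next
    case (Suc e')
    let ?a = "reach t l e"
    let ?first = "Cond (NLess N1 (nv ''ce'')) (rset ''ca'' (RGet ''X'' (cpos (kcl +n nv ''ce'' -n NLit 2)))) (rset ''ca'' (RGet ''B'' (nv ''ct'')))"
    have 1: "ok ?first s (\<lambda>t' s'. s' = rupd ''ca'' 0 ?a s \<and> t' <= 40)"
    proof (cases "1 < e")
      case True
      have "cm t l + e - 2 < cnt l" using e True cm_le[OF tT, of l] by auto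
      then show ?thesis using True ctxD(13)[OF x l, of "cm t l + e - 2"]
        by (simp add: cpos_def kcl_def v kk ctxD(9)[OF x l] reach_def)
    next
      case False
      then show ?thesis by (simp add: v ct tstD(9)[OF c] reach_def cpos_def kcl_def)
    qed
    define s1 where "s1 = rupd ''qy'' 0 ((?a - B t) / 2) (nupd ''qp'' 0 (fcnt l) (nupd ''ql'' 0 l (rupd ''ca'' 0 ?a s)))"
    have x1: "ctx s1" using x by (simp add: s1_def)
    have y: "0 <= (?a - B t) / 2" using reach_ge[OF tT e] by simp
    have nr: "ok near s1 (\<lambda>t' s'. s'$$''qd'' = fdist fs (l, (?a - B t) / 2) \<and> near_ok (isfac fs) (s'$''qf'') (l, (?a - B t) / 2) \<and>
      (\<exists>p'. s'$''qp'' = p' \<and> p' <= fcnt l \<and> fac_above l ((?a - B t) / 2) p' \<and> t' <= near_time (fcnt l) p'))"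
      by (rule ok_near[OF x1 _ l _ _ _ y]) (simp_all add: s1_def fac_above_def)
    let ?rest = "rset ''cw'' (RDiv (rv ''ca'' +r RGet ''B'' (nv ''ct'')) (RLit 2) +r rv ''qd'') ;;
     Cond (RLess (rv ''cw'') (RGet ''G'' (cpos (kcl +n nv ''ce'' -n N1))))
       (RSet ''W'' (cpos (nv ''ce'')) (RGet ''G'' (cpos (kcl +n nv ''ce'' -n N1))))
       (RSet ''W'' (cpos (nv ''ce'')) (rv ''cw'')) ;;
     NSet ''WF'' (cpos (nv ''ce'')) (nv ''qf'')"
    have 2: "ok (near ;; ?rest) s1 (\<lambda>t' s'. wcelld t s' l e \<and> W_but (ubase l + e) s s' \<and>
      t' <= near_max + 100)"
    proof (rule ok_seq[OF nr])
      fix t1 :: nat and s2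
      assume a: "s2$$''qd'' = fdist fs (l, (?a - B t) / 2) \<and> near_ok (isfac fs) (s2$''qf'') (l, (?a - B t) / 2) \<and>
        (\<exists>p'. s2$''qp'' = p' \<and> p' <= fcnt l \<and> fac_above l ((?a - B t) / 2) p' \<and> t1 <= near_time (fcnt l) p')"
        and f: "frame near s1 s2"
      have tm: "t1 <= near_max" using a by (auto simp: near_time_def near_max_def)
      have q: "s2$$''qd'' = fdist fs (l, (?a - B t) / 2)" "near_ok (isfac fs) (s2$''qf'') (l, (?a - B t) / 2)" using a by blast+
      have c2: "tst s2" using tst_frame[OF f] c by (simp add: s1_def)
      note x2 = tstD(2)[OF c2]
      note fr = frameD[OF f]
      have w2: "s2$''cl'' = l" "s2$''ce'' = e" "nats s2 ''kk'' l = cm t l" "s2$$''ca'' = ?a" "s2$''ct'' = t"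
        "reals s2 ''W'' = reals s ''W''" "nats s2 ''WF'' = nats s ''WF''"
        using v kk ct by (simp_all add: fr s1_def)
      have wc: "wcost G t l e = max (G l (cm t l + e - 1)) ((?a + B t) / 2 + fdist fs (l, (?a - B t) / 2))"
        using Suc by (simp add: wcost_def)
      show "ok ?rest s2 (\<lambda>t' s'. wcelld t s' l e \<and> W_but (ubase l + e) s s' \<and>
        t1 + t' <= near_max + 100)"
      proof (cases "(?a + B t) / 2 + fdist fs (l, (?a - B t) / 2) < G l (cm t l + e - 1)")
        case True
        then show ?thesis using tm
          by (simp add: cpos_def kcl_def w2 q ctxD(9)[OF x2 l] tstD(9,10)[OF c2] wcelld_def wc del: Nat.add_diff_assoc Nat.diff_add_assoc)
      next
        case False
        then show ?thesis using tm
          by (simp add: cpos_def kcl_def w2 q ctxD(9)[OF x2 l] tstD(9,10)[OF c2] wcelld_def wc del: Nat.add_diff_assoc Nat.diff_add_assoc)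
      qed
    qed
    have b: "bval (NLess N0 (nv ''ce'')) s" using Suc v by simp
    have 3: "ok (?first ;; nset ''ql'' (nv ''cl'') ;; nset ''qp'' (NGet ''fc'' (nv ''cl'')) ;;
       rset ''qy'' (RDiv (rv ''ca'' -r RGet ''B'' (nv ''ct'')) (RLit 2)) ;; near ;; ?rest) s
      (\<lambda>t' s'. wcelld t s' l e \<and> W_but (ubase l + e) s s' \<and>
        t' <= near_max + 190)"
    proof (rule ok_seq[OF 1])
      fix t0 :: nat and s0 assume a: "s0 = rupd ''ca'' 0 ?a s \<and> t0 <= 40"
      have st: "ok (near ;; ?rest) s1 (\<lambda>t' s'. wcelld t s' l e \<and> W_but (ubase l + e) s s' \<and>
        t0 + (5 + (6 + (12 + t'))) <= near_max + 190)" by (rule ok_conseq[OF 2]) (use a in simp)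
      show "ok (nset ''ql'' (nv ''cl'') ;; nset ''qp'' (NGet ''fc'' (nv ''cl'')) ;;
       rset ''qy'' (RDiv (rv ''ca'' -r RGet ''B'' (nv ''ct'')) (RLit 2)) ;; near ;; ?rest) s0
        (\<lambda>t' s'. wcelld t s' l e \<and> W_but (ubase l + e) s s' \<and>
        t0 + t' <= near_max + 190)"
        unfolding ok_Seq[of "nset _ _"] ok_Seq[of "rset _ _"] ok_NSet ok_RSet
        by (rule ok_conseq[OF st[unfolded s1_def], THEN back_subst[of "\<lambda>x. ok _ x _"]])
          (use a ctxD(12)[OF x l] in \<open>simp_all add: v ct tstD(9)[OF c]\<close>)
    qed
    show ?thesis unfolding wcell_def ok_Cond_True[OF b]
      by (rule ok_conseq[OF 3]) simp
  qed
qed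

definition wtab_time :: nat where
  "wtab_time = (d + 1) * ((Kc + 2) * (near_max + 300) + 100) + 50"

lemma ok_wtab:
  assumes p: "pst t s"
  shows "ok wtab s (\<lambda>t' s'. (wtabd t s') \<and> t' <= wtab_time)"
  unfolding wtab_def
proof (rule ok_For[where I = "\<lambda>k s'. \<forall>l<k. \<forall>e\<le>lim l - cm t l + 1. wcelld t s' l e" and N = "Suc d"
    and c = "(Kc + 2) * (near_max + 250) + 50"], goal_cases)
  case (3 k s1)
  have "pst t s1" using pst_frame[OF 3(3)] p by simp
  then show ?case using ctxD(1)[OF tstD(2)[OF pstD(1)]] by simp
next
  case (4 k s1)
  have p1: "pst t s1" using pst_frame[OF 4(3)] p by simp
  have k: "k <= d" using 4(1) by simp
  have out: "wcelld t s3 l' e'" if "wcelld t s2 l' e'" "W_but (ubase l + e) s2 s3"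
    "l' ~= l \<or> e' ~= e" "e < n + 2" "e' < n + 2" for s2 s3 l' e' l e
    using that ubase_inj[of e' e l' l] unfolding wcelld_def by metis
  have bnd: "e < n + 2" if "e <= lim l - cm t l + 1" for l e using that cnt_le[of l] by linarith
  show ?case
  proof (rule ok_For[where I = "\<lambda>e s'. (\<forall>l<k. \<forall>e\<le>lim l - cm t l + 1. wcelld t s' l e) \<and> (\<forall>e'<e. wcelld t s' k e')"
      and N = "lim k - cm t k + 2" and c = "near_max + 200"], goal_cases)
    case 1
    show ?case using 4(2) by (simp add: wcelld_def)
  next
    case (3 e s2)
    have p2: "pst t s2" using pst_frame[OF 3(3)] p1 by simp
    have cl: "s2$''cl'' = k" using frameD(1)[OF 3(3)] 4(4) by simp
    show ?case using tstD(6)[OF pstD(1)[OF p2] k] pstD(4)[OF p2 k] cl by (simp add: elen_def kcl_def)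
  next
    case (4 e s2)
    have p2: "pst t s2" using pst_frame[OF 4(3)] p1 by simp
    have cl: "s2$''cl'' = k" using frameD(1)[OF 4(3)] \<open>s1$''cl'' = k\<close> by simp
    have e: "e <= lim k - cm t k + 1" using 4(1) by simp
    show ?case
    proof (rule ok_conseq[OF ok_wcell[OF p2 cl 4(4) k e]])
      fix t' :: nat and s3
      assume a: "wcelld t s3 k e \<and> W_but (ubase k + e) s2 s3 \<and> t' <= near_max + 200"
      have a1: "wcelld t s3 k e" and a2: "W_but (ubase k + e) s2 s3"
        and a3: "t' <= near_max + 200" using a by blast+
      have i1: "wcelld t s3 l e'" if "l < k" "e' <= lim l - cm t l + 1" for l e'
      proof (rule out[OF _ a2])
        show "wcelld t s2 l e'" using 4(2) that by blast
      qed (use that bnd[OF e] bnd[OF that(2)] in simp_all)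
      have i2: "wcelld t s3 k e'" if "e' < Suc e" for e'
      proof (cases "e' = e")
        case False
        then have lt: "e' < e" using that by simp
        show ?thesis
        proof (rule out[OF _ a2])
          show "wcelld t s2 k e'" using 4(2) lt by blast
        qed (use lt bnd[OF e] in simp_all)
      qed (use a1 in simp)
      have up: "wcelld t (nupd ''ce'' 0 (Suc e) s3) l e' = wcelld t s3 l e'" for l e' by (simp add: wcelld_def)
      show "t' <= near_max + 200 \<and> (\<forall>l<k. \<forall>e'\<le>lim l - cm t l + 1. wcelld t (nupd ''ce'' 0 (Suc e) s3) l e') \<and>
        (\<forall>e'<Suc e. wcelld t (nupd ''ce'' 0 (Suc e) s3) k e')"
        unfolding up using a3 i1 i2 by blast
    qed
  next
    case (5 t' s2)
    have up: "wcelld t (nupd ''cl'' 0 (Suc k) s2) l e' = wcelld t s2 l e'" for l e' by (simp add: wcelld_def)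
    have i: "\<forall>l<Suc k. \<forall>e\<le>lim l - cm t l + 1. wcelld t s2 l e"
    proof (intro allI impI)
      fix l e assume l: "l < Suc k" "e <= lim l - cm t l + 1"
      show "wcelld t s2 l e"
      proof (cases "l = k")
        case True
        have "e < lim k - cm t k + 2" using l(2) unfolding True by linarith
        then show ?thesis using 5(1) True by blast
      next
        case False
        then have "l < k" using l(1) by simp
        then show ?thesis using 5(1) l(2) by blast
      qed
    qed
    have "lim k - cm t k + 2 <= Kc + 2" by simp
    then have "(lim k - cm t k + 2) * (near_max + 250) <= (Kc + 2) * (near_max + 250)" by (rule mult_le_mono1)
    moreover have "(lim k - cm t k + 2) * (near_max + 200 + ncost elen + 10) <= (lim k - cm t k + 2) * (near_max + 250)"
      by (rule mult_le_mono2) (simp add: elen_def kcl_def)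
    moreover have "ncost elen = 9" by (simp add: elen_def kcl_def)
    ultimately have "t' <= (Kc + 2) * (near_max + 250) + 50" using 5(4) by linarith
    then show ?case unfolding up using i by blast
  qed simp
next
  case (5 t' s1)
  have "Suc d * ((Kc + 2) * (near_max + 250) + 50 + 14) + 14 <= wtab_time"
  proof -
    have "(Kc + 2) * (near_max + 250) <= (Kc + 2) * (near_max + 300)" by (rule mult_le_mono2) simp
    then have "Suc d * ((Kc + 2) * (near_max + 250) + 50 + 14) <= Suc d * ((Kc + 2) * (near_max + 300) + 100)" by (intro mult_le_mono2) linarith
    then show ?thesis unfolding wtab_time_def by simp
  qed
  then have "t' <= wtab_time" using 5(4) by simp
  then show ?case using 5(1) unfolding less_Suc_eq_le by blast
qed simp_all

lemma take_bit_step: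
  fixes S :: nat
  shows "S mod 2 ^ Suc l = S mod 2 ^ l + (if bit S l then 2 ^ l else 0)"
proof -
  have "take_bit (Suc l) S = 2 ^ l * of_bool (bit S l) + take_bit l S" by (rule take_bit_Suc_from_most)
  then show ?thesis unfolding take_bit_eq_mod
    by (cases "bit S l") (simp_all only: of_bool_eq mult_1_right mult_0_right if_True if_False add_0_left add_0_right add.commute)
qed

lemma ok_decode:
  assumes c: "tst s" and S: "s$''cs'' = S" "S < NS"
  shows "ok decode s (\<lambda>t s'. (\<forall>l\<le>d. nats s' ''ins'' l = (if bit S l then 1 else 0)) \<and> t <= 60 * d + 150)"
proof -
  define s1 where "s1 = nupd ''cl'' 0 (Suc d) (nupd ''rem'' 0 S s)"
  have c1: "tst s1" using c by (simp add: s1_def)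
  let ?w = "While (NLess N0 (nv ''cl'')) (nset ''cl'' (nv ''cl'' -n N1) ;;
      Cond (NLess (nv ''rem'') (NGet ''pw'' (nv ''cl''))) (NSet ''ins'' (nv ''cl'') N0)
        (NSet ''ins'' (nv ''cl'') N1 ;; nset ''rem'' (nv ''rem'' -n NGet ''pw'' (nv ''cl''))))"
  have w: "ok ?w s1 (\<lambda>t s'. (\<forall>l\<le>d. nats s' ''ins'' l = (if bit S l then 1 else 0)) \<and> t <= 60 * d + 70)"
  proof (rule ok_While[where I = "\<lambda>s'. s'$''rem'' = S mod 2 ^ (s'$''cl'') \<and> s'$''cl'' <= Suc d \<and>
      (\<forall>l\<le>d. s'$''cl'' <= l --> nats s' ''ins'' l = (if bit S l then 1 else 0))" and \<Phi> = "\<lambda>s'. 60 * s'$''cl''"], goal_cases)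
    case 1
    show ?case using S(2) by (simp add: s1_def)
  next
    case (2 s2)
    obtain k where k: "s2$''cl'' = Suc k" using 2(3) by (cases "s2$''cl''") auto
    have c2: "tst s2" using tst_frame[OF 2(2)] c1 by simp
    have kd: "k <= d" using 2(1) k by simp
    have pw: "nats s2 ''pw'' k = 2 ^ k" using tstD(3)[OF c2, of k] kd by simp
    have rem: "s2$''rem'' = S mod 2 ^ k + (if bit S k then 2 ^ k else 0)"
      using 2(1) unfolding k take_bit_step by simp
    have lt: "S mod 2 ^ k < 2 ^ k" by simp
    have ins: "\<forall>l\<le>d. Suc k <= l --> nats s2 ''ins'' l = (if bit S l then 1 else 0)" using 2(1) unfolding k by blast
    then have z: "nats s2 ''ins'' l = (if bit S l then 1 else 0)" if "l <= d" "k <= l" "l ~= k" for l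
      using that by (simp only: Suc_le_eq le_neq_implies_less)
    have lt': "(s2$''rem'' < 2 ^ k) = (\<not> bit S k)" using rem lt by simp
    show ?case
    proof (cases "bit S k")
      case True
      have "s2$''rem'' - 2 ^ k = S mod 2 ^ k" using rem True by simp
      then show ?thesis using True kd by (simp add: k pw lt' z)
    next
      case False
      have "s2$''rem'' = S mod 2 ^ k" using rem False by simp
      then show ?thesis using False kd lt by (simp add: k pw z)
    qed
  next
    case (3 t s2)
    then show ?case by (simp add: s1_def)
  qed
  let ?r = "nupd ''rem'' (nval N0 s) (nval (nv ''cs'') s) s"
  have e: "nupd ''cl'' (nval N0 ?r) (nval (nv ''d'' +n N1) ?r) ?r = s1"
    by (simp add: S s1_def ctxD(1)[OF tstD(2)[OF c]])
  show ?thesis unfolding decode_def ok_Seq ok_NSet e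
    by (rule ok_conseq[OF w]) simp
qed

end

definition dpos :: "nexp => nexp => nexp" where
  "dpos eS eD = NGet ''ot'' (nv ''ct'') +n NGet ''os'' eS +n eD"

lemma ncost_dpos [simp]: "ncost (dpos a b) = ncost a + ncost b + 6"
  by (simp add: dpos_def)

lemma ncost_cpos [simp]: "ncost (cpos a) = ncost a + 4"
  by (simp add: cpos_def)

lemma ncost_elen [simp]: "ncost elen = 9"
  by (simp add: elen_def kcl_def)

definition opt_need :: prog where
  "opt_need = Cond (NLess N0 (nv ''ce'')) (nset ''nd'' (nv ''r'' +n N1 -n nv ''ce'')) (nset ''nd'' N0)"

definition opt_try :: prog where
  "opt_try = rset ''val'' (RGet ''V'' (dpos (nv ''cs'' +n NGet ''pw'' (nv ''cl'')) (nv ''cd'' +n nv ''nd''))) ;;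
    Cond (RLess (rv ''val'') (RGet ''W'' (cpos (nv ''ce'')))) (rset ''val'' (RGet ''W'' (cpos (nv ''ce'')))) Skip ;;
    Cond (RLess (rv ''val'') (rv ''bv''))
      (rset ''bv'' (rv ''val'') ;; nset ''bo'' (nv ''cl'' +n N1) ;; nset ''be'' (nv ''ce'') ;; nset ''bf'' (NGet ''WF'' (cpos (nv ''ce'')))) Skip"

text \<open>Tests only what the surrounding loops do not ensure: that the leg is untreated is
  checked through \<open>''ins''\<close>, and the range of \<open>e\<close> is that of the
  loop.\<close>

definition opt_guard :: bexp where
  "opt_guard = BAnd (NLe (nv ''cd'' +n nv ''nd'') (nv ''Dm''))
     (BNot (BAnd (BAnd (NLess (nv ''ce'') N1) (NLess (nv ''cs'') N1)) (NLess N0 (nv ''ct''))))"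

definition opt :: prog where
  "opt = opt_need ;; Cond opt_guard opt_try Skip"

definition cell_base :: prog where
  "cell_base = Cond (NLess N0 (nv ''ct''))
      (Cond (NLess N0 (NGet ''ins'' (NGet ''own'' (nv ''ct'' -n N1)))) (nset ''cp'' (nv ''cd'' -n N1)) (nset ''cp'' (nv ''cd'')) ;;
       rset ''bv'' (RGet ''V'' (NGet ''ot'' (nv ''ct'' -n N1) +n NGet ''os'' (nv ''cs'') +n nv ''cp'')))
      (Cond (BAnd (NLe (NGet ''pw'' (nv ''d'' +n N1)) (nv ''cs'' +n N1)) (NLess (nv ''cd'') N1)) (rset ''bv'' (RLit 0)) (rset ''bv'' (rv ''inf''))) ;;
    nset ''bo'' N0 ;; nset ''be'' N0 ;; nset ''bf'' N0"

definition cell_loop :: prog where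
  "cell_loop = For ''cl'' (nv ''d'' +n N1) (Cond (NLess (NGet ''ins'' (nv ''cl'')) N1) (For ''ce'' elen opt) Skip)"

definition cell_store :: prog where
  "cell_store = RSet ''V'' (dpos (nv ''cs'') (nv ''cd'')) (rv ''bv'') ;; NSet ''CO'' (dpos (nv ''cs'') (nv ''cd'')) (nv ''bo'') ;;
    NSet ''CE'' (dpos (nv ''cs'') (nv ''cd'')) (nv ''be'') ;; NSet ''CF'' (dpos (nv ''cs'') (nv ''cd'')) (nv ''bf'')"

definition cell :: prog where
  "cell = cell_base ;; cell_loop ;; cell_store"

definition row :: prog where
  "row = decode ;; For ''cd'' (nv ''Dm'' +n N1) cell"

definition stage_kk :: prog where
  "stage_kk = Cond (NLess N0 (nv ''ct''))
    (NSet ''kk'' (NGet ''own'' (nv ''ct'' -n N1)) (NGet ''kk'' (NGet ''own'' (nv ''ct'' -n N1)) +n N1)) Skip"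

text \<open>Sets are visited downwards because opening a leg adds a bit: an entry refers to larger
  sets at the same threshold.\<close>

definition dp_stage :: prog where
  "dp_stage = stage_kk ;; wtab ;; nset ''cs'' (NGet ''pw'' (nv ''d'' +n N1)) ;;
    While (NLess N0 (nv ''cs'')) (nset ''cs'' (nv ''cs'' -n N1) ;; row)"

definition dp :: prog where
  "dp = dp_setup ;; For ''ct'' (nv ''T'' +n N1) dp_stage"

lemma writes_opt [simp]: "nwrites opt = {''nd'', ''bo'', ''be'', ''bf''}" "rwrites opt = {''val'', ''bv''}"
  by (auto simp: opt_def opt_need_def opt_try_def)

lemma writes_cell_parts [simp]:
  "nwrites cell_base = {''cp'', ''bo'', ''be'', ''bf''}" "rwrites cell_base = {''bv''}"
  "nwrites cell_loop = {''cl'', ''ce'', ''nd'', ''bo'', ''be'', ''bf''}" "rwrites cell_loop = {''val'', ''bv''}"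
  "nwrites cell_store = {''CO'', ''CE'', ''CF''}" "rwrites cell_store = {''V''}"
  by (auto simp: cell_base_def cell_loop_def cell_store_def)

lemma writes_cell [simp]:
  "nwrites cell = {''cp'', ''bo'', ''be'', ''bf'', ''cl'', ''ce'', ''nd'', ''CO'', ''CE'', ''CF''}" "rwrites cell = {''bv'', ''val'', ''V''}"
  by (auto simp: cell_def)

lemma writes_row [simp]:
  "nwrites row = {''rem'', ''ins'', ''cd'', ''cp'', ''bo'', ''be'', ''bf'', ''cl'', ''ce'', ''nd'', ''CO'', ''CE'', ''CF''}"
  "rwrites row = {''bv'', ''val'', ''V''}"
  by (auto simp: row_def)

lemma writes_stage_kk [simp]: "nwrites stage_kk = {''kk''}" "rwrites stage_kk = {}"
  by (auto simp: stage_kk_def)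

lemma writes_dp_stage [simp]:
  "nwrites dp_stage = {''kk'', ''cl'', ''ce'', ''ql'', ''qp'', ''qf'', ''WF'', ''cs'', ''rem'', ''ins'', ''cd'', ''cp'', ''bo'', ''be'', ''bf'', ''nd'', ''CO'', ''CE'', ''CF''}"
  "rwrites dp_stage = {''ca'', ''qy'', ''qd'', ''cw'', ''W'', ''bv'', ''val'', ''V''}"
  by (auto simp: dp_stage_def)

context spider_core begin

section \<open>Correctness of the table and its stored choices\<close>

definition addr :: "nat => nat => nat => nat" where
  "addr t S D = t * (NS * (Dmax + 1)) + S * (Dmax + 1) + D"

lemma addr_inj:
  assumes "S < NS" "S' < NS" "D <= Dmax" "D' <= Dmax"
  shows "addr t S D = addr t' S' D' \<longleftrightarrow> t = t' \<and> S = S' \<and> D = D'"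
proof -
  have b: "S * (Dmax + 1) + D < NS * (Dmax + 1)" if "S < NS" "D <= Dmax" for S D
  proof -
    have "S * (Dmax + 1) + D < Suc S * (Dmax + 1)" using that by simp
    also have "\<dots> <= NS * (Dmax + 1)" using that by (intro mult_le_mono1) simp
    finally show ?thesis .
  qed
  have "addr t S D = addr t' S' D' \<longleftrightarrow> t = t' \<and> S * (Dmax + 1) + D = S' * (Dmax + 1) + D'"
    unfolding addr_def add.assoc by (rule index_inj) (use b assms in blast)+
  moreover have "S * (Dmax + 1) + D = S' * (Dmax + 1) + D' \<longleftrightarrow> S = S' \<and> D = D'"
    by (rule index_inj) (use assms in simp_all)
  ultimately show ?thesis by simp
qed

abbreviation Vf :: "state => nat => nat => nat => real" where "Vf s t S D \<equiv> reals s ''V'' (addr t S D)"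
abbreviation COf :: "state => nat => nat => nat => nat" where "COf s t S D \<equiv> nats s ''CO'' (addr t S D)"
abbreviation CEf :: "state => nat => nat => nat => nat" where "CEf s t S D \<equiv> nats s ''CE'' (addr t S D)"
abbreviation CFf :: "state => nat => nat => nat => nat" where "CFf s t S D \<equiv> nats s ''CF'' (addr t S D)"

definition optv :: "(nat => nat => nat => real) => nat => nat => nat => nat => nat => real" where
  "optv V t S D l e = max (wcost G t l e) (V t (S + 2 ^ l) (D + need r e))"

definition base :: "(nat => nat => nat => real) => nat => nat => nat => real" where
  "base V t S D = (if t = 0 then (if S = full \<and> D = 0 then 0 else big) else V (t - 1) S (pay t S D))"

text \<open>The stored number is 0 for passing a user, and also for an initial entry at threshold 0,
  and \<open>Suc l\<close> for opening leg \<open>l\<close>. Upper bounds on the referenced values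
  are all that the traceback needs, so no equation is stated.\<close>

definition choice :: "(nat => nat => nat => real) => nat => nat => nat => real => nat => nat => nat => bool" where
  "choice V t S D v c e f \<longleftrightarrow> (c = 0 \<and> base V t S D <= v) \<or>
    (\<exists>l. c = Suc l \<and> can_open t S D l e \<and> optv V t S D l e <= v \<and>
      (1 <= e --> near_ok (isfac fs) f (l, (reach t l e - B t) / 2)))"

abbreviation chosen :: "(nat => nat => nat => real) => nat => nat => nat => state => bool" where
  "chosen V t S D s \<equiv> choice V t S D (s$$''bv'') (s$''bo'') (s$''be'') (s$''bf'')"

text \<open>The half of the recurrence that serves optimality; \<open>choice\<close> is the half
  that serves the construction.\<close>

definition low :: "(nat => nat => nat => real) => nat => nat => nat => real => bool" where
  "low V t S D v \<longleftrightarrow> v <= base V t S D \<and> (\<forall>l e. can_open t S D l e --> v <= optv V t S D l e)"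

definition cellok :: "state => nat => nat => nat => bool" where
  "cellok s t S D \<longleftrightarrow> low (Vf s) t S D (Vf s t S D) \<and>
    choice (Vf s) t S D (Vf s t S D) (COf s t S D) (CEf s t S D) (CFf s t S D)"

definition rctx :: "nat => nat => state => bool" where
  "rctx t S s \<longleftrightarrow> pst t s \<and> (wtabd t s) \<and> s$''cs'' = S \<and> S < NS \<and>
    (\<forall>l\<le>d. nats s ''ins'' l = (if bit S l then 1 else 0))"

lemma rctx_frame: "frame p s s' ==> rctx t S s ==> nwrites p \<inter> (tstN \<union> {''ct'', ''kk'', ''WF'', ''cs'', ''ins''}) = {} ==>
    rwrites p \<inter> (cstR \<union> {''W''}) = {} ==> rctx t S s'"
proof -
  assume f: "frame p s s'" and r: "rctx t S s" and d: "nwrites p \<inter> (tstN \<union> {''ct'', ''kk'', ''WF'', ''cs'', ''ins''}) = {}"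
    "rwrites p \<inter> (cstR \<union> {''W''}) = {}"
  have "tstN \<union> {''ct'', ''kk''} \<subseteq> tstN \<union> {''ct'', ''kk'', ''WF'', ''cs'', ''ins''}" by (rule Un_mono) simp_all
  then have "pst t s' = pst t s" by (rule pst_frame[OF f disj_sub[OF d(1)] disj_sub[OF d(2) Un_upper1]])
  moreover have "nats s' ''WF'' = nats s ''WF''" "nats s' ''cs'' = nats s ''cs''" "nats s' ''ins'' = nats s ''ins''"
    by (rule frame_eqs(1)[OF f d(1)], simp)+
  moreover have "reals s' ''W'' = reals s ''W''" by (rule frame_eqs(2)[OF f d(2)], simp)
  ultimately have "rctx t S s' = rctx t S s" unfolding rctx_def wcelld_def by (simp only:)
  then show ?thesis using r by (simp only:)
qed

lemma rctxD:
  assumes "rctx t S s"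
  shows "pst t s" "l <= d ==> e <= lim l - cm t l + 1 ==> wcelld t s l e" "s$''cs'' = S" "S < NS"
    "l <= d ==> nats s ''ins'' l = (if bit S l then 1 else 0)"
proof -
  have e: "pst t s" "wtabd t s" "s$''cs'' = S" "S < NS"
    "\<forall>l\<le>d. nats s ''ins'' l = (if bit S l then 1 else 0)"
    using assms unfolding rctx_def by - (elim conjE, assumption)+
  show "pst t s" "s$''cs'' = S" "S < NS" by (fact e)+
  show "l <= d ==> e <= lim l - cm t l + 1 ==> wcelld t s l e" using e(2) by simp
  show "l <= d ==> nats s ''ins'' l = (if bit S l then 1 else 0)" using e(5) by simp
qed

lemma nval_dpos:
  assumes "tst s" "s$''ct'' = t" "t <= T" "nval eS s = S" "S <= NS" "nval eD s = D"
  shows "nval (dpos eS eD) s = addr t S D"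
  using tstD(4)[OF assms(1,5)] tstD(5)[OF assms(1,3)] assms by (simp add: dpos_def addr_def)

lemma nval_cpos: "ctx s ==> s$''cl'' = l ==> l <= d ==> nval (cpos e) s = ubase l + nval e s"
  by (simp add: cpos_def ctxD(9))

lemma can_open_iff:
  "l <= d ==> \<not> bit S l ==> e <= lim l - cm t l + 1 ==>
    can_open t S D l e \<longleftrightarrow> D + need r e <= Dmax \<and> \<not> (e = 0 \<and> S = 0 \<and> 0 < t)"
  unfolding can_open_def by blast

lemma ok_opt_try:
  assumes c: "rctx t S s" and v: "s$''cl'' = l" "s$''ce'' = e" "s$''cd'' = D" "s$''nd'' = need r e"
    and op: "can_open t S D l e"
    and ch: "chosen V t S D s" and V: "V = Vf s"
  shows "ok opt_try s (\<lambda>t' s'. s'$$''bv'' <= optv V t S D l e \<and> s'$$''bv'' <= s$$''bv'' \<and>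
    chosen V t S D s' \<and> t' <= 100)"
proof -
  note p = rctxD(1)[OF c]
  note k = pstD(1)[OF p] and ct = pstD(2)[OF p] and tT = pstD(3)[OF p]
  note x = tstD(2)[OF k]
  have o: "l <= d" "\<not> bit S l" "e <= lim l - cm t l + 1" "D + need r e <= Dmax" using op unfolding can_open_def by blast+
  have w: "wcelld t s l e" by (rule rctxD(2)[OF c o(1,3)])
  have S': "S + 2 ^ l < NS" by (rule add_pow_less[OF rctxD(4)[OF c] o(2)]) (use o(1) in simp)
  have pw: "nats s ''pw'' l = 2 ^ l" using tstD(3)[OF k, of l] o(1) by simp
  let ?V = "V t (S + 2 ^ l) (D + need r e)" and ?W = "wcost G t l e"
  have i1: "nval (dpos (nv ''cs'' +n NGet ''pw'' (nv ''cl'')) (nv ''cd'' +n nv ''nd'')) s = addr t (S + 2 ^ l) (D + need r e)"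
    by (rule nval_dpos[OF k ct tT _ less_imp_le[OF S']]) (simp_all add: v rctxD(3)[OF c] pw)
  have W: "reals s ''W'' (ubase l + e) = ?W" using w by (simp add: wcelld_def)
  define s1 where "s1 = rupd ''val'' 0 ?V s"
  define s2 where "s2 = rupd ''val'' 0 (optv V t S D l e) s1"
  have 1: "ok (rset ''val'' (RGet ''V'' (dpos (nv ''cs'' +n NGet ''pw'' (nv ''cl'')) (nv ''cd'' +n nv ''nd'')))) s (\<lambda>t' s'. s' = s1 \<and> t' <= 25)"
    by (simp add: i1 s1_def V del: nval.simps(2-4))
  have x1: "ctx s1" using x by (simp add: s1_def)
  have i2: "nval (cpos (nv ''ce'')) s' = ubase l + e" if "ctx s'" "nats s' = nats s" for s'
    using nval_cpos[OF that(1) _ o(1), of "nv ''ce''"] that(2) v by simp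
  have 2: "ok (Cond (RLess (rv ''val'') (RGet ''W'' (cpos (nv ''ce'')))) (rset ''val'' (RGet ''W'' (cpos (nv ''ce'')))) Skip) s1 (\<lambda>t' s'. s' = s2 \<and> t' <= 25)"
  proof -
    have e: "nval (cpos (nv ''ce'')) s1 = ubase l + e" by (rule i2[OF x1]) (simp add: s1_def)
    have f: "s1$$''val'' = ?V" "reals s1 ''W'' (ubase l + e) = ?W" using W by (simp_all add: s1_def)
    have u: "s2 = s1" if "\<not> ?V < ?W" using that unfolding s2_def s1_def optv_def by (simp add: rupd_def max_def)
    show ?thesis
    proof (cases "?V < ?W")
      case True
      then show ?thesis by (simp add: e f s2_def optv_def max_def)
    next
      case False
      then show ?thesis using u by (simp add: e f)
    qed
  qed
  have i3: "nval (cpos (nv ''ce'')) (nupd ''be'' 0 e (nupd ''bo'' 0 (Suc l) (rupd ''bv'' 0 z s2))) = ubase l + e" for z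
    using nval_cpos[of "nupd ''be'' 0 e (nupd ''bo'' 0 (Suc l) (rupd ''bv'' 0 z s2))" l "nv ''ce''"] x1 o(1) v by (simp add: s2_def s1_def)
  have ch': "choice V t S D (optv V t S D l e) (Suc l) e (nats s ''WF'' (ubase l + e))"
    unfolding choice_def using op w by (simp add: wcelld_def)
  have s2v: "s2$$''val'' = optv V t S D l e" "reals s2 ''bv'' = reals s ''bv''" "nats s2 = nats s" by (simp_all add: s2_def s1_def)
  have 3: "ok (Cond (RLess (rv ''val'') (rv ''bv''))
      (rset ''bv'' (rv ''val'') ;; nset ''bo'' (nv ''cl'' +n N1) ;; nset ''be'' (nv ''ce'') ;; nset ''bf'' (NGet ''WF'' (cpos (nv ''ce'')))) Skip) s2
    (\<lambda>t' s'. s'$$''bv'' <= optv V t S D l e \<and> s'$$''bv'' <= s$$''bv'' \<and>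
    chosen V t S D s' \<and> t' <= 50)"
  proof (cases "optv V t S D l e < s$$''bv''")
    case True
    then show ?thesis using ch' by (simp add: s2v v i3)
  next
    case False
    then show ?thesis using ch by (simp add: s2v)
  qed
  show ?thesis unfolding opt_try_def
  proof (rule ok_seq[OF 1], rule ok_seq)
    fix t1 :: nat and s1' assume a: "s1' = s1 \<and> t1 <= 25"
    show "ok (Cond (RLess (rv ''val'') (RGet ''W'' (cpos (nv ''ce'')))) (rset ''val'' (RGet ''W'' (cpos (nv ''ce'')))) Skip) s1' (\<lambda>t' s'. s' = s2 \<and> t' <= 25)"
      using 2 a by simp
    fix t2 :: nat and s2' assume b: "s2' = s2 \<and> t2 <= 25"
    show "ok (Cond (RLess (rv ''val'') (rv ''bv''))
      (rset ''bv'' (rv ''val'') ;; nset ''bo'' (nv ''cl'' +n N1) ;; nset ''be'' (nv ''ce'') ;; nset ''bf'' (NGet ''WF'' (cpos (nv ''ce'')))) Skip) s2'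
    (\<lambda>t' s'. s'$$''bv'' <= optv V t S D l e \<and> s'$$''bv'' <= s$$''bv'' \<and>
    chosen V t S D s' \<and> t1 + (t2 + t') <= 100)"
      unfolding conjunct1[OF b] by (rule ok_conseq[OF 3]) (use a b in simp)
  qed
qed

lemma ok_opt:
  assumes c: "rctx t S s" and v: "s$''cl'' = l" "s$''ce'' = e" "s$''cd'' = D"
    and l: "l <= d" "\<not> bit S l" "e <= lim l - cm t l + 1"
    and ch: "chosen V t S D s" and V: "V = Vf s"
  shows "ok opt s (\<lambda>t' s'. (can_open t S D l e --> s'$$''bv'' <= optv V t S D l e) \<and> s'$$''bv'' <= s$$''bv'' \<and>
    chosen V t S D s' \<and> t' <= 150)"
proof -
  note p = rctxD(1)[OF c]
  note k = pstD(1)[OF p] and ct = pstD(2)[OF p] and tT = pstD(3)[OF p]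
  note x = tstD(2)[OF k]
  define s1 where "s1 = nupd ''nd'' 0 (need r e) s"
  have 1: "ok opt_need s (\<lambda>t' s'. s' = s1 \<and> t' <= 15)"
    by (simp add: opt_need_def v ctxD(2)[OF x] s1_def need_def)
  have c1: "rctx t S s1" by (rule rctx_frame[of "nset ''nd'' N0" s]) (simp_all add: c s1_def frame_def)
  have g: "bval opt_guard s1 = can_open t S D l e"
  proof -
    have "bval (NLess (nv ''Dm'') (nv ''cd'' +n nv ''nd'')) s1 = (\<not> D + need r e <= Dmax)" by (simp add: s1_def v ctxD(8)[OF x] not_le)
    moreover have "bval (NLess (nv ''ce'') N1) s1 = (e = 0)" by (simp add: s1_def v)
    moreover have "bval (NLess (nv ''cs'') N1) s1 = (S = 0)" by (simp add: s1_def rctxD(3)[OF c])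
    moreover have "bval (NLess N0 (nv ''ct'')) s1 = (0 < t)" by (simp add: s1_def ct)
    ultimately show ?thesis unfolding opt_guard_def can_open_iff[OF l] by (simp only: bval.simps(3,4)) blast
  qed
  have bc: "bcost opt_guard = 25" by (simp add: opt_guard_def)
  have b1: "reals s1 = reals s" "nats s1 ''bo'' = nats s ''bo''" "nats s1 ''be'' = nats s ''be''" "nats s1 ''bf'' = nats s ''bf''" by (simp_all add: s1_def)
  have 2: "ok (Cond opt_guard opt_try Skip) s1 (\<lambda>t' s'. (can_open t S D l e --> s'$$''bv'' <= optv V t S D l e) \<and> s'$$''bv'' <= s$$''bv'' \<and>
    chosen V t S D s' \<and> t' <= 130)"
  proof (cases "can_open t S D l e")
    case True
    have t: "ok opt_try s1 (\<lambda>t' s'. s'$$''bv'' <= optv V t S D l e \<and> s'$$''bv'' <= s1$$''bv'' \<and>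
      chosen V t S D s' \<and> t' <= 100)"
      by (rule ok_opt_try[OF c1 _ _ _ _ True]) (use v ch V in \<open>simp_all add: s1_def\<close>)
    have b: "bval opt_guard s1" using True g by simp
    show ?thesis unfolding ok_Cond_True[OF b] bc
      by (rule ok_conseq[OF t]) (simp add: b1)
  next
    case False
    have b: "\<not> bval opt_guard s1" using False g by simp
    show ?thesis unfolding ok_Cond_False[OF b] bc using False ch b1 by simp
  qed
  show ?thesis unfolding opt_def
  proof (rule ok_seq[OF 1])
    fix t1 :: nat and s' assume a: "s' = s1 \<and> t1 <= 15"
    show "ok (Cond opt_guard opt_try Skip) s' (\<lambda>t' s'. (can_open t S D l e --> s'$$''bv'' <= optv V t S D l e) \<and> s'$$''bv'' <= s$$''bv'' \<and>
      chosen V t S D s' \<and> t1 + t' <= 150)"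
      unfolding conjunct1[OF a] by (rule ok_conseq[OF 2]) (use a in simp)
  qed
qed

lemma ok_opt_loop:
  assumes c: "rctx t S s" and v: "s$''cl'' = l" "s$''cd'' = D" and l: "l <= d" "\<not> bit S l"
    and ch: "chosen V t S D s" and V: "V = Vf s"
  shows "ok (For ''ce'' elen opt) s (\<lambda>t' s'. (\<forall>e. can_open t S D l e --> s'$$''bv'' <= optv V t S D l e) \<and> s'$$''bv'' <= s$$''bv'' \<and>
    chosen V t S D s' \<and> t' <= (Kc + 2) * 170 + 20)"
proof (rule ok_For[where I = "\<lambda>k s'. (\<forall>e<k. can_open t S D l e --> s'$$''bv'' <= optv V t S D l e) \<and> s'$$''bv'' <= s$$''bv'' \<and>
    chosen V t S D s'" and N = "lim l - cm t l + 2" and c = 150], goal_cases)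
  case 1
  show ?case using ch by simp
next
  case (3 k s1)
  have c1: "rctx t S s1" by (rule rctx_frame[OF 3(3) c]) simp_all
  have cl: "s1$''cl'' = l" using frameD(1)[OF 3(3)] v by simp
  show ?case using tstD(6)[OF pstD(1)[OF rctxD(1)[OF c1]] l(1)] pstD(4)[OF rctxD(1)[OF c1] l(1)] cl by (simp add: elen_def kcl_def)
next
  case (4 k s1)
  have c1: "rctx t S s1" by (rule rctx_frame[OF 4(3) c]) simp_all
  have w: "s1$''cl'' = l" "s1$''cd'' = D" "V = Vf s1" using frameD[OF 4(3)] v V by simp_all
  have e: "k <= lim l - cm t l + 1" using 4(1) by simp
  have ch1: "chosen V t S D s1" using 4(2) by blast
  show ?case
  proof (rule ok_conseq[OF ok_opt[OF c1 w(1) 4(4) w(2) l e ch1 w(3)]])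
    fix t' :: nat and s2 :: state
    assume a: "(can_open t S D l k --> s2$$''bv'' <= optv V t S D l k) \<and> s2$$''bv'' <= s1$$''bv'' \<and>
      chosen V t S D s2 \<and> t' <= 150"
    have "\<forall>e<Suc k. can_open t S D l e --> s2$$''bv'' <= optv V t S D l e"
    proof (intro allI impI)
      fix e assume e: "e < Suc k" "can_open t S D l e"
      show "s2$$''bv'' <= optv V t S D l e"
      proof (cases "e = k")
        case False
        then have "s1$$''bv'' <= optv V t S D l e" using 4(2) e by simp
        then show ?thesis using a by linarith
      qed (use a e in blast)
    qed
    moreover have "s2$$''bv'' <= s$$''bv''" using a 4(2) by linarith
    ultimately show "t' <= 150 \<and> (\<forall>e<Suc k. can_open t S D l e --> reals (nupd ''ce'' 0 (Suc k) s2) ''bv'' 0 <= optv V t S D l e) \<and>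
      reals (nupd ''ce'' 0 (Suc k) s2) ''bv'' 0 <= s$$''bv'' \<and>
      choice V t S D (reals (nupd ''ce'' 0 (Suc k) s2) ''bv'' 0) (nats (nupd ''ce'' 0 (Suc k) s2) ''bo'' 0) (nats (nupd ''ce'' 0 (Suc k) s2) ''be'' 0) (nats (nupd ''ce'' 0 (Suc k) s2) ''bf'' 0)"
      using a by simp
  qed
next
  case (5 t' s1)
  have "(lim l - cm t l + 2) * (150 + ncost elen + 10) <= (Kc + 2) * 170" by (rule mult_le_mono) simp_all
  moreover have "ncost elen = 9" by simp
  ultimately have "t' <= (Kc + 2) * 170 + 20" using 5(4) by linarith
  moreover have "\<forall>e. can_open t S D l e --> s1$$''bv'' <= optv V t S D l e"
  proof (intro allI impI)
    fix e assume o: "can_open t S D l e"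
    then have "e < lim l - cm t l + 2" unfolding can_open_def by linarith
    then show "s1$$''bv'' <= optv V t S D l e" using 5(1) o by blast
  qed
  ultimately show ?case using 5(1) by blast
qed simp_all

definition cell_time :: nat where
  "cell_time = (d + 1) * ((Kc + 2) * 170 + 50) + 200"

lemma ok_cell_loop:
  assumes c: "rctx t S s" and v: "s$''cd'' = D"
    and ch: "chosen V t S D s" and V: "V = Vf s"
  shows "ok cell_loop s (\<lambda>t' s'. (\<forall>l e. can_open t S D l e --> s'$$''bv'' <= optv V t S D l e) \<and> s'$$''bv'' <= s$$''bv'' \<and>
    chosen V t S D s' \<and> t' + 180 <= cell_time)"
  unfolding cell_loop_def
proof (rule ok_For[where I = "\<lambda>k s'. (\<forall>l<k. \<forall>e. can_open t S D l e --> s'$$''bv'' <= optv V t S D l e) \<and> s'$$''bv'' <= s$$''bv'' \<and>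
    chosen V t S D s'" and N = "Suc d" and c = "(Kc + 2) * 170 + 30"], goal_cases)
  case 1
  show ?case using ch by simp
next
  case (3 k s1)
  have c1: "rctx t S s1" by (rule rctx_frame[OF 3(3) c]) simp_all
  show ?case using ctxD(1)[OF tstD(2)[OF pstD(1)[OF rctxD(1)[OF c1]]]] by simp
next
  case (4 k s1)
  have c1: "rctx t S s1" by (rule rctx_frame[OF 4(3) c]) simp_all
  have w: "s1$''cd'' = D" "V = Vf s1" using frameD[OF 4(3)] v V by simp_all
  have k: "k <= d" using 4(1) by simp
  have ch1: "chosen V t S D s1" using 4(2) by blast
  have bc: "bcost (NLess (NGet ''ins'' (nv ''cl'')) N1) = 5" by simp
  have fin: "t' <= (Kc + 2) * 170 + 30 \<and> (\<forall>l<Suc k. \<forall>e. can_open t S D l e --> reals (nupd ''cl'' 0 (Suc k) s2) ''bv'' 0 <= optv V t S D l e) \<and>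
      reals (nupd ''cl'' 0 (Suc k) s2) ''bv'' 0 <= s$$''bv'' \<and>
      choice V t S D (reals (nupd ''cl'' 0 (Suc k) s2) ''bv'' 0) (nats (nupd ''cl'' 0 (Suc k) s2) ''bo'' 0) (nats (nupd ''cl'' 0 (Suc k) s2) ''be'' 0) (nats (nupd ''cl'' 0 (Suc k) s2) ''bf'' 0)"
    if a1: "\<forall>e. can_open t S D k e --> s2$$''bv'' <= optv V t S D k e" and a2: "s2$$''bv'' <= s1$$''bv''"
      and a3: "chosen V t S D s2" and a4: "t' <= (Kc + 2) * 170 + 30" for t' and s2 :: state
  proof -
    have "\<forall>l<Suc k. \<forall>e. can_open t S D l e --> s2$$''bv'' <= optv V t S D l e"
    proof (intro allI impI)
      fix l e assume l: "l < Suc k" "can_open t S D l e"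
      show "s2$$''bv'' <= optv V t S D l e"
      proof (cases "l = k")
        case False
        then have "s1$$''bv'' <= optv V t S D l e" using 4(2) l by simp
        then show ?thesis using a2 by linarith
      qed (use a1 l in blast)
    qed
    moreover have "s2$$''bv'' <= s$$''bv''" using a2 4(2) by linarith
    ultimately show ?thesis using a3 a4 by simp
  qed
  show ?case
  proof (cases "bit S k")
    case True
    have b: "\<not> bval (NLess (NGet ''ins'' (nv ''cl'')) N1) s1" using True rctxD(5)[OF c1 k] 4(4) by simp
    have "\<forall>e. \<not> can_open t S D k e" using True unfolding can_open_def by blast
    then show ?thesis unfolding ok_Cond_False[OF b] ok_Skip bc by (intro fin) (use ch1 in simp_all)
  next
    case False
    have b: "bval (NLess (NGet ''ins'' (nv ''cl'')) N1) s1" using False rctxD(5)[OF c1 k] 4(4) by simp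
    show ?thesis unfolding ok_Cond_True[OF b] bc
    proof (rule ok_conseq[OF ok_opt_loop[OF c1 4(4) w(1) k False ch1 w(2)]], rule fin, goal_cases)
      case (4 t' s2)
      then show ?case by simp
    qed blast+
  qed
next
  case (5 t' s1)
  have "Suc d * ((Kc + 2) * 170 + 30 + ncost (nv ''d'' +n N1) + 10) + ncost (nv ''d'' +n N1) + 10 + 180 <= cell_time"
    unfolding cell_time_def by (simp add: algebra_simps)
  then have "t' + 180 <= cell_time" using 5(4) by linarith
  moreover have "\<forall>l e. can_open t S D l e --> s1$$''bv'' <= optv V t S D l e"
  proof (intro allI impI)
    fix l e assume o: "can_open t S D l e"
    then have "l < Suc d" unfolding can_open_def by linarith
    then show "s1$$''bv'' <= optv V t S D l e" using 5(1) o by blast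
  qed
  ultimately show ?case using 5(1) by blast
qed simp_all

lemma ok_cell_base:
  assumes c: "rctx t S s" and v: "s$''cd'' = D"
  shows "ok cell_base s (\<lambda>t' s'. s'$$''bv'' = base (Vf s) t S D \<and> s'$''bo'' = 0 \<and> t' <= 80)"
proof -
  note p = rctxD(1)[OF c]
  note k = pstD(1)[OF p] and ct = pstD(2)[OF p] and tT = pstD(3)[OF p] and S = rctxD(3,4)[OF c]
  note x = tstD(2)[OF k]
  show ?thesis
  proof (cases t)
    case 0
    have pw: "nats s ''pw'' (Suc d) = NS" using tstD(3)[OF k, of "d + 1"] by simp
    have f: "S = full \<longleftrightarrow> \<not> Suc S < NS" using S(2) by linarith
    show ?thesis
    proof (cases "Suc S < NS")
      case True
      then show ?thesis using 0 f by (simp add: cell_base_def ct v S ctxD(1,5)[OF x] pw base_def)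
    next
      case False
      then show ?thesis using 0 f by (simp add: cell_base_def ct v S ctxD(1,5)[OF x] pw base_def)
    qed
  next
    case (Suc u)
    have u: "u < T" "u <= T" using Suc tT by simp_all
    have ow: "own u <= d" using own[OF u(1)] by simp
    have os: "nats s ''ot'' u + nats s ''os'' S + D' = addr u S D'" for D'
      using tstD(4)[OF k, of S] tstD(5)[OF k u(2)] S by (simp add: addr_def)
    show ?thesis
    proof (cases "bit S (own u)")
      case True
      then show ?thesis using Suc by (simp add: cell_base_def ct v S tstD(8)[OF k] rctxD(5)[OF c ow] os base_def pay_def del: Nat.add_diff_assoc Nat.diff_add_assoc)
    next
      case False
      then show ?thesis using Suc by (simp add: cell_base_def ct v S tstD(8)[OF k] rctxD(5)[OF c ow] os base_def pay_def del: Nat.add_diff_assoc Nat.diff_add_assoc)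
    qed
  qed
qed

definition same_but :: "nat => state => state => bool" where
  "same_but a s s' \<longleftrightarrow> (\<forall>b. b ~= a --> reals s' ''V'' b = reals s ''V'' b \<and> nats s' ''CO'' b = nats s ''CO'' b \<and>
    nats s' ''CE'' b = nats s ''CE'' b \<and> nats s' ''CF'' b = nats s ''CF'' b)"

lemma ok_cell:
  assumes c: "rctx t S s" and v: "s$''cd'' = D" and D: "D <= Dmax"
  shows "ok cell s (\<lambda>t' s'. low (Vf s) t S D (Vf s' t S D) \<and>
    choice (Vf s) t S D (Vf s' t S D) (COf s' t S D) (CEf s' t S D) (CFf s' t S D) \<and> same_but (addr t S D) s s' \<and> t' <= cell_time)"
  unfolding cell_def
proof (rule ok_seq[OF ok_cell_base[OF c v]], rule ok_seq)
  fix t1 :: nat and s1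
  assume a: "s1$$''bv'' = base (Vf s) t S D \<and> s1$''bo'' = 0 \<and> t1 <= 80" and f1: "frame cell_base s s1"
  have c1: "rctx t S s1" by (rule rctx_frame[OF f1 c]) simp_all
  have v1: "s1$''cd'' = D" "Vf s = Vf s1" using frameD[OF f1] v by simp_all
  have ch: "chosen (Vf s) t S D s1"
    using a unfolding choice_def by simp
  show "ok cell_loop s1 (\<lambda>t' s'. (\<forall>l e. can_open t S D l e --> s'$$''bv'' <= optv (Vf s) t S D l e) \<and> s'$$''bv'' <= s1$$''bv'' \<and>
    chosen (Vf s) t S D s' \<and> t' + 180 <= cell_time)"
    by (rule ok_cell_loop[OF c1 v1(1) ch v1(2)])
  fix t2 :: nat and s2
  assume b: "(\<forall>l e. can_open t S D l e --> s2$$''bv'' <= optv (Vf s) t S D l e) \<and> s2$$''bv'' <= s1$$''bv'' \<and>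
    chosen (Vf s) t S D s2 \<and> t2 + 180 <= cell_time"
    and f2: "frame cell_loop s1 s2"
  have c2: "rctx t S s2" by (rule rctx_frame[OF f2 c1]) simp_all
  note p2 = rctxD(1)[OF c2]
  have v2: "s2$''cd'' = D" using frameD[OF f2] v1 by simp
  have lw: "low (Vf s) t S D (s2$$''bv'')" unfolding low_def using a b by simp
  have ch2: "chosen (Vf s) t S D s2" using b by blast
  have i: "nval (dpos (nv ''cs'') (nv ''cd'')) s' = addr t S D" if "tst s'" "s'$''ct'' = t" "s'$''cs'' = S" "s'$''cd'' = D" for s'
    by (rule nval_dpos[OF that(1,2) pstD(3)[OF p2] _ less_imp_le[OF rctxD(4)[OF c2]]]) (use that in simp_all)
  have old: "reals s2 ''V'' = reals s ''V''" "nats s2 ''CO'' = nats s ''CO''" "nats s2 ''CE'' = nats s ''CE''" "nats s2 ''CF'' = nats s ''CF''"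
    using frameD[OF f1] frameD[OF f2] by simp_all
  show "ok cell_store s2 (\<lambda>t' s'. low (Vf s) t S D (Vf s' t S D) \<and>
    choice (Vf s) t S D (Vf s' t S D) (COf s' t S D) (CEf s' t S D) (CFf s' t S D) \<and> same_but (addr t S D) s s' \<and> t1 + (t2 + t') <= cell_time)"
    using lw ch2 a b pstD(1,2)[OF p2] rctxD(3)[OF c2] v2 by (simp add: cell_store_def i same_but_def old)
qed

lemma low_cong: "base V' t S D = base V t S D ==> (\<And>l e. can_open t S D l e ==> optv V' t S D l e = optv V t S D l e) ==>
    low V' t S D v = low V t S D v"
  unfolding low_def by simp

lemma choice_cong: "base V' t S D = base V t S D ==> (\<And>l e. can_open t S D l e ==> optv V' t S D l e = optv V t S D l e) ==>
    choice V' t S D v c e f = choice V t S D v c e f"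
  unfolding choice_def by (metis (no_types, lifting))

text \<open>Entries refer to smaller thresholds or to larger sets at the same threshold. Hence
  writing an entry disturbs neither the values that it used itself nor those used by entries
  completed before.\<close>

lemma same_but_refs:
  assumes sb: "same_but (addr t S D) s s'" and ok: "S < NS" "D <= Dmax" "S' < NS" "D' <= Dmax" and le: "t' < t \<or> t' = t \<and> S <= S'"
  shows "base (Vf s') t' S' D' = base (Vf s) t' S' D'"
    and "can_open t' S' D' l e ==> optv (Vf s') t' S' D' l e = optv (Vf s) t' S' D' l e"
proof -
  have far: "Vf s' u P E = Vf s u P E" if "P < NS" "E <= Dmax" "u < t \<or> S < P" for u P E
  proof -
    have "addr u P E ~= addr t S D" unfolding addr_inj[OF that(1) ok(1) that(2) ok(2)] using that(3) by auto
    then show ?thesis using sb unfolding same_but_def by blast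
  qed
  show "base (Vf s') t' S' D' = base (Vf s) t' S' D'"
  proof (cases "t' = 0")
    case False
    have "pay t' S' D' <= Dmax" using ok(4) by (auto simp: pay_def)
    then have "Vf s' (t' - 1) S' (pay t' S' D') = Vf s (t' - 1) S' (pay t' S' D')"
      by (intro far[OF ok(3)]) (use le False in auto)
    then show ?thesis using False by (simp add: base_def)
  qed (simp add: base_def)
  show "optv (Vf s') t' S' D' l e = optv (Vf s) t' S' D' l e" if "can_open t' S' D' l e"
  proof -
    have o: "l <= d" "\<not> bit S' l" "D' + need r e <= Dmax" using that unfolding can_open_def by blast+
    have "S' + 2 ^ l < NS" by (rule add_pow_less[OF ok(3) o(2)]) (use o(1) in simp)
    moreover have "S' < S' + 2 ^ l" by simp
    ultimately have "Vf s' t' (S' + 2 ^ l) (D' + need r e) = Vf s t' (S' + 2 ^ l) (D' + need r e)"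
      by (intro far[OF _ o(3)]) (use le in linarith)+
    then show ?thesis by (simp add: optv_def)
  qed
qed

lemma cellok_other:
  assumes sb: "same_but (addr t S D) s s'" and v: "S < NS" "D <= Dmax" "S' < NS" "D' <= Dmax" and le: "t' < t \<or> t' = t \<and> S <= S'"
    and ne: "(t', S', D') ~= (t, S, D)" and c: "cellok s t' S' D'"
  shows "cellok s' t' S' D'"
proof -
  have "addr t' S' D' ~= addr t S D" unfolding addr_inj[OF v(3,1,4,2)] using ne by simp
  then have e: "Vf s' t' S' D' = Vf s t' S' D'" "COf s' t' S' D' = COf s t' S' D'" "CEf s' t' S' D' = CEf s t' S' D'" "CFf s' t' S' D' = CFf s t' S' D'"
    using sb unfolding same_but_def by blast+
  note r = same_but_refs[OF sb v le]
  have "low (Vf s') t' S' D' x = low (Vf s) t' S' D' x" for x by (rule low_cong[OF r])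
  moreover have "choice (Vf s') t' S' D' x a b f = choice (Vf s) t' S' D' x a b f" for x a b f by (rule choice_cong[OF r])
  ultimately show ?thesis using c unfolding cellok_def e by (simp only:)
qed

text \<open>Mirrors the order of filling: thresholds upwards and, within one threshold, sets
  downwards.\<close>

definition fin :: "nat => nat => state => bool" where
  "fin t S s \<longleftrightarrow> (\<forall>t' S' D'. S' < NS --> D' <= Dmax --> t' < t \<or> t' = t \<and> S <= S' --> cellok s t' S' D')"

lemma fin_cong: "reals s' ''V'' = reals s ''V'' ==> nats s' ''CO'' = nats s ''CO'' ==> nats s' ''CE'' = nats s ''CE'' ==> nats s' ''CF'' = nats s ''CF'' ==> fin t S s' = fin t S s"
  unfolding fin_def cellok_def by simp

definition row_time :: nat where
  "row_time = 60 * d + 200 + (Dmax + 1) * (cell_time + 20)"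

lemma ok_row:
  assumes p: "pst t s" and W: "wtabd t s" and S: "s$''cs'' = S" "S < NS" and fn: "fin t (Suc S) s"
  shows "ok row s (\<lambda>t' s'. fin t S s' \<and> t' <= row_time)"
  unfolding row_def
proof (rule ok_seq[OF ok_decode[OF pstD(1)[OF p] S]])
  fix t1 :: nat and s1
  assume a: "(\<forall>l\<le>d. nats s1 ''ins'' l = (if bit S l then 1 else 0)) \<and> t1 <= 60 * d + 150" and f: "frame decode s s1"
  note fr = frameD[OF f]
  have p1: "pst t s1" using pst_frame[OF f] p by simp
  have c1: "rctx t S s1" unfolding rctx_def using p1 W S a by (simp add: fr wcelld_def)
  have fn1: "fin t (Suc S) s1" using fin_cong[of s1 s t "Suc S"] fn by (simp add: fr)
  show "ok (For ''cd'' (nv ''Dm'' +n N1) cell) s1 (\<lambda>t' s'. fin t S s' \<and> t1 + t' <= row_time)"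
  proof (rule ok_For[where I = "\<lambda>k s'. fin t (Suc S) s' \<and> (\<forall>D<k. cellok s' t S D)" and N = "Dmax + 1" and c = cell_time], goal_cases)
    case 1
    show ?case using fin_cong[of "nupd ''cd'' 0 0 s1" s1 t "Suc S"] fn1 by simp
  next
    case (3 k s2)
    have c2: "rctx t S s2" by (rule rctx_frame[OF 3(3) c1]) simp_all
    show ?case using ctxD(8)[OF tstD(2)[OF pstD(1)[OF rctxD(1)[OF c2]]]] by simp
  next
    case (4 k s2)
    have c2: "rctx t S s2" by (rule rctx_frame[OF 4(3) c1]) simp_all
    have k: "k <= Dmax" using 4(1) by simp
    show ?case
    proof (rule ok_conseq[OF ok_cell[OF c2 4(4) k]])
      fix t' :: nat and s3 :: state
      assume b: "low (Vf s2) t S k (Vf s3 t S k) \<and> choice (Vf s2) t S k (Vf s3 t S k) (COf s3 t S k) (CEf s3 t S k) (CFf s3 t S k) \<and>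
        same_but (addr t S k) s2 s3 \<and> t' <= cell_time"
      have sb: "same_but (addr t S k) s2 s3" using b by blast
      have f3: "fin t (Suc S) s3" unfolding fin_def
      proof (intro allI impI)
        fix t' S' D' assume h: "S' < NS" "D' <= Dmax" "t' < t \<or> t' = t \<and> Suc S <= S'"
        show "cellok s3 t' S' D'"
        proof (rule cellok_other[OF sb S(2) k h(1,2)])
          show "cellok s2 t' S' D'" using 4(2) h unfolding fin_def by blast
        qed (use h(3) in auto)
      qed
      have new: "cellok s3 t S D" if "D < Suc k" for D
      proof (cases "D = k")
        case True
        have le: "t < t \<or> t = t \<and> S <= S" by simp
        note r = same_but_refs[OF sb S(2) k S(2) k le]
        have "low (Vf s3) t S k x = low (Vf s2) t S k x" for x by (rule low_cong[OF r])
        moreover have "choice (Vf s3) t S k x a b f = choice (Vf s2) t S k x a b f" for x a b f by (rule choice_cong[OF r])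
        ultimately show ?thesis using b unfolding True cellok_def by (simp only: simp_thms)
      next
        case False
        then have D: "D < k" using that by simp
        show ?thesis
        proof (rule cellok_other[OF sb S(2) k S(2)])
          show "cellok s2 t S D" using 4(2) D by blast
        qed (use D k in auto)
      qed
      have up: "fin t (Suc S) (nupd ''cd'' 0 (Suc k) s3) = fin t (Suc S) s3" "cellok (nupd ''cd'' 0 (Suc k) s3) t S D = cellok s3 t S D" for D
        by (rule fin_cong; simp) (simp add: cellok_def)
      show "t' <= cell_time \<and> fin t (Suc S) (nupd ''cd'' 0 (Suc k) s3) \<and> (\<forall>D<Suc k. cellok (nupd ''cd'' 0 (Suc k) s3) t S D)"
        unfolding up using b f3 new by blast
    qed
  next
    case (5 t' s2)
    have "fin t S s2" unfolding fin_def
    proof (intro allI impI)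
      fix t' S' D' assume h: "S' < NS" "D' <= Dmax" "t' < t \<or> t' = t \<and> S <= S'"
      show "cellok s2 t' S' D'"
      proof (cases "t' = t \<and> S' = S")
        case True
        have "D' < Dmax + 1" using h(2) by simp
        then show ?thesis using 5(1) True by blast
      next
        case False
        then have "t' < t \<or> t' = t \<and> Suc S <= S'" using h(3) by auto
        then show ?thesis using 5(1) h(1,2) unfolding fin_def by blast
      qed
    qed
    moreover have "(Dmax + 1) * (cell_time + ncost (nv ''Dm'' +n N1) + 10) <= (Dmax + 1) * (cell_time + 20)"
      by (rule mult_le_mono2) simp
    moreover have "ncost (nv ''Dm'' +n N1) = 4" by simp
    ultimately show ?case using 5(4) a unfolding row_time_def by linarith
  qed simp_all
qed

definition stage_time :: nat where
  "stage_time = wtab_time + NS * (row_time + 30) + 100"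

lemma ok_dp_stage:
  assumes c: "tst s" and ct: "s$''ct'' = t" "t <= T" and kk: "\<forall>l\<le>d. nats s ''kk'' l = cn own (t - 1) l" and fn: "fin t NS s"
  shows "ok dp_stage s (\<lambda>t' s'. pst t s' \<and> fin (Suc t) NS s' \<and> t' <= stage_time)"
  unfolding dp_stage_def
proof (rule ok_seq)
  show "ok stage_kk s (\<lambda>t' s'. pst t s' \<and> t' <= 40)"
  proof (cases t)
    case 0
    then show ?thesis using c ct kk by (simp add: stage_kk_def pst_def)
  next
    case (Suc u)
    have u: "u < T" using Suc ct by simp
    have ow: "own u <= d" using own[OF u] by simp
    have k: "\<And>l. l <= d ==> nats s ''kk'' l = cn own u l" using kk Suc by simp
    have k2: "Suc (nats s ''kk'' (own u)) = cn own (Suc u) (own u)" "\<And>l. l <= d ==> l ~= own u ==> nats s ''kk'' l = cn own (Suc u) l"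
      using k ow by (simp_all add: cn_Suc)
    show ?thesis using c ct unfolding Suc by (simp add: stage_kk_def pst_def tstD(8)[OF c] k2)
  qed
  fix t1 :: nat and s1 assume a: "pst t s1 \<and> t1 <= 40" and f1: "frame stage_kk s s1"
  have p1: "pst t s1" using a by blast
  show "ok (wtab ;; nset ''cs'' (NGet ''pw'' (nv ''d'' +n N1)) ;; While (NLess N0 (nv ''cs'')) (nset ''cs'' (nv ''cs'' -n N1) ;; row)) s1
    (\<lambda>t' s'. pst t s' \<and> fin (Suc t) NS s' \<and> t1 + t' <= stage_time)"
  proof (rule ok_seq[OF ok_wtab[OF p1]])
    fix t2 :: nat and s2
    assume b: "(wtabd t s2) \<and> t2 <= wtab_time" and f2: "frame wtab s1 s2"
    have p2: "pst t s2" using pst_frame[OF f2] p1 by simp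
    define s3 where "s3 = nupd ''cs'' 0 NS s2"
    have f3: "frame (nset ''cs'' N0) s2 s3" by (simp add: s3_def frame_def)
    have p3: "pst t s3" using pst_frame[OF f3] p2 by simp
    have W3: "wtabd t s3" using b by (simp add: s3_def wcelld_def)
    have fn3: "fin t NS s3"
      using fin_cong[of s3 s t NS] fn frameD[OF f1] frameD[OF f2] by (simp add: s3_def)
    have st: "nupd ''cs'' (nval N0 s2) (nval (NGet ''pw'' (nv ''d'' +n N1)) s2) s2 = s3"
      using ctxD(1)[OF tstD(2)[OF pstD(1)[OF p2]]] tstD(3)[OF pstD(1)[OF p2], of "d + 1"] by (simp add: s3_def)
    have w: "ok (While (NLess N0 (nv ''cs'')) (nset ''cs'' (nv ''cs'' -n N1) ;; row)) s3 (\<lambda>t' s'. pst t s' \<and> fin (Suc t) NS s' \<and> t' <= NS * (row_time + 30) + 10)"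
    proof (rule ok_While[where I = "\<lambda>s'. fin t (s'$''cs'') s' \<and> s'$''cs'' <= NS" and \<Phi> = "\<lambda>s'. s'$''cs'' * (row_time + 30)"], goal_cases)
      case 1
      show ?case using fn3 by (simp add: s3_def)
    next
      case (2 s4)
      obtain S where S: "s4$''cs'' = Suc S" using 2(3) by (cases "s4$''cs''") auto
      have p4: "pst t s4" using pst_frame[OF 2(2)] p3 by simp
      define s5 where "s5 = nupd ''cs'' 0 S s4"
      have f5: "frame (nset ''cs'' N0) s4 s5" by (simp add: s5_def frame_def)
      have p5: "pst t s5" using pst_frame[OF f5] p4 by simp
      have W5: "wtabd t s5" using W3 frameD[OF 2(2)] by (simp add: s5_def wcelld_def)
      have S5: "s5$''cs'' = S" "S < NS" using 2(1) S by (simp_all add: s5_def)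
      have fn5: "fin t (Suc S) s5" using fin_cong[of s5 s4 t "Suc S"] 2(1) S by (simp add: s5_def)
      have e: "nupd ''cs'' (nval N0 s4) (nval (nv ''cs'' -n N1) s4) s4 = s5" using S by (simp add: s5_def)
      have nc: "ncost N0 + ncost (nv ''cs'' -n N1) + 1 = 6" "bcost (NLess N0 (nv ''cs'')) = 4" by simp_all
      show ?case unfolding ok_Seq ok_NSet e nc
      proof (rule ok_conseq[OF ok_row[OF p5 W5 S5 fn5]])
        fix t' :: nat and s6 :: state assume h: "fin t S s6 \<and> t' <= row_time" and f6: "frame row s5 s6"
        have "s6$''cs'' = S" using frameD(1)[OF f6] S5 by simp
        then show "(fin t (s6$''cs'') s6 \<and> s6$''cs'' <= NS) \<and> 4 + (6 + t') + 1 + s6$''cs'' * (row_time + 30) <= s4$''cs'' * (row_time + 30)"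
          using h S5 S by simp
      qed
    next
      case (3 t' s4)
      have p4: "pst t s4" using pst_frame[OF 3(2)] p3 by simp
      have z: "s4$''cs'' = 0" using 3(3) by simp
      have "fin (Suc t) NS s4" using 3(1) unfolding z fin_def by (auto simp: less_Suc_eq)
      moreover have "t' <= NS * (row_time + 30) + 10" using 3(4) z by (simp add: s3_def)
      ultimately show ?case using p4 by blast
    qed
    have nc: "ncost N0 + ncost (NGet ''pw'' (nv ''d'' +n N1)) + 1 = 7" by simp
    show "ok (nset ''cs'' (NGet ''pw'' (nv ''d'' +n N1)) ;; While (NLess N0 (nv ''cs'')) (nset ''cs'' (nv ''cs'' -n N1) ;; row)) s2
      (\<lambda>t' s'. pst t s' \<and> fin (Suc t) NS s' \<and> t1 + (t2 + t') <= stage_time)"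
      unfolding ok_Seq ok_NSet st nc
    proof (rule ok_conseq[OF w])
      fix t' :: nat and s' :: state assume "pst t s' \<and> fin (Suc t) NS s' \<and> t' <= NS * (row_time + 30) + 10"
      then show "pst t s' \<and> fin (Suc t) NS s' \<and> t1 + (t2 + (7 + t')) <= stage_time" using a b unfolding stage_time_def by linarith
    qed
  qed
qed

definition dp_time :: nat where
  "dp_time = (T + 1) * (stage_time + 20) + 100 * d + 60 * NS + 60 * T + 500"

lemma ok_dp:
  assumes c: "cst s"
  shows "ok dp s (\<lambda>t s'. tst s' \<and> (\<forall>l\<le>d. nats s' ''kk'' l = cn own T l) \<and> fin (Suc T) NS s' \<and> t <= dp_time)"
  unfolding dp_def
proof (rule ok_seq[OF ok_dp_setup[OF c]])
  fix t0 :: nat and s0 assume a: "tst s0 \<and> (\<forall>l\<le>d. nats s0 ''kk'' l = 0) \<and> t0 <= 100 * d + 60 * NS + 60 * T + 400"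
  have c0: "tst s0" using a by blast
  show "ok (For ''ct'' (nv ''T'' +n N1) dp_stage) s0 (\<lambda>t s'. tst s' \<and> (\<forall>l\<le>d. nats s' ''kk'' l = cn own T l) \<and> fin (Suc T) NS s' \<and> t0 + t <= dp_time)"
  proof (rule ok_For[where I = "\<lambda>k s'. (\<forall>l\<le>d. nats s' ''kk'' l = cn own (k - 1) l) \<and> fin k NS s'" and N = "T + 1" and c = stage_time], goal_cases)
    case 1
    show ?case using a by (simp add: fin_def)
  next
    case (3 k s1)
    have "tst s1" using tst_frame[OF 3(3)] c0 by simp
    then show ?case by (simp add: tstD(7))
  next
    case (4 k s1)
    have c1: "tst s1" using tst_frame[OF 4(3)] c0 by simp
    have k: "k <= T" using 4(1) by simp
    show ?case
    proof (rule ok_conseq[OF ok_dp_stage[OF c1 4(4) k conjunct1[OF 4(2)] conjunct2[OF 4(2)]]])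
      fix t' :: nat and s2 :: state assume b: "pst k s2 \<and> fin (Suc k) NS s2 \<and> t' <= stage_time"
      have "\<forall>l\<le>d. nats s2 ''kk'' l = cn own k l" using b unfolding pst_def by blast
      moreover have "fin (Suc k) NS (nupd ''ct'' 0 (Suc k) s2) = fin (Suc k) NS s2" by (rule fin_cong) simp_all
      ultimately show "t' <= stage_time \<and> (\<forall>l\<le>d. nats (nupd ''ct'' 0 (Suc k) s2) ''kk'' l = cn own (Suc k - 1) l) \<and> fin (Suc k) NS (nupd ''ct'' 0 (Suc k) s2)"
        using b by simp
    qed
  next
    case (5 t' s1)
    have "tst s1" using tst_frame[OF 5(2)] c0 by simp
    moreover have "(T + 1) * (stage_time + ncost (nv ''T'' +n N1) + 10) <= (T + 1) * (stage_time + 20)" by (rule mult_le_mono2) simp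
    moreover have "ncost (nv ''T'' +n N1) = 4" by simp
    ultimately have "t0 + t' <= dp_time" using 5(4) a unfolding dp_time_def by linarith
    then show ?case using 5(1) \<open>tst s1\<close> by simp
  qed simp_all
qed

lemma fin_dp_upper: "fin (Suc T) NS s ==> dp_upper G (Vf s)"
  unfolding dp_upper_def
proof (intro allI impI)
  fix t S D assume f: "fin (Suc T) NS s" and h: "t <= T" "S < NS" "D <= Dmax"
  have "cellok s t S D" using f h unfolding fin_def by (simp add: less_Suc_eq_le)
  then have lw: "Vf s t S D <= base (Vf s) t S D" "\<And>l e. can_open t S D l e ==> Vf s t S D <= optv (Vf s) t S D l e"
    unfolding cellok_def low_def by blast+
  then show "(t = 0 \<and> S = full \<and> D = 0 --> Vf s t S D <= 0) \<and> (0 < t --> Vf s t S D <= Vf s (t - 1) S (pay t S D)) \<and>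
    (\<forall>l e. can_open t S D l e --> Vf s t S D <= max (wcost G t l e) (Vf s t (S + 2 ^ l) (D + need r e)))"
    unfolding base_def optv_def by auto
qed

end

section \<open>Tracing back\<close>

definition tpos :: nexp where
  "tpos = NGet ''ot'' (nv ''tt'') +n NGet ''os'' (nv ''tS'') +n nv ''tD''"

definition t_back :: prog where
  "t_back = nset ''tt'' (nv ''tt'' -n N1) ;; nset ''pl'' (NGet ''own'' (nv ''tt'')) ;;
    NSet ''kk'' (nv ''pl'') (NGet ''kk'' (nv ''pl'') -n N1)"

definition pl_user :: "nexp => nexp" where
  "pl_user e = NGet ''U'' (NGet ''ub'' (nv ''pl'') +n e)"

definition t_label :: prog where
  "t_label = Cond (NLess N0 (nv ''tD'')) (nset ''lb'' (NGet ''slot'' (nv ''tD'' -n N1))) (nset ''lb'' (nv ''ab'')) ;;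
    NSet ''cluster'' (pl_user (NGet ''kk'' (nv ''pl''))) (nv ''lb'') ;; nset ''tD'' (nv ''tD'' -n N1)"

definition t_pass :: prog where
  "t_pass = t_back ;; Cond (NLess N0 (NGet ''tin'' (nv ''pl''))) t_label Skip"

definition o_read :: prog where
  "o_read = nset ''pl'' (NGet ''CO'' tpos -n N1) ;; nset ''pe'' (NGet ''CE'' tpos) ;; NSet ''fac'' (nv ''pl'') (NGet ''CF'' tpos) ;;
    Cond (NLess (nv ''tS'') N1) (nset ''ab'' (nv ''pl'')) Skip ;;
    NSet ''KF'' (nv ''pl'') (NGet ''kk'' (nv ''pl'') +n (nv ''pe'' -n N1))"

definition o_label :: prog where
  "o_label = For ''pi'' (nv ''pe'' -n N1) (NSet ''cluster'' (pl_user (NGet ''kk'' (nv ''pl'') +n nv ''pi'')) (nv ''pl''))"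

definition o_slots :: prog where
  "o_slots = Cond (NLess N0 (nv ''pe'')) (nset ''nd'' (nv ''r'' +n N1 -n nv ''pe'')) (nset ''nd'' N0) ;;
    For ''pi'' (nv ''nd'') (NSet ''slot'' (nv ''tD'' +n nv ''pi'') (nv ''pl''))"

definition o_fin :: prog where
  "o_fin = nset ''tD'' (nv ''tD'' +n nv ''nd'') ;; nset ''tS'' (nv ''tS'' +n NGet ''pw'' (nv ''pl'')) ;; NSet ''tin'' (nv ''pl'') N1"

definition t_open :: prog where
  "t_open = o_read ;; o_label ;; o_slots ;; o_fin"

definition t_init :: prog where
  "t_init = nset ''tt'' (nv ''T'') ;; nset ''tS'' N0 ;; nset ''tD'' N0 ;; For ''pi'' (nv ''d'' +n N1) (NSet ''tin'' (nv ''pi'') N0)"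

text \<open>Reaching threshold 0 does not end the walk, since legs may still have to be opened
  there; it ends when in addition the stored choice is 0.\<close>

definition trace :: prog where
  "trace = t_init ;; While (NLess N0 (NGet ''CO'' tpos +n nv ''tt'')) (Cond (NLess (NGet ''CO'' tpos) N1) t_pass t_open)"

abbreviation "traceN \<equiv> {''tt'', ''pl'', ''kk'', ''lb'', ''cluster'', ''tD'', ''pe'', ''fac'', ''ab'', ''KF'', ''pi'', ''nd'', ''slot'', ''tS'', ''tin''}"

lemma writes_t [simp]:
  "nwrites t_label = {''lb'', ''cluster'', ''tD''}" "rwrites t_label = {}"
  "nwrites o_label = {''pi'', ''cluster''}" "rwrites o_label = {}"
  "nwrites o_slots = {''nd'', ''pi'', ''slot''}" "rwrites o_slots = {}"
  "nwrites t_init = {''tt'', ''tS'', ''tD'', ''pi'', ''tin''}" "rwrites t_init = {}"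
  by (auto simp: t_label_def o_label_def o_slots_def t_init_def)

lemma writes_t_pass: "nwrites t_pass \<subseteq> traceN" "rwrites t_pass = {}"
  by (simp_all add: t_pass_def t_back_def)

lemma writes_t_open: "nwrites t_open \<subseteq> traceN" "rwrites t_open = {}"
  by (simp_all add: t_open_def o_read_def o_fin_def)

lemma writes_trace: "nwrites trace \<subseteq> traceN" "rwrites trace = {}"
  using writes_t_pass writes_t_open by (simp_all add: trace_def)

context spider_core begin

abbreviation Lf :: "state => nat \<times> nat => nat" where "Lf s \<equiv> \<lambda>p. nats s ''cluster'' (uidp p)"

text \<open>The entry of the current state never exceeds the initial value \<open>v\<close>. As
  \<open>v\<close> is below \<open>big\<close>, the walk cannot end in an impossible state.\<close>

definition TI :: "real => state => nat => nat => nat => bool" where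
  "TI v s t S D \<longleftrightarrow> tst s \<and> fin (Suc T) NS s \<and> s$''tt'' = t \<and> s$''tS'' = S \<and> s$''tD'' = D \<and>
    tinv (isfac fs) G v t S D (nats s ''KF'') (nats s ''fac'') (nats s ''slot'') (s$''ab'') (Lf s) \<and>
    (\<forall>l\<le>d. nats s ''kk'' l = cn own t l) \<and> (\<forall>l\<le>d. nats s ''tin'' l = (if bit S l then 1 else 0)) \<and> Vf s t S D <= v"

lemma TID:
  assumes "TI v s t S D"
  shows "tst s" "fin (Suc T) NS s" "s$''tt'' = t" "s$''tS'' = S" "s$''tD'' = D"
    "tinv (isfac fs) G v t S D (nats s ''KF'') (nats s ''fac'') (nats s ''slot'') (s$''ab'') (Lf s)"
    "l <= d ==> nats s ''kk'' l = cn own t l" "l <= d ==> nats s ''tin'' l = (if bit S l then 1 else 0)" "Vf s t S D <= v"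
proof -
  have e: "tst s" "fin (Suc T) NS s" "s$''tt'' = t" "s$''tS'' = S" "s$''tD'' = D"
    "tinv (isfac fs) G v t S D (nats s ''KF'') (nats s ''fac'') (nats s ''slot'') (s$''ab'') (Lf s)"
    "\<forall>l\<le>d. nats s ''kk'' l = cn own t l" "\<forall>l\<le>d. nats s ''tin'' l = (if bit S l then 1 else 0)" "Vf s t S D <= v"
    using assms unfolding TI_def by - (elim conjE, assumption)+
  show "tst s" "fin (Suc T) NS s" "s$''tt'' = t" "s$''tS'' = S" "s$''tD'' = D"
    "tinv (isfac fs) G v t S D (nats s ''KF'') (nats s ''fac'') (nats s ''slot'') (s$''ab'') (Lf s)" "Vf s t S D <= v" by (fact e)+
  show "l <= d ==> nats s ''kk'' l = cn own t l" using e(7) by simp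
  show "l <= d ==> nats s ''tin'' l = (if bit S l then 1 else 0)" using e(8) by simp
qed

lemma uidp_inj: "p \<in> Us ==> q \<in> Us ==> uidp p = uidp q ==> p = q"
  using bij_betw_imp_inj_on[OF uidp_bij] by (rule inj_onD)

lemma in_Us: "i < cnt l ==> (l, i) \<in> Us"
  by (simp add: Us_def)

lemma nval_pl_user:
  assumes "ctx s" "s$''pl'' = l" "l <= d" "nval e s = i" "i < cnt l"
  shows "nval (pl_user e) s = uidp (l, i)"
  using ctxD(14)[OF assms(1,3,5)] ctxD(9)[OF assms(1,3)] assms by (simp add: pl_user_def uidp_def)

lemma ncost_pl_user [simp]: "ncost (pl_user e) = ncost e + 5"
  by (simp add: pl_user_def)

lemma ncost_tpos [simp]: "ncost tpos = 10"
  by (simp add: tpos_def)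

lemma nval_tpos: "TI v s t S D ==> nval tpos s = addr t S D"
proof -
  assume i: "TI v s t S D"
  have b: "t <= T" "S <= NS" using tinvD(1,2)[OF TID(6)[OF i]] by simp_all
  show ?thesis using tstD(4)[OF TID(1)[OF i] b(2)] tstD(5)[OF TID(1)[OF i] b(1)] TID(3-5)[OF i] by (simp add: tpos_def addr_def)
qed

lemma ok_pass:
  assumes i: "TI v s (Suc t) S D" and V: "Vf s t S (pay (Suc t) S D) <= v"
  shows "ok t_pass s (\<lambda>t' s'. (\<exists>D'. TI v s' t S D') \<and> t' <= 80)"
proof -
  note c = TID(1)[OF i]
  note x = tstD(2)[OF c]
  note ti = TID(6)[OF i]
  have tT: "t < T" using tinvD(1)[OF ti] by simp
  let ?l = "own t"
  have l: "?l <= d" "?l < d" using own[OF tT] by simp_all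
  have kl: "nats s ''kk'' ?l = Suc (cn own t ?l)" using TID(7)[OF i l(1)] by (simp add: cn_Suc)
  have cl: "cn own t ?l < cnt ?l" using cm_own[OF tT] by simp
  define s1 where "s1 = nupd ''kk'' ?l (cn own t ?l) (nupd ''pl'' 0 ?l (nupd ''tt'' 0 t s))"
  have 1: "ok t_back s (\<lambda>t' s'. s' = s1 \<and> t' <= 30)"
    by (simp add: t_back_def s1_def TID(3)[OF i] tstD(8)[OF c] kl)
  have c1: "tst s1" using c by (simp add: s1_def)
  have f1: "fin (Suc T) NS s1" using TID(2)[OF i] fin_cong[of s1 s "Suc T" NS] by (simp add: s1_def)
  have kk: "nats s1 ''kk'' l = cn own t l" if "l <= d" for l
    using TID(7)[OF i that] by (simp add: s1_def cn_Suc)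
  have b: "bval (NLess N0 (NGet ''tin'' (nv ''pl''))) s1 = bit S ?l"
    using TID(8)[OF i l(1)] by (simp add: s1_def)
  have bc: "bcost (NLess N0 (NGet ''tin'' (nv ''pl''))) = 5" by simp
  have tin1: "nats s1 ''tin'' = nats s ''tin''" by (simp add: s1_def)
  have 2: "ok (Cond (NLess N0 (NGet ''tin'' (nv ''pl''))) t_label Skip) s1 (\<lambda>t' s'. (\<exists>D'. TI v s' t S D') \<and> t' <= 50)"
  proof (cases "bit S ?l")
    case False
    have nb: "\<not> bval (NLess N0 (NGet ''tin'' (nv ''pl''))) s1" using False b by simp
    have "TI v s1 t S D" unfolding TI_def
    proof (intro conjI allI impI c1 f1)
      show "tinv (isfac fs) G v t S D (nats s1 ''KF'') (nats s1 ''fac'') (nats s1 ''slot'') (s1$''ab'') (Lf s1)"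
        using tinv_pass_closed[OF ti False] by (simp add: s1_def)
      show "nats s1 ''tin'' l = (if bit S l then 1 else 0)" if "l <= d" for l unfolding tin1 by (rule TID(8)[OF i that])
      show "Vf s1 t S D <= v" using V False by (simp add: pay_def s1_def)
    qed (use TID(3-5)[OF i] kk in \<open>simp_all add: s1_def\<close>)
    then show ?thesis unfolding ok_Cond_False[OF nb] ok_Skip bc by auto
  next
    case True
    have nb: "bval (NLess N0 (NGet ''tin'' (nv ''pl''))) s1" using True b by simp
    define lb where "lb = (if 0 < D then nats s ''slot'' (D - 1) else s$''ab'')"
    define s2 where "s2 = nupd ''tD'' 0 (D - 1) (nupd ''cluster'' (uidp (?l, cn own t ?l)) lb (nupd ''lb'' 0 lb s1))"
    have pu: "nval (pl_user (NGet ''kk'' (nv ''pl''))) (nupd ''lb'' 0 lb s1) = uidp (?l, cn own t ?l)"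
      by (rule nval_pl_user[OF _ _ l(1) _ cl]) (use x in \<open>simp_all add: s1_def\<close>)
    have "ok t_label s1 (\<lambda>t' s'. s' = s2 \<and> t' <= 40)"
    proof (cases "0 < D")
      case T: True
      then have e: "nats s ''slot'' (D - 1) = lb" by (simp add: lb_def)
      have e1: "s1$''tD'' = D" "nats s1 ''slot'' (D - Suc 0) = lb" using TID(5)[OF i] e by (simp_all add: s1_def)
      show ?thesis using T by (simp add: t_label_def e1 pu s2_def)
    next
      case F: False
      then have e: "s$''ab'' = lb" by (simp add: lb_def)
      have e1: "s1$''tD'' = D" "s1$''ab'' = lb" using TID(5)[OF i] e by (simp_all add: s1_def)
      show ?thesis using F by (simp add: t_label_def e1 pu s2_def)
    qed
    moreover have "TI v s2 t S (D - 1)" unfolding TI_def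
    proof (intro conjI allI impI)
      show "tst s2" using c1 by (simp add: s2_def)
      show "fin (Suc T) NS s2" using f1 fin_cong[of s2 s1 "Suc T" NS] by (simp add: s2_def)
      have "tinv (isfac fs) G v t S (D - 1) (nats s ''KF'') (nats s ''fac'') (nats s ''slot'') (s$''ab'') (Lf s2)"
      proof (rule tinv_pass_open[OF ti True lb_def])
        show "Lf s2 (own t, cn own t (own t)) = lb" by (simp add: s2_def)
        show "Lf s2 p = Lf s p" if "p \<in> Us" "p ~= (own t, cn own t (own t))" for p
          using uidp_inj[OF that(1) in_Us[OF cl]] that(2) by (auto simp: s2_def s1_def)
      qed
      then show "tinv (isfac fs) G v t S (D - 1) (nats s2 ''KF'') (nats s2 ''fac'') (nats s2 ''slot'') (s2$''ab'') (Lf s2)"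
        by (simp add: s2_def s1_def)
      show "nats s2 ''tin'' l = (if bit S l then 1 else 0)" if "l <= d" for l using TID(8)[OF i that] by (simp add: s2_def s1_def)
      show "nats s2 ''kk'' l = cn own t l" if "l <= d" for l using kk[OF that] by (simp add: s2_def)
      show "Vf s2 t S (D - 1) <= v" using V True by (simp add: pay_def s1_def s2_def)
    qed (use TID(3-5)[OF i] in \<open>simp_all add: s1_def s2_def\<close>)
    ultimately show ?thesis unfolding ok_Cond_True[OF nb] bc by (elim ok_conseq) auto
  qed
  show ?thesis unfolding t_pass_def
  proof (rule ok_seq[OF 1])
    fix t1 :: nat and s' :: state assume a: "s' = s1 \<and> t1 <= 30"
    show "ok (Cond (NLess N0 (NGet ''tin'' (nv ''pl''))) t_label Skip) s' (\<lambda>t' s'. (\<exists>D'. TI v s' t S D') \<and> t1 + t' <= 80)"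
      unfolding conjunct1[OF a] by (rule ok_conseq[OF 2]) (use a in simp)
  qed
qed

definition open_time :: nat where "open_time = 60 * Kc + 60 * r + 300"

lemma ok_open:
  assumes i: "TI v s t S D" and co: "nats s ''CO'' (addr t S D) = Suc l" "nats s ''CE'' (addr t S D) = e" "nats s ''CF'' (addr t S D) = f"
    and op: "can_open t S D l e" and w: "wcost G t l e <= v" and V: "Vf s t (S + 2 ^ l) (D + need r e) <= v"
    and near: "1 <= e ==> near_ok (isfac fs) f (l, (reach t l e - B t) / 2)"
  shows "ok t_open s (\<lambda>t' s'. TI v s' t (S + 2 ^ l) (D + need r e) \<and> t' <= open_time)"
proof -
  note c = TID(1)[OF i]
  note x = tstD(2)[OF c]
  note ti = TID(6)[OF i]
  have o: "l <= d" "\<not> bit S l" "e <= lim l - cm t l + 1" using op unfolding can_open_def by blast+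
  have tT: "t <= T" by (rule tinvD(1)[OF ti])
  have kl: "nats s ''kk'' l = cn own t l" by (rule TID(7)[OF i o(1)])
  have el: "cn own t l + (e - 1) <= cnt l" using o(3) cm_le[OF tT, of l] by linarith
  have ek: "e - 1 <= Kc" using o(3) by linarith
  have tp: "nval tpos s' = addr t S D" if "nats s' ''ot'' = nats s ''ot''" "nats s' ''os'' = nats s ''os''" "nats s' ''tt'' = nats s ''tt''"
    "nats s' ''tS'' = nats s ''tS''" "nats s' ''tD'' = nats s ''tD''" for s'
    using nval_tpos[OF i] that by (simp add: tpos_def)
  define ab where "ab = (if S = 0 then l else s$''ab'')"
  define s1 where "s1 = nupd ''KF'' l (cn own t l + (e - 1)) (nupd ''ab'' 0 ab (nupd ''fac'' l f (nupd ''pe'' 0 e (nupd ''pl'' 0 l s))))"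
  have 1: "ok o_read s (\<lambda>t' s'. s' = s1 \<and> t' <= 100)"
  proof (cases "S = 0")
    case True
    then show ?thesis by (simp add: o_read_def tp co[unfolded True] TID(4)[OF i] kl s1_def ab_def)
  next
    case False
    have "nupd ''ab'' 0 ab s' = s'" if "s'$''ab'' = s$''ab''" for s'
      using that False nupd_same[of "''ab''" s'] by (simp add: ab_def)
    then have "s1 = nupd ''KF'' l (cn own t l + (e - 1)) (nupd ''fac'' l f (nupd ''pe'' 0 e (nupd ''pl'' 0 l s)))" by (simp add: s1_def)
    then show ?thesis using False by (simp add: o_read_def tp co TID(4)[OF i] kl)
  qed
  have c1: "tst s1" using c by (simp add: s1_def)
  have v1: "s1$''pl'' = l" "s1$''pe'' = e" "nats s1 ''kk'' l = cn own t l" "s1$''tD'' = D" "s1$''tS'' = S"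
    using TID(4,5)[OF i] kl by (simp_all add: s1_def)
  have 2: "ok o_label s1 (\<lambda>t' s'. (\<forall>j<e - 1. Lf s' (l, cn own t l + j) = l) \<and> (\<forall>p\<in>Us. fst p ~= l --> Lf s' p = Lf s p) \<and> t' <= 60 * Kc + 20)"
    unfolding o_label_def
  proof (rule ok_For[where I = "\<lambda>k s'. (\<forall>j<k. Lf s' (l, cn own t l + j) = l) \<and> (\<forall>p\<in>Us. fst p ~= l --> Lf s' p = Lf s p)"
      and N = "e - 1" and c = 30], goal_cases)
    case 1
    show ?case by (simp add: s1_def)
  next
    case (3 k s2)
    show ?case using frameD(1)[OF 3(3)] v1 by simp
  next
    case (4 k s2)
    have c2: "ctx s2" using tst_frame[OF 4(3)] c1 tstD(2) by simp
    have v2: "s2$''pl'' = l" "nats s2 ''kk'' l = cn own t l" using frameD(1)[OF 4(3)] v1 by simp_all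
    have kc: "cn own t l + k < cnt l" using 4(1) el by linarith
    have pu: "nval (pl_user (NGet ''kk'' (nv ''pl'') +n nv ''pi'')) s2 = uidp (l, cn own t l + k)"
      by (rule nval_pl_user[OF c2 v2(1) o(1) _ kc]) (simp add: v2 4(4))
    have L: "\<forall>j<Suc k. (if uidp (l, cn own t l + j) = uidp (l, cn own t l + k) then l else Lf s2 (l, cn own t l + j)) = l"
      using 4(2) by (auto simp: less_Suc_eq)
    have O: "\<forall>p\<in>Us. fst p ~= l --> (if uidp p = uidp (l, cn own t l + k) then l else Lf s2 p) = Lf s p"
    proof (intro ballI impI)
      fix p assume p: "p \<in> Us" "fst p ~= l"
      have "uidp p ~= uidp (l, cn own t l + k)" using uidp_inj[OF p(1) in_Us[OF kc]] p(2) by auto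
      then show "(if uidp p = uidp (l, cn own t l + k) then l else Lf s2 p) = Lf s p" using 4(2) p by simp
    qed
    show ?case unfolding ok_NSet pu using L O by (simp add: v2)
  next
    case (5 t' s2)
    have "(e - 1) * 45 <= Kc * 45" using ek by (rule mult_le_mono1)
    then show ?case using 5(1,4) by simp
  qed simp_all
  have dn: "D + need r e <= Dmax" using op unfolding can_open_def by blast
  have nr: "need r e <= r" by (cases e) (simp_all add: need_def)
  have main: "ok (o_label ;; o_slots ;; o_fin) s1 (\<lambda>t' s'. TI v s' t (S + 2 ^ l) (D + need r e) \<and> t' + 100 <= open_time)"
  proof (rule ok_seq[OF 2])
    fix t2 :: nat and s2 :: state
    assume a2: "(\<forall>j<e - 1. Lf s2 (l, cn own t l + j) = l) \<and> (\<forall>p\<in>Us. fst p ~= l --> Lf s2 p = Lf s p) \<and> t2 <= 60 * Kc + 20"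
      and fr2: "frame o_label s1 s2"
    note f2 = frameD[OF fr2]
    have c2: "tst s2" using tst_frame[OF fr2] c1 by simp
    have v2: "s2$''pl'' = l" "s2$''pe'' = e" "s2$''tD'' = D" "s2$''r'' = r"
      using v1 ctxD(2)[OF tstD(2)[OF c2]] by (simp_all add: f2)
    define s3 where "s3 = nupd ''nd'' 0 (need r e) s2"
    have n3: "ok (Cond (NLess N0 (nv ''pe'')) (nset ''nd'' (nv ''r'' +n N1 -n nv ''pe'')) (nset ''nd'' N0)) s2 (\<lambda>t' s'. s' = s3 \<and> t' <= 20)"
      by (simp add: v2 s3_def need_def)
    have sl: "ok (For ''pi'' (nv ''nd'') (NSet ''slot'' (nv ''tD'' +n nv ''pi'') (nv ''pl''))) s3
      (\<lambda>t' s'. (\<forall>j<D. nats s' ''slot'' j = nats s ''slot'' j) \<and> (\<forall>j<need r e. nats s' ''slot'' (D + j) = l) \<and> t' <= 50 * r + 20)"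
    proof (rule ok_For[where I = "\<lambda>k s'. (\<forall>j<D. nats s' ''slot'' j = nats s ''slot'' j) \<and> (\<forall>j<k. nats s' ''slot'' (D + j) = l)"
        and N = "need r e" and c = 20], goal_cases)
      case 1
      show ?case by (simp add: s3_def f2 s1_def)
    next
      case (3 k s4)
      show ?case using frameD(1)[OF 3(3)] by (simp add: s3_def)
    next
      case (4 k s4)
      have v4: "s4$''pl'' = l" "s4$''tD'' = D" using frameD(1)[OF 4(3)] v2 by (simp_all add: s3_def)
      show ?case using 4(2,4) by (simp add: v4 less_Suc_eq)
    next
      case (5 t' s4)
      have "need r e * 32 <= r * 32" using nr by (rule mult_le_mono1)
      then show ?case using 5(1,4) by simp
    qed simp_all
    show "ok (o_slots ;; o_fin) s2 (\<lambda>t' s'. TI v s' t (S + 2 ^ l) (D + need r e) \<and> t2 + t' + 100 <= open_time)"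
      unfolding o_slots_def seq_assoc[symmetric]
    proof (rule ok_seq[OF n3], rule ok_seq)
      fix t3 :: nat and s3' :: state assume a3: "s3' = s3 \<and> t3 <= 20"
      show "ok (For ''pi'' (nv ''nd'') (NSet ''slot'' (nv ''tD'' +n nv ''pi'') (nv ''pl''))) s3'
        (\<lambda>t' s'. (\<forall>j<D. nats s' ''slot'' j = nats s ''slot'' j) \<and> (\<forall>j<need r e. nats s' ''slot'' (D + j) = l) \<and> t' <= 50 * r + 20)"
        using sl a3 by simp
      fix t4 :: nat and s4 :: state
      assume a4: "(\<forall>j<D. nats s4 ''slot'' j = nats s ''slot'' j) \<and> (\<forall>j<need r e. nats s4 ''slot'' (D + j) = l) \<and> t4 <= 50 * r + 20"
        and fr4: "frame (For ''pi'' (nv ''nd'') (NSet ''slot'' (nv ''tD'' +n nv ''pi'') (nv ''pl''))) s3' s4"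
      note f4 = frameD[OF fr4]
      have s3': "s3' = s3" using a3 by blast
      have c4: "tst s4" using tst_frame[OF fr4] c2 by (simp add: s3' s3_def)
      have v4: "s4$''pl'' = l" "s4$''nd'' = need r e" "s4$''tD'' = D" "s4$''tS'' = S" "s4$''tt'' = t"
        using v1 v2 TID(3)[OF i] by (simp_all add: f4 s3' s3_def f2 s1_def)
      have pw: "nats s4 ''pw'' l = 2 ^ l" using tstD(3)[OF c4, of l] o(1) by simp
      define s5 where "s5 = nupd ''tin'' l 1 (nupd ''tS'' 0 (S + 2 ^ l) (nupd ''tD'' 0 (D + need r e) s4))"
      have of: "ok o_fin s4 (\<lambda>t' s'. s' = s5 \<and> t' <= 40)" by (simp add: o_fin_def v4 pw s5_def)
      have g5: "nats s5 ''KF'' = nats s1 ''KF''" "nats s5 ''fac'' = nats s1 ''fac''" "nats s5 ''slot'' = nats s4 ''slot''" "nats s5 ''ab'' = nats s1 ''ab''"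
        "nats s5 ''cluster'' = nats s2 ''cluster''" "nats s5 ''kk'' = nats s ''kk''" "nats s4 ''tin'' = nats s ''tin''"
        "reals s5 ''V'' = reals s ''V''" "nats s5 ''CO'' = nats s ''CO''" "nats s5 ''CE'' = nats s ''CE''" "nats s5 ''CF'' = nats s ''CF''"
        by (simp_all add: s5_def f4 s3' s3_def f2 s1_def)
      have "TI v s5 t (S + 2 ^ l) (D + need r e)" unfolding TI_def
      proof (intro conjI allI impI)
        show "tst s5" using c4 by (simp add: s5_def)
        show "fin (Suc T) NS s5" using TID(2)[OF i] fin_cong[of s5 s "Suc T" NS] by (simp add: g5)
        show "tinv (isfac fs) G v t (S + 2 ^ l) (D + need r e) (nats s5 ''KF'') (nats s5 ''fac'') (nats s5 ''slot'') (s5$''ab'') (Lf s5)"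
        proof (rule tinv_open[OF ti op w])
          show "near_ok (isfac fs) (nats s5 ''fac'' l) (l, (reach t l e - B t) / 2)" if "1 <= e" using near[OF that] by (simp add: g5 s1_def)
          show "nats s5 ''KF'' l = cm t l + (e - 1)" by (simp add: g5 s1_def)
          show "nats s5 ''KF'' l' = nats s ''KF'' l'" if "l' ~= l" for l' using that by (simp add: g5 s1_def)
          show "nats s5 ''fac'' l' = nats s ''fac'' l'" if "l' ~= l" for l' using that by (simp add: g5 s1_def)
          show "s5$''ab'' = (if S = 0 then l else s$''ab'')" by (simp add: g5 s1_def ab_def)
          show "nats s5 ''slot'' j = nats s ''slot'' j" if "j < D" for j using a4 that by (simp add: g5)
          show "nats s5 ''slot'' j = l" if "D <= j" "j < D + need r e" for j
          proof -
            have "nats s4 ''slot'' (D + (j - D)) = l" using a4 that by (metis add_less_cancel_left le_add_diff_inverse)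
            then show ?thesis using that by (simp add: g5)
          qed
          show "Lf s5 (l, cm t l + j) = l" if "j < e - 1" for j using a2 that by (simp add: g5)
          show "Lf s5 p = Lf s p" if "p \<in> Us" "fst p ~= l" for p using a2 that by (simp add: g5)
        qed
        show "nats s5 ''kk'' l' = cn own t l'" if "l' <= d" for l' using TID(7)[OF i that] by (simp add: g5)
        show "nats s5 ''tin'' l' = (if bit (S + 2 ^ l) l' then 1 else 0)" if "l' <= d" for l'
          using TID(8)[OF i that] bit_add_pow[OF o(2), of l'] by (simp add: s5_def g5)
        show "Vf s5 t (S + 2 ^ l) (D + need r e) <= v" using V by (simp add: g5)
      qed (simp_all add: s5_def v4)
      then show "ok o_fin s4 (\<lambda>t' s'. TI v s' t (S + 2 ^ l) (D + need r e) \<and> t2 + (t3 + (t4 + t')) + 100 <= open_time)"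
        using a2 a3 a4 by (intro ok_conseq[OF of]) (simp add: open_time_def)
    qed
  qed
  show ?thesis unfolding t_open_def
  proof (rule ok_seq[OF 1])
    fix t1 :: nat and s' :: state assume a: "s' = s1 \<and> t1 <= 100"
    show "ok (o_label ;; o_slots ;; o_fin) s' (\<lambda>t' s'. TI v s' t (S + 2 ^ l) (D + need r e) \<and> t1 + t' <= open_time)"
      unfolding conjunct1[OF a] by (rule ok_conseq[OF main]) (use a in simp)
  qed
qed

definition placed :: "real => state => bool" where
  "placed v s \<longleftrightarrow> sat (isfac fs) v {p \<in> Us. snd p < nats s ''KF'' (fst p)} (Lf s) (nats s ''fac'') \<and>
    (\<forall>l\<le>d. nats s ''KF'' l <= cnt l \<and> G l (nats s ''KF'' l) <= v) \<and> (\<forall>p\<in>Us. snd p < nats s ''KF'' (fst p) --> Lf s p <= d)"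

lemma ok_trace:
  assumes c: "tst s" and kk: "\<forall>l\<le>d. nats s ''kk'' l = cn own T l" and fn: "fin (Suc T) NS s" and v: "Vf s T 0 0 = v" "v < big"
  shows "ok trace s (\<lambda>t' s'. placed v s' \<and> t' <= T * 200 + NS * (open_time + 100) + 40 * d + 200)"
proof -
  have i1: "ok t_init s (\<lambda>t' s'. TI v s' T 0 0 \<and> t' <= 40 * d + 100)"
    unfolding t_init_def ok_Seq[of "nset _ _"] ok_NSet
  proof (rule ok_For[where I = "\<lambda>k s'. \<forall>l<k. nats s' ''tin'' l = 0" and N = "Suc d" and c = 10], goal_cases)
    case (3 k s1)
    have "nats s1 ''d'' = nats s ''d''" using frameD(1)[OF 3(3)] by simp
    then show ?case using ctxD(1)[OF tstD(2)[OF c]] by simp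
  next
    case (4 k s1)
    then show ?case by (simp add: less_Suc_eq)
  next
    case (5 t' s1)
    note fr = frameD[OF 5(2)]
    have "tst s1" using tst_frame[OF 5(2)] c by simp
    moreover have "fin (Suc T) NS s1" using fn fin_cong[of s1 s "Suc T" NS] by (simp add: fr)
    moreover have "\<forall>l\<le>d. nats s1 ''kk'' l = cn own T l" using kk by (simp add: fr)
    moreover have "\<forall>l\<le>d. nats s1 ''tin'' l = (if bit (0::nat) l then 1 else 0)" using 5(1) by simp
    ultimately have "TI v s1 T 0 0" unfolding TI_def using v tinv_init tstD(7)[OF c] by (simp add: fr)
    then show ?case using 5(4) by simp
  qed simp_all
  let ?b = "NLess N0 (NGet ''CO'' tpos +n nv ''tt'')"
  have w: "ok (While ?b (Cond (NLess (NGet ''CO'' tpos) N1) t_pass t_open)) s1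
    (\<lambda>t' s'. placed v s' \<and> t' <= T * 200 + NS * (open_time + 100) + 50)" if s1: "TI v s1 T 0 0" for s1
  \<comment> \<open>A passing step lowers the threshold, an opening step raises the set as a number.
    Counting openings by that number is generous, but the resulting O(2^d r d) stays within the
    bound.\<close>
  proof (rule ok_While[where I = "\<lambda>s'. \<exists>t S D. TI v s' t S D" and \<Phi> = "\<lambda>s'. s'$''tt'' * 200 + (NS - s'$''tS'') * (open_time + 100)"], goal_cases)
    case 1
    show ?case using s1 by blast
  next
    case (2 s2)
    then obtain t S D where i: "TI v s2 t S D" by blast
    note tp = nval_tpos[OF i]
    note ti = TID(6)[OF i]
    have bd: "t < Suc T" "S < NS" "D <= Dmax" using tinvD(1-3)[OF ti] by simp_all
    have ok: "cellok s2 t S D" using TID(2)[OF i] bd unfolding fin_def by blast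
    have ch: "choice (Vf s2) t S D (Vf s2 t S D) (COf s2 t S D) (CEf s2 t S D) (CFf s2 t S D)" using ok unfolding cellok_def by blast
    have Vv: "Vf s2 t S D <= v" by (rule TID(9)[OF i])
    have bc: "bcost ?b = 16" "bcost (NLess (NGet ''CO'' tpos) N1) = 13" by simp_all
    have tt: "s2$''tt'' = t" "s2$''tS'' = S" by (rule TID(3)[OF i], rule TID(4)[OF i])
    show ?case
    proof (cases "COf s2 t S D")
      case 0
      have b: "bval (NLess (NGet ''CO'' tpos) N1) s2" using 0 tp by simp
      obtain u where u: "t = Suc u" using 2(3) 0 tp tt by (cases t) auto
      have "base (Vf s2) t S D <= Vf s2 t S D" using ch 0 unfolding choice_def by simp
      then have V: "Vf s2 u S (pay (Suc u) S D) <= v" using Vv by (simp add: base_def u)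
      show ?thesis unfolding ok_Cond_True[OF b] bc
      proof (rule ok_conseq[OF ok_pass[OF i[unfolded u] V]])
        fix t' :: nat and s3 :: state assume a: "(\<exists>D'. TI v s3 u S D') \<and> t' <= 80"
        then obtain D' where i3: "TI v s3 u S D'" by blast
        show "(\<exists>t S D. TI v s3 t S D) \<and> 16 + (13 + t' + 1) + 1 + (s3$''tt'' * 200 + (NS - s3$''tS'') * (open_time + 100))
          <= s2$''tt'' * 200 + (NS - s2$''tS'') * (open_time + 100)"
          using i3 a unfolding TID(3)[OF i3] TID(4)[OF i3] tt u by auto
      qed
    next
      case (Suc l)
      have b: "\<not> bval (NLess (NGet ''CO'' tpos) N1) s2" using Suc tp by simp
      have o: "can_open t S D l (CEf s2 t S D)" "optv (Vf s2) t S D l (CEf s2 t S D) <= Vf s2 t S D"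
        "1 <= CEf s2 t S D ==> near_ok (isfac fs) (CFf s2 t S D) (l, (reach t l (CEf s2 t S D) - B t) / 2)"
        using ch Suc unfolding choice_def by simp_all
      have m: "wcost G t l (CEf s2 t S D) <= v" "Vf s2 t (S + 2 ^ l) (D + need r (CEf s2 t S D)) <= v"
        using o(2) Vv unfolding optv_def by simp_all
      have "l <= d" "\<not> bit S l" using o(1) unfolding can_open_def by blast+
      then have S': "S + 2 ^ l < NS" using add_pow_less[OF bd(2), of l] by simp
      show ?thesis unfolding ok_Cond_False[OF b] bc
      proof (rule ok_conseq[OF ok_open[OF i Suc refl refl o(1) m o(3)]], assumption)
        fix t' :: nat and s3 :: state assume a: "TI v s3 t (S + 2 ^ l) (D + need r (CEf s2 t S D)) \<and> t' <= open_time"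
        then have i3: "TI v s3 t (S + 2 ^ l) (D + need r (CEf s2 t S D))" by blast
        have "(1::nat) <= 2 ^ l" by simp
        then have "Suc (NS - (S + 2 ^ l)) <= NS - S" using S' by linarith
        then have "Suc (NS - (S + 2 ^ l)) * (open_time + 100) <= (NS - S) * (open_time + 100)" by (rule mult_le_mono1)
        then have "open_time + 100 + (NS - (S + 2 ^ l)) * (open_time + 100) <= (NS - S) * (open_time + 100)" by simp
        then show "(\<exists>t S D. TI v s3 t S D) \<and> 16 + (13 + t' + 1) + 1 + (s3$''tt'' * 200 + (NS - s3$''tS'') * (open_time + 100))
          <= s2$''tt'' * 200 + (NS - s2$''tS'') * (open_time + 100)"
          using i3 a unfolding TID(3)[OF i3] TID(4)[OF i3] tt by auto
      qed
    qed
  next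
    case (3 t' s2)
    then obtain t S D where i: "TI v s2 t S D" by blast
    note tp = nval_tpos[OF i]
    note ti = TID(6)[OF i]
    have bd: "t < Suc T" "S < NS" "D <= Dmax" using tinvD(1-3)[OF ti] by simp_all
    have ok: "cellok s2 t S D" using TID(2)[OF i] bd unfolding fin_def by blast
    have "nats s2 ''CO'' (nval tpos s2) + s2$''tt'' = 0" using 3(3) by simp
    then have "COf s2 t S D + t = 0" unfolding tp TID(3)[OF i] .
    then have z: "COf s2 t S D = 0" "t = 0" unfolding add_is_0 by (rule conjunct1, rule conjunct2)
    have "base (Vf s2) t S D <= v" using ok z TID(9)[OF i] unfolding cellok_def choice_def by auto
    \<comment> \<open>At threshold 0, a base value below \<open>big\<close> occurs only for the full
      set without debts.\<close>
    then have f: "S = full" "D = 0" using v(2) z(2) by (auto simp: base_def split: if_splits)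
    have "placed v s2" unfolding placed_def
      using tinv_final[OF ti[unfolded z f]] by blast
    moreover have "t' <= T * 200 + NS * (open_time + 100) + 50" using 3(4) TID(3,4)[OF s1] by simp
    ultimately show ?case by blast
  qed
  show ?thesis unfolding trace_def
  proof (rule ok_seq[OF i1])
    fix t1 :: nat and s1 :: state assume a: "TI v s1 T 0 0 \<and> t1 <= 40 * d + 100"
    show "ok (While ?b (Cond (NLess (NGet ''CO'' tpos) N1) t_pass t_open)) s1
      (\<lambda>t' s'. placed v s' \<and> t1 + t' <= T * 200 + NS * (open_time + 100) + 40 * d + 200)"
      by (rule ok_conseq[OF w[OF conjunct1[OF a]]]) (use a in simp)
  qed
qed

end

section \<open>Labelling the users outside the mixed prefixes\<close>

definition al_pos :: "nexp => nexp" where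
  "al_pos e = NGet ''ub'' (nv ''al'') +n e"

text \<open>A segment is labelled by \<open>d + 1\<close> plus the index of its first user. This
  differs from the labels of mixed clusters, which are at most \<open>d\<close>, and from those of
  other segments.\<close>

definition a_read :: prog where
  "a_read = nset ''ax'' (NGet ''nx'' (al_pos (nv ''aj''))) ;;
    nset ''ag'' (nv ''d'' +n N1 +n NGet ''U'' (al_pos (nv ''aj''))) ;; NSet ''fac'' (nv ''ag'') (NGet ''NF'' (al_pos (nv ''aj'')))"

definition a_label :: prog where
  "a_label = For ''ai'' (nv ''ax'' -n nv ''aj'') (NSet ''cluster'' (NGet ''U'' (al_pos (nv ''aj'' +n nv ''ai''))) (nv ''ag''))"

definition a_group :: prog where
  "a_group = a_read ;; a_label ;; nset ''aj'' (nv ''ax'')"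

definition a_leg :: prog where
  "a_leg = nset ''aj'' (NGet ''KF'' (nv ''al'')) ;; While (NLess (nv ''aj'') (NGet ''uc'' (nv ''al''))) a_group"

definition a_all :: prog where
  "a_all = For ''al'' (nv ''d'' +n N1) a_leg"

definition a_out :: prog where
  "a_out = For ''ai'' (nv ''n'') (NSet ''assignment'' (nv ''ai'') (NGet ''fac'' (NGet ''cluster'' (nv ''ai''))))"

lemma writes_a [simp]:
  "nwrites a_read = {''ax'', ''ag'', ''fac''}" "rwrites a_read = {}"
  "nwrites a_label = {''ai'', ''cluster''}" "rwrites a_label = {}"
  "nwrites a_group = {''ax'', ''ag'', ''fac'', ''ai'', ''cluster'', ''aj''}" "rwrites a_group = {}"
  "nwrites a_leg = {''ax'', ''ag'', ''fac'', ''ai'', ''cluster'', ''aj''}" "rwrites a_leg = {}"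
  "nwrites a_all = {''al'', ''ax'', ''ag'', ''fac'', ''ai'', ''cluster'', ''aj''}" "rwrites a_all = {}"
  "nwrites a_out = {''ai'', ''assignment''}" "rwrites a_out = {}"
  by (auto simp: a_read_def a_label_def a_group_def a_leg_def a_all_def a_out_def)

lemma ncost_al_pos [simp]: "ncost (al_pos e) = ncost e + 4"
  by (simp add: al_pos_def)

context spider_core begin

definition Pset :: "(nat => nat) => nat => nat => (nat \<times> nat) set" where
  "Pset KF l j = {p \<in> Us. fst p < l \<or> fst p = l \<and> snd p < j \<or> l < fst p \<and> snd p < KF (fst p)}"

lemma Pset_start: "Pset KF 0 (KF 0) = {p \<in> Us. snd p < KF (fst p)}"
  unfolding Pset_def by (rule Collect_cong) (metis gr_zeroI not_less_zero)

lemma Pset_next: "Pset KF (Suc l) (KF (Suc l)) = Pset KF l (cnt l)"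
proof -
  have "(fst p < Suc l \<or> fst p = Suc l \<and> snd p < KF (Suc l) \<or> Suc l < fst p \<and> snd p < KF (fst p)) \<longleftrightarrow>
    (fst p < l \<or> fst p = l \<and> snd p < cnt l \<or> l < fst p \<and> snd p < KF (fst p))" if "p \<in> Us" for p
  proof -
    have "snd p < cnt (fst p)" using that by (auto simp: Us_def)
    then show ?thesis by (cases "fst p < l"; cases "fst p = l"; cases "fst p = Suc l") auto
  qed
  then show ?thesis unfolding Pset_def by blast
qed

lemma Pset_end: "Pset KF (Suc d) j = Us"
  unfolding Pset_def using Us_leg by (auto simp: less_Suc_eq)

lemma Pset_step: "j <= x ==> x <= cnt l ==> Pset KF l x = Pset KF l j \<union> Pair l ` {j..<x}"
proof (rule set_eqI)
  fix p :: "nat \<times> nat" assume h: "j <= x" "x <= cnt l"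
  obtain a b where p: "p = (a, b)" by (cases p)
  show "p \<in> Pset KF l x \<longleftrightarrow> p \<in> Pset KF l j \<union> Pair l ` {j..<x}"
    using h by (auto simp: Pset_def p Us_def)
qed

text \<open>The second conjunct ensures that the label of the next segment is fresh.\<close>

definition ZI :: "real => (nat => nat) => nat => nat => state => bool" where
  "ZI v KF l j s \<longleftrightarrow> sat (isfac fs) v (Pset KF l j) (Lf s) (nats s ''fac'') \<and>
    (\<forall>p\<in>Pset KF l j. Lf s p <= d \<or> (\<exists>q\<in>Pset KF l j. Lf s p = d + 1 + uidp q))"

lemma ok_group:
  assumes c: "tst s" and z: "ZI v KF l j s" and a: "s$''al'' = l" "s$''aj'' = j" and l: "l <= d" and j: "j < cnt l"
    and G: "G l j <= v" "v < big"
  shows "ok a_group s (\<lambda>t s'. \<exists>x. s'$''aj'' = x \<and> j < x \<and> x <= cnt l \<and> G l x <= v \<and> ZI v KF l x s' \<and> t <= 60 * (x - j) + 100)"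
proof -
  note x0 = tstD(2)[OF c]
  let ?x = "nx l j"
  have lo: "line_ok l 0 (G l) (nx l) (NF l)" by (rule lines_ok[OF l])
  then have lj: "if cnt l < j + r then G l j = big
     else j + r <= ?x \<and> ?x <= cnt l \<and> G l j = max (G l ?x) (seg l j ?x) \<and>
       near_ok (isfac fs) (NF l j) (l, (X l j + X l (?x - 1)) / 2) \<and>
       (\<forall>x. j + r <= x \<and> x <= cnt l --> G l j <= max (G l x) (seg l j x))"
    using j unfolding line_ok_def by blast
  \<comment> \<open>The value at \<open>j\<close> is below \<open>big\<close>, so at least r users
    are left and the stored segment is genuine.\<close>
  have "\<not> cnt l < j + r" using lj G by auto
  then have x: "j + r <= ?x" "?x <= cnt l" "G l j = max (G l ?x) (seg l j ?x)" "near_ok (isfac fs) (NF l j) (l, (X l j + X l (?x - 1)) / 2)"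
    using lj by simp_all
  have jx: "j < ?x" using x(1) r1 by linarith
  have Gx: "G l ?x <= v" "seg l j ?x <= v" using x(3) G by simp_all
  obtain zz where zz: "isfac fs (NF l j) zz" "0 <= snd zz" "\<And>u. u \<in> {j..<?x} ==> spider_dist zz (l, X l u) <= v"
    using seg_cover[OF x(4) Gx(2) jx x(2)] by blast
  let ?g = "d + 1 + uid l j"
  define s1 where "s1 = nupd ''fac'' ?g (NF l j) (nupd ''ag'' 0 ?g (nupd ''ax'' 0 ?x s))"
  have 1: "ok a_read s (\<lambda>t s'. s' = s1 \<and> t <= 60)"
    using ctxD(14)[OF x0 l j]
    by (simp add: a_read_def al_pos_def a ctxD(1)[OF x0] ctxD(9)[OF x0 l] tstD(11,12)[OF c] s1_def del: add_Suc add_Suc_right)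
  have c1: "tst s1" using c by (simp add: s1_def)
  have 2: "ok a_label s1 (\<lambda>t s'. (\<forall>i<?x - j. Lf s' (l, j + i) = ?g) \<and> (\<forall>p\<in>Us. fst p ~= l \<or> snd p < j \<or> ?x <= snd p --> Lf s' p = Lf s p) \<and> t <= 50 * (?x - j) + 20)"
    unfolding a_label_def
  proof (rule ok_For[where I = "\<lambda>k s'. (\<forall>i<k. Lf s' (l, j + i) = ?g) \<and> (\<forall>p\<in>Us. fst p ~= l \<or> snd p < j \<or> ?x <= snd p --> Lf s' p = Lf s p)"
      and N = "?x - j" and c = 30], goal_cases)
    case 1
    show ?case by (simp add: s1_def)
  next
    case (3 k s2)
    show ?case using frameD(1)[OF 3(3)] a by (simp add: s1_def)
  next
    case (4 k s2)
    have c2: "ctx s2" using tst_frame[OF 4(3)] c1 tstD(2) by simp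
    have v2: "s2$''al'' = l" "s2$''aj'' = j" "s2$''ag'' = ?g" using frameD(1)[OF 4(3)] a by (simp_all add: s1_def)
    have kc: "j + k < cnt l" using 4(1) x(2) by linarith
    have pu: "nval (NGet ''U'' (al_pos (nv ''aj'' +n nv ''ai''))) s2 = uidp (l, j + k)"
      using ctxD(14)[OF c2 l kc] by (simp add: al_pos_def v2 4(4) ctxD(9)[OF c2 l] uidp_def)
    have L: "\<forall>i<Suc k. (if uidp (l, j + i) = uidp (l, j + k) then ?g else Lf s2 (l, j + i)) = ?g"
      using 4(2) by (auto simp: less_Suc_eq)
    have O: "\<forall>p\<in>Us. fst p ~= l \<or> snd p < j \<or> ?x <= snd p --> (if uidp p = uidp (l, j + k) then ?g else Lf s2 p) = Lf s p"
    proof (intro ballI impI)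
      fix p assume p: "p \<in> Us" "fst p ~= l \<or> snd p < j \<or> ?x <= snd p"
      have "uidp p ~= uidp (l, j + k)"
      proof
        assume "uidp p = uidp (l, j + k)"
        then have "p = (l, j + k)" by (rule uidp_inj[OF p(1) in_Us[OF kc]])
        then show False using p(2) 4(1) by auto
      qed
      then show "(if uidp p = uidp (l, j + k) then ?g else Lf s2 p) = Lf s p" using 4(2) p by simp
    qed
    have nc: "ncost (NGet ''U'' (al_pos (nv ''aj'' +n nv ''ai''))) + ncost (nv ''ag'') + 1 <= 30" by simp
    have vg: "nval (nv ''ag'') s2 = ?g" using v2 by simp
    have e: "Lf (nupd ''ai'' 0 (Suc k) (nupd ''cluster'' (uidp (l, j + k)) ?g s2)) p = (if uidp p = uidp (l, j + k) then ?g else Lf s2 p)" for p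
      by simp
    show ?case unfolding ok_NSet pu vg e
      using nc L O by (intro conjI)
  next
    case (5 t s2)
    have "t <= (?x - j) * 45 + 15" using 5(4) by simp
    then show ?case using 5(1) by simp
  qed simp_all
  show ?thesis unfolding a_group_def
  proof (rule ok_seq[OF 1])
    fix t1 :: nat and s1' :: state assume a1: "s1' = s1 \<and> t1 <= 60"
    show "ok (a_label ;; nset ''aj'' (nv ''ax'')) s1' (\<lambda>t s'. \<exists>x. s'$''aj'' = x \<and> j < x \<and> x <= cnt l \<and> G l x <= v \<and> ZI v KF l x s' \<and> t1 + t <= 60 * (x - j) + 100)"
      unfolding conjunct1[OF a1]
    proof (rule ok_seq[OF 2])
      fix t2 :: nat and s2 :: state
      assume a2: "(\<forall>i<?x - j. Lf s2 (l, j + i) = ?g) \<and> (\<forall>p\<in>Us. fst p ~= l \<or> snd p < j \<or> ?x <= snd p --> Lf s2 p = Lf s p) \<and> t2 <= 50 * (?x - j) + 20"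
        and f2: "frame a_label s1 s2"
      have v2: "s2$''ax'' = ?x" "nats s2 ''fac'' = (nats s ''fac'')(?g := NF l j)" using frameD(1)[OF f2] by (simp_all add: s1_def)
      let ?P = "Pset KF l j" and ?A = "Pair l ` {j..<?x}"
      have st: "Pset KF l ?x = ?P \<union> ?A" by (rule Pset_step) (use jx x(2) in simp_all)
      have PU: "p \<in> Us" if "p \<in> ?P" for p using that by (simp add: Pset_def)
      have Plj: "fst p ~= l \<or> snd p < j \<or> ?x <= snd p" if "p \<in> ?P" for p using that by (auto simp: Pset_def)
      have nP: "(l, j) \<notin> ?P" by (simp add: Pset_def)
      have old: "Lf s p ~= ?g \<and> Lf s2 p = Lf s p" if p: "p \<in> ?P" for p
      proof
        show "Lf s2 p = Lf s p" using a2 PU[OF p] Plj[OF p] by blast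
        have "Lf s p <= d \<or> (\<exists>q\<in>?P. Lf s p = d + 1 + uidp q)" using z p unfolding ZI_def by blast
        then show "Lf s p ~= ?g"
        proof
          assume "\<exists>q\<in>?P. Lf s p = d + 1 + uidp q"
          then obtain q where q: "q \<in> ?P" "Lf s p = d + 1 + uidp q" by blast
          have "q ~= (l, j)" using q(1) nP by blast
          then have "uidp q ~= uidp (l, j)" using uidp_inj[OF PU[OF q(1)] in_Us[OF j]] by blast
          then show ?thesis using q(2) by (simp add: uidp_def)
        qed simp
      qed
      have new: "Lf s2 p = ?g" if "p \<in> ?A" for p
      proof -
        obtain u where u: "p = (l, u)" "u \<in> {j..<?x}" using \<open>p \<in> ?A\<close> by (rule imageE)
        then have e: "u = j + (u - j)" "u - j < ?x - j" by auto
        have "Lf s2 (l, j + (u - j)) = ?g" using a2 e(2) by blast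
        then show ?thesis using u(1) e(1) by simp
      qed
      have sat2: "sat (isfac fs) v (Pset KF l ?x) (Lf s2) (nats s2 ''fac'')" unfolding st
      proof (rule sat_add)
        show "sat (isfac fs) v ?P (Lf s) (nats s ''fac'')" using z unfolding ZI_def by blast
        show "finite ?P" by (rule finite_subset[OF _ finite_Us]) (auto simp: Pset_def)
        show "finite ?A" by simp
        show "r <= card ?A" using x(1) by (simp add: card_image inj_on_def)
        show "Lf s p ~= ?g \<and> Lf s2 p = Lf s p" if "p \<in> ?P" for p by (rule old[OF that])
        show "Lf s2 p = ?g" if "p \<in> ?A" for p by (rule new[OF that])
        show "nats s2 ''fac'' k = nats s ''fac'' k" if "k ~= ?g" for k using that by (simp add: v2)
        show "isfac fs (nats s2 ''fac'' ?g) zz" using zz(1) by (simp add: v2)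
        show "0 <= snd zz" by (rule zz(2))
        show "spider_dist zz (pt p) <= v" if "p \<in> ?A" for p
        proof -
          obtain u where u: "p = (l, u)" "u \<in> {j..<?x}" using \<open>p \<in> ?A\<close> by (rule imageE)
          then show ?thesis using zz(3)[of u] by (simp add: pt_def)
        qed
      qed
      have lab: "Lf s2 p <= d \<or> (\<exists>q\<in>Pset KF l ?x. Lf s2 p = d + 1 + uidp q)" if p: "p \<in> Pset KF l ?x" for p
      proof (cases "p \<in> ?P")
        case True
        then have "Lf s p <= d \<or> (\<exists>q\<in>?P. Lf s p = d + 1 + uidp q)" using z unfolding ZI_def by blast
        then show ?thesis using conjunct2[OF old[OF True]] unfolding st by auto
      next
        case False
        then have "p \<in> ?A" using p unfolding st by blast
        then have "Lf s2 p = d + 1 + uidp (l, j)" using new by (simp add: uidp_def)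
        moreover have "(l, j) \<in> Pset KF l ?x" using jx in_Us[OF j] by (simp add: Pset_def)
        ultimately show ?thesis by blast
      qed
      have ZI2: "ZI v KF l ?x s2" unfolding ZI_def using sat2 lab by blast
      have tm: "t1 + (t2 + 5) <= 60 * (?x - j) + 100" using a1 a2 by linarith
      have "ZI v KF l ?x (nupd ''aj'' 0 ?x s2)" using ZI2 by (simp add: ZI_def)
      then show "ok (nset ''aj'' (nv ''ax'')) s2 (\<lambda>t s'. \<exists>x. s'$''aj'' = x \<and> j < x \<and> x <= cnt l \<and> G l x <= v \<and> ZI v KF l x s' \<and> t1 + (t2 + t) <= 60 * (x - j) + 100)"
        using jx x(2) Gx(1) tm by (simp add: v2)
    qed
  qed
qed

lemma ok_leg:
  assumes c: "tst s" and z: "ZI v KF l (KF l) s" and a: "s$''al'' = l" "nats s ''KF'' = KF" and l: "l <= d"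
    and K: "KF l <= cnt l" "G l (KF l) <= v" and v: "v < big"
  shows "ok a_leg s (\<lambda>t s'. ZI v KF l (cnt l) s' \<and> t <= 200 * cnt l + 50)"
proof -
  define s1 where "s1 = nupd ''aj'' 0 (KF l) s"
  have c1: "tst s1" using c by (simp add: s1_def)
  have st: "nupd ''aj'' (nval N0 s) (nval (NGet ''KF'' (nv ''al'')) s) s = s1" by (simp add: a s1_def)
  have z1: "ZI v KF l (KF l) s1" using z by (simp add: ZI_def s1_def)
  have w: "ok (While (NLess (nv ''aj'') (NGet ''uc'' (nv ''al''))) a_group) s1 (\<lambda>t s'. ZI v KF l (cnt l) s' \<and> t <= 200 * cnt l + 20)"
  proof (rule ok_While[where I = "\<lambda>s'. s'$''aj'' <= cnt l \<and> G l (s'$''aj'') <= v \<and> ZI v KF l (s'$''aj'') s'"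
      and \<Phi> = "\<lambda>s'. 200 * (cnt l - s'$''aj'')"], goal_cases)
    case 1
    show ?case using K z1 by (simp add: s1_def)
  next
    case (2 s2)
    have c2: "tst s2" using tst_frame[OF 2(2)] c1 by simp
    have al: "s2$''al'' = l" using frameD(1)[OF 2(2)] a by (simp add: s1_def)
    have j: "s2$''aj'' < cnt l" using 2(3) al ctxD(11)[OF tstD(2)[OF c2] l] by simp
    let ?j = "s2$''aj''"
    have I: "ZI v KF l ?j s2" "G l ?j <= v" using 2(1) by blast+
    show ?case
    proof (rule ok_conseq[OF ok_group[OF c2 I(1) al refl l j I(2) v]])
      fix t :: nat and s3 :: state
      assume "\<exists>x. s3$''aj'' = x \<and> ?j < x \<and> x <= cnt l \<and> G l x <= v \<and> ZI v KF l x s3 \<and> t <= 60 * (x - ?j) + 100"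
      then obtain x where x: "s3$''aj'' = x" "?j < x" "x <= cnt l" "G l x <= v" "ZI v KF l x s3" "t <= 60 * (x - ?j) + 100"
        by (elim exE conjE) (rule that)
      have "200 * (cnt l - ?j) = 200 * (cnt l - x) + 200 * (x - ?j)" using x(2,3) by linarith
      moreover have "1 <= x - ?j" using x(2) by linarith
      moreover have "bcost (NLess (nv ''aj'') (NGet ''uc'' (nv ''al''))) = 6" by simp
      ultimately have "bcost (NLess (nv ''aj'') (NGet ''uc'' (nv ''al''))) + t + 1 + 200 * (cnt l - x) <= 200 * (cnt l - ?j)"
        using x(6) by linarith
      then show "(s3$''aj'' <= cnt l \<and> G l (s3$''aj'') <= v \<and> ZI v KF l (s3$''aj'') s3) \<and>
        bcost (NLess (nv ''aj'') (NGet ''uc'' (nv ''al''))) + t + 1 + 200 * (cnt l - s3$''aj'') <= 200 * (cnt l - ?j)"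
        using x by blast
    qed
  next
    case (3 t s2)
    have c2: "tst s2" using tst_frame[OF 3(2)] c1 by simp
    have al: "s2$''al'' = l" using frameD(1)[OF 3(2)] a by (simp add: s1_def)
    have j: "s2$''aj'' = cnt l" using 3(1,3) al ctxD(11)[OF tstD(2)[OF c2] l] by simp
    have "t <= 200 * cnt l + 20" using 3(4) j by (simp add: s1_def)
    then show ?case using 3(1) j by simp
  qed
  have nc: "ncost N0 + ncost (NGet ''KF'' (nv ''al'')) + 1 = 5" by simp
  show ?thesis unfolding a_leg_def ok_Seq ok_NSet st nc
    by (rule ok_conseq[OF w]) simp
qed

lemma ok_a_all:
  assumes c: "tst s" and pl: "placed v s" and v: "v < big"
  shows "ok a_all s (\<lambda>t s'. sat (isfac fs) v Us (Lf s') (nats s' ''fac'') \<and> t <= 200 * n + 100 * d + 200)"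
proof -
  define KF where "KF = nats s ''KF''"
  have K: "KF l <= cnt l" "G l (KF l) <= v" if "l <= d" for l using pl that unfolding placed_def KF_def by blast+
  have z0: "ZI v KF 0 (KF 0) s" using pl unfolding placed_def ZI_def Pset_start KF_def by blast
  show ?thesis unfolding a_all_def
  proof (rule ok_For_sum[where I = "\<lambda>k s'. ZI v KF k (KF k) s'" and N = "Suc d" and c = "\<lambda>l. 200 * cnt l + 50"], goal_cases)
    case 1
    show ?case using z0 by (simp add: ZI_def)
  next
    case (3 k s1)
    have "tst s1" using tst_frame[OF 3(3)] c by simp
    then show ?case using ctxD(1)[OF tstD(2)] by simp
  next
    case (4 k s1)
    have c1: "tst s1" using tst_frame[OF 4(3)] c by simp
    have KF1: "nats s1 ''KF'' = KF" using frameD(1)[OF 4(3)] by (simp add: KF_def)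
    have k: "k <= d" using 4(1) by simp
    show ?case
    proof (rule ok_conseq[OF ok_leg[OF c1 4(2) 4(4) KF1 k K[OF k] v]])
      fix t :: nat and s2 :: state assume a: "ZI v KF k (cnt k) s2 \<and> t <= 200 * cnt k + 50"
      then have "ZI v KF (Suc k) (KF (Suc k)) s2" unfolding ZI_def Pset_next by blast
      then show "t <= 200 * cnt k + 50 \<and> ZI v KF (Suc k) (KF (Suc k)) (nupd ''al'' 0 (Suc k) s2)" using a by (simp add: ZI_def)
    qed
  next
    case (5 t s1)
    have "(\<Sum>l<Suc d. 200 * cnt l + 50) = 200 * (\<Sum>l<Suc d. cnt l) + 50 * Suc d"
      by (simp only: sum.distrib sum_distrib_left[symmetric]) simp
    moreover have "(\<Sum>l<Suc d. cnt l) <= n" unfolding cnt_def by (rule sum_legix)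
    ultimately have "t <= (200 * n + 50 * Suc d) + (14 * d + 14) + 4 + 10" using 5(4) by simp
    then show ?case using 5(1) unfolding ZI_def Pset_end by simp
  qed simp_all
qed

lemma ok_a_out:
  assumes c: "tst s"
  shows "ok a_out s (\<lambda>t s'. (\<forall>u<n. nats s' ''assignment'' u = nats s ''fac'' (nats s ''cluster'' u)) \<and> t <= 40 * n + 40)"
  unfolding a_out_def
proof (rule ok_For[where I = "\<lambda>k s'. \<forall>u<k. nats s' ''assignment'' u = nats s ''fac'' (nats s ''cluster'' u)" and N = n and c = 15], goal_cases)
  case (3 k s1)
  have "tst s1" using tst_frame[OF 3(3)] c by simp
  then show ?case using ctxD(3)[OF tstD(2)] by simp
next
  case (4 k s1)
  have "nats s1 ''fac'' = nats s ''fac''" "nats s1 ''cluster'' = nats s ''cluster''" using frameD(1)[OF 4(3)] by simp_all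
  then show ?case using 4(2,4) by (simp add: less_Suc_eq)
next
  case (5 t s1)
  then show ?case by simp
qed simp_all

definition solve_time :: nat where
  "solve_time = dp_time + (T * 200 + NS * (open_time + 100) + 40 * d + 200) + (200 * n + 100 * d + 200) + (40 * n + 40)"

text \<open>The entry for the start state is a lower bound for every radius by
  \<open>dp_complete\<close>, and the labelling traced back from it attains this value.\<close>

lemma ok_solve:
  assumes c: "cst s" and rn: "r <= n"
  shows "ok (dp ;; trace ;; a_all ;; a_out) s (\<lambda>t s'. solved s' \<and> t <= solve_time)"
proof (rule ok_seq[OF ok_dp[OF c]])
  fix t1 :: nat and s1 :: state
  assume a1: "tst s1 \<and> (\<forall>l\<le>d. nats s1 ''kk'' l = cn own T l) \<and> fin (Suc T) NS s1 \<and> t1 <= dp_time"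
  define v where "v = Vf s1 T 0 0"
  have c1: "tst s1" and kk: "\<forall>l\<le>d. nats s1 ''kk'' l = cn own T l" and fn: "fin (Suc T) NS s1" using a1 by blast+
  have opt: "v <= c" if "0 <= c" "solution c f z" for c f z
  proof -
    have G0: "G l (cnt l) <= 0" if "l <= d" for l using lines_ok[OF that] unfolding line_ok_def by simp
    have G1: "G l j <= max (G l i) (seg l j i)" if "l <= d" "j < cnt l" "j + r <= i" "i <= cnt l" for l j i
    proof -
      have nb: "\<not> cnt l < j + r" using that(3,4) by linarith
      have "if cnt l < j + r then G l j = big
         else j + r <= nx l j \<and> nx l j <= cnt l \<and> G l j = max (G l (nx l j)) (seg l j (nx l j)) \<and>
           near_ok (isfac fs) (NF l j) (l, (X l j + X l (nx l j - 1)) / 2) \<and>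
           (\<forall>x. j + r <= x \<and> x <= cnt l --> G l j <= max (G l x) (seg l j x))"
        using lines_ok[OF that(1)] that(2) unfolding line_ok_def by blast
      then have "\<forall>x. j + r <= x \<and> x <= cnt l --> G l j <= max (G l x) (seg l j x)"
        unfolding if_not_P[OF nb] by - (elim conjE, assumption)
      then show ?thesis using that(3,4) by blast
    qed
    show ?thesis unfolding v_def
      by (rule dp_complete[OF that(2,1) G0 G1 fin_dp_upper[OF fn]])
  qed
  \<comment> \<open>The trivial solution bounds the optimum by \<open>big - 1\<close>, so infinite
    entries do not lie on the traced path.\<close>
  have vb: "v < big"
  proof -
    obtain z where "solution (fpos0 + total) (\<lambda>_. 0) z" using trivial_solution[OF rn] by blast
    then have "v <= fpos0 + total" using opt fpos0_nonneg total_nonneg by simp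
    then show ?thesis by (simp add: big_def)
  qed
  show "ok (trace ;; a_all ;; a_out) s1 (\<lambda>t s'. solved s' \<and> t1 + t <= solve_time)"
  proof (rule ok_seq[OF ok_trace[OF c1 kk fn v_def[symmetric] vb]])
    fix t2 :: nat and s2 :: state
    assume a2: "placed v s2 \<and> t2 <= T * 200 + NS * (open_time + 100) + 40 * d + 200" and f2: "frame trace s1 s2"
    have "traceN \<inter> tstN = {}" by simp
    then have "nwrites trace \<inter> tstN = {}" using writes_trace(1) by blast
    then have c2: "tst s2" using tst_frame[OF f2] c1 writes_trace(2) by simp
    show "ok (a_all ;; a_out) s2 (\<lambda>t s'. solved s' \<and> t1 + (t2 + t) <= solve_time)"
    proof (rule ok_seq[OF ok_a_all[OF c2 conjunct1[OF a2] vb]])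
      fix t3 :: nat and s3 :: state
      assume a3: "sat (isfac fs) v Us (Lf s3) (nats s3 ''fac'') \<and> t3 <= 200 * n + 100 * d + 200" and f3: "frame a_all s2 s3"
      have c3: "tst s3" using tst_frame[OF f3] c2 by simp
      have res: "result (nats s3 ''cluster'') (nats s3 ''fac'') v" unfolding result_def using a3 opt by blast
      show "ok a_out s3 (\<lambda>t s'. solved s' \<and> t1 + (t2 + (t3 + t)) <= solve_time)"
      proof (rule ok_conseq[OF ok_a_out[OF c3]])
        fix t4 :: nat and s4 :: state
        assume a4: "(\<forall>u<n. nats s4 ''assignment'' u = nats s3 ''fac'' (nats s3 ''cluster'' u)) \<and> t4 <= 40 * n + 40" and f4: "frame a_out s3 s4"
        have e: "nats s4 ''cluster'' = nats s3 ''cluster''" "nats s4 ''fac'' = nats s3 ''fac''" using frameD(1)[OF f4] by simp_all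
        have "t1 + (t2 + (t3 + t4)) <= solve_time" using a1 a2 a3 a4 unfolding solve_time_def by linarith
        then show "solved s4 \<and> t1 + (t2 + (t3 + t4)) <= solve_time"
          using res a4 unfolding e by blast
      qed
    qed
  qed
qed

end

section \<open>Running time\<close>

text \<open>Equality holds at \<open>d = 4\<close>; from there on a step of \<open>d\<close> at most
  doubles the cube, while it doubles the power exactly.\<close>

lemma cube_le: "(d::nat) ^ 3 <= 4 * 2 ^ d"
proof (cases "4 <= d")
  case True
  then show ?thesis
  proof (induction d rule: nat_induct_at_least)
    case base
    show ?case by simp
  next
    case (Suc d)
    have a: "4 * d <= d * d" using Suc.hyps by (intro mult_le_mono1)
    then have "4 * (d * d) <= d * (d * d)" using Suc.hyps by (intro mult_le_mono1)
    moreover have "Suc d ^ 3 = d * (d * d) + 3 * (d * d) + 3 * d + 1" by (simp add: power3_eq_cube algebra_simps)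
    ultimately have "Suc d ^ 3 <= 2 * (d * (d * d))" using a Suc.hyps by linarith
    then show ?case using Suc.IH by (simp add: power3_eq_cube algebra_simps)
  qed
next
  case False
  then have "d = 0 \<or> d = 1 \<or> d = 2 \<or> d = 3" by linarith
  then show ?thesis by (elim disjE) simp_all
qed

definition core :: prog where
  "core = prelude ;; line_dp ;; merge ;; dp ;; trace ;; a_all ;; a_out"

context spider_problem begin

definition Y :: nat where "Y = 2 ^ d * r ^ 4 * d ^ 5"

lemma Y_mono:
  assumes "a <= 4" "b <= 5"
  shows "2 ^ d * (r ^ a * d ^ b) <= Y" "r ^ a * d ^ b <= Y"
proof -
  have "r ^ a * d ^ b <= r ^ 4 * d ^ 5" using assms r1 d1 by (intro mult_le_mono power_increasing) auto
  then have "2 ^ d * (r ^ a * d ^ b) <= 2 ^ d * (r ^ 4 * d ^ 5)" by (rule mult_le_mono2)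
  then show *: "2 ^ d * (r ^ a * d ^ b) <= Y" by (simp add: Y_def mult.assoc)
  have "1 * (r ^ a * d ^ b) <= 2 ^ d * (r ^ a * d ^ b)" by (rule mult_le_mono1) simp
  then show "r ^ a * d ^ b <= Y" using * by linarith
qed

text \<open>Units for the estimates: \<open>u1\<close> is the order of \<open>Kc\<close> and of the
  largest debt, \<open>u2\<close> that of the number of thresholds.\<close>

abbreviation "u1 \<equiv> r * d"
abbreviation "u2 \<equiv> d * u1"

lemma Y_facts:
  "1 <= Y" "d <= Y" "r <= Y" "u1 <= Y" "u2 <= Y" "d * u2 <= Y" "2 ^ d <= Y" "2 ^ d * u1 <= Y" "u2 * u2 <= Y" "2 ^ d * (u2 * (u1 * u2)) <= Y"
  using Y_mono(2)[of 0 0] Y_mono(2)[of 0 1] Y_mono(2)[of 1 0] Y_mono(2)[of 1 1] Y_mono(2)[of 1 2] Y_mono(2)[of 1 3] Y_mono(1)[of 0 0]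
    Y_mono(1)[of 1 1] Y_mono(2)[of 2 4] Y_mono(1)[of 3 5]
  by (simp_all add: power2_eq_square power_numeral_reduce mult.assoc mult.left_commute mult.commute)

text \<open>The square of the number of isolated queries has order r^4 d^8; its surplus factor d^3
  is absorbed by \<open>2 ^ d\<close>.\<close>

lemma Y_eight: "(u2 * u2) * (u2 * u2) <= 4 * Y"
proof -
  have "(u2 * u2) * (u2 * u2) = (r ^ 4 * d ^ 5) * d ^ 3" by (simp add: power_numeral_reduce mult.assoc mult.left_commute mult.commute)
  also have "\<dots> <= (r ^ 4 * d ^ 5) * (4 * 2 ^ d)" by (rule mult_le_mono2[OF cube_le])
  finally show ?thesis by (simp add: Y_def mult.assoc mult.left_commute mult.commute)
qed

lemma basic_bounds: "1 <= u1" "r <= u1" "d <= u1" "1 <= u2" "u1 <= u2" "d <= u2" "d + 1 <= 2 * d" "Kc <= 4 * u1" "Kc + 2 <= 6 * u1" "r * (d + 1) + 1 <= 3 * u1"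
proof -
  show a: "1 <= u1" "r <= u1" "d <= u1" using r1 d1 by simp_all
  have "1 * u1 <= d * u1" using d1 by (rule mult_le_mono1)
  then show b: "u1 <= u2" by simp
  show "1 <= u2" "d <= u2" using a b by linarith+
  show "d + 1 <= 2 * d" using d1 by simp
  have "Kc = 2 * u1 + 2 * r" by (simp add: Kc_def algebra_simps)
  then show "Kc <= 4 * u1" "Kc + 2 <= 6 * u1" using a by linarith+
  have "r * (d + 1) + 1 = u1 + r + 1" by (simp add: algebra_simps)
  then show "r * (d + 1) + 1 <= 3 * u1" using a by linarith
qed

lemma prep_bound:
  "prelude_time + (3000 * n + 130 * m + 200 * d + 300) + (((d + 1) * Kc) * (60 * d + 200) + 100 * d + 300) <= 10000 * (Y + n + m)"
proof -
  have "((d + 1) * Kc) * (60 * d + 200) <= ((2 * d) * (4 * u1)) * (260 * d)"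
    using basic_bounds(7,8) d1 by (intro mult_le_mono) simp_all
  also have "\<dots> = 2080 * (d * u2)" by (simp add: algebra_simps)
  finally have "((d + 1) * Kc) * (60 * d + 200) <= 2080 * Y" using Y_facts(6) by linarith
  moreover have "prelude_time <= 100 * n + 100 * m + 2800 * Y"
    unfolding prelude_time_def using Y_facts(1,2,4) basic_bounds(8) by simp
  moreover have "x + (3000 * n + 130 * m + 200 * d + 300) + (y + 100 * d + 300) <= 10000 * (Y + n + m)"
    if "x <= 100 * n + 100 * m + 2800 * Y" "y <= 2080 * Y" for x y
    using that Y_facts(1,2) by simp
  ultimately show ?thesis by blast
qed

end

context spider_core begin

text \<open>Two terms dominate: \<open>u2 * u2\<close> isolated queries of cost m/q + q, and
  \<open>2 ^ d * u2 * u1\<close> states with \<open>u2\<close> choices each, all up to constant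
  factors.\<close>

lemma dp_time_bound: "dp_time <= 1900000 * Y + 6480 * m"
proof -
  note bb = basic_bounds
  have ct: "cell_time + 20 <= 2360 * u2"
  proof -
    have "(d + 1) * ((Kc + 2) * 170 + 50) <= (2 * d) * ((6 * u1) * 170 + 50)"
      using bb(7,9) by (intro mult_le_mono add_le_mono) simp_all
    also have "\<dots> = 2040 * u2 + 100 * d" by (simp add: algebra_simps)
    finally show ?thesis unfolding cell_time_def using bb(4,6) by linarith
  qed
  have rt: "row_time + 30 <= 7400 * (u1 * u2)"
  proof -
    have "(Dmax + 1) * (cell_time + 20) <= (3 * u1) * (2360 * u2)" using bb(10) ct by (rule mult_le_mono)
    moreover have "1 * u2 <= u1 * u2" by (rule mult_le_mono1[OF bb(1)])
    ultimately show ?thesis unfolding row_time_def using bb(4,6) by linarith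
  qed
  have wt: "wtab_time <= 12 * (u2 * (near_max + 325))"
  proof -
    have "(d + 1) * ((Kc + 2) * (near_max + 300) + 100) <= (2 * d) * ((6 * u1) * (near_max + 300) + 100)"
      using bb(7,9) by (intro mult_le_mono add_le_mono) simp_all
    also have "\<dots> = 12 * (u2 * (near_max + 300)) + 200 * d" by (simp add: algebra_simps)
    finally have "wtab_time <= 12 * (u2 * (near_max + 300)) + 250 * u2" unfolding wtab_time_def using bb(4,6) by linarith
    moreover have "u2 * (near_max + 325) = u2 * (near_max + 300) + 25 * u2" by (simp add: algebra_simps)
    ultimately show ?thesis using bb(4) by linarith
  qed
  have st: "stage_time + 20 <= 12 * (u2 * (near_max + 325)) + 14800 * (2 ^ d * (u1 * u2)) + 120"
  proof -
    have "NS * (row_time + 30) <= NS * (7400 * (u1 * u2))" by (rule mult_le_mono2[OF rt])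
    also have "\<dots> = 14800 * (2 ^ d * (u1 * u2))" by simp
    finally show ?thesis unfolding stage_time_def using wt by linarith
  qed
  have Tb: "T + 1 <= 9 * u2"
  proof -
    have "(d + 1) * Kc <= (2 * d) * (4 * u1)" using bb(7,8) by (rule mult_le_mono)
    also have "\<dots> = 8 * u2" by simp
    finally show ?thesis using T_le bb(4) by linarith
  qed
  have "(T + 1) * (stage_time + 20) <= (9 * u2) * (12 * (u2 * (near_max + 325)) + 14800 * (2 ^ d * (u1 * u2)) + 120)"
    using Tb st by (rule mult_le_mono)
  also have "\<dots> = 108 * ((u2 * u2) * (near_max + 325)) + 133200 * (2 ^ d * (u2 * (u1 * u2))) + 1080 * u2"
    by (simp add: algebra_simps)
  finally have main: "(T + 1) * (stage_time + 20) <= 108 * ((u2 * u2) * (near_max + 325)) + 133200 * Y + 1080 * Y"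
    using Y_facts(5,10) by linarith
  \<comment> \<open>The stride is squeezed between constant multiples of \<open>u2 * u2\<close>. The
    lower bound makes the jumps of all queries O(m), the upper bound makes the walks
    O(u2^4).\<close>
  have q1: "u2 * u2 <= qc"
  proof -
    have a: "d <= d + 1" and b: "2 * u1 <= Kc" by (simp_all add: Kc_def algebra_simps)
    have "d * (d * ((2 * u1) * (2 * u1))) <= qc" unfolding qc_def
      by (rule mult_le_mono[OF a mult_le_mono[OF a mult_le_mono[OF b b]]])
    moreover have "d * (d * ((2 * u1) * (2 * u1))) = 4 * (u2 * u2)" by simp
    ultimately show ?thesis by linarith
  qed
  have q2: "qc <= 64 * (u2 * u2)"
  proof -
    have "qc <= (2 * d) * ((2 * d) * ((4 * u1) * (4 * u1)))" unfolding qc_def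
      using bb(7,8) by (intro mult_le_mono)
    also have "\<dots> = 64 * (u2 * u2)" by simp
    finally show ?thesis .
  qed
  have "(u2 * u2) * (m div qc) <= qc * (m div qc)" using q1 by (rule mult_le_mono1)
  also have "\<dots> <= m" by simp
  finally have n1: "(u2 * u2) * (m div qc) <= m" .
  have "(u2 * u2) * qc <= (u2 * u2) * (64 * (u2 * u2))" using q2 by (rule mult_le_mono2)
  then have n2: "(u2 * u2) * qc <= 256 * Y" using Y_eight by linarith
  have "(u2 * u2) * (near_max + 325) = 60 * ((u2 * u2) * (m div qc)) + 60 * ((u2 * u2) * qc) + 725 * (u2 * u2)"
    unfolding near_max_def by (simp only: distrib_left)
  then have "(u2 * u2) * (near_max + 325) <= 60 * m + 16085 * Y" using n1 n2 Y_facts(9) by linarith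
  moreover have "T + 1 <= 9 * Y" using Tb Y_facts(5) by linarith
  moreover have "NS <= 2 * Y" using Y_facts(7) by simp
  ultimately show ?thesis unfolding dp_time_def using main Y_facts(1,2) by linarith
qed

lemma solve_time_bound: "solve_time <= 2000000 * (Y + n + m)"
proof -
  have "open_time + 100 <= 700 * u1" unfolding open_time_def using basic_bounds(1,2,8) by linarith
  then have "NS * (open_time + 100) <= NS * (700 * u1)" by (rule mult_le_mono2)
  also have "\<dots> = 1400 * (2 ^ d * u1)" by simp
  finally have "NS * (open_time + 100) <= 1400 * Y" using Y_facts(8) by linarith
  moreover have "T <= 9 * Y"
  proof -
    have "(d + 1) * Kc <= (2 * d) * (4 * u1)" using basic_bounds(7,8) by (rule mult_le_mono)
    also have "\<dots> = 8 * u2" by simp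
    finally show ?thesis using T_le Y_facts(5) by linarith
  qed
  moreover have "x + (y * 200 + z + 40 * d + 200) + (200 * n + 100 * d + 200) + (40 * n + 40) <= 2000000 * (Y + n + m)"
    if "x <= 1900000 * Y + 6480 * m" "y <= 9 * Y" "z <= 1400 * Y" for x y z
    using that Y_facts(1,2) by simp
  ultimately show ?thesis unfolding solve_time_def using dp_time_bound by blast
qed

end

context spider_problem begin

lemma ok_core:
  assumes s: "inp s" "nats s ''uc'' = (\<lambda>_. 0)" "nats s ''fc'' = (\<lambda>_. 0)" and rn: "r <= n"
  shows "ok core s (\<lambda>t s'. solved s' \<and> t <= 2010000 * (Y + n + m))"
  unfolding core_def
proof (rule ok_seq[OF ok_prelude[OF s]])
  fix t1 :: nat and s1 :: state assume a1: "ctx s1 \<and> t1 <= prelude_time"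
  show "ok (line_dp ;; merge ;; dp ;; trace ;; a_all ;; a_out) s1 (\<lambda>t s'. solved s' \<and> t1 + t <= 2010000 * (Y + n + m))"
  proof (rule ok_seq[OF ok_line_dp[OF conjunct1[OF a1]]])
    fix t2 :: nat and s2 :: state assume a2: "ctx s2 \<and> lines s2 \<and> t2 <= 3000 * n + 130 * m + 200 * d + 300"
    show "ok (merge ;; dp ;; trace ;; a_all ;; a_out) s2 (\<lambda>t s'. solved s' \<and> t1 + (t2 + t) <= 2010000 * (Y + n + m))"
    proof (rule ok_seq[OF ok_merge[OF conjunct1[OF a2]]])
      fix t3 :: nat and s3 :: state
      assume a3: "merged s3 \<and> t3 <= ((d + 1) * Kc) * (60 * d + 200) + 100 * d + 300" and f3: "frame merge s2 s3"
      have c3: "ctx s3" using ctx_frame[OF f3] a2 by simp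
      have mg: "\<forall>l\<le>d. nats s3 ''lm'' l = lmt l" "s3$''T'' <= (d + 1) * Kc"
        "spider_merge d r cnt X Kc (s3$''T'') (nats s3 ''own'') (reals s3 ''B'')" using a3 unfolding merged_def by blast+
      have ln: "lines s3" using a2 frameD[OF f3] by (simp add: lines_def)
      interpret C: spider_core d r us fs "s3$''T''" "nats s3 ''own''" "reals s3 ''B''"
        "\<lambda>l i. reals s3 ''G'' (ubase l + i)" "\<lambda>l i. nats s3 ''nx'' (ubase l + i)" "\<lambda>l i. nats s3 ''NF'' (ubase l + i)"
        by (intro spider_core.intro spider_problem_axioms mg(3) spider_core_axioms.intro)
          (use mg(2) ln in \<open>simp_all add: lines_def\<close>)
      have cs: "C.cst s3" unfolding C.cst_def using c3 mg(1) by simp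
      have tb: "t1 + (t2 + (t3 + C.solve_time)) <= 2010000 * (Y + n + m)"
        using a1 a2 a3 C.solve_time_bound prep_bound by linarith
      show "ok (dp ;; trace ;; a_all ;; a_out) s3 (\<lambda>t s'. solved s' \<and> t1 + (t2 + (t3 + t)) <= 2010000 * (Y + n + m))"
      proof (rule ok_conseq[OF C.ok_solve[OF cs rn]])
        fix t :: nat and s' :: state
        assume b: "solved s' \<and> t <= C.solve_time"
        then have "t1 + (t2 + (t3 + t)) <= 2010000 * (Y + n + m)" using tb by linarith
        then show "solved s' \<and> t1 + (t2 + (t3 + t)) <= 2010000 * (Y + n + m)"
          using b by blast
      qed
    qed
  qed
qed

end

section \<open>The two solvers with their degenerate cases\<close>

definition clustering_solver :: prog where
  "clustering_solver = Cond (NLess N0 (nv ''n''))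
     (Cond (NLess (nv ''n'') (nv ''r'')) (nset ''feasible'' N0) (core ;; nset ''feasible'' N1)) (nset ''feasible'' N1)"

definition gathering_solver :: prog where
  "gathering_solver = Cond (NLess N0 (nv ''n''))
     (Cond (BAnd (NLe (nv ''r'') (nv ''n'')) (NLess N0 (nv ''m''))) (core ;; nset ''feasible'' N1) (nset ''feasible'' N0)) (nset ''feasible'' N1)"

text \<open>The empty partition is the only one and hence optimal, whatever the unspecified
  \<open>Max {}\<close> is.\<close>

lemma no_users_clustering: "r_gather_clustering r [] P \<longleftrightarrow> P = {}"
  by (auto simp: r_gather_clustering_def partition_on_def)

lemma no_users_gathering: "r_gathering r [] fs \<pi>"
  by (simp add: r_gathering_def)

lemma ok_clustering_solver:
  assumes "1 <= d" "1 <= r" "spider_input d us"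
  shows "ok clustering_solver (clustering_input d r us) (\<lambda>t s. answers_clustering r us s \<and> t <= 2011000 * (2 ^ d * r ^ 4 * d ^ 5 + length us))"
proof -
  \<comment> \<open>Clustering is the instance without facilities; the entries for facilities in its
    input are the initial zeros.\<close>
  interpret spider_problem d r us "[]"
    by unfold_locales (use assms in \<open>simp_all add: spider_input_def\<close>)
  let ?s = "clustering_input d r us"
  have i: "inp ?s" "nats ?s ''uc'' = (\<lambda>_. 0)" "nats ?s ''fc'' = (\<lambda>_. 0)"
    by (simp_all add: inp_def clustering_input_def array_of_def fpos0_def)
  have v: "?s$''n'' = n" "?s$''r'' = r" by (simp_all add: clustering_input_def array_of_def)
  have Y1: "1 <= Y" by (rule Y_facts(1))
  show ?thesis
  proof (cases "us = []")
    case True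
    have "answers_clustering r us (nupd ''feasible'' 0 1 ?s)"
      unfolding answers_clustering_def optimal_clustering_def is_arg_min_def True
      by (simp add: no_users_clustering clusters_def)
    moreover have "9 <= 2011000 * (Y + n)" using Y1 by simp
    ultimately show ?thesis using True unfolding Y_def by (simp add: clustering_solver_def v[unfolded True])
  next
    case False
    have feas: "(\<exists>P. r_gather_clustering r us P) = (r <= n)" by (rule clustering_feasible[OF False])
    have b: "bval (NLess N0 (nv ''n'')) ?s" using False by (simp add: v)
    show ?thesis
    proof (cases "r <= n")
      case True
      have nb: "\<not> bval (NLess (nv ''n'') (nv ''r'')) ?s" using True by (simp add: v)
      have bc: "bcost (NLess (nv ''n'') (nv ''r'')) = 5" "bcost (NLess N0 (nv ''n'')) = 4" by simp_all
      have "ok (core ;; nset ''feasible'' N1) ?s (\<lambda>t s. answers_clustering r us s \<and> 4 + (5 + t + 1) + 1 <= 2011000 * (2 ^ d * r ^ 4 * d ^ 5 + n))"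
      proof (rule ok_seq[OF ok_core[OF i True]])
        fix t :: nat and s :: state
        assume a: "solved s \<and> t <= 2010000 * (Y + n + length [])"
        then obtain w where "result (nats s ''cluster'') (nats s ''fac'') w" by blast
        then have "optimal_clustering r us (clusters n (nats s ''cluster''))" by (rule result_clustering[OF refl False])
        then have "answers_clustering r us (nupd ''feasible'' 0 1 s)" using feas True by (simp add: answers_clustering_def)
        moreover have "t + 20 <= 2011000 * (Y + n)" using a Y1 by simp
        ultimately show "ok (nset ''feasible'' N1) s (\<lambda>t' s. answers_clustering r us s \<and> 4 + (5 + (t + t') + 1) + 1 <= 2011000 * (2 ^ d * r ^ 4 * d ^ 5 + n))"
          unfolding Y_def by simp
      qed
      then show ?thesis unfolding clustering_solver_def ok_Cond_True[OF b] ok_Cond_False[OF nb] bc .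
    next
      case r: False
      have "answers_clustering r us (nupd ''feasible'' 0 0 ?s)" using feas r by (simp add: answers_clustering_def)
      moreover have "20 <= 2011000 * (Y + n)" using Y1 by simp
      ultimately show ?thesis using False r unfolding Y_def by (simp add: clustering_solver_def v)
    qed
  qed
qed

lemma ok_gathering_solver:
  assumes "1 <= d" "1 <= r" "spider_input d us" "spider_input d fs"
  shows "ok gathering_solver (gathering_input d r us fs) (\<lambda>t s. answers_gathering r us fs s \<and>
    t <= 2011000 * (2 ^ d * r ^ 4 * d ^ 5 + length us + length fs))"
proof -
  interpret spider_problem d r us fs
    by unfold_locales (use assms in simp_all)
  let ?s = "gathering_input d r us fs"
  have i: "inp ?s" "nats ?s ''uc'' = (\<lambda>_. 0)" "nats ?s ''fc'' = (\<lambda>_. 0)"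
    by (simp_all add: inp_def gathering_input_def array_of_def fpos0_def)
  have v: "?s$''n'' = n" "?s$''r'' = r" "?s$''m'' = m" by (simp_all add: gathering_input_def array_of_def)
  have Y1: "1 <= Y" by (rule Y_facts(1))
  show ?thesis
  proof (cases "us = []")
    case True
    \<comment> \<open>Without users every assignment has the same cost \<open>Max {}\<close>, so
      none is strictly better than the one in memory.\<close>
    have "answers_gathering r us fs (nupd ''feasible'' 0 1 ?s)"
      unfolding answers_gathering_def optimal_gathering_def is_arg_min_def True
      by (simp add: no_users_gathering gathering_cost_def)
    moreover have "9 <= 2011000 * (Y + n + m)" using Y1 by simp
    ultimately show ?thesis using True unfolding Y_def by (simp add: gathering_solver_def v[unfolded True])
  next
    case False
    have feas: "(\<exists>\<pi>. r_gathering r us fs \<pi>) = (r <= n \<and> fs ~= [])" by (rule gathering_feasible[OF False])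
    have b: "bval (NLess N0 (nv ''n'')) ?s" using False by (simp add: v)
    let ?g = "BAnd (NLe (nv ''r'') (nv ''n'')) (NLess N0 (nv ''m''))"
    have bc: "bcost ?g = 11" "bcost (NLess N0 (nv ''n'')) = 4" by simp_all
    have g: "bval ?g ?s = (r <= n \<and> fs ~= [])" by (simp add: v not_less)
    show ?thesis
    proof (cases "r <= n \<and> fs ~= []")
      case True
      have bg: "bval ?g ?s" using True g by blast
      have rn: "r <= n" and ne: "fs ~= []" using True by blast+
      have "ok (core ;; nset ''feasible'' N1) ?s (\<lambda>t s. answers_gathering r us fs s \<and> 4 + (11 + t + 1) + 1 <= 2011000 * (2 ^ d * r ^ 4 * d ^ 5 + n + m))"
      proof (rule ok_seq[OF ok_core[OF i rn]])
        fix t :: nat and s :: state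
        assume a: "solved s \<and> t <= 2010000 * (Y + n + m)"
        then obtain w where "result (nats s ''cluster'') (nats s ''fac'') w" by blast
        then have "optimal_gathering r us fs (nats s ''assignment'')" by (rule result_gathering[OF ne False]) (use a in blast)
        then have "answers_gathering r us fs (nupd ''feasible'' 0 1 s)" using feas True by (simp add: answers_gathering_def)
        moreover have "t + 25 <= 2011000 * (Y + n + m)" using a Y1 by simp
        ultimately show "ok (nset ''feasible'' N1) s (\<lambda>t' s. answers_gathering r us fs s \<and> 4 + (11 + (t + t') + 1) + 1 <= 2011000 * (2 ^ d * r ^ 4 * d ^ 5 + n + m))"
          unfolding Y_def by simp
      qed
      then show ?thesis unfolding gathering_solver_def ok_Cond_True[OF b] ok_Cond_True[OF bg] bc .
    next
      case nf: False
      have nbg: "\<not> bval ?g ?s" using nf g by blast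
      have "answers_gathering r us fs (nupd ''feasible'' 0 0 ?s)" unfolding answers_gathering_def feas using nf by simp
      moreover have "25 <= 2011000 * (Y + n + m)" using Y1 by simp
      ultimately show ?thesis unfolding gathering_solver_def ok_Cond_True[OF b] ok_Cond_False[OF nbg] bc Y_def by simp
    qed
  qed
qed

theorem theorem2:
  shows
    "(\<exists>algorithm. \<exists>C::nat. \<forall>d r us.
        1 \<le> d \<and> 1 \<le> r \<and> spider_input d us \<longrightarrow>
        (\<exists>t s. run algorithm (clustering_input d r us) t s \<and>
          answers_clustering r us s \<and>
          t \<le> C * (2 ^ d * r ^ 4 * d ^ 5 + length us))) \<and>
     (\<exists>algorithm. \<exists>C::nat. \<forall>d r us fs.
        1 \<le> d \<and> 1 \<le> r \<and> spider_input d us \<and> spider_input d fs \<longrightarrow>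
        (\<exists>t s. run algorithm (gathering_input d r us fs) t s \<and>
          answers_gathering r us fs s \<and>
          t \<le> C * (2 ^ d * r ^ 4 * d ^ 5 + length us + length fs)))"
  using ok_clustering_solver ok_gathering_solver unfolding ok_def by blast

end
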